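(* Let $\Omega\subset\mathbb{R}^2\cong\mathbb{C}$ be a bounded open domain with Lipschitz boundary, and let $\gamma=\sigma+i\omega\epsilon$ with $\sigma,\epsilon$ real-valued, $\sigma>\sigma_0$ and $\|\sigma\|_{W^{1,\infty}},\|\epsilon\|_{W^{1,\infty}}\le\beta$ on $\mathbb{R}^2$ for positive constants $\sigma_0,\beta$, with $\gamma\equiv1$ outside $\Omega$, and let $\omega$ be sufficiently small. Then for $k\in\mathbb{C}$ the off-diagonal entries $$S_{12}(k)=\frac i\pi\int_{\mathbb{R}^2}Q_{12}(z)\,e(z,-\bar k)\,M_{22}(z,k)\,d\mu(z),\qquad S_{21}(k)=-\frac i\pi\int_{\mathbb{R}^2}Q_{21}(z)\,e(z,k)\,M_{11}(z,k)\,d\mu(z)$$ of the scattering transform satisfy $$S_{12}(k)=\frac{i}{2\pi}\int_{\partial\Omega}e^{-i\bar kz}\,\Psi_{12}(z,k)\,(\nu_1+i\nu_2)\,dS(z),\qquad S_{21}(k)=-\frac{i}{2\pi}\int_{\partial\Omega}e^{i\bar k\bar z}\,\Psi_{21}(z,k)\,(\nu_1-i\nu_2)\,dS(z),$$ where $\nu=\nu_1+i\nu_2$ is the outward unit normal to $\partial\Omega$.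
   Context: Write $z=x+iy$, $\partial_z=\frac12(\partial_x-i\partial_y)$, $\bar\partial_z=\frac12(\partial_x+i\partial_y)$, $e(z,k)=\exp\{i(zk+\bar z\bar k)\}$; $\mu$ is Lebesgue measure on $\mathbb{R}^2$; $\log\gamma$ is the principal branch. Put $Q_{12}=-\frac12\partial_z\log\gamma$, $Q_{21}=-\frac12\bar\partial_z\log\gamma$. "$\omega$ sufficiently small" means $0\le\omega<\omega_0$ for a constant $\omega_0>0$ depending only on $\beta,\sigma_0,\Omega$. For such $\omega$ it is known (Francini) that for every $k\in\mathbb{C}$ there is a unique $2\times2$ matrix $M(\cdot,k)$ with $M(\cdot,k)-I\in L^q(\mathbb{R}^2)$ for some $q>2$ solving $$\bar\partial_zM_{11}=Q_{12}M_{21},\quad(\bar\partial_z-ik)M_{12}=Q_{12}M_{22},\quad(\partial_z+ik)M_{21}=Q_{21}M_{11},\quad\partial_zM_{22}=Q_{21}M_{12}$$ in $\mathbb{R}^2$. Set $\Psi_{12}(z,k)=e^{-i\bar zk}M_{12}(z,k)$ and $\Psi_{21}(z,k)=e^{izk}M_{21}(z,k)$. *)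

theory Defs
  imports "HOL-Analysis.Analysis" "HOL-Probability.Essential_Supremum"
begin

section \<open>Weak derivatives and function spaces on the plane\<close>

fun C_k :: "nat \<Rightarrow> (complex \<Rightarrow> complex) \<Rightarrow> bool" where
  "C_k 0 f \<longleftrightarrow> continuous_on UNIV f"
| "C_k (Suc n) f \<longleftrightarrow> (\<exists>fx fy. C_k n fx \<and> C_k n fy \<and>
     (\<forall>z. (f has_derivative (\<lambda>h. of_real (Re h) * fx z + of_real (Im h) * fy z)) (at z)))"

definition test_function :: "(complex \<Rightarrow> complex) \<Rightarrow> bool" where
  "test_function \<phi> \<longleftrightarrow> (\<forall>n. C_k n \<phi>) \<and> (\<exists>K. compact K \<and> (\<forall>z. z \<notin> K \<longrightarrow> \<phi> z = 0))"

definition locally_integrable :: "(complex \<Rightarrow> complex) \<Rightarrow> bool" where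
  "locally_integrable f \<longleftrightarrow> (\<forall>K. compact K \<longrightarrow> set_integrable lebesgue K f)"

text \<open>The constant-coefficient first order operator \<open>a \<partial>\<^sub>x + b \<partial>\<^sub>y\<close>, classically and in the
  sense of distributions (with a locally integrable right-hand side).\<close>

definition first_order :: "complex \<Rightarrow> complex \<Rightarrow> (complex \<Rightarrow> complex) \<Rightarrow> complex \<Rightarrow> complex" where
  "first_order a b \<phi> z = a * frechet_derivative \<phi> (at z) 1 + b * frechet_derivative \<phi> (at z) \<i>"

definition has_weak_deriv ::
    "complex \<Rightarrow> complex \<Rightarrow> (complex \<Rightarrow> complex) \<Rightarrow> (complex \<Rightarrow> complex) \<Rightarrow> bool" where
  "has_weak_deriv a b f g \<longleftrightarrow> locally_integrable f \<and> locally_integrable g \<and>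
     (\<forall>\<phi>. test_function \<phi> \<longrightarrow>
        (LINT z|lebesgue. f z * first_order a b \<phi> z) = - (LINT z|lebesgue. g z * \<phi> z))"

abbreviation has_weak_dx where "has_weak_dx \<equiv> has_weak_deriv 1 0"
abbreviation has_weak_dy where "has_weak_dy \<equiv> has_weak_deriv 0 1"
abbreviation has_weak_dz where "has_weak_dz \<equiv> has_weak_deriv (1/2) (- (\<i>/2))"
abbreviation has_weak_dbar where "has_weak_dbar \<equiv> has_weak_deriv (1/2) (\<i>/2)"

text \<open>Weak derivatives as functions: some representative, determined up to a null set.\<close>

definition weak_dx :: "(complex \<Rightarrow> complex) \<Rightarrow> complex \<Rightarrow> complex" where
  "weak_dx f = (SOME g. has_weak_dx f g)"
definition weak_dy :: "(complex \<Rightarrow> complex) \<Rightarrow> complex \<Rightarrow> complex" where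
  "weak_dy f = (SOME g. has_weak_dy f g)"
definition weak_dz :: "(complex \<Rightarrow> complex) \<Rightarrow> complex \<Rightarrow> complex" where
  "weak_dz f = (SOME g. has_weak_dz f g)"
definition weak_dbar :: "(complex \<Rightarrow> complex) \<Rightarrow> complex \<Rightarrow> complex" where
  "weak_dbar f = (SOME g. has_weak_dbar f g)"

definition Linf_norm :: "(complex \<Rightarrow> complex) \<Rightarrow> ereal" where
  "Linf_norm f = esssup lebesgue (\<lambda>z. ereal (norm (f z)))"

definition W1inf_norm :: "(complex \<Rightarrow> real) \<Rightarrow> ereal" where
  "W1inf_norm f = (let F = (\<lambda>z. complex_of_real (f z)) in
     Linf_norm F + Linf_norm (weak_dx F) + Linf_norm (weak_dy F))"

definition W1inf :: "(complex \<Rightarrow> real) set" where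
  "W1inf = {f. f \<in> borel_measurable lebesgue \<and>
     (\<exists>g. has_weak_dx (\<lambda>z. complex_of_real (f z)) g) \<and>
     (\<exists>g. has_weak_dy (\<lambda>z. complex_of_real (f z)) g) \<and>
     W1inf_norm f < \<infinity>}"

definition in_Lp :: "real \<Rightarrow> (complex \<Rightarrow> 'b::euclidean_space) \<Rightarrow> bool" where
  "in_Lp q f \<longleftrightarrow> f \<in> borel_measurable lebesgue \<and> integrable lebesgue (\<lambda>z. norm (f z) powr q)"

text \<open>The continuous representative of a function given up to null sets (unique if it exists).\<close>

definition cont_rep :: "(complex \<Rightarrow> complex) \<Rightarrow> complex \<Rightarrow> complex" where
  "cont_rep f = (THE g. continuous_on UNIV g \<and> (AE z in lebesgue. g z = f z))"


section \<open>Lipschitz domains, outward normal and arc length\<close>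

text \<open>Near \<open>p\<close>, in coordinates rotated by the unit complex number \<open>u\<close>, the set \<open>\<Omega>\<close> is the part
  of a rectangle lying below the graph of a Lipschitz function.\<close>

definition lipschitz_chart ::
    "complex set \<Rightarrow> complex \<Rightarrow> complex \<Rightarrow> real \<Rightarrow> real \<Rightarrow> (real \<Rightarrow> real) \<Rightarrow> bool" where
  "lipschitz_chart \<Omega> p u r h \<phi> \<longleftrightarrow>
     norm u = 1 \<and> 0 < r \<and> 0 < h \<and> (\<exists>L. L-lipschitz_on UNIV \<phi>) \<and>
     (\<forall>s. \<bar>s\<bar> < r \<longrightarrow> \<bar>\<phi> s\<bar> < h) \<and>
     (\<forall>s t. \<bar>s\<bar> < r \<and> \<bar>t\<bar> < h \<longrightarrow> (p + u * Complex s t \<in> \<Omega> \<longleftrightarrow> t < \<phi> s))"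

definition bounded_lipschitz_domain :: "complex set \<Rightarrow> bool" where
  "bounded_lipschitz_domain \<Omega> \<longleftrightarrow> open \<Omega> \<and> connected \<Omega> \<and> \<Omega> \<noteq> {} \<and> bounded \<Omega> \<and>
     (\<forall>p\<in>frontier \<Omega>. \<exists>u r h \<phi>. lipschitz_chart \<Omega> p u r h \<phi>)"

text \<open>Here \<open>Re ((w - z) * cnj n)\<close> is the Euclidean inner product of \<open>w - z\<close> and \<open>n\<close>: close to \<open>z\<close>,
  the set lies on the negative side of the line through \<open>z\<close> normal to \<open>n\<close>, up to arbitrarily thin
  cones around that line. At the boundary of a Lipschitz domain such an \<open>n\<close> exists almost everywhere
  with respect to arc length.\<close>

definition is_outward_unit_normal :: "complex set \<Rightarrow> complex \<Rightarrow> complex \<Rightarrow> bool" where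
  "is_outward_unit_normal \<Omega> z n \<longleftrightarrow> norm n = 1 \<and>
     (\<forall>\<epsilon>>0. \<exists>\<delta>>0. \<forall>w. 0 < dist w z \<and> dist w z < \<delta> \<longrightarrow>
        (Re ((w - z) * cnj n) < - \<epsilon> * dist w z \<longrightarrow> w \<in> \<Omega>) \<and>
        (Re ((w - z) * cnj n) > \<epsilon> * dist w z \<longrightarrow> w \<notin> \<Omega>))"

definition outward_normal :: "complex set \<Rightarrow> complex \<Rightarrow> complex" where
  "outward_normal \<Omega> z = (THE n. is_outward_unit_normal \<Omega> z n)"

text \<open>Arc length \<open>dS\<close> is one-dimensional Hausdorff measure, defined on the Caratheodory-measurable
  sets of the corresponding outer measure.\<close>

definition hausdorff1_delta :: "real \<Rightarrow> complex set \<Rightarrow> ennreal" where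
  "hausdorff1_delta \<delta> A =
     (INF C\<in>{C :: nat \<Rightarrow> complex set. A \<subseteq> \<Union>(range C) \<and> (\<forall>n. bounded (C n) \<and> diameter (C n) \<le> \<delta>)}.
        (\<Sum>n. ennreal (diameter (C n))))"

definition hausdorff1_outer :: "complex set \<Rightarrow> ennreal" where
  "hausdorff1_outer A = (SUP \<delta>\<in>{0<..}. hausdorff1_delta \<delta> A)"

definition arc_length :: "complex measure" where
  "arc_length = measure_of UNIV (lambda_system UNIV UNIV hausdorff1_outer) hausdorff1_outer"


section \<open>The first order system and the scattering transform\<close>

definition conductivity :: "real \<Rightarrow> (complex \<Rightarrow> real) \<Rightarrow> (complex \<Rightarrow> real) \<Rightarrow> complex \<Rightarrow> complex" where
  "conductivity \<omega> \<sigma> \<epsilon> z = of_real (\<sigma> z) + \<i> * of_real \<omega> * of_real (\<epsilon> z)"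

definition Q12 :: "(complex \<Rightarrow> complex) \<Rightarrow> complex \<Rightarrow> complex" where
  "Q12 \<gamma> z = - (1/2) * weak_dz (\<lambda>w. Ln (\<gamma> w)) z"

definition Q21 :: "(complex \<Rightarrow> complex) \<Rightarrow> complex \<Rightarrow> complex" where
  "Q21 \<gamma> z = - (1/2) * weak_dbar (\<lambda>w. Ln (\<gamma> w)) z"

definition e_zk :: "complex \<Rightarrow> complex \<Rightarrow> complex" where
  "e_zk z k = exp (\<i> * (z * k + cnj z * cnj k))"

definition cgo_solution ::
    "(complex \<Rightarrow> complex) \<Rightarrow> complex \<Rightarrow> (complex \<Rightarrow> complex^2^2) \<Rightarrow> bool" where
  "cgo_solution \<gamma> k M \<longleftrightarrow>
     (\<exists>q>2. in_Lp q (\<lambda>z. M z - mat 1)) \<and>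
     has_weak_dbar (\<lambda>z. M z $ 1 $ 1) (\<lambda>z. Q12 \<gamma> z * M z $ 2 $ 1) \<and>
     has_weak_dbar (\<lambda>z. M z $ 1 $ 2) (\<lambda>z. \<i> * k * M z $ 1 $ 2 + Q12 \<gamma> z * M z $ 2 $ 2) \<and>
     has_weak_dz (\<lambda>z. M z $ 2 $ 1) (\<lambda>z. - \<i> * k * M z $ 2 $ 1 + Q21 \<gamma> z * M z $ 1 $ 1) \<and>
     has_weak_dz (\<lambda>z. M z $ 2 $ 2) (\<lambda>z. Q21 \<gamma> z * M z $ 1 $ 2)"

definition S12 :: "(complex \<Rightarrow> complex) \<Rightarrow> (complex \<Rightarrow> complex \<Rightarrow> complex^2^2) \<Rightarrow> complex \<Rightarrow> complex" where
  "S12 \<gamma> M k = \<i> / of_real pi * (LINT z|lebesgue. Q12 \<gamma> z * e_zk z (- cnj k) * M z k $ 2 $ 2)"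

definition S21 :: "(complex \<Rightarrow> complex) \<Rightarrow> (complex \<Rightarrow> complex \<Rightarrow> complex^2^2) \<Rightarrow> complex \<Rightarrow> complex" where
  "S21 \<gamma> M k = - (\<i> / of_real pi) * (LINT z|lebesgue. Q21 \<gamma> z * e_zk z k * M z k $ 1 $ 1)"

text \<open>Being evaluated on a boundary curve, the functions \<open>\<Psi>\<close> are formed with the continuous
  representatives of the entries of \<open>M(\<cdot>,k)\<close>.\<close>

definition Psi12 :: "(complex \<Rightarrow> complex \<Rightarrow> complex^2^2) \<Rightarrow> complex \<Rightarrow> complex \<Rightarrow> complex" where
  "Psi12 M z k = exp (- \<i> * cnj z * k) * cont_rep (\<lambda>w. M w k $ 1 $ 2) z"

definition Psi21 :: "(complex \<Rightarrow> complex \<Rightarrow> complex^2^2) \<Rightarrow> complex \<Rightarrow> complex \<Rightarrow> complex" where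
  "Psi21 M z k = exp (\<i> * z * k) * cont_rep (\<lambda>w. M w k $ 2 $ 1) z"

end

theory Submission imports Defs
begin

text \<open>Since \<open>M\<^sub>1\<^sub>2\<close> and its \<open>\<partial>\<close>-bar derivative are locally in \<open>L\<^sup>q\<close> with \<open>q > 2\<close>, the representation by the
  Cauchy kernel shows that \<open>M\<^sub>1\<^sub>2\<close> is continuous. The factor \<open>E = exp (- \<i> (cnj k z + k cnj z))\<close> absorbs the
  term \<open>\<i> k M\<^sub>1\<^sub>2\<close>, so that \<open>E Q\<^sub>1\<^sub>2 M\<^sub>2\<^sub>2\<close> is the weak \<open>\<partial>\<close>-bar derivative of \<open>E M\<^sub>1\<^sub>2\<close>. The logarithm of the
  conductivity is Lipschitz and vanishes outside \<open>\<Omega>\<close>, so \<open>Q\<^sub>1\<^sub>2\<close> is bounded and supported in the closure of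
  \<open>\<Omega>\<close>, whose boundary is a null set; hence \<open>S\<^sub>1\<^sub>2\<close> is the integral of a \<open>\<partial>\<close>-bar derivative over \<open>\<Omega>\<close>, to which
  Green's formula applies. The formula for \<open>S\<^sub>2\<^sub>1\<close> follows by complex conjugation.

  Green's formula holds for test functions supported in one boundary chart by Rademacher's theorem in one
  variable and the area formula for graphs. Applied to mollifiers it yields the derivative of the mollified
  indicator of \<open>\<Omega>\<close>; testing the weak equation against that function and passing to the limit gives Green's
  formula for continuous functions with a locally integrable weak \<open>\<partial>\<close>-bar derivative.\<close>

section \<open>Lipschitz functions of one real variable\<close>

text \<open>Three obstacles shape the proof. \<open>M\<close> and the potentials are determined only
  up to null sets, while the boundary integrals read point values; q > 2 says that the conjugate
  exponent p = q/(q-1) is below 2, so that |w|^(-p) is locally integrable in the plane, and this is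
  what produces a continuous representative. The boundary is only Lipschitz, so a normal exists
  merely almost everywhere, and its measurability has to come from the completeness of arc length.
  Finally the dbar derivative in the weak equation is merely locally integrable, so the mollifier is
  put on the indicator of \<Omega>: that converges boundedly off the null boundary, and the
  mollified solution, which then appears only against the finite boundary measure, converges by
  continuity alone. The same device replaces a partition of unity, because a mollifier of small
  support sees either one boundary chart or no boundary at all.\<close>

text \<open>The intervals between x and x + h on which \<open>F\<close> deviates from its
  linearisation by more than e |h| form a Vitali cover of the set. Disjoint members, tagged by x,
  are a partial division, so Henstock's lemma bounds the sum of their deviations by e \<eta>, hence
  their total length by \<eta>.\<close>

lemma negligible_Henstock_exceptional:
  fixes f F :: "real \<Rightarrow> real"
  assumes int: "\<And>a b. a \<le> b \<Longrightarrow> (f has_integral (F b - F a)) {a..b}" and e: "e > 0"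
  shows "negligible {x. \<bar>x\<bar> < m \<and> (\<forall>d>0. \<exists>h. 0 < \<bar>h\<bar> \<and> \<bar>h\<bar> < d \<and>
           \<bar>F (x + h) - F x - f x * h\<bar> > e * \<bar>h\<bar>)}" (is "negligible ?E")
proof (subst negligible_outer_le, intro allI impI)
  fix \<eta> :: real assume "\<eta> > 0"
  show "\<exists>T. ?E \<subseteq> T \<and> T \<in> lmeasurable \<and> measure lebesgue T \<le> \<eta>"
  proof (cases "m > 0")
    case False
    then have "?E = {}" by auto
    then show ?thesis using \<open>\<eta> > 0\<close> by (intro exI[of _ "{}"]) auto
  next
    case True
    have intm: "f integrable_on cbox (-m) m"
      using int[of "-m" m] True by (auto simp: integrable_on_def)
    have "e * \<eta> > 0" using e \<open>\<eta> > 0\<close> by simp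
    from Henstock_lemma[OF intm this] obtain \<gamma> where g: "gauge \<gamma>"
      and \<gamma>: "\<And>p. \<lbrakk>p tagged_partial_division_of cbox (-m) m; \<gamma> fine p\<rbrakk> \<Longrightarrow>
        (\<Sum>(x,k)\<in>p. norm (measure lborel k *\<^sub>R f x - integral k f)) < e * \<eta>" by blast
    \<comment> \<open>The interval between x and x + h for either sign of h, written as a ball
      because the covering theorem speaks of balls; the tag x is one of its end points.\<close>
    define I where "I = (\<lambda>(x::real,h::real). cball (x + h/2) (\<bar>h\<bar>/2))"
    have I_eq: "I (x,h) = {min x (x+h)..max x (x+h)}" for x h
      by (auto simp: I_def cball_eq_atLeastAtMost min_def max_def field_simps)
    define K where "K = {(x,h). x \<in> ?E \<and> 0 < \<bar>h\<bar> \<and> I (x,h) \<subseteq> cbox (-m) m \<and> I (x,h) \<subseteq> \<gamma> x \<and>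
        \<bar>F (x + h) - F x - f x * h\<bar> > e * \<bar>h\<bar>}"
    have cov: "\<exists>i. i \<in> K \<and> x \<in> cball (case i of (x,h) \<Rightarrow> x + h/2) (case i of (x,h) \<Rightarrow> \<bar>h\<bar>/2)
        \<and> (case i of (x,h) \<Rightarrow> \<bar>h\<bar>/2) < d" if x: "x \<in> ?E" and d: "0 < d" for x d
    proof -
      have "open (\<gamma> x)" "x \<in> \<gamma> x" using g by (auto simp: gauge_def)
      then obtain r where r: "r > 0" "ball x r \<subseteq> \<gamma> x" by (meson openE)
      define d' where "d' = min (min d r) (m - \<bar>x\<bar>)"
      have "d' > 0" using d r x by (auto simp: d'_def)
      with x obtain h where h: "0 < \<bar>h\<bar>" "\<bar>h\<bar> < d'" "\<bar>F (x + h) - F x - f x * h\<bar> > e * \<bar>h\<bar>" by blast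
      have "I (x,h) \<subseteq> ball x r" using h unfolding I_eq d'_def by (auto simp: dist_real_def)
      moreover have "I (x,h) \<subseteq> cbox (-m) m" using h unfolding I_eq d'_def by auto
      ultimately have "(x,h) \<in> K" using x h r by (auto simp: K_def)
      then show ?thesis using h by (intro exI[of _ "(x,h)"]) (auto simp: d'_def dist_real_def)
    qed
    have rad: "0 < (case i of (x,h) \<Rightarrow> \<bar>h\<bar>/2)" if "i \<in> K" for i using that by (auto simp: K_def)
    have I_alt: "cball (case i of (x,h) \<Rightarrow> x + h/2) (case i of (x,h) \<Rightarrow> \<bar>h\<bar>/2) = I i" for i
      by (simp add: I_def case_prod_beta)
    obtain C where C: "countable C" "C \<subseteq> K" "pairwise (\<lambda>i j. disjnt (I i) (I j)) C"
      "negligible (?E - (\<Union>i\<in>C. I i))"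
      using Vitali_covering_theorem_cballs[of K "\<lambda>(x,h). \<bar>h\<bar>/2" ?E "\<lambda>(x,h). x + h/2", OF rad cov]
      unfolding I_alt by blast
    have bd: "measure lebesgue (\<Union>i\<in>C'. I i) \<le> \<eta>" if C': "C' \<subseteq> C" "finite C'" for C'
    proof -
      have ne: "I i \<noteq> {}" for i by (cases i) (auto simp: I_eq)
      \<comment> \<open>A tagged division is a set of pairs. Disjoint nonempty intervals are
        distinct, so the sum over this set is a sum over the index set.\<close>
      have inj: "inj_on (\<lambda>i. (fst i, I i)) C'"
        using C(3) C' ne unfolding inj_on_def pairwise_def disjnt_def
        by (metis Pair_inject Int_absorb subsetD)
      define p where "p = (\<lambda>i. (fst i, I i)) ` C'"
      have "p tagged_partial_division_of cbox (-m) m"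
        unfolding tagged_partial_division_of_def p_def
      proof (intro conjI allI impI; (elim imageE conjE)?)
        show "finite ((\<lambda>i. (fst i, I i)) ` C')" using C' by auto
      next
        fix x Ka i assume "(x, Ka) = (fst i, I i)" "i \<in> C'"
        then show "x \<in> Ka" "Ka \<subseteq> cbox (-m) m" "\<exists>a b. Ka = cbox a b"
          using C C' by (cases i; auto simp: I_eq K_def)+
      next
        fix x1 K1 x2 K2 i j
        assume *: "(x1, K1) = (fst i, I i)" "i \<in> C'" "(x2, K2) = (fst j, I j)" "j \<in> C'"
          and ne: "(x1, K1) \<noteq> (x2, K2)"
        then have "i \<noteq> j" by auto
        then have "I i \<inter> I j = {}" using * C' C(3) by (auto simp: pairwise_def disjnt_def)
        then show "interior K1 \<inter> interior K2 = {}" using * interior_subset by blast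
      qed
      moreover have "\<gamma> fine p"
        unfolding p_def fine_def using C(2) C' by (fastforce simp: K_def)
      ultimately have "(\<Sum>(x,k)\<in>p. norm (measure lborel k *\<^sub>R f x - integral k f)) < e * \<eta>" by (rule \<gamma>)
      also have "(\<Sum>(x,k)\<in>p. norm (measure lborel k *\<^sub>R f x - integral k f))
          = (\<Sum>i\<in>C'. norm (measure lborel (I i) *\<^sub>R f (fst i) - integral (I i) f))"
        unfolding p_def by (subst sum.reindex[OF inj]) auto
      finally have 1: "(\<Sum>i\<in>C'. norm (measure lborel (I i) *\<^sub>R f (fst i) - integral (I i) f)) < e * \<eta>" .
      have 2: "e * measure lborel (I i) \<le> norm (measure lborel (I i) *\<^sub>R f (fst i) - integral (I i) f)"
        if "i \<in> C'" for i
      proof -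
        obtain x h where i: "i = (x,h)" by (cases i)
        have "(x,h) \<in> K" using that C C' i by auto
        then have h: "h \<noteq> 0" "\<bar>F (x + h) - F x - f x * h\<bar> > e * \<bar>h\<bar>" by (auto simp: K_def)
        show ?thesis
        proof (cases "h > 0")
          case True
          then have "integral (I i) f = F (x+h) - F x"
            using int[of x "x+h"] by (auto simp: i I_eq min_def max_def integral_unique)
          then show ?thesis using True h by (auto simp: i I_eq min_def max_def algebra_simps)
        next
          case False
          then have "integral (I i) f = F x - F (x+h)"
            using int[of "x+h" x] by (auto simp: i I_eq min_def max_def integral_unique)
          then show ?thesis using False h by (auto simp: i I_eq min_def max_def algebra_simps abs_if)
        qed
      qed
      have "measure lebesgue (\<Union>i\<in>C'. I i) \<le> (\<Sum>i\<in>C'. measure lebesgue (I i))"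
        by (intro measure_UNION_le) (use C' in \<open>auto simp: I_def\<close>)
      also have "\<dots> = (\<Sum>i\<in>C'. measure lborel (I i))"
        by (intro sum.cong refl) (auto simp: I_def case_prod_beta)
      also have "e * (\<Sum>i\<in>C'. measure lborel (I i)) \<le> (\<Sum>i\<in>C'. norm (measure lborel (I i) *\<^sub>R f (fst i) - integral (I i) f))"
        unfolding sum_distrib_left by (intro sum_mono 2)
      then have "e * (\<Sum>i\<in>C'. measure lborel (I i)) \<le> e * \<eta>" using 1 by linarith
      then have "(\<Sum>i\<in>C'. measure lborel (I i)) \<le> \<eta>" using e by simp
      finally show ?thesis .
    qed
    have Im: "I i \<in> lmeasurable" for i by (cases i) (auto simp: I_eq)
    have bm: "(\<Union>i\<in>C. I i) \<in> lmeasurable" "measure lebesgue (\<Union>i\<in>C. I i) \<le> \<eta>"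
      using fmeasurable_UN_bound[OF C(1) Im bd] measure_UN_bound[OF C(1) Im bd] by auto
    let ?T = "(\<Union>i\<in>C. I i) \<union> (?E - (\<Union>i\<in>C. I i))"
    have "?T \<in> lmeasurable" using bm C(4) negligible_imp_measurable by blast
    moreover have "measure lebesgue ?T \<le> \<eta>"
      using measure_Un_le[of "\<Union>i\<in>C. I i" lebesgue "?E - (\<Union>i\<in>C. I i)"] bm C(4)
        negligible_imp_measure0[OF C(4)] negligible_imp_sets[OF C(4)] by auto
    ultimately show ?thesis by (intro exI[of _ ?T]) auto
  qed
qed

text \<open>Failure of the derivative at x is witnessed by a tolerance 1/(n + 1), and x lies in some
  (-m, m), so countably many exceptional sets cover everything.\<close>

lemma indefinite_integral_AE_differentiable:
  fixes f F :: "real \<Rightarrow> real"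
  assumes int: "\<And>a b. a \<le> b \<Longrightarrow> (f has_integral (F b - F a)) {a..b}"
  shows "negligible {x. \<not> (F has_real_derivative f x) (at x)}"
proof -
  define E where "E m e = {x. \<bar>x\<bar> < m \<and> (\<forall>d>0. \<exists>h. 0 < \<bar>h\<bar> \<and> \<bar>h\<bar> < d \<and>
           \<bar>F (x + h) - F x - f x * h\<bar> > e * \<bar>h\<bar>)}" for m e :: real
  have "negligible (\<Union>m. \<Union>n. E (real m) (1 / real (Suc n)))"
    unfolding E_def by (intro negligible_Union_nat negligible_Henstock_exceptional int) auto
  moreover have "{x. \<not> (F has_real_derivative f x) (at x)} \<subseteq> (\<Union>m. \<Union>n. E (real m) (1 / real (Suc n)))"
  proof
    fix x assume "x \<in> {x. \<not> (F has_real_derivative f x) (at x)}"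
    then have "\<not> (\<forall>e>0. \<exists>d>0. \<forall>h. h \<noteq> 0 \<and> \<bar>h\<bar> < d \<longrightarrow> \<bar>(F (x+h) - F x) / h - f x\<bar> < e)"
      by (simp add: DERIV_def LIM_def dist_real_def)
    then obtain e where e: "e > 0"
      "\<And>d. d > 0 \<Longrightarrow> \<exists>h. h \<noteq> 0 \<and> \<bar>h\<bar> < d \<and> \<not> \<bar>(F (x+h) - F x) / h - f x\<bar> < e" by meson
    obtain n where n: "1 / real (Suc n) < e" using e(1) nat_approx_posE by metis
    obtain m where m: "\<bar>x\<bar> < real m" using reals_Archimedean2 by blast
    have "x \<in> E (real m) (1 / real (Suc n))"
      unfolding E_def
    proof (intro CollectI conjI allI impI m)
      fix d :: real assume "d > 0"
      then obtain h where h: "h \<noteq> 0" "\<bar>h\<bar> < d" "\<bar>(F (x+h) - F x) / h - f x\<bar> \<ge> e" using e(2) by force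
      have "\<bar>F (x + h) - F x - f x * h\<bar> = \<bar>(F (x+h) - F x) / h - f x\<bar> * \<bar>h\<bar>"
        using h by (simp add: abs_mult[symmetric] field_simps)
      also have "\<dots> \<ge> e * \<bar>h\<bar>" using h by (intro mult_right_mono) auto
      finally have "\<bar>F (x + h) - F x - f x * h\<bar> \<ge> e * \<bar>h\<bar>" .
      moreover have "e * \<bar>h\<bar> > 1 / real (Suc n) * \<bar>h\<bar>" using n h by (intro mult_strict_right_mono) auto
      ultimately have "\<bar>F (x + h) - F x - f x * h\<bar> > 1 / real (Suc n) * \<bar>h\<bar>" by linarith
      then show "\<exists>h. 0 < \<bar>h\<bar> \<and> \<bar>h\<bar> < d \<and> \<bar>F (x + h) - F x - f x * h\<bar> > 1 / real (Suc n) * \<bar>h\<bar>"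
        using h by (intro exI[of _ h]) auto
    qed
    then show "x \<in> (\<Union>m. \<Union>n. E (real m) (1 / real (Suc n)))" by blast
  qed
  ultimately show ?thesis using negligible_subset by blast
qed

text \<open>A bi-Lipschitz increasing homeomorphism \<open>F\<close> is the indefinite integral of the density of the
  image of Lebesgue measure under the inverse of \<open>F\<close>.\<close>

lemma increasing_bilipschitz_AE_differentiable:
  fixes F :: "real \<Rightarrow> real"
  assumes lo: "\<And>x y. x \<le> y \<Longrightarrow> y - x \<le> F y - F x"
    and up: "\<And>x y. x \<le> y \<Longrightarrow> F y - F x \<le> L * (y - x)"
  shows "negligible {x. \<not> F differentiable (at x)}"
proof -
  have sm: "strict_mono F" using lo by (auto simp: strict_mono_def) (smt (verit))
  have L: "L \<ge> 1" using lo[of 0 1] up[of 0 1] by simp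
  have lip: "\<bar>F y - F x\<bar> \<le> L * \<bar>y - x\<bar>" for x y
    using lo[of x y] up[of x y] lo[of y x] up[of y x] by (cases "x \<le> y") auto
  have cont: "continuous_on UNIV F"
    using lip L by (intro lipschitz_on_continuous_on[of L] lipschitz_onI) (auto simp: dist_real_def)
  have "surj F"
  proof -
    have "\<exists>x. F x = y" for y
    proof -
      define M where "M = \<bar>y - F 0\<bar>"
      have 1: "F (-M) \<le> y" using lo[of "-M" 0] by (auto simp: M_def)
      have 2: "y \<le> F M" using lo[of 0 M] by (auto simp: M_def)
      show ?thesis using IVT'[of F "-M" y M] 1 2 continuous_on_subset[OF cont] by (auto simp: M_def)
    qed
    then show ?thesis by (metis surjI)
  qed
  then have bij: "bij F" using sm strict_mono_imp_inj_on by (auto simp: bij_def)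
  define G where "G = inv F"
  have FG[simp]: "F (G y) = y" and GF[simp]: "G (F x) = x" for x y
    using bij by (auto simp: G_def bij_is_surj surj_f_inv_f bij_is_inj)
  have "\<bar>G y - G x\<bar> \<le> 1 * \<bar>y - x\<bar>" for x y
    using lo[of "G x" "G y"] lo[of "G y" "G x"] by (cases "G x \<le> G y") auto
  then have "1-lipschitz_on UNIV G" by (intro lipschitz_onI) (auto simp: dist_real_def)
  then have "continuous_on UNIV G" by (rule lipschitz_on_continuous_on)
  then have Gm[measurable]: "G \<in> borel_measurable borel" by (rule borel_measurable_continuous_onI)
  define N where "N = distr lborel lborel G"
  have vim: "G -` A = F ` A" for A by (auto simp: image_iff) (metis FG)
  have "absolutely_continuous lborel N"
    unfolding absolutely_continuous_def
  proof
    fix A :: "real set" assume A: "A \<in> null_sets lborel"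
    then have "negligible A" using negligible_iff_null_sets null_sets_completionI by blast
    \<comment> \<open>A Lipschitz map sends null sets to null sets. As preimages under
      \<open>G\<close> are images under \<open>F\<close>, this is the absolute continuity of
      \<open>N\<close>.\<close>
    then have "negligible (F ` A)"
      by (intro negligible_locally_Lipschitz_image)
         (auto intro!: exI[of _ UNIV] exI[of _ L] simp: lip)
    then have "emeasure lebesgue (F ` A) = 0" using negligible_iff_emeasure0 negligible_imp_sets by blast
    moreover have "F ` A \<in> sets lborel"
      using A measurable_sets[OF Gm, of A] unfolding vim[symmetric] by (auto simp: null_sets_def)
    ultimately show "A \<in> null_sets N"
      using A by (auto simp: N_def null_sets_def emeasure_distr vim)
  qed
  then obtain g where g[measurable]: "g \<in> borel_measurable lborel" and dens: "density lborel g = N"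
    using sigma_finite_measure.Radon_Nikodym[OF sigma_finite_lborel, of N] by (auto simp: N_def)
  have gint: "(\<integral>\<^sup>+x. g x * indicator {a..b} x \<partial>lborel) = ennreal (F b - F a)" if "a \<le> b" for a b
  proof -
    have mono: "F x \<le> F y \<longleftrightarrow> x \<le> y" for x y using sm by (simp add: strict_mono_less_eq)
    have "F ` {a..b} = {F a..F b}"
      using mono by (auto simp: image_iff) (metis FG mono atLeastAtMost_iff)
    then have "emeasure N {a..b} = ennreal (F b - F a)"
      using that mono[of a b] by (simp add: N_def emeasure_distr vim)
    then show ?thesis unfolding dens[symmetric] by (simp add: emeasure_density)
  qed
  \<comment> \<open>The density takes values in \<open>ennreal\<close>; bounded intervals have
    finite mass, so it is finite almost everywhere and \<open>enn2real\<close> loses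
    nothing.\<close>
  have fin: "AE x in lborel. g x \<noteq> \<infinity>"
  proof -
    have "AE x in lborel. g x * indicator {- real n..real n} x \<noteq> \<infinity>" for n
      by (rule nn_integral_PInf_AE) (use gint[of "- real n" "real n"] in auto)
    then have "AE x in lborel. \<forall>n. g x * indicator {- real n..real n} x \<noteq> \<infinity>"
      by (simp add: AE_all_countable)
    then show ?thesis
    proof eventually_elim
      case (elim x)
      obtain n where "\<bar>x\<bar> \<le> real n" using real_arch_simple by blast
      then have "indicator {- real n..real n} x = (1::ennreal)" by (auto simp: indicator_def abs_le_iff)
      then show ?case using spec[OF elim, of n] by auto
    qed
  qed
  define f where "f x = enn2real (g x)" for x
  have [measurable]: "f \<in> borel_measurable borel" unfolding f_def using g by simp
  have "(f has_integral (F b - F a)) {a..b}" if "a \<le> b" for a b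
  proof -
    have "(\<integral>\<^sup>+x. ennreal (f x * indicator {a..b} x) \<partial>lborel) = (\<integral>\<^sup>+x. g x * indicator {a..b} x \<partial>lborel)"
      using fin by (intro nn_integral_cong_AE, eventually_elim)
        (auto simp: f_def indicator_def top.not_eq_extremum)
    then have "((\<lambda>x. f x * indicator {a..b} x) has_integral (F b - F a)) UNIV"
      using gint[OF that] lo[OF that] that
      by (intro nn_integral_has_integral) (auto simp: f_def)
    moreover have "(\<lambda>x. f x * indicator {a..b} x) = (\<lambda>x. if x \<in> {a..b} then f x else 0)" by auto
    ultimately show ?thesis by (metis has_integral_restrict_UNIV)
  qed
  from indefinite_integral_AE_differentiable[OF this]
  show ?thesis
    by (rule negligible_subset) (auto simp: real_differentiable_def)
qed

section \<open>Lipschitz functions on the line: derivative almost everywhere and fundamental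
  theorem\<close>

text \<open>A limit along one fixed sequence of steps is a total function and Borel measurable by
  construction. It is the derivative wherever that exists and an unspecified value where the
  quotients diverge.\<close>

definition dquot_lim :: "(real \<Rightarrow> 'a::euclidean_space) \<Rightarrow> real \<Rightarrow> 'a" where
  "dquot_lim f x = lim (\<lambda>n. real (Suc n) *\<^sub>R (f (x + 1 / real (Suc n)) - f x))"

lemma dquot_lim_eq:
  assumes "(f has_vector_derivative D) (at x)"
  shows "(\<lambda>n. real (Suc n) *\<^sub>R (f (x + 1 / real (Suc n)) - f x)) \<longlonglongrightarrow> D" "dquot_lim f x = D"
proof -
  have "((\<lambda>h. (f (x + h) - f x) /\<^sub>R h) \<longlongrightarrow> D) (at 0)"
  proof -
    have "((\<lambda>h. norm (f (x + h) - f x - h *\<^sub>R D) / norm h) \<longlongrightarrow> 0) (at 0)"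
      using assms by (simp add: has_vector_derivative_def has_derivative_at)
    then have "((\<lambda>h. norm ((f (x + h) - f x) /\<^sub>R h - D)) \<longlongrightarrow> 0) (at 0)"
    proof (rule Lim_transform_eventually)
      show "\<forall>\<^sub>F h in at 0. norm (f (x + h) - f x - h *\<^sub>R D) / norm h = norm ((f (x + h) - f x) /\<^sub>R h - D)"
      proof (intro eventually_at_filter[THEN iffD2] always_eventually allI impI)
        fix h :: real assume "h \<noteq> 0"
        then have "(f (x + h) - f x) /\<^sub>R h - D = (f (x + h) - f x - h *\<^sub>R D) /\<^sub>R h"
          by (simp add: scaleR_diff_right)
        then show "norm (f (x + h) - f x - h *\<^sub>R D) / norm h = norm ((f (x + h) - f x) /\<^sub>R h - D)"
          by (simp add: divide_inverse_commute)
      qed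
    qed
    then show ?thesis using LIM_zero_cancel tendsto_norm_zero_iff by blast
  qed
  moreover have "filterlim (\<lambda>n. 1 / real (Suc n)) (at 0) sequentially"
    by (intro filterlim_atI lim_1_over_n[THEN LIMSEQ_Suc]) auto
  ultimately have "(\<lambda>n. (f (x + 1 / real (Suc n)) - f x) /\<^sub>R (1 / real (Suc n))) \<longlonglongrightarrow> D"
    by (rule filterlim_compose)
  then show "(\<lambda>n. real (Suc n) *\<^sub>R (f (x + 1 / real (Suc n)) - f x)) \<longlonglongrightarrow> D" by simp
  then show "dquot_lim f x = D" unfolding dquot_lim_def by (rule limI)
qed

text \<open>Adding (L + 1) x to a component turns slopes between -L and L into slopes between 1 and
  2 L + 1, which is the increasing bi-Lipschitz case. Finitely many components then give the vector
  case.\<close>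

lemma lipschitz_AE_has_vector_derivative:
  fixes f :: "real \<Rightarrow> 'a::euclidean_space"
  assumes lip: "L-lipschitz_on UNIV f"
  shows "AE x in lborel. (f has_vector_derivative dquot_lim f x) (at x) \<and> norm (dquot_lim f x) \<le> L"
proof -
  have L: "L \<ge> 0" using lip by (rule lipschitz_on_nonneg)
  have b: "norm (f y - f x) \<le> L * \<bar>y - x\<bar>" for x y
    using lipschitz_onD[OF lip, of y x] by (simp add: dist_norm)
  have comp: "AE x in lborel. (\<lambda>x. f x \<bullet> i) differentiable (at x)" if "i \<in> Basis" for i
  proof -
    define F where "F x = f x \<bullet> i + (L + 1) * x" for x
    have bi: "\<bar>f y \<bullet> i - f x \<bullet> i\<bar> \<le> L * \<bar>y - x\<bar>" for x y
      using Basis_le_norm[OF that, of "f y - f x"] b[of y x] by (simp add: inner_diff_left)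
    have "negligible {x. \<not> F differentiable (at x)}"
    proof (rule increasing_bilipschitz_AE_differentiable[where L = "2 * L + 1"])
      fix x y :: real assume "x \<le> y"
      then show "y - x \<le> F y - F x" "F y - F x \<le> (2 * L + 1) * (y - x)"
        using bi[where x=x and y=y] by (auto simp: F_def algebra_simps abs_le_iff)
    qed
    then have "AE x in lebesgue. F differentiable (at x)"
      by (simp add: negligible_iff_null_sets eventually_ae_filter) blast
    then have "AE x in lborel. F differentiable (at x)" by (simp add: AE_completion_iff)
    then show ?thesis
    proof eventually_elim
      case (elim x)
      have "(\<lambda>x. F x - (L + 1) * x) differentiable (at x)"
        by (intro differentiable_diff elim) (auto intro: derivative_intros)
      then show ?case by (simp add: F_def)
    qed
  qed
  have "AE x in lborel. \<forall>i\<in>Basis. (\<lambda>x. f x \<bullet> i) differentiable (at x)"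
    by (subst AE_ball_countable) (use comp in \<open>auto intro: countable_finite\<close>)
  then show ?thesis
  proof eventually_elim
    case (elim x)
    have "f differentiable (at x)" using elim by (subst differentiable_componentwise_within) auto
    then obtain D where D: "(f has_vector_derivative D) (at x)"
      using vector_derivative_works by blast
    note q = dquot_lim_eq[OF D]
    have "norm D \<le> L"
    proof (rule LIMSEQ_le_const2[OF tendsto_norm[OF q(1)]], intro exI allI impI)
      fix n
      have "real (Suc n) * norm (f (x + 1 / real (Suc n)) - f x) \<le> real (Suc n) * (L * \<bar>1 / real (Suc n)\<bar>)"
        using b[of "x + 1 / real (Suc n)" x] by (intro mult_left_mono) auto
      also have "\<dots> = L" by simp
      finally show "norm (real (Suc n) *\<^sub>R (f (x + 1 / real (Suc n)) - f x)) \<le> L" by simp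
    qed
    then show ?case using D q by simp
  qed
qed

lemma borel_measurable_dquot_lim[measurable]:
  fixes f :: "real \<Rightarrow> 'a::euclidean_space"
  assumes [measurable]: "f \<in> borel_measurable borel"
  shows "dquot_lim f \<in> borel_measurable borel"
  unfolding dquot_lim_def by measurable

text \<open>The difference quotients of f are bounded by L and converge almost everywhere, so their
  integrals converge to the integral of the derivative. The same integrals are differences of
  quotients of a primitive of f at b and at a, and these converge to f b - f a because f is
  continuous.\<close>

lemma lipschitz_FTC:
  fixes f :: "real \<Rightarrow> 'a::euclidean_space"
  assumes lip: "L-lipschitz_on UNIV f" and ab: "a \<le> b"
  shows "set_integrable lborel {a..b} (dquot_lim f)" "(LINT x:{a..b}|lborel. dquot_lim f x) = f b - f a"
proof -
  have cont: "continuous_on S f" for S using lip lipschitz_on_continuous_on lipschitz_on_subset by blast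
  have L: "L \<ge> 0" using lip by (rule lipschitz_on_nonneg)
  have bnd: "norm (f y - f x) \<le> L * \<bar>y - x\<bar>" for x y
    using lipschitz_onD[OF lip, of y x] by (simp add: dist_norm)
  have [measurable]: "f \<in> borel_measurable borel" by (intro borel_measurable_continuous_onI cont)
  define q where "q n x = real (Suc n) *\<^sub>R (f (x + 1 / real (Suc n)) - f x)" for n x
  have [measurable]: "q n \<in> borel_measurable borel" for n unfolding q_def by measurable
  have nq: "norm (q n x) \<le> L" for n x
  proof -
    have "real (Suc n) * norm (f (x + 1 / real (Suc n)) - f x) \<le> real (Suc n) * (L * \<bar>1 / real (Suc n)\<bar>)"
      using bnd[of "x + 1 / real (Suc n)" x] by (intro mult_left_mono) auto
    also have "\<dots> = L" by simp
    finally show ?thesis by (simp add: q_def)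
  qed
  let ?I = "\<lambda>x. indicator {a..b} x :: real"
  have dom: "integrable lborel (\<lambda>x. L * ?I x)"
    by (intro integrable_mult_right integrable_real_indicator) (auto simp: emeasure_lborel_Icc_eq)
  have ptw: "AE x in lborel. (\<lambda>n. ?I x *\<^sub>R q n x) \<longlonglongrightarrow> ?I x *\<^sub>R dquot_lim f x"
    using lipschitz_AE_has_vector_derivative[OF lip]
    by eventually_elim (unfold q_def, intro tendsto_scaleR[OF tendsto_const] dquot_lim_eq(1), auto)
  have bd: "AE x in lborel. norm (?I x *\<^sub>R q n x) \<le> L * ?I x" for n
    using nq[of n] by (intro AE_I2) (auto simp: indicator_def)
  have meas: "(\<lambda>x. ?I x *\<^sub>R dquot_lim f x) \<in> borel_measurable lborel"
    "\<And>n. (\<lambda>x. ?I x *\<^sub>R q n x) \<in> borel_measurable lborel" by measurable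
  show "set_integrable lborel {a..b} (dquot_lim f)"
    unfolding set_integrable_def by (rule integrable_dominated_convergence[OF meas dom ptw bd]) 
  have lim1: "(\<lambda>n. LINT x|lborel. ?I x *\<^sub>R q n x) \<longlonglongrightarrow> (LINT x|lborel. ?I x *\<^sub>R dquot_lim f x)"
    by (rule integral_dominated_convergence[OF meas dom ptw bd])
  define H where "H x = integral {a-1..x} f" for x
  have Hd: "(H has_vector_derivative f x) (at x within {a-1..b+1})" if "x \<in> {a-1..b+1}" for x
    unfolding H_def by (intro integral_has_vector_derivative cont that)
  have qi: "(LINT x|lborel. ?I x *\<^sub>R q n x) = real (Suc n) *\<^sub>R (H (b + 1 / real (Suc n)) - H b)
      - real (Suc n) *\<^sub>R (H (a + 1 / real (Suc n)) - H a)" for n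
  proof -
    let ?d = "1 / real (Suc n)"
    have d: "0 < ?d" "?d \<le> 1" by auto
    have sh: "x + ?d \<in> {a-1..b+1}" if "x \<in> {a..b}" for x
      using that d unfolding atLeastAtMost_iff by linarith
    have sub: "(\<lambda>x. x + ?d) ` {a..b} \<subseteq> {a-1..b+1}" by (intro image_subsetI sh)
    have "((\<lambda>x. real (Suc n) *\<^sub>R (H (x + ?d) - H x)) has_vector_derivative q n x) (at x within {a..b})"
      if "x \<in> {a..b}" for x
    proof -
      have 1: "(H has_vector_derivative f x) (at x within {a..b})"
        using that by (intro has_vector_derivative_within_subset[OF Hd]) auto
      have "((H \<circ> (\<lambda>x. x + ?d)) has_vector_derivative 1 *\<^sub>R f (x + ?d)) (at x within {a..b})"
      proof (rule vector_diff_chain_within)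
        show "((\<lambda>x. x + ?d) has_vector_derivative 1) (at x within {a..b})"
          by (auto intro!: derivative_eq_intros)
        show "(H has_vector_derivative f (x + ?d)) (at (x + ?d) within (\<lambda>x. x + ?d) ` {a..b})"
          by (rule has_vector_derivative_within_subset[OF Hd[OF sh[OF that]] sub])
      qed
      then have 2: "((\<lambda>x. H (x + ?d)) has_vector_derivative f (x + ?d)) (at x within {a..b})"
        by (simp add: o_def)
      show ?thesis unfolding q_def
        using has_vector_derivative_scaleR[OF DERIV_const has_vector_derivative_diff[OF 2 1], of "real (Suc n)"]
        by simp
    qed
    from fundamental_theorem_of_calculus[OF ab this]
    have "(q n has_integral (real (Suc n) *\<^sub>R (H (b + ?d) - H b) - real (Suc n) *\<^sub>R (H (a + ?d) - H a))) {a..b}"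
      by simp
    moreover have "set_integrable lborel {a..b} (q n)"
      unfolding set_integrable_def by (rule integrable_dominated_convergence2[OF meas dom ptw bd]) 
    ultimately show ?thesis
      using set_borel_integral_eq_integral(2)[of "{a..b}" "q n"]
      by (simp add: integral_unique set_lebesgue_integral_def)
  qed
  have Hlim: "(\<lambda>n. real (Suc n) *\<^sub>R (H (x + 1 / real (Suc n)) - H x)) \<longlonglongrightarrow> f x" if "x \<in> {a..b}" for x
  proof -
    have "x \<in> interior {a-1..b+1}" using that by (simp add: interior_atLeastAtMost_real)
    then have "at x within {a-1..b+1} = at x" by (rule at_within_interior)
    moreover have "x \<in> {a-1..b+1}" using that by simp
    ultimately have "(H has_vector_derivative f x) (at x)"
      using Hd[of x] by metis
    then show ?thesis by (rule dquot_lim_eq(1))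
  qed
  have "(\<lambda>n. LINT x|lborel. ?I x *\<^sub>R q n x) \<longlonglongrightarrow> f b - f a"
    unfolding qi using ab by (intro tendsto_diff Hlim) auto
  then show "(LINT x:{a..b}|lborel. dquot_lim f x) = f b - f a"
    unfolding set_lebesgue_integral_def using lim1 LIMSEQ_unique by blast
qed

section \<open>Lebesgue measure on the plane in rotated coordinates\<close>

lemma borel_measurable_Complex [measurable (raw)]:
  assumes [measurable]: "f \<in> borel_measurable M" "g \<in> borel_measurable M"
  shows "(\<lambda>x. Complex (f x) (g x)) \<in> borel_measurable M"
  unfolding Complex_eq by measurable

lemma lborel_complex_eq:
  "distr (lborel \<Otimes>\<^sub>M lborel) borel (\<lambda>(x,y). Complex x y) = lborel"
proof (rule lborel_eqI[symmetric])
  fix l u :: complex assume le: "\<And>b. b \<in> Basis \<Longrightarrow> l \<bullet> b \<le> u \<bullet> b"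
  have le': "Re l \<le> Re u" "Im l \<le> Im u" using le[of 1] le[of \<i>] by (auto simp: Basis_complex_def)
  have "(\<lambda>(x,y). Complex x y) -` box l u = {Re l<..<Re u} \<times> {Im l<..<Im u}"
    by (auto simp: in_box_complex_iff)
  then show "emeasure (distr (lborel \<Otimes>\<^sub>M lborel) borel (\<lambda>(x,y). Complex x y)) (box l u) = (\<Prod>b\<in>Basis. (u - l) \<bullet> b)"
    using le' by (subst emeasure_distr)
      (auto simp: space_pair_measure lborel.emeasure_pair_measure_Times Basis_complex_def ennreal_mult')
qed simp

lemma nn_integral_plane:
  assumes [measurable]: "f \<in> borel_measurable borel"
  shows "(\<integral>\<^sup>+z. f z \<partial>lborel) = (\<integral>\<^sup>+y. \<integral>\<^sup>+x. f (Complex x y) \<partial>lborel \<partial>lborel)"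
    "(\<integral>\<^sup>+z. f z \<partial>lborel) = (\<integral>\<^sup>+x. \<integral>\<^sup>+y. f (Complex x y) \<partial>lborel \<partial>lborel)"
proof -
  have "(\<integral>\<^sup>+z. f z \<partial>lborel) = (\<integral>\<^sup>+(x,y). f (Complex x y) \<partial>(lborel \<Otimes>\<^sub>M lborel))"
    by (subst lborel_complex_eq[symmetric], subst nn_integral_distr) (auto simp: case_prod_unfold)
  also have "\<dots> = (\<integral>\<^sup>+y. \<integral>\<^sup>+x. f (Complex x y) \<partial>lborel \<partial>lborel)"
    by (subst lborel_pair.nn_integral_snd[symmetric]) simp_all
  finally show 1: "(\<integral>\<^sup>+z. f z \<partial>lborel) = (\<integral>\<^sup>+y. \<integral>\<^sup>+x. f (Complex x y) \<partial>lborel \<partial>lborel)" .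
  show "(\<integral>\<^sup>+z. f z \<partial>lborel) = (\<integral>\<^sup>+x. \<integral>\<^sup>+y. f (Complex x y) \<partial>lborel \<partial>lborel)"
    unfolding 1 by (rule lborel_pair.Fubini') simp
qed

text \<open>Fubini reduces a shear to translations of the lines that it preserves.\<close>

lemma lborel_distr_shear:
  fixes a :: real
  shows "distr lborel borel (\<lambda>z. Complex (Re z + a * Im z) (Im z)) = (lborel :: complex measure)"
    "distr lborel borel (\<lambda>z. Complex (Re z) (Im z + a * Re z)) = (lborel :: complex measure)"
proof -
  have sh: "(\<integral>\<^sup>+x. f (x + c) \<partial>lborel) = (\<integral>\<^sup>+x. f x \<partial>lborel)" if "f \<in> borel_measurable borel"
    for f :: "real \<Rightarrow> ennreal" and c :: real
    using nn_integral_real_affine[of f 1 c] that by (simp add: add.commute)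
  show "distr lborel borel (\<lambda>z. Complex (Re z + a * Im z) (Im z)) = (lborel :: complex measure)"
  proof (rule measure_eqI)
    fix A :: "complex set"
    assume "A \<in> sets (distr lborel borel (\<lambda>z. Complex (Re z + a * Im z) (Im z)))"
    then have [measurable]: "A \<in> sets borel" by simp
    have "emeasure (distr lborel borel (\<lambda>z. Complex (Re z + a * Im z) (Im z))) A
      = (\<integral>\<^sup>+z. indicator A (Complex (Re z + a * Im z) (Im z)) \<partial>lborel)"
      by (subst nn_integral_indicator[symmetric], simp, subst nn_integral_distr) auto
    also have "\<dots> = (\<integral>\<^sup>+z. indicator A z \<partial>lborel)"
      using sh[of "\<lambda>x. indicator A (Complex x _)"] by (simp add: nn_integral_plane(1) del: nn_integral_indicator)
    finally show "emeasure (distr lborel borel (\<lambda>z. Complex (Re z + a * Im z) (Im z))) A = emeasure lborel A"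
      by simp
  qed simp
  show "distr lborel borel (\<lambda>z. Complex (Re z) (Im z + a * Re z)) = (lborel :: complex measure)"
  proof (rule measure_eqI)
    fix A :: "complex set"
    assume "A \<in> sets (distr lborel borel (\<lambda>z. Complex (Re z) (Im z + a * Re z)))"
    then have [measurable]: "A \<in> sets borel" by simp
    have "emeasure (distr lborel borel (\<lambda>z. Complex (Re z) (Im z + a * Re z))) A
      = (\<integral>\<^sup>+z. indicator A (Complex (Re z) (Im z + a * Re z)) \<partial>lborel)"
      by (subst nn_integral_indicator[symmetric], simp, subst nn_integral_distr) auto
    also have "\<dots> = (\<integral>\<^sup>+z. indicator A z \<partial>lborel)"
      using sh[of "\<lambda>y. indicator A (Complex _ y)"] by (simp add: nn_integral_plane(2) del: nn_integral_indicator)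
    finally show "emeasure (distr lborel borel (\<lambda>z. Complex (Re z) (Im z + a * Re z))) A = emeasure lborel A"
      by simp
  qed simp
qed

text \<open>A rotation by an angle other than \<open>\<pi>\<close> is a product of three shears; every rotation is the
  square of such a rotation.\<close>

lemma lborel_distr_rotation:
  fixes u :: complex
  assumes u: "norm u = 1"
  shows "distr lborel borel (\<lambda>z. u * z) = lborel"
proof -
  have *: "distr lborel borel (\<lambda>z. v * z) = lborel" if v: "norm v = 1" "Re v \<ge> 0" for v :: complex
  proof -
    \<comment> \<open>The tangent of half the angle: the rotation by \<theta> is the product of
      shears with parameters - tan (\<theta>/2), sin \<theta> and - tan (\<theta>/2).\<close>
    define t where "t = Im v / (1 + Re v)"
    define T where "T = (\<lambda>z. Complex (Re z + (-t) * Im z) (Im z))"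
    define U where "U = (\<lambda>z. Complex (Re z) (Im z + Im v * Re z))"
    have [measurable]: "T \<in> borel \<rightarrow>\<^sub>M borel" "U \<in> borel \<rightarrow>\<^sub>M borel" unfolding T_def U_def by measurable
    have n: "(Re v)\<^sup>2 + (Im v)\<^sup>2 = 1" using v(1) by (simp add: cmod_def)
    have tb: "t * Im v = 1 - Re v"
    proof -
      have "(Im v)\<^sup>2 = (1 - Re v) * (1 + Re v)" using n by (simp add: algebra_simps power2_eq_square)
      then show ?thesis using v(2) by (simp add: t_def field_simps power2_eq_square)
    qed
    have ta: "t * (1 + Re v) = Im v" using v(2) by (simp add: t_def)
    have "T (U (T z)) = v * z" for z
    proof (rule complex_eqI)
      have "Im z + Im v * (Re z + - t * Im z) = Im z + Im v * Re z - (t * Im v) * Im z"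
        by (simp add: algebra_simps)
      also have "\<dots> = Im v * Re z + Re v * Im z" unfolding tb by (simp add: algebra_simps)
      finally have y: "Im z + Im v * (Re z + - t * Im z) = Im v * Re z + Re v * Im z" .
      have TUT: "T (U (T z)) = Complex (Re z + - t * Im z + - t * (Im z + Im v * (Re z + - t * Im z)))
          (Im z + Im v * (Re z + - t * Im z))" by (simp only: T_def U_def complex.sel)
      show "Im (T (U (T z))) = Im (v * z)" unfolding TUT y by simp
      have "Re z + - t * Im z + - t * (Im v * Re z + Re v * Im z)
          = Re z - (t * Im v) * Re z - (t * (1 + Re v)) * Im z" by (simp add: algebra_simps)
      also have "\<dots> = Re v * Re z - Im v * Im z" unfolding tb ta by (simp add: algebra_simps)
      finally show "Re (T (U (T z))) = Re (v * z)" unfolding TUT y by simp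
    qed
    then have "(\<lambda>z. v * z) = T \<circ> (U \<circ> T)" by (auto simp: o_def)
    then have "distr lborel borel (\<lambda>z. v * z) = distr lborel borel (T \<circ> (U \<circ> T))" by (simp only:)
    also have "distr lborel borel (T \<circ> (U \<circ> T)) = distr (distr (distr lborel borel T) borel U) borel T"
      by (simp add: distr_distr o_assoc)
    also have "\<dots> = lborel" unfolding T_def U_def lborel_distr_shear ..
    finally show ?thesis .
  qed
  \<comment> \<open>The principal root halves the angle and has nonnegative real part, which keeps
    the denominator 1 + Re v of the tangent positive.\<close>
  define v where "v = csqrt u"
  have "v * v = u" by (simp add: v_def flip: power2_eq_square)
  then have "norm v * norm v = 1" using u by (metis norm_mult)
  then have "norm v = 1" by (simp add: abs_square_eq_1 power2_eq_square[symmetric] power2_eq_1_iff)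
  moreover have "Re v \<ge> 0" using csqrt_principal[of u] by (auto simp: v_def)
  ultimately have "distr lborel borel (\<lambda>z. v * z) = lborel" by (rule *)
  then have "distr (distr lborel borel (\<lambda>z. v * z)) borel (\<lambda>z. v * z) = lborel" by simp
  then show ?thesis using \<open>v * v = u\<close> by (simp add: distr_distr o_def mult.assoc[symmetric])
qed

lemma lborel_distr_chart:
  fixes u p :: complex
  assumes u: "norm u = 1"
  shows "distr (lborel \<Otimes>\<^sub>M lborel) borel (\<lambda>(s,t). p + u * Complex s t) = lborel"
proof -
  have "distr (lborel \<Otimes>\<^sub>M lborel) borel (\<lambda>(s,t). p + u * Complex s t)
     = distr (distr (distr (lborel \<Otimes>\<^sub>M lborel) borel (\<lambda>(x,y). Complex x y)) borel (\<lambda>z. u * z)) borel ((+) p)"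
    by (simp add: distr_distr o_def case_prod_unfold)
  also have "\<dots> = lborel" using lborel_distr_rotation[OF u] by (simp add: lborel_complex_eq lborel_distr_plus)
  finally show ?thesis .
qed

lemma chart_fubini:
  fixes u p :: complex and f :: "complex \<Rightarrow> 'a::{banach, second_countable_topology}"
  assumes u: "norm u = 1" and f: "integrable lborel f"
  shows "integrable (lborel \<Otimes>\<^sub>M lborel) (\<lambda>(s,t). f (p + u * Complex s t))"
    "(LINT z|lborel. f z) = (LINT t|lborel. LINT s|lborel. f (p + u * Complex s t))"
    "(LINT z|lborel. f z) = (LINT s|lborel. LINT t|lborel. f (p + u * Complex s t))"
proof -
  have [measurable]: "f \<in> borel_measurable borel" using f borel_measurable_integrable by auto
  have m: "(\<lambda>(s,t). p + u * Complex s t) \<in> lborel \<Otimes>\<^sub>M lborel \<rightarrow>\<^sub>M borel" by measurable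
  have "integrable (distr (lborel \<Otimes>\<^sub>M lborel) borel (\<lambda>(s,t). p + u * Complex s t)) f"
    unfolding lborel_distr_chart[OF u] by (rule f)
  then show i: "integrable (lborel \<Otimes>\<^sub>M lborel) (\<lambda>(s,t). f (p + u * Complex s t))"
    by (subst (asm) integrable_distr_eq[OF m]) (auto simp: case_prod_unfold)
  have "(LINT z|lborel. f z) = (LINT z|(distr (lborel \<Otimes>\<^sub>M lborel) borel (\<lambda>(s,t). p + u * Complex s t)). f z)"
    unfolding lborel_distr_chart[OF u] ..
  also have "\<dots> = (LINT x|(lborel \<Otimes>\<^sub>M lborel). (case x of (s,t) \<Rightarrow> f (p + u * Complex s t)))"
    by (subst integral_distr[OF m]) (auto simp: case_prod_unfold)
  finally have e: "(LINT z|lborel. f z) = (LINT x|(lborel \<Otimes>\<^sub>M lborel). (case x of (s,t) \<Rightarrow> f (p + u * Complex s t)))" .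
  show "(LINT z|lborel. f z) = (LINT t|lborel. LINT s|lborel. f (p + u * Complex s t))"
    using lborel_pair.integral_snd[OF i] e by simp
  show "(LINT z|lborel. f z) = (LINT s|lborel. LINT t|lborel. f (p + u * Complex s t))"
    using lborel_pair.integral_fst'[OF i] e by simp
qed

lemma chart_null_set:
  fixes u p :: complex
  assumes u: "norm u = 1" and N[measurable]: "N \<in> sets borel"
    and P: "\<And>s. AE t in lborel. p + u * Complex s t \<notin> N"
  shows "N \<in> null_sets lborel"
proof -
  have [measurable]: "(\<lambda>(s,t). p + u * Complex s t) \<in> lborel \<Otimes>\<^sub>M lborel \<rightarrow>\<^sub>M borel" by measurable
  have "AE x in lborel \<Otimes>\<^sub>M lborel. (case x of (s,t) \<Rightarrow> p + u * Complex s t) \<notin> N"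
  proof (rule lborel_pair.AE_pair_measure)
    have "Measurable.pred (lborel \<Otimes>\<^sub>M lborel) (\<lambda>x. (case x of (s,t) \<Rightarrow> p + u * Complex s t) \<notin> N)" by measurable
    then show "{x \<in> space (lborel \<Otimes>\<^sub>M lborel). (case x of (s,t) \<Rightarrow> p + u * Complex s t) \<notin> N} \<in> sets (lborel \<Otimes>\<^sub>M lborel)"
      unfolding pred_def .
  qed (use P in auto)
  then have "AE z in distr (lborel \<Otimes>\<^sub>M lborel) borel (\<lambda>(s,t). p + u * Complex s t). z \<notin> N"
    by (subst AE_distr_iff) auto
  then have "AE z in lborel. z \<notin> N" unfolding lborel_distr_chart[OF u] .
  then show ?thesis using AE_iff_null_sets[of N lborel] by simp
qed

section \<open>Derivatives of compactly supported functions have integral zero\<close>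

lemma lipschitz_compact_support_integral:
  fixes f g :: "real \<Rightarrow> 'a::euclidean_space"
  assumes lip: "L-lipschitz_on UNIV f" and supp: "\<And>x. R < \<bar>x\<bar> \<Longrightarrow> f x = 0"
    and [measurable]: "g \<in> borel_measurable borel"
    and g: "AE x in lborel. (f has_vector_derivative g x) (at x)"
  shows "integrable lborel g" "(LINT x|lborel. g x) = 0"
proof -
  \<comment> \<open>The extra 1 puts both end points strictly outside the support, so
    \<open>f\<close> vanishes at them.\<close>
  define S where "S = \<bar>R\<bar> + 1"
  have [measurable]: "f \<in> borel_measurable borel"
    using lip by (intro borel_measurable_continuous_onI lipschitz_on_continuous_on)
  have ae: "AE x in lborel. g x = indicator {-S..S} x *\<^sub>R dquot_lim f x"
    using g
  proof eventually_elim
    case (elim x)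
    show ?case
    proof (cases "x \<in> {-S..S}")
      case True then show ?thesis using dquot_lim_eq(2)[OF elim] by simp
    next
      case False
      have o: "open (- {-\<bar>R\<bar>..\<bar>R\<bar>})" by (intro open_Compl) auto
      have "((\<lambda>_. 0) has_vector_derivative g x) (at x)"
        by (rule has_vector_derivative_transform_within_open[OF elim o])
           (use False in \<open>auto simp: S_def intro!: supp\<close>)
      then have "g x = 0"
        using vector_derivative_unique_at has_vector_derivative_const by blast
      then show ?thesis using False by simp
    qed
  qed
  have s: "-S \<le> S" by (simp add: S_def)
  have m: "(\<lambda>x. indicator {-S..S} x *\<^sub>R dquot_lim f x) \<in> borel_measurable lborel" by measurable
  have "integrable lborel (\<lambda>x. indicator {-S..S} x *\<^sub>R dquot_lim f x)"
    using lipschitz_FTC(1)[OF lip s] by (simp add: set_integrable_def)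
  then show "integrable lborel g"
    using ae by (subst integrable_cong_AE[OF _ m]) auto
  have "(LINT x|lborel. g x) = (LINT x:{-S..S}|lborel. dquot_lim f x)"
    unfolding set_lebesgue_integral_def using ae m by (intro integral_cong_AE) auto
  also have "\<dots> = 0" using lipschitz_FTC(2)[OF lip s] supp[of S] supp[of "-S"] by (simp add: S_def)
  finally show "(LINT x|lborel. g x) = 0" .
qed

text \<open>On every line in direction u the integrand is almost everywhere the derivative of a
  compactly supported Lipschitz function and has integral 0; Fubini in coordinates rotated by u adds
  these up.\<close>

lemma plane_directional_derivative_integral:
  fixes F D :: "complex \<Rightarrow> complex" and u :: complex
  assumes u: "norm u = 1" and lip: "L-lipschitz_on UNIV F" and supp: "\<And>z. R < norm z \<Longrightarrow> F z = 0"
    and D: "integrable lborel D"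
    and der: "\<And>z. AE s in lborel. ((\<lambda>s. F (z + u * of_real s)) has_vector_derivative D (z + u * of_real s)) (at s)"
  shows "(LINT z|lborel. D z) = 0"
proof -
  have [measurable]: "D \<in> borel_measurable borel" using D borel_measurable_integrable by auto
  have c: "0 + u * Complex s t = u * \<i> * of_real t + u * of_real s" for s t
    by (simp add: Complex_eq algebra_simps)
  have "(LINT s|lborel. D (u * \<i> * of_real t + u * of_real s)) = 0" for t
  proof (rule lipschitz_compact_support_integral(2))
    show "L-lipschitz_on UNIV (\<lambda>s. F (u * \<i> * of_real t + u * of_real s))"
    proof (rule lipschitz_onI)
      fix x y :: real
      have "dist (F (u * \<i> * of_real t + u * of_real x)) (F (u * \<i> * of_real t + u * of_real y))
        \<le> L * dist (u * \<i> * of_real t + u * of_real x) (u * \<i> * of_real t + u * of_real y)"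
        by (rule lipschitz_onD[OF lip]) auto
      also have "dist (u * \<i> * of_real t + u * of_real x) (u * \<i> * of_real t + u * of_real y) = dist x y"
      proof -
        have "u * \<i> * of_real t + u * of_real x - (u * \<i> * of_real t + u * of_real y) = u * of_real (x - y)"
          by (simp add: algebra_simps)
        then show ?thesis using u by (simp add: dist_norm norm_mult del: of_real_diff)
      qed
      finally show "dist (F (u * \<i> * of_real t + u * of_real x)) (F (u * \<i> * of_real t + u * of_real y)) \<le> L * dist x y" .
    qed (use lip lipschitz_on_nonneg in auto)
  next
    fix s :: real assume s: "R < \<bar>s\<bar>"
    have "\<bar>s\<bar> \<le> norm (u * Complex s t)" using u abs_Re_le_cmod[of "Complex s t"] by (simp add: norm_mult)
    then show "F (u * \<i> * of_real t + u * of_real s) = 0" using s c[of s t] supp by auto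
  qed (use der[of "u * \<i> * of_real t"] in measurable)
  then show ?thesis
    using chart_fubini(2)[OF u D, of 0] unfolding c by simp
qed

section \<open>Smooth functions and test functions\<close>

text \<open>The product rule pairs a derivative of order n with an undifferentiated factor known to
  order n + 1; this brings both to the same order.\<close>

lemma C_k_Suc_imp: "C_k (Suc n) f \<Longrightarrow> C_k n f"
proof (induction n arbitrary: f)
  case 0
  then show ?case
    by (auto intro!: differentiable_imp_continuous_on simp: differentiable_on_def differentiable_def)
      (meson has_derivative_at_withinI)
next
  case (Suc n)
  then show ?case by (metis C_k.simps(2))
qed

lemma C_k_SucI:
  assumes "\<And>z. (f has_derivative (\<lambda>h. of_real (Re h) * fx z + of_real (Im h) * fy z)) (at z)"
    "C_k n fx" "C_k n fy"
  shows "C_k (Suc n) f"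
  using assms by (simp only: C_k.simps) blast

definition smooth :: "(complex \<Rightarrow> complex) \<Rightarrow> bool" where
  "smooth f \<longleftrightarrow> (\<forall>n. C_k n f)"

definition dx :: "(complex \<Rightarrow> complex) \<Rightarrow> complex \<Rightarrow> complex" where
  "dx f z = frechet_derivative f (at z) 1"
definition dy :: "(complex \<Rightarrow> complex) \<Rightarrow> complex \<Rightarrow> complex" where
  "dy f z = frechet_derivative f (at z) \<i>"

lemma first_order_eq: "first_order a b f z = a * dx f z + b * dy f z"
  by (simp add: first_order_def dx_def dy_def)

lemma dx_dy_eqI:
  assumes "(f has_derivative (\<lambda>h. of_real (Re h) * p + of_real (Im h) * q)) (at z)"
  shows "dx f z = p" "dy f z = q"
  using frechet_derivative_at[OF assms] by (auto simp: dx_def dy_def dest: fun_cong[of _ _ 1] fun_cong[of _ _ \<i>] simp flip: frechet_derivative_at[OF assms])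

lemma smoothD:
  assumes "smooth f"
  shows "(f has_derivative (\<lambda>h. of_real (Re h) * dx f z + of_real (Im h) * dy f z)) (at z)"
    "smooth (dx f)" "smooth (dy f)" "continuous_on S f"
proof -
  have *: "\<exists>fx fy. C_k n fx \<and> C_k n fy \<and>
     (\<forall>z. (f has_derivative (\<lambda>h. of_real (Re h) * fx z + of_real (Im h) * fy z)) (at z))" for n
    using assms C_k.simps(2) unfolding smooth_def by blast
  have **: "C_k n (dx f) \<and> C_k n (dy f) \<and>
     (\<forall>z. (f has_derivative (\<lambda>h. of_real (Re h) * dx f z + of_real (Im h) * dy f z)) (at z))" for n
  proof -
    obtain fx fy where f: "C_k n fx" "C_k n fy"
     "\<And>z. (f has_derivative (\<lambda>h. of_real (Re h) * fx z + of_real (Im h) * fy z)) (at z)" using * by blast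
    have "dx f = fx" "dy f = fy" using dx_dy_eqI[OF f(3)] by auto
    then show ?thesis using f by simp
  qed
  show "(f has_derivative (\<lambda>h. of_real (Re h) * dx f z + of_real (Im h) * dy f z)) (at z)"
    "smooth (dx f)" "smooth (dy f)" using ** by (auto simp: smooth_def)
  show "continuous_on S f"
    using assms C_k.simps(1) continuous_on_subset unfolding smooth_def by blast
qed

text \<open>Meant for families that contain their own partial derivatives, such as the multiples of
  one exponential or the convolutions of a kernel with test functions. Membership in the family is
  the invariant of the induction on the order.\<close>

lemma smooth_coinduct:
  assumes "f \<in> S" and "\<And>f. f \<in> S \<Longrightarrow> \<exists>fx\<in>S. \<exists>fy\<in>S.
     \<forall>z. (f has_derivative (\<lambda>h. of_real (Re h) * fx z + of_real (Im h) * fy z)) (at z)"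
  shows "smooth f"
  unfolding smooth_def
proof
  fix n show "C_k n f" using assms(1)
  proof (induction n arbitrary: f)
    case 0
    then obtain fx fy where "\<forall>z. (f has_derivative (\<lambda>h. of_real (Re h) * fx z + of_real (Im h) * fy z)) (at z)"
      using assms(2) by blast
    then show ?case
      using has_derivative_continuous_on[of UNIV f "\<lambda>z h. of_real (Re h) * fx z + of_real (Im h) * fy z"] by simp
  next
    case (Suc n)
    obtain fx fy where "fx \<in> S" "fy \<in> S"
      "\<And>z. (f has_derivative (\<lambda>h. of_real (Re h) * fx z + of_real (Im h) * fy z)) (at z)"
      using assms(2)[OF Suc.prems] by blast
    then show ?case using Suc.IH by (intro C_k_SucI)
  qed
qed

lemma C_k_const: "C_k n (\<lambda>z. c)"
  by (induction n arbitrary: c) (auto intro!: exI[of _ "\<lambda>_. 0"])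

lemma C_k_add: "C_k n f \<Longrightarrow> C_k n g \<Longrightarrow> C_k n (\<lambda>z. f z + g z)"
proof (induction n arbitrary: f g)
  case (Suc n)
  from Suc.prems obtain fx fy gx gy where *: "C_k n fx" "C_k n fy" "C_k n gx" "C_k n gy"
    and f: "\<And>z. (f has_derivative (\<lambda>h. of_real (Re h) * fx z + of_real (Im h) * fy z)) (at z)"
    and g: "\<And>z. (g has_derivative (\<lambda>h. of_real (Re h) * gx z + of_real (Im h) * gy z)) (at z)" by auto
  have "((\<lambda>z. f z + g z) has_derivative (\<lambda>h. of_real (Re h) * (fx z + gx z) + of_real (Im h) * (fy z + gy z))) (at z)" for z
    by (rule has_derivative_eq_rhs[OF has_derivative_add[OF f[of z] g[of z]]]) (simp add: algebra_simps)
  then show ?case by (rule C_k_SucI) (intro Suc.IH *)+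
qed (auto intro: continuous_intros)

lemma C_k_mult: "C_k n f \<Longrightarrow> C_k n g \<Longrightarrow> C_k n (\<lambda>z. f z * g z)"
proof (induction n arbitrary: f g)
  case (Suc n)
  from Suc.prems obtain fx fy gx gy where *: "C_k n fx" "C_k n fy" "C_k n gx" "C_k n gy"
    and f: "\<And>z. (f has_derivative (\<lambda>h. of_real (Re h) * fx z + of_real (Im h) * fy z)) (at z)"
    and g: "\<And>z. (g has_derivative (\<lambda>h. of_real (Re h) * gx z + of_real (Im h) * gy z)) (at z)" by auto
  have "((\<lambda>z. f z * g z) has_derivative
      (\<lambda>h. of_real (Re h) * (fx z * g z + f z * gx z) + of_real (Im h) * (fy z * g z + f z * gy z))) (at z)" for z
    by (rule has_derivative_eq_rhs[OF has_derivative_mult[OF f[of z] g[of z]]]) (simp add: algebra_simps)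
  moreover have "C_k n (\<lambda>z. fx z * g z + f z * gx z)" "C_k n (\<lambda>z. fy z * g z + f z * gy z)"
    by (intro C_k_add Suc.IH * C_k_Suc_imp[OF Suc.prems(1)] C_k_Suc_imp[OF Suc.prems(2)])+
  ultimately show ?case by (rule C_k_SucI)
qed (auto intro: continuous_intros)

lemma C_k_cnj: "C_k n f \<Longrightarrow> C_k n (\<lambda>z. cnj (f z))"
proof (induction n arbitrary: f)
  case (Suc n)
  from Suc.prems obtain fx fy where *: "C_k n fx" "C_k n fy"
    and f: "\<And>z. (f has_derivative (\<lambda>h. of_real (Re h) * fx z + of_real (Im h) * fy z)) (at z)" by auto
  have "((\<lambda>z. cnj (f z)) has_derivative (\<lambda>h. of_real (Re h) * cnj (fx z) + of_real (Im h) * cnj (fy z))) (at z)" for z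
    using bounded_linear.has_derivative[OF bounded_linear_cnj f[of z]] by simp
  then show ?case using * by (rule C_k_SucI[OF _ Suc.IH Suc.IH])
qed (auto intro: continuous_intros)

lemma C_k_reflect: "C_k n f \<Longrightarrow> C_k n (\<lambda>w. f (z - w))"
proof (induction n arbitrary: f)
  case (Suc n)
  from Suc.prems obtain fx fy where *: "C_k n fx" "C_k n fy"
    and f: "\<And>z. (f has_derivative (\<lambda>h. of_real (Re h) * fx z + of_real (Im h) * fy z)) (at z)" by auto
  have "((\<lambda>w. f (z - w)) has_derivative (\<lambda>h. of_real (Re h) * (-1 * fx (z - w)) + of_real (Im h) * (-1 * fy (z - w)))) (at w)" for w
  proof -
    have r: "((\<lambda>w. z - w) has_derivative (\<lambda>h. - h)) (at w)" by (auto intro!: derivative_eq_intros)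
    show ?thesis by (rule has_derivative_eq_rhs[OF has_derivative_compose[OF r f[of "z - w"]]]) (simp add: algebra_simps)
  qed
  moreover have "C_k n (\<lambda>w. -1 * fx (z - w))" "C_k n (\<lambda>w. -1 * fy (z - w))"
    by (intro C_k_mult[OF C_k_const] Suc.IH *)+
  ultimately show ?case by (rule C_k_SucI)
qed (auto intro!: continuous_intros elim: continuous_on_compose2)

lemma smooth_intros:
  "smooth (\<lambda>z. c)"
  "smooth f \<Longrightarrow> smooth g \<Longrightarrow> smooth (\<lambda>z. f z + g z)"
  "smooth f \<Longrightarrow> smooth g \<Longrightarrow> smooth (\<lambda>z. f z * g z)"
  "smooth f \<Longrightarrow> smooth (\<lambda>z. cnj (f z))"
  "smooth f \<Longrightarrow> smooth (\<lambda>w. f (z - w))"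
  unfolding smooth_def by (auto intro: C_k_const C_k_add C_k_mult C_k_cnj C_k_reflect)

lemma has_derivative_exp_linear:
  "((\<lambda>z. c * exp (a * z + b * cnj z)) has_derivative
     (\<lambda>h. of_real (Re h) * ((c * (a + b)) * exp (a * z + b * cnj z)) +
          of_real (Im h) * ((c * (\<i> * (a - b))) * exp (a * z + b * cnj z)))) (at z)"
proof -
  have "((\<lambda>z. c * exp (a * z + b * cnj z)) has_derivative
     (\<lambda>h. c * (exp (a * z + b * cnj z) * (a * h + b * cnj h)))) (at z)"
  proof -
    have l: "((\<lambda>z. a * z + b * cnj z) has_derivative (\<lambda>h. a * h + b * cnj h)) (at z)"
      by (intro derivative_intros has_derivative_ident bounded_linear.has_derivative[OF bounded_linear_cnj])
    have e: "(exp has_derivative (\<lambda>x. exp (a * z + b * cnj z) * x)) (at (a * z + b * cnj z))"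
      using DERIV_exp[of "a * z + b * cnj z"] unfolding has_field_derivative_def .
    show ?thesis by (rule has_derivative_mult_right[OF has_derivative_compose[OF l e]])
  qed
  moreover have "c * (e * (a * h + b * cnj h)) = of_real (Re h) * ((c * (a + b)) * e) +
          of_real (Im h) * ((c * (\<i> * (a - b))) * e)" for h e
    by (subst (1 2) complex_eq[of h]) (simp add: algebra_simps)
  ultimately show ?thesis by simp
qed

lemma smooth_exp_linear: "smooth (\<lambda>z. exp (a * z + b * cnj z))"
proof (rule smooth_coinduct[where S = "range (\<lambda>c z. c * exp (a * z + b * cnj z))"])
  show "(\<lambda>z. exp (a * z + b * cnj z)) \<in> range (\<lambda>c z. c * exp (a * z + b * cnj z))"
    by (auto intro!: image_eqI[of _ _ 1])
  fix f assume "f \<in> range (\<lambda>c z. c * exp (a * z + b * cnj z))"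
  then obtain c where f: "f = (\<lambda>z. c * exp (a * z + b * cnj z))" by auto
  show "\<exists>fx\<in>range (\<lambda>c z. c * exp (a * z + b * cnj z)). \<exists>fy\<in>range (\<lambda>c z. c * exp (a * z + b * cnj z)).
     \<forall>z. (f has_derivative (\<lambda>h. of_real (Re h) * fx z + of_real (Im h) * fy z)) (at z)"
    unfolding f
    by (intro bexI[of _ "\<lambda>z. (c * (a + b)) * exp (a * z + b * cnj z)"] bexI[of _ "\<lambda>z. (c * (\<i> * (a - b))) * exp (a * z + b * cnj z)"]
        allI has_derivative_exp_linear rangeI)
qed

lemma dx_exp_linear: "dx (\<lambda>z. exp (a * z + b * cnj z)) z = (a + b) * exp (a * z + b * cnj z)"
  and dy_exp_linear: "dy (\<lambda>z. exp (a * z + b * cnj z)) z = \<i> * (a - b) * exp (a * z + b * cnj z)"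
  using dx_dy_eqI[OF has_derivative_exp_linear[of 1 a b z]] by (simp_all add: mult.assoc)

lemma dx_dy_mult:
  assumes "smooth f" "smooth g"
  shows "dx (\<lambda>z. f z * g z) z = dx f z * g z + f z * dx g z"
    "dy (\<lambda>z. f z * g z) z = dy f z * g z + f z * dy g z"
proof -
  have "((\<lambda>z. f z * g z) has_derivative
      (\<lambda>h. of_real (Re h) * (dx f z * g z + f z * dx g z) + of_real (Im h) * (dy f z * g z + f z * dy g z))) (at z)"
    using has_derivative_mult[OF smoothD(1)[OF assms(1), of z] smoothD(1)[OF assms(2), of z]] by (simp add: algebra_simps)
  from dx_dy_eqI[OF this] show "dx (\<lambda>z. f z * g z) z = dx f z * g z + f z * dx g z"
    "dy (\<lambda>z. f z * g z) z = dy f z * g z + f z * dy g z" by auto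
qed

lemma first_order_mult:
  assumes "smooth f" "smooth g"
  shows "first_order a b (\<lambda>z. f z * g z) z = first_order a b f z * g z + f z * first_order a b g z"
  by (simp add: first_order_eq dx_dy_mult[OF assms] algebra_simps)

lemma dx_dy_reflect:
  assumes "smooth f"
  shows "dx (\<lambda>w. f (z - w)) w = - dx f (z - w)" "dy (\<lambda>w. f (z - w)) w = - dy f (z - w)"
proof -
  have "((\<lambda>w. f (z - w)) has_derivative (\<lambda>h. of_real (Re h) * (- dx f (z - w)) + of_real (Im h) * (- dy f (z - w)))) (at w)"
  proof -
    have r: "((\<lambda>w. z - w) has_derivative (\<lambda>h. - h)) (at w)" by (auto intro!: derivative_eq_intros)
    show ?thesis by (rule has_derivative_eq_rhs[OF has_derivative_compose[OF r smoothD(1)[OF assms, of "z - w"]]]) (simp add: algebra_simps)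
  qed
  from dx_dy_eqI[OF this] show "dx (\<lambda>w. f (z - w)) w = - dx f (z - w)" "dy (\<lambda>w. f (z - w)) w = - dy f (z - w)" by auto
qed

lemma dx_dy_cnj:
  assumes "smooth f"
  shows "dx (\<lambda>z. cnj (f z)) z = cnj (dx f z)" "dy (\<lambda>z. cnj (f z)) z = cnj (dy f z)"
proof -
  have "((\<lambda>z. cnj (f z)) has_derivative (\<lambda>h. of_real (Re h) * cnj (dx f z) + of_real (Im h) * cnj (dy f z))) (at z)"
    using bounded_linear.has_derivative[OF bounded_linear_cnj smoothD(1)[OF assms, of z]] by simp
  from dx_dy_eqI[OF this] show "dx (\<lambda>z. cnj (f z)) z = cnj (dx f z)" "dy (\<lambda>z. cnj (f z)) z = cnj (dy f z)" by auto
qed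

section \<open>Test functions: bounded support, bounds and Lipschitz constants\<close>

lemma test_function_iff:
  "test_function \<phi> \<longleftrightarrow> smooth \<phi> \<and> (\<exists>R. \<forall>z. norm z > R \<longrightarrow> \<phi> z = 0)"
proof
  assume "test_function \<phi>"
  then obtain K where K: "compact K" "\<And>z. z \<notin> K \<Longrightarrow> \<phi> z = 0" "smooth \<phi>"
    by (auto simp: test_function_def smooth_def)
  then obtain R where "\<And>z. z \<in> K \<Longrightarrow> norm z \<le> R" using compact_imp_bounded bounded_iff by metis
  then show "smooth \<phi> \<and> (\<exists>R. \<forall>z. norm z > R \<longrightarrow> \<phi> z = 0)" using K by (meson not_le)
next
  assume "smooth \<phi> \<and> (\<exists>R. \<forall>z. norm z > R \<longrightarrow> \<phi> z = 0)"
  then obtain R where "smooth \<phi>" "\<And>z. norm z > R \<Longrightarrow> \<phi> z = 0" by auto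
  then show "test_function \<phi>"
    by (auto simp: test_function_def smooth_def intro!: exI[of _ "cball 0 R"])
qed

lemma deriv_zero_outside:
  assumes "smooth f" "closed S" "\<And>z. z \<notin> S \<Longrightarrow> f z = 0" "z \<notin> S"
  shows "dx f z = 0" "dy f z = 0"
proof -
  have "(f has_derivative (\<lambda>h. 0)) (at z)"
    by (rule has_derivative_transform_within_open[of "\<lambda>_. 0" _ _ _ "- S"]) (use assms in auto)
  then have "(f has_derivative (\<lambda>h. of_real (Re h) * 0 + of_real (Im h) * 0)) (at z)" by simp
  from dx_dy_eqI[OF this] show "dx f z = 0" "dy f z = 0" by auto
qed

lemma test_functionD:
  assumes "test_function \<phi>"
  shows "smooth \<phi>" "test_function (dx \<phi>)" "test_function (dy \<phi>)" "continuous_on S \<phi>"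
    "\<exists>R>0. \<forall>z. norm z > R \<longrightarrow> \<phi> z = 0 \<and> dx \<phi> z = 0 \<and> dy \<phi> z = 0"
    "\<exists>B>0. \<forall>z. norm (\<phi> z) \<le> B"
proof -
  show s: "smooth \<phi>" using assms test_function_iff by auto
  then show c: "continuous_on S \<phi>" for S by (rule smoothD)
  obtain R where R: "\<And>z. norm z > R \<Longrightarrow> \<phi> z = 0" using assms test_function_iff by auto
  then have z: "dx \<phi> z = 0" "dy \<phi> z = 0" if "norm z > R" for z
    using deriv_zero_outside[OF s, of "cball 0 R" z] that by auto
  then show "test_function (dx \<phi>)" "test_function (dy \<phi>)"
    using s smoothD test_function_iff by blast+
  show "\<exists>R>0. \<forall>z. norm z > R \<longrightarrow> \<phi> z = 0 \<and> dx \<phi> z = 0 \<and> dy \<phi> z = 0"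
    using R z by (intro exI[of _ "max R 1"]) auto
  have "bounded (\<phi> ` cball 0 R)" using c by (intro compact_imp_bounded compact_continuous_image) auto
  then obtain B where B: "B > 0" "\<And>z. z \<in> cball 0 R \<Longrightarrow> norm (\<phi> z) \<le> B" by (auto simp: bounded_pos)
  have "norm (\<phi> z) \<le> B" for z using B R[of z] by (cases "norm z > R") auto
  with B show "\<exists>B>0. \<forall>z. norm (\<phi> z) \<le> B" by blast
qed

lemma test_function_intros:
  "test_function f \<Longrightarrow> smooth g \<Longrightarrow> test_function (\<lambda>z. f z * g z)"
  "smooth g \<Longrightarrow> test_function f \<Longrightarrow> test_function (\<lambda>z. g z * f z)"
  "test_function f \<Longrightarrow> test_function (\<lambda>z. cnj (f z))"
  "test_function f \<Longrightarrow> test_function (\<lambda>w. f (z - w))"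
proof -
  show "test_function (\<lambda>w. f (z - w))" if f: "test_function f"
  proof -
    obtain R where R: "\<And>z. norm z > R \<Longrightarrow> f z = 0" "smooth f" using f test_function_iff by auto
    have "f (z - w) = 0" if "norm w > R + norm z" for w
    proof (rule R(1))
      show "R < norm (z - w)" using that norm_triangle_ineq2[of w z] by (simp add: norm_minus_commute)
    qed
    then show ?thesis unfolding test_function_iff using smooth_intros(5)[OF R(2), of z] by metis
  qed
  show "test_function (\<lambda>z. f z * g z)" if "test_function f" "smooth g"
    using that smooth_intros(3)[of f g] unfolding test_function_iff by (metis mult_zero_left)
  show "test_function (\<lambda>z. g z * f z)" if "smooth g" "test_function f"
    using that smooth_intros(3)[of g f] unfolding test_function_iff by (metis mult_zero_right)
  show "test_function (\<lambda>z. cnj (f z))" if "test_function f"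
    using that smooth_intros(4)[of f] unfolding test_function_iff by (metis complex_cnj_zero)
qed

lemma gradient_bound_lipschitz:
  assumes "\<And>z. (F has_derivative (\<lambda>h. of_real (Re h) * Fx z + of_real (Im h) * Fy z)) (at z)"
    and A: "\<And>z. norm (Fx z) \<le> A" and B: "\<And>z. norm (Fy z) \<le> (B::real)"
  shows "(A + B)-lipschitz_on UNIV (F :: complex \<Rightarrow> complex)"
proof (rule bounded_derivative_imp_lipschitz)
  have nn: "A \<ge> 0" "B \<ge> 0" using order_trans[OF norm_ge_zero A[of 0]] order_trans[OF norm_ge_zero B[of 0]] by simp_all
  then show "0 \<le> A + B" by simp
  show "onorm (\<lambda>h. of_real (Re h) * Fx z + of_real (Im h) * Fy z) \<le> A + B" for z
  proof (rule onorm_bound)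
    fix h :: complex
    have "norm (of_real (Re h) * Fx z + of_real (Im h) * Fy z) \<le> \<bar>Re h\<bar> * norm (Fx z) + \<bar>Im h\<bar> * norm (Fy z)"
      by (rule norm_triangle_le) (simp add: norm_mult)
    also have "\<dots> \<le> norm h * A + norm h * B"
      using A B abs_Re_le_cmod[of h] abs_Im_le_cmod[of h] nn by (intro add_mono mult_mono) auto
    finally show "norm (of_real (Re h) * Fx z + of_real (Im h) * Fy z) \<le> (A + B) * norm h" by (simp add: algebra_simps)
  qed (use nn in auto)
qed (use assms in auto)

lemma test_function_lipschitz:
  assumes "test_function \<phi>" shows "\<exists>L. L-lipschitz_on UNIV \<phi>"
proof -
  obtain B1 where B1: "B1 > 0" "\<And>z. norm (dx \<phi> z) \<le> B1"
    using test_functionD(6)[OF test_functionD(2)[OF assms]] by auto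
  obtain B2 where B2: "B2 > 0" "\<And>z. norm (dy \<phi> z) \<le> B2"
    using test_functionD(6)[OF test_functionD(3)[OF assms]] by auto
  have "(B1 + B2)-lipschitz_on UNIV \<phi>"
    by (rule gradient_bound_lipschitz[OF smoothD(1)[OF test_functionD(1)[OF assms]] B1(2) B2(2)])
  then show ?thesis by blast
qed

subsection \<open>Bump functions\<close>

text \<open>The factor t^(-k) closes the family under differentiation: the derivative of member k
  combines members k + 2 and k + 1. Smoothness of exp (-1/t), the member k = 0, is therefore proved
  for all k at once.\<close>

definition bumpf :: "nat \<Rightarrow> real \<Rightarrow> real" where
  "bumpf k t = (if t > 0 then exp (- (1/t)) / t ^ k else 0)"

lemma bumpf_tendsto_0: "(bumpf k \<longlongrightarrow> 0) (at 0)"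
proof -
  have "((\<lambda>t. bumpf k t) \<longlongrightarrow> 0) (at_right 0)"
  proof (rule Lim_transform_eventually)
    have "((\<lambda>x::real. x ^ k / exp x) \<longlongrightarrow> 0) at_top" by (rule tendsto_power_div_exp_0)
    then show "((\<lambda>t::real. (inverse t) ^ k / exp (inverse t)) \<longlongrightarrow> 0) (at_right 0)"
      by (rule filterlim_compose) (rule filterlim_inverse_at_top_right)
    show "\<forall>\<^sub>F t in at_right 0. (inverse t) ^ k / exp (inverse t) = bumpf k t"
      unfolding eventually_at_filter
      by (intro always_eventually) (auto simp: bumpf_def exp_minus field_simps)
  qed
  moreover have "(bumpf k \<longlongrightarrow> 0) (at_left 0)"
  proof (rule Lim_transform_eventually[OF tendsto_const])
    show "\<forall>\<^sub>F t in at_left 0. 0 = bumpf k t"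
      unfolding eventually_at_filter by (intro always_eventually) (auto simp: bumpf_def)
  qed
  ultimately show ?thesis using filterlim_split_at by blast
qed

lemma bumpf_deriv: "(bumpf k has_real_derivative (bumpf (k + 2) t - real k * bumpf (k + 1) t)) (at t)"
proof -
  consider "t < 0" | "t > 0" | "t = 0" by linarith
  then show ?thesis
  proof cases
    case 1
    have "(bumpf k has_real_derivative 0) (at t)"
      by (rule has_field_derivative_transform_within_open[of "\<lambda>_. 0" _ _ "{..<0}"])
         (use 1 in \<open>auto simp: bumpf_def\<close>)
    then show ?thesis using 1 by (simp add: bumpf_def)
  next
    case 2
    have "((\<lambda>t. exp (- (1/t)) / t ^ k) has_real_derivative
      (exp (- (1/t)) * (1 / t^2) * t ^ k - exp (- (1/t)) * (real k * t ^ (k - 1))) / (t ^ k * t ^ k)) (at t)"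
      using 2 by (auto intro!: derivative_eq_intros simp: power2_eq_square)
    also have "(exp (- (1/t)) * (1 / t^2) * t ^ k - exp (- (1/t)) * (real k * t ^ (k - 1))) / (t ^ k * t ^ k)
      = exp (- (1/t)) / t ^ (k + 2) - real k * (exp (- (1/t)) / t ^ (k + 1))"
      using 2 by (cases k) (auto simp: field_simps power2_eq_square power_add)
    finally have "(bumpf k has_real_derivative exp (- (1/t)) / t ^ (k + 2) - real k * (exp (- (1/t)) / t ^ (k + 1))) (at t)"
      by (rule has_field_derivative_transform_within_open[of _ _ _ "{0<..}"])
         (use 2 in \<open>auto simp: bumpf_def\<close>)
    then show ?thesis using 2 by (simp add: bumpf_def)
  next
    case 3
    \<comment> \<open>The difference quotient at 0 is \<open>bumpf (k + 1)\<close>, which tends to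
      0.\<close>
    have "((\<lambda>h. (bumpf k (0 + h) - bumpf k 0) / h) \<longlongrightarrow> 0) (at 0)"
      by (rule Lim_transform_eventually[OF bumpf_tendsto_0[of "k + 1"]])
         (auto simp: eventually_at_filter bumpf_def field_simps)
    then show ?thesis using 3 by (simp add: DERIV_def bumpf_def)
  qed
qed

lemma smooth_bumpf:
  "smooth (\<lambda>z. of_real (bumpf 0 (\<alpha> * Re z + \<beta> * Im z + c)))"
  unfolding smooth_def
proof
  have "C_k n (\<lambda>z. of_real (bumpf k (\<alpha> * Re z + \<beta> * Im z + c)))" for k n
  proof (induction n arbitrary: k)
    case 0
    have "continuous_on UNIV (bumpf k)"
      by (intro DERIV_continuous_on[of _ _ "\<lambda>t. bumpf (k + 2) t - real k * bumpf (k + 1) t"])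
         (rule bumpf_deriv)
    then have "continuous_on UNIV (\<lambda>z. bumpf k (\<alpha> * Re z + \<beta> * Im z + c))"
      by (rule continuous_on_compose2) (auto intro!: continuous_intros)
    then show ?case by (auto intro: continuous_intros)
  next
    case (Suc n)
    define l where "l z = \<alpha> * Re z + \<beta> * Im z + c" for z
    define d where "d z = bumpf (k + 2) (l z) - real k * bumpf (k + 1) (l z)" for z
    have der: "((\<lambda>z. complex_of_real (bumpf k (l z))) has_derivative
       (\<lambda>h. of_real (Re h) * (of_real \<alpha> * of_real (d z)) + of_real (Im h) * (of_real \<beta> * of_real (d z)))) (at z)" for z
    proof -
      have l: "(l has_derivative (\<lambda>h. \<alpha> * Re h + \<beta> * Im h)) (at z)"
        unfolding l_def by (auto intro!: derivative_eq_intros)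
      have b: "(bumpf k has_derivative (\<lambda>x. d z * x)) (at (l z))"
        using bumpf_deriv[of k "l z"] by (simp add: has_field_derivative_def d_def)
      have "((\<lambda>z. bumpf k (l z)) has_derivative (\<lambda>h. d z * (\<alpha> * Re h + \<beta> * Im h))) (at z)"
        using has_derivative_compose[OF l b] .
      from bounded_linear.has_derivative[OF bounded_linear_of_real this]
      show ?thesis by (rule has_derivative_eq_rhs) (simp add: algebra_simps)
    qed
    have "C_k n (\<lambda>z. of_real (d z))"
    proof -
      have "C_k n (\<lambda>z. of_real (bumpf (k + 2) (l z)) + (- of_nat k) * of_real (bumpf (k + 1) (l z)))"
        by (intro C_k_add C_k_mult[OF C_k_const]; unfold l_def; rule Suc.IH)
      then show ?thesis by (simp add: d_def)
    qed
    then have "C_k n (\<lambda>z. of_real \<alpha> * of_real (d z))" "C_k n (\<lambda>z. of_real \<beta> * of_real (d z))"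
      by (auto intro: C_k_mult[OF C_k_const])
    with der show ?case unfolding l_def[symmetric] by (rule C_k_SucI)
  qed
  then show "C_k n (\<lambda>z. of_real (bumpf 0 (\<alpha> * Re z + \<beta> * Im z + c)))" for n .
qed

text \<open>A product of four one-sided factors, one for each side of the box. The parameter
  \<open>m\<close> steepens the flanks without moving the support, so the choice m = n + 1
  approximates the indicator of the open box.\<close>

definition box_bump :: "real \<Rightarrow> complex \<Rightarrow> complex \<Rightarrow> complex \<Rightarrow> real" where
  "box_bump m a b z = bumpf 0 (m * (Re z - Re a)) * bumpf 0 (m * (Re b - Re z)) *
     (bumpf 0 (m * (Im z - Im a)) * bumpf 0 (m * (Im b - Im z)))"

lemma bumpf_0_le: "0 \<le> bumpf 0 t" "bumpf 0 t \<le> 1" "0 < bumpf 0 t \<longleftrightarrow> 0 < t" "bumpf 0 t = 0 \<longleftrightarrow> \<not> 0 < t"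
  by (auto simp: bumpf_def)

lemma box_bump_bounds:
  "0 \<le> box_bump m a b z" "box_bump m a b z \<le> 1"
  unfolding box_bump_def
  by (intro mult_nonneg_nonneg mult_le_one bumpf_0_le)+

lemma box_bump_pos: "m > 0 \<Longrightarrow> z \<in> box a b \<Longrightarrow> 0 < box_bump m a b z"
  unfolding box_bump_def by (intro mult_pos_pos) (auto simp: in_box_complex_iff bumpf_0_le)

lemma box_bump_zero: "m > 0 \<Longrightarrow> z \<notin> box a b \<Longrightarrow> box_bump m a b z = 0"
  by (auto simp: box_bump_def in_box_complex_iff bumpf_0_le zero_less_mult_iff)

lemma test_function_box_bump:
  assumes "m > 0" shows "test_function (\<lambda>z. of_real (box_bump m a b z))"
proof -
  have "smooth (\<lambda>z. of_real (box_bump m a b z))"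
  proof -
    have "smooth (\<lambda>z. of_real (bumpf 0 (m * Re z + 0 * Im z + (- m * Re a))) * of_real (bumpf 0 (-m * Re z + 0 * Im z + (m * Re b))) *
     (of_real (bumpf 0 (0 * Re z + m * Im z + (- m * Im a))) * of_real (bumpf 0 (0 * Re z + (-m) * Im z + (m * Im b)))))"
      by (intro smooth_intros smooth_bumpf)
    then show ?thesis by (simp add: box_bump_def algebra_simps)
  qed
  moreover have "\<exists>R. \<forall>z. norm z > R \<longrightarrow> (of_real (box_bump m a b z) :: complex) = 0"
  proof -
    obtain R where "\<And>z. z \<in> box a b \<Longrightarrow> norm z \<le> R" using bounded_box[of a b] bounded_iff by metis
    then show ?thesis using box_bump_zero[OF assms] by (intro exI[of _ R]) (auto simp: not_le[symmetric])
  qed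
  ultimately show ?thesis using test_function_iff by blast
qed

lemma box_bump_tendsto:
  "(\<lambda>n. box_bump (real (Suc n)) a b z) \<longlonglongrightarrow> indicator (box a b) z"
proof -
  have *: "(\<lambda>n. bumpf 0 (real (Suc n) * t)) \<longlonglongrightarrow> 1" if t: "t > 0" for t
  proof -
    have "(\<lambda>n. exp (- (1 / real (Suc n) * (1 / t)))) \<longlonglongrightarrow> exp (- (0 * (1 / t)))"
      by (intro tendsto_intros lim_1_over_n[THEN LIMSEQ_Suc])
    then show ?thesis using t by (simp add: bumpf_def)
  qed
  show ?thesis
  proof (cases "z \<in> box a b")
    case True
    then have "(\<lambda>n. box_bump (real (Suc n)) a b z) \<longlonglongrightarrow> 1 * 1 * (1 * 1)"
      unfolding box_bump_def by (intro tendsto_mult *) (auto simp: in_box_complex_iff)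
    then show ?thesis using True by simp
  qed (simp add: box_bump_zero)
qed

section \<open>Locally integrable functions and weak derivatives\<close>

text \<open>The Borel counterpart of \<open>locally_integrable\<close>. Borel functions stay
  measurable under composition and on product spaces, as convolution and Fubini require;
  \<open>locally_integrable_iff\<close> and \<open>weak_deriv_iff\<close> carry the results over to
  Lebesgue measurable functions.\<close>

definition loc_int :: "(complex \<Rightarrow> complex) \<Rightarrow> bool" where
  "loc_int f \<longleftrightarrow> f \<in> borel_measurable borel \<and> (\<forall>R. set_integrable lborel (cball 0 R) f)"

lemma loc_intD [measurable_dest]: "loc_int f \<Longrightarrow> f \<in> borel_measurable borel"
  by (simp add: loc_int_def)

lemma loc_int_cball: "loc_int f \<Longrightarrow> set_integrable lborel (cball 0 R) f"
  by (simp add: loc_int_def)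

lemma loc_int_dominated:
  fixes g :: "complex \<Rightarrow> complex"
  assumes f: "loc_int f" and [measurable]: "g \<in> borel_measurable borel"
    and bd: "\<And>z. norm z \<le> R \<Longrightarrow> norm (g z) \<le> B * norm (f z)" and z: "\<And>z. norm z > R \<Longrightarrow> g z = 0"
  shows "integrable lborel g"
proof (rule Bochner_Integration.integrable_bound[where f="\<lambda>z. B *\<^sub>R (indicator (cball 0 R) z *\<^sub>R f z)"])
  show "integrable lborel (\<lambda>z. B *\<^sub>R (indicator (cball 0 R) z *\<^sub>R f z))"
    using loc_int_cball[OF f, of R] unfolding set_integrable_def by (rule integrable_scaleR_right)
  show "AE z in lborel. norm (g z) \<le> norm (B *\<^sub>R (indicator (cball 0 R) z *\<^sub>R f z))"
  proof (rule AE_I2)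
    fix z show "norm (g z) \<le> norm (B *\<^sub>R (indicator (cball 0 R) z *\<^sub>R f z))"
    proof (cases "norm z \<le> R")
      case True
      have "norm (g z) \<le> \<bar>B\<bar> * norm (f z)" using bd[OF True] by (meson abs_ge_self mult_right_mono norm_ge_zero order_trans)
      then show ?thesis using True by simp
    qed (simp add: z)
  qed
qed simp

lemma loc_int_mult:
  assumes f: "loc_int f" and g: "continuous_on UNIV g" and z: "\<And>z. norm z > R \<Longrightarrow> g z = 0"
  shows "integrable lborel (\<lambda>z. f z * g z)"
proof -
  have [measurable]: "f \<in> borel_measurable borel" "g \<in> borel_measurable borel"
    using f g by (auto simp: loc_int_def intro: borel_measurable_continuous_onI)
  have "bounded (g ` cball 0 R)"
    using continuous_on_subset[OF g] by (intro compact_imp_bounded compact_continuous_image) auto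
  then obtain B where "\<And>z. z \<in> cball 0 R \<Longrightarrow> norm (g z) \<le> B" unfolding bounded_iff by blast
  then show ?thesis
    by (intro loc_int_dominated[OF f, of _ R B]) (auto simp: z norm_mult mult.commute[of _ "norm (f _)"] mult_left_mono)
qed

lemma loc_int_test: "loc_int f \<Longrightarrow> test_function \<phi> \<Longrightarrow> integrable lborel (\<lambda>z. f z * \<phi> z)"
  using loc_int_mult[of f \<phi>] test_functionD(4)[of \<phi> UNIV] test_function_iff[of \<phi>] by blast

lemma loc_int_continuous: "continuous_on UNIV f \<Longrightarrow> loc_int f"
  unfolding loc_int_def set_integrable_def
  by (auto intro!: borel_measurable_continuous_onI borel_integrable_compact continuous_on_subset[of UNIV])

lemma loc_int_times_continuous:
  assumes "loc_int f" "continuous_on UNIV g" shows "loc_int (\<lambda>z. f z * g z)"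
  unfolding loc_int_def
proof (intro conjI allI)
  have [measurable]: "f \<in> borel_measurable borel" "g \<in> borel_measurable borel"
    using assms by (auto simp: loc_int_def intro: borel_measurable_continuous_onI)
  show "(\<lambda>z. f z * g z) \<in> borel_measurable borel" by measurable
  fix R
  have "bounded (g ` cball 0 R)"
    using continuous_on_subset[OF assms(2)] by (intro compact_imp_bounded compact_continuous_image) auto
  then obtain B where "\<And>z. z \<in> cball 0 R \<Longrightarrow> norm (g z) \<le> B" unfolding bounded_iff by blast
  moreover have "(\<lambda>x. indicator (cball 0 R) x *\<^sub>R (f x * g x)) \<in> borel_measurable borel"
    by (intro borel_measurable_scaleR borel_measurable_indicator borel_measurable_times) auto
  ultimately show "set_integrable lborel (cball 0 R) (\<lambda>z. f z * g z)"
    unfolding set_integrable_def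
    by (intro loc_int_dominated[OF assms(1), of _ R B]) (auto simp: norm_mult mult.commute[of _ "norm (f _)"] mult_left_mono)
qed

section \<open>Passing from Lebesgue measurable functions to Borel representatives\<close>

lemma borel_representative:
  fixes f :: "complex \<Rightarrow> complex"
  assumes "f \<in> borel_measurable lebesgue"
  shows "\<exists>f'\<in>borel_measurable borel. AE z in lborel. f z = f' z"
proof -
  have "(\<lambda>z. Re (f z)) \<in> borel_measurable lebesgue" "(\<lambda>z. Im (f z)) \<in> borel_measurable lebesgue"
    using assms by measurable
  then obtain r i where ri: "r \<in> borel_measurable lborel" "AE z in lborel. Re (f z) = r z"
    "i \<in> borel_measurable lborel" "AE z in lborel. Im (f z) = i z"
    using completion_ex_borel_measurable_real[of "\<lambda>z. Re (f z)" lborel]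
      completion_ex_borel_measurable_real[of "\<lambda>z. Im (f z)" lborel] by blast
  have "AE z in lborel. f z = Complex (r z) (i z)"
    using ri(2,4) by eventually_elim (simp add: complex_eq_iff)
  moreover have "(\<lambda>z. Complex (r z) (i z)) \<in> borel_measurable borel"
    using ri(1,3) by (intro borel_measurable_Complex) simp_all
  ultimately show ?thesis by (intro bexI[of _ "\<lambda>z. Complex (r z) (i z)"])
qed

lemma AE_eq_measurable_lebesgue:
  fixes f f' :: "'a::euclidean_space \<Rightarrow> 'b::euclidean_space"
  assumes f: "f \<in> borel_measurable borel" and ae: "AE z in lborel. f' z = f z"
  shows "f' \<in> borel_measurable lebesgue"
proof (rule measurableI)
  fix A :: "'b set" assume "A \<in> sets borel"
  then have A: "f -` A \<in> sets lebesgue" using measurable_sets[OF f, of A] by auto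
  have "AE z in lebesgue. z \<in> f -` A \<longleftrightarrow> z \<in> f' -` A"
    using AE_completion[OF ae] by eventually_elim auto
  then show "f' -` A \<inter> space lebesgue \<in> sets lebesgue"
    using completion.in_sets_AE[OF _ A, of "f' -` A"] by simp
qed simp

lemma integral_lebesgue_lborel:
  fixes f f' :: "complex \<Rightarrow> complex"
  assumes f: "f \<in> borel_measurable borel" and ae: "AE z in lborel. f' z = f z"
  shows "(LINT z|lebesgue. f' z) = (LINT z|lborel. f z)"
    "integrable lebesgue f' \<longleftrightarrow> integrable lborel f"
proof -
  have m: "f' \<in> borel_measurable lebesgue" "f \<in> borel_measurable lebesgue"
    using f AE_eq_measurable_lebesgue[OF f ae] by (auto intro: measurable_completion)
  show "(LINT z|lebesgue. f' z) = (LINT z|lborel. f z)"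
    using integral_cong_AE[OF m AE_completion[OF ae]] f by (simp add: integral_completion)
  show "integrable lebesgue f' \<longleftrightarrow> integrable lborel f"
    using integrable_cong_AE[OF m AE_completion[OF ae]] f by (simp add: integrable_completion)
qed

lemma locally_integrable_iff:
  assumes f: "f \<in> borel_measurable borel" and ae: "AE z in lborel. f' z = f z"
  shows "locally_integrable f' \<longleftrightarrow> loc_int f"
proof -
  have *: "set_integrable lebesgue K f' \<longleftrightarrow> set_integrable lborel K f" if "K \<in> sets borel" for K
    unfolding set_integrable_def using that f ae
    by (intro integral_lebesgue_lborel(2)) (auto elim!: eventually_mono)
  show ?thesis
  proof
    assume "locally_integrable f'"
    then have "set_integrable lborel (cball 0 R) f" for R using *[of "cball 0 R"] by (simp add: locally_integrable_def)
    then show "loc_int f" using f by (simp add: loc_int_def)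
  next
    assume l: "loc_int f"
    show "locally_integrable f'"
      unfolding locally_integrable_def
    proof (intro allI impI)
      fix K :: "complex set" assume K: "compact K"
      then obtain R where "K \<subseteq> cball 0 R" using bounded_subset_ballD[OF compact_imp_bounded, of K 0] ball_subset_cball by (metis order_trans)
      moreover have "K \<in> sets borel" using K by (simp add: compact_imp_closed borel_closed)
      ultimately show "set_integrable lebesgue K f'"
        using set_integrable_subset[OF loc_int_cball[OF l]] * by auto
    qed
  qed
qed

definition weak_deriv :: "complex \<Rightarrow> complex \<Rightarrow> (complex \<Rightarrow> complex) \<Rightarrow> (complex \<Rightarrow> complex) \<Rightarrow> bool" where
  "weak_deriv a b f g \<longleftrightarrow> loc_int f \<and> loc_int g \<and> (\<forall>\<phi>. test_function \<phi> \<longrightarrow>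
        (LINT z|lborel. f z * first_order a b \<phi> z) = - (LINT z|lborel. g z * \<phi> z))"

lemma test_function_measurable [measurable_dest]: "test_function \<phi> \<Longrightarrow> \<phi> \<in> borel_measurable borel"
  by (intro borel_measurable_continuous_onI test_functionD(4))

lemma test_first_order: "test_function \<phi> \<Longrightarrow> test_function (first_order a b \<phi>)"
proof -
  assume t: "test_function \<phi>"
  have "smooth (\<lambda>z. a * dx \<phi> z + b * dy \<phi> z)"
    using smoothD(2,3)[OF test_functionD(1)[OF t]] by (intro smooth_intros)
  moreover have "first_order a b \<phi> = (\<lambda>z. a * dx \<phi> z + b * dy \<phi> z)" by (auto simp: first_order_eq)
  moreover obtain R where "\<forall>z. norm z > R \<longrightarrow> \<phi> z = 0 \<and> dx \<phi> z = 0 \<and> dy \<phi> z = 0"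
    using test_functionD(5)[OF t] by auto
  then have "\<exists>R. \<forall>z. norm z > R \<longrightarrow> a * dx \<phi> z + b * dy \<phi> z = 0" by (intro exI[of _ R]) auto
  ultimately show ?thesis using test_function_iff by auto
qed

lemma weak_deriv_iff:
  assumes f: "f \<in> borel_measurable borel" "AE z in lborel. f' z = f z"
    and g: "g \<in> borel_measurable borel" "AE z in lborel. g' z = g z"
  shows "has_weak_deriv a b f' g' \<longleftrightarrow> weak_deriv a b f g"
proof -
  have "(LINT z|lebesgue. f' z * first_order a b \<phi> z) = (LINT z|lborel. f z * first_order a b \<phi> z)"
    "(LINT z|lebesgue. g' z * \<phi> z) = (LINT z|lborel. g z * \<phi> z)" if t: "test_function \<phi>" for \<phi>
  proof -
    note [measurable] = f(1) g(1) test_function_measurable[OF t] test_function_measurable[OF test_first_order[OF t]]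
    show "(LINT z|lebesgue. f' z * first_order a b \<phi> z) = (LINT z|lborel. f z * first_order a b \<phi> z)"
      using f(2) by (intro integral_lebesgue_lborel(1)) (measurable, auto elim!: eventually_mono)
    show "(LINT z|lebesgue. g' z * \<phi> z) = (LINT z|lborel. g z * \<phi> z)"
      using g(2) by (intro integral_lebesgue_lborel(1)) (measurable, auto elim!: eventually_mono)
  qed
  then show ?thesis
    using locally_integrable_iff[OF f] locally_integrable_iff[OF g]
    unfolding has_weak_deriv_def weak_deriv_def by auto
qed

lemma locally_integrable_measurable:
  assumes "locally_integrable f" shows "f \<in> borel_measurable lebesgue"
proof -
  have "(\<lambda>z. indicator (cball 0 (real n)) z *\<^sub>R f z) \<in> borel_measurable lebesgue" for n
    using assms unfolding locally_integrable_def set_integrable_def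
    by (meson borel_measurable_integrable compact_cball)
  moreover have "(\<lambda>n. indicator (cball 0 (real n)) z *\<^sub>R f z) \<longlonglongrightarrow> f z" for z
  proof (rule tendsto_eventually)
    obtain m where "norm z \<le> real m" using real_arch_simple by blast
    then show "\<forall>\<^sub>F n in sequentially. indicator (cball 0 (real n)) z *\<^sub>R f z = f z"
      by (intro eventually_sequentiallyI[of m]) (auto simp: indicator_def)
  qed
  ultimately show ?thesis by (rule borel_measurable_LIMSEQ_metric)
qed

lemma weak_deriv_representative:
  assumes "has_weak_deriv a b f g"
  obtains f' g' where "weak_deriv a b f' g'" "AE z in lborel. f z = f' z" "AE z in lborel. g z = g' z"
proof -
  have "f \<in> borel_measurable lebesgue" "g \<in> borel_measurable lebesgue"
    using assms locally_integrable_measurable by (auto simp: has_weak_deriv_def)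
  then obtain f' g' where "f' \<in> borel_measurable borel" "AE z in lborel. f z = f' z"
    "g' \<in> borel_measurable borel" "AE z in lborel. g z = g' z" using borel_representative by meson
  then show thesis using weak_deriv_iff[of f' f g' g] assms that by blast
qed

section \<open>The fundamental lemma of the calculus of variations\<close>

text \<open>The positive and the negative part of h are densities of two measures that agree on
  boxes, an intersection-stable generator of the Borel sets. The measures coincide, densities are
  unique almost everywhere, and equality of the two parts forces h to be 0.\<close>

lemma AE_zero_of_box_integrals:
  fixes h :: "complex \<Rightarrow> real"
  assumes h: "integrable lborel h" and z: "\<And>a b. (LINT z|lborel. indicator (box a b) z * h z) = 0"
  shows "AE z in lborel. h z = 0"
proof -
  have [measurable]: "h \<in> borel_measurable borel" using borel_measurable_integrable[OF h] by simp
  have p: "integrable lborel (\<lambda>z. max 0 (h z))" "integrable lborel (\<lambda>z. max 0 (- h z))"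
    using h by auto
  have ind: "integrable lborel (\<lambda>z. max 0 (h z) * indicator A z)" "integrable lborel (\<lambda>z. max 0 (- h z) * indicator A z)"
    if "A \<in> sets borel" for A using that p by (auto intro!: integrable_real_mult_indicator)
  have eq: "emeasure (density lborel (\<lambda>z. ennreal (max 0 (h z)))) A = ennreal (LINT z|lborel. max 0 (h z) * indicator A z)"
       "emeasure (density lborel (\<lambda>z. ennreal (max 0 (- h z)))) A = ennreal (LINT z|lborel. max 0 (- h z) * indicator A z)"
    if [measurable]: "A \<in> sets borel" for A
    by (subst emeasure_density, simp, simp, subst nn_integral_eq_integral[symmetric],
        use ind[OF that] in \<open>auto simp: ennreal_mult'' ennreal_indicator\<close>)+
  have beq: "emeasure (density lborel (\<lambda>z. ennreal (max 0 (h z)))) (box a b)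
     = emeasure (density lborel (\<lambda>z. ennreal (max 0 (- h z)))) (box a b)" for a b
  proof -
    have "(LINT z|lborel. max 0 (h z) * indicator (box a b) z) - (LINT z|lborel. max 0 (- h z) * indicator (box a b) z)
       = (LINT z|lborel. indicator (box a b) z * h z)"
      by (subst Bochner_Integration.integral_diff[symmetric], rule ind, simp, rule ind, simp)
         (auto intro!: Bochner_Integration.integral_cong simp: max_def indicator_def)
    then show ?thesis unfolding z by (simp add: eq)
  qed
  have "density lborel (\<lambda>z. ennreal (max 0 (h z))) = density lborel (\<lambda>z. ennreal (max 0 (- h z)))"
  proof (rule measure_eqI_generator_eq)
    let ?E = "range (\<lambda>(a, b). box a b::complex set)"
    show "Int_stable ?E" by (auto simp: Int_stable_def box_Int_box)
    show "?E \<subseteq> Pow UNIV" "sets (density lborel (\<lambda>z. ennreal (max 0 (h z)))) = sigma_sets UNIV ?E"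
      "sets (density lborel (\<lambda>z. ennreal (max 0 (- h z)))) = sigma_sets UNIV ?E"
      by (simp_all add: borel_eq_box)
    let ?A = "\<lambda>n::nat. box (- (real n *\<^sub>R One)) (real n *\<^sub>R One) :: complex set"
    show "range ?A \<subseteq> ?E" "(\<Union>i. ?A i) = UNIV" unfolding UN_box_eq_UNIV by auto
    show "emeasure (density lborel (\<lambda>z. ennreal (max 0 (h z)))) (?A i) \<noteq> \<infinity>" for i
      by (subst eq) auto
    show "emeasure (density lborel (\<lambda>z. ennreal (max 0 (h z)))) X
        = emeasure (density lborel (\<lambda>z. ennreal (max 0 (- h z)))) X" if "X \<in> ?E" for X
      using that beq by auto
  qed
  then have "AE z in lborel. ennreal (max 0 (h z)) = ennreal (max 0 (- h z))"
    by (intro sigma_finite_measure.density_unique[OF sigma_finite_lborel]) auto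
  then show ?thesis by eventually_elim (auto simp: max_def split: if_splits)
qed

text \<open>Box bumps converge boundedly to the indicator of a box, so all integrals over boxes
  vanish. Real and imaginary part are treated separately, and on an exhausting sequence of boxes
  because g is integrable only locally.\<close>

lemma fundamental_lemma:
  assumes g: "loc_int g" and z: "\<And>\<phi>. test_function \<phi> \<Longrightarrow> (LINT z|lborel. g z * \<phi> z) = 0"
  shows "AE z in lborel. g z = 0"
proof -
  have [measurable]: "g \<in> borel_measurable borel" using g by (rule loc_intD)
  have box0: "(LINT z|lborel. indicator (box a b) z *\<^sub>R g z) = 0" for a b
  proof -
    obtain R where R: "box a b \<subseteq> cball 0 R" using bounded_box[of _ _] bounded_subset_ballD[of _ 0] ball_subset_cball by (metis order_trans)
    have bm: "(\<lambda>z. complex_of_real (box_bump (real (Suc n)) a b z)) \<in> borel_measurable borel" for n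
      by (intro test_function_measurable test_function_box_bump) simp
    have "(\<lambda>n. LINT z|lborel. g z * of_real (box_bump (real (Suc n)) a b z)) \<longlonglongrightarrow> (LINT z|lborel. g z * of_real (indicator (box a b) z))"
    proof (rule integral_dominated_convergence)
      show "integrable lborel (\<lambda>z. norm (indicator (cball 0 R) z *\<^sub>R g z))"
        using loc_int_cball[OF g, of R] unfolding set_integrable_def by (rule integrable_norm)
      show "AE z in lborel. (\<lambda>n. g z * of_real (box_bump (real (Suc n)) a b z)) \<longlonglongrightarrow> g z * of_real (indicator (box a b) z)"
        by (intro AE_I2 tendsto_intros box_bump_tendsto)
      fix n show "AE z in lborel. norm (g z * of_real (box_bump (real (Suc n)) a b z)) \<le> norm (indicator (cball 0 R) z *\<^sub>R g z)"
      proof (rule AE_I2)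
        fix z show "norm (g z * of_real (box_bump (real (Suc n)) a b z)) \<le> norm (indicator (cball 0 R) z *\<^sub>R g z)"
        proof (cases "z \<in> box a b")
          case True
          have "norm (g z) * \<bar>box_bump (real (Suc n)) a b z\<bar> \<le> norm (g z) * 1"
            using box_bump_bounds[of "real (Suc n)" a b z] by (intro mult_left_mono) auto
          then show ?thesis using True R by (auto simp: norm_mult)
        qed (simp add: box_bump_zero)
      qed
    qed (use bm in measurable)
    moreover have "(LINT z|lborel. g z * of_real (box_bump (real (Suc n)) a b z)) = 0" for n
      by (intro z test_function_box_bump) simp
    ultimately have "(LINT z|lborel. g z * of_real (indicator (box a b) z)) = 0"
      by (simp add: LIMSEQ_const_iff)
    then show ?thesis by (simp add: scaleR_conv_of_real mult.commute)
  qed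
  have "AE z in lborel. z \<in> box (- (real n *\<^sub>R One)) (real n *\<^sub>R One) \<longrightarrow> g z = 0" for n
  proof -
    let ?B = "box (- (real n *\<^sub>R One)) (real n *\<^sub>R One) :: complex set"
    obtain R where R: "?B \<subseteq> cball 0 R" using bounded_box[of _ _] bounded_subset_ballD[of _ 0] ball_subset_cball by (metis order_trans)
    have i: "integrable lborel (\<lambda>z. indicator ?B z *\<^sub>R g z)"
      using set_integrable_subset[OF loc_int_cball[OF g], of ?B R] R by (simp add: set_integrable_def)
    have b: "(LINT z|lborel. indicator (box a b) z *\<^sub>R (indicator ?B z *\<^sub>R g z)) = 0" for a b
    proof -
      have "indicator (box a b) z *\<^sub>R (indicator ?B z *\<^sub>R g z) = indicator (box a b \<inter> ?B) z *\<^sub>R g z" for z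
        by (simp add: indicator_inter_arith)
      then show ?thesis by (simp only: box_Int_box box0)
    qed
    have ib: "integrable lborel (\<lambda>z. indicator (box a b) z *\<^sub>R (indicator ?B z *\<^sub>R g z))" for a b
      by (intro integrable_mult_indicator i) simp
    have "AE z in lborel. Re (indicator ?B z *\<^sub>R g z) = 0"
    proof (rule AE_zero_of_box_integrals)
      show "integrable lborel (\<lambda>z. Re (indicator ?B z *\<^sub>R g z))" using i by (rule integrable_Re)
      fix a b
      have "(LINT z|lborel. indicator (box a b) z * Re (indicator ?B z *\<^sub>R g z)) =
          (LINT z|lborel. Re (indicator (box a b) z *\<^sub>R (indicator ?B z *\<^sub>R g z)))" by (simp add: mult.assoc)
      also have "\<dots> = 0" using integral_Re[OF ib] b by simp
      finally show "(LINT z|lborel. indicator (box a b) z * Re (indicator ?B z *\<^sub>R g z)) = 0" .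
    qed
    moreover have "AE z in lborel. Im (indicator ?B z *\<^sub>R g z) = 0"
    proof (rule AE_zero_of_box_integrals)
      show "integrable lborel (\<lambda>z. Im (indicator ?B z *\<^sub>R g z))" using i by (rule integrable_Im)
      fix a b
      have "(LINT z|lborel. indicator (box a b) z * Im (indicator ?B z *\<^sub>R g z)) =
          (LINT z|lborel. Im (indicator (box a b) z *\<^sub>R (indicator ?B z *\<^sub>R g z)))" by (simp add: mult.assoc)
      also have "\<dots> = 0" using integral_Im[OF ib] b by simp
      finally show "(LINT z|lborel. indicator (box a b) z * Im (indicator ?B z *\<^sub>R g z)) = 0" .
    qed
    ultimately show ?thesis by eventually_elim (auto simp: complex_eq_iff)
  qed
  then have "AE z in lborel. \<forall>n. z \<in> box (- (real n *\<^sub>R One)) (real n *\<^sub>R One) \<longrightarrow> g z = 0"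
    unfolding AE_all_countable by blast
  then show ?thesis
  proof eventually_elim
    case (elim z)
    have "z \<in> (\<Union>n::nat. box (- (real n *\<^sub>R One)) (real n *\<^sub>R One))" unfolding UN_box_eq_UNIV by simp
    then show ?case using elim by blast
  qed
qed

lemma loc_int_diff: "loc_int f \<Longrightarrow> loc_int g \<Longrightarrow> loc_int (\<lambda>z. f z - g z)"
  and loc_int_add: "loc_int f \<Longrightarrow> loc_int g \<Longrightarrow> loc_int (\<lambda>z. f z + g z)"
  unfolding loc_int_def by auto

lemma weak_deriv_unique:
  assumes "weak_deriv a b f g" "weak_deriv a b f h"
  shows "AE z in lborel. g z = h z"
proof -
  have l: "loc_int g" "loc_int h" using assms by (auto simp: weak_deriv_def)
  have "AE z in lborel. g z - h z = 0"
  proof (rule fundamental_lemma[OF loc_int_diff[OF l]])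
    fix \<phi> assume t: "test_function \<phi>"
    show "(LINT z|lborel. (g z - h z) * \<phi> z) = 0"
      using assms t loc_int_test[OF l(1) t] loc_int_test[OF l(2) t]
      by (auto simp: weak_deriv_def left_diff_distrib)
  qed
  then show ?thesis by simp
qed

section \<open>Convolution with test functions\<close>

definition conv :: "(complex \<Rightarrow> complex) \<Rightarrow> (complex \<Rightarrow> complex) \<Rightarrow> complex \<Rightarrow> complex" where
  "conv k \<psi> z = (LINT w|lborel. k w * \<psi> (z - w))"

lemma conv_integrable: "loc_int k \<Longrightarrow> test_function \<psi> \<Longrightarrow> integrable lborel (\<lambda>w. k w * \<psi> (z - w))"
  by (intro loc_int_test test_function_intros)

text \<open>The first derivatives are Lipschitz, so the mean value inequality for \<psi> minus its
  linearisation at z gives a quadratic remainder with a constant independent of z. This uniformity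
  allows differentiation under the integral of a convolution.\<close>

lemma test_function_taylor:
  assumes t: "test_function \<psi>"
  obtains C where "C \<ge> 0" "\<And>z h. norm (\<psi> (z + h) - \<psi> z - (of_real (Re h) * dx \<psi> z + of_real (Im h) * dy \<psi> z)) \<le> C * (norm h)\<^sup>2"
proof -
  obtain L1 L2 where L: "L1-lipschitz_on UNIV (dx \<psi>)" "L2-lipschitz_on UNIV (dy \<psi>)"
    using test_function_lipschitz test_functionD(2,3)[OF t] by meson
  have nn: "L1 \<ge> 0" "L2 \<ge> 0" using L lipschitz_on_nonneg by auto
  show thesis
  proof (rule that[of "L1 + L2"])
    fix z h
    define D where "D w k = of_real (Re k) * dx \<psi> w + of_real (Im k) * dy \<psi> w" for w k
    have "norm ((\<psi> (z + h) - D z (z + h)) - (\<psi> z - D z z)) \<le> ((L1 + L2) * norm h) * norm ((z + h) - z)"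
    proof (rule differentiable_bound[of "cball z (norm h)" "\<lambda>w. \<psi> w - D z w" "\<lambda>w k. D w k - D z k"])
      fix w assume w: "w \<in> cball z (norm h)"
      have l: "(D z has_derivative D z) (at w within cball z (norm h))"
        by (rule bounded_linear_imp_has_derivative)
           (auto simp: D_def[abs_def] intro!: bounded_linear_intros bounded_linear_mult_const
             bounded_linear_compose[OF bounded_linear_of_real bounded_linear_Re]
             bounded_linear_compose[OF bounded_linear_of_real bounded_linear_Im])
      show "((\<lambda>w. \<psi> w - D z w) has_derivative (\<lambda>k. D w k - D z k)) (at w within cball z (norm h))"
        using smoothD(1)[OF test_functionD(1)[OF t], of w] 
        by (intro has_derivative_diff l) (auto simp: D_def intro: has_derivative_at_withinI)
      show "onorm (\<lambda>k. D w k - D z k) \<le> (L1 + L2) * norm h"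
      proof (rule onorm_bound)
        fix k :: complex
        have "D w k - D z k = of_real (Re k) * (dx \<psi> w - dx \<psi> z) + of_real (Im k) * (dy \<psi> w - dy \<psi> z)"
          by (simp add: D_def algebra_simps)
        also have "norm \<dots> \<le> \<bar>Re k\<bar> * norm (dx \<psi> w - dx \<psi> z) + \<bar>Im k\<bar> * norm (dy \<psi> w - dy \<psi> z)"
          by (rule norm_triangle_le) (simp add: norm_mult)
        also have "\<dots> \<le> norm k * (L1 * norm h) + norm k * (L2 * norm h)"
        proof (intro add_mono mult_mono)
          have wz: "dist w z \<le> norm h" using w by (simp add: dist_commute)
          show "norm (dx \<psi> w - dx \<psi> z) \<le> L1 * norm h" "norm (dy \<psi> w - dy \<psi> z) \<le> L2 * norm h"
            using lipschitz_onD[OF L(1), of w z] lipschitz_onD[OF L(2), of w z] mult_left_mono[OF wz nn(1)] mult_left_mono[OF wz nn(2)]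
            by (auto simp: dist_norm[of "dx _ _"] dist_norm[of "dy _ _"])
        qed (use abs_Re_le_cmod abs_Im_le_cmod in auto)
        finally show "norm (D w k - D z k) \<le> (L1 + L2) * norm h * norm k" by (simp add: algebra_simps)
      qed (use nn in auto)
    qed (auto simp: dist_norm)
    moreover have "D z (z + h) = D z z + D z h" by (simp add: D_def algebra_simps)
    ultimately show "norm (\<psi> (z + h) - \<psi> z - (of_real (Re h) * dx \<psi> z + of_real (Im h) * dy \<psi> z)) \<le> (L1 + L2) * (norm h)\<^sup>2"
      unfolding D_def[symmetric] by (simp add: power2_eq_square algebra_simps)
  qed (use nn in auto)
qed

text \<open>The uniform Taylor remainder of \<psi>, integrated against |k| over one fixed ball, is
  at most C K |h|^2.\<close>

lemma conv_has_derivative: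
  assumes k: "loc_int k" and t: "test_function \<psi>"
  shows "(conv k \<psi> has_derivative (\<lambda>h. of_real (Re h) * conv k (dx \<psi>) z + of_real (Im h) * conv k (dy \<psi>) z)) (at z)"
proof -
  have [measurable]: "k \<in> borel_measurable borel" using k by (rule loc_intD)
  obtain C where C: "C \<ge> 0" "\<And>z h. norm (\<psi> (z + h) - \<psi> z - (of_real (Re h) * dx \<psi> z + of_real (Im h) * dy \<psi> z)) \<le> C * (norm h)\<^sup>2"
    using test_function_taylor[OF t] by blast
  obtain R where R: "R > 0" "\<And>z. norm z > R \<Longrightarrow> \<psi> z = 0 \<and> dx \<psi> z = 0 \<and> dy \<psi> z = 0"
    using test_functionD(5)[OF t] by blast
  \<comment> \<open>For |h| < 1 and |w| > S both z - w and z + h - w lie outside the support of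
    \<psi>, so only the ball of radius S contributes.\<close>
  define S where "S = R + norm z + 1"
  define K where "K = (LINT w|lborel. norm (indicator (cball 0 S) w *\<^sub>R k w))"
  have Ki: "integrable lborel (\<lambda>w. norm (indicator (cball 0 S) w *\<^sub>R k w))"
    using loc_int_cball[OF k, of S] unfolding set_integrable_def by (rule integrable_norm)
  have "K \<ge> 0" unfolding K_def by simp
  note ci = conv_integrable[OF k t] conv_integrable[OF k test_functionD(2)[OF t]] conv_integrable[OF k test_functionD(3)[OF t]]
  show ?thesis
  proof (rule has_derivativeI_sandwich[where e = 1 and H = "\<lambda>y. C * K * norm (y - z)"])
    show "bounded_linear (\<lambda>h. of_real (Re h) * conv k (dx \<psi>) z + of_real (Im h) * conv k (dy \<psi>) z)"
      by (auto intro!: bounded_linear_intros bounded_linear_mult_const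
             bounded_linear_compose[OF bounded_linear_of_real bounded_linear_Re]
             bounded_linear_compose[OF bounded_linear_of_real bounded_linear_Im])
    show "((\<lambda>y. C * K * norm (y - z)) \<longlongrightarrow> 0) (at z)"
      by (auto intro!: tendsto_eq_intros)
    fix y assume y: "y \<noteq> z" "dist y z < 1"
    define h where "h = y - z"
    have h: "norm h < 1" "h \<noteq> 0" "y = z + h" using y by (auto simp: h_def dist_norm)
    let ?E = "\<lambda>w. \<psi> (z + h - w) - \<psi> (z - w) - (of_real (Re h) * dx \<psi> (z - w) + of_real (Im h) * dy \<psi> (z - w))"
    have "conv k \<psi> y - conv k \<psi> z - (of_real (Re h) * conv k (dx \<psi>) z + of_real (Im h) * conv k (dy \<psi>) z)
       = (LINT w|lborel. k w * \<psi> (z + h - w) - k w * \<psi> (z - w) - (of_real (Re h) * (k w * dx \<psi> (z - w)) + of_real (Im h) * (k w * dy \<psi> (z - w))))"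
      unfolding conv_def h(3) using ci by simp
    also have "\<dots> = (LINT w|lborel. k w * ?E w)" by (simp add: algebra_simps)
    finally have e: "conv k \<psi> y - conv k \<psi> z - (of_real (Re h) * conv k (dx \<psi>) z + of_real (Im h) * conv k (dy \<psi>) z) = (LINT w|lborel. k w * ?E w)" .
    have pt: "norm (k w * ?E w) \<le> (C * (norm h)\<^sup>2) * norm (indicator (cball 0 S) w *\<^sub>R k w)" for w
    proof (cases "norm w \<le> S")
      case True
      have "norm (?E w) \<le> C * (norm h)\<^sup>2" using C(2)[of "z - w" h] by (simp add: algebra_simps)
      from mult_left_mono[OF this, of "norm (k w)"] show ?thesis using True
        unfolding norm_mult by (simp add: mult.commute)
    next
      case False
      have 1: "norm (z - w) \<ge> norm w - norm z" by (simp add: norm_minus_commute norm_triangle_ineq2)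
      have 2: "norm (z + h - w) \<ge> norm (z - w) - norm h"
        using norm_triangle_ineq2[of "z - w" "-h"] by (simp add: algebra_simps)
      have "norm (z - w) > R" "norm (z + h - w) > R" using 1 2 False h unfolding S_def by linarith+
      then have "?E w = 0" using R(2) by simp
      then show ?thesis by (simp only: mult_zero_right norm_zero) (use C in simp)
    qed
    have "norm (LINT w|lborel. k w * ?E w) \<le> (LINT w|lborel. (C * (norm h)\<^sup>2) * norm (indicator (cball 0 S) w *\<^sub>R k w))"
      using Ki by (intro Bochner_Integration.integral_norm_bound_integral[OF _ _ pt] integrable_mult_right)
        (auto intro!: Bochner_Integration.integrable_bound[OF integrable_mult_right[OF Ki, of "C * (norm h)\<^sup>2"]] AE_I2
          order_trans[OF pt] borel_measurable_times borel_measurable_diff borel_measurable_add borel_measurable_const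
          measurable_compose[OF _ test_function_measurable[OF t]] measurable_compose[OF _ test_function_measurable[OF test_functionD(2)[OF t]]]
          measurable_compose[OF _ test_function_measurable[OF test_functionD(3)[OF t]]])
    also have "\<dots> = C * K * norm h * norm h" unfolding K_def by (simp add: power2_eq_square)
    finally have "norm (conv k \<psi> y - conv k \<psi> z - (of_real (Re h) * conv k (dx \<psi>) z + of_real (Im h) * conv k (dy \<psi>) z)) \<le> C * K * norm h * norm h"
      unfolding e .
    then show "norm (conv k \<psi> y - conv k \<psi> z - (of_real (Re (y - z)) * conv k (dx \<psi>) z + of_real (Im (y - z)) * conv k (dy \<psi>) z)) / norm (y - z) \<le> C * K * norm (y - z)"
      using h unfolding h_def[symmetric] by (simp add: field_simps)
  qed simp
qed

lemma smooth_conv: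
  assumes k: "loc_int k" and t: "test_function \<psi>"
  shows "smooth (conv k \<psi>)" "dx (conv k \<psi>) z = conv k (dx \<psi>) z" "dy (conv k \<psi>) z = conv k (dy \<psi>) z"
    "first_order a b (conv k \<psi>) z = conv k (first_order a b \<psi>) z"
proof -
  show "smooth (conv k \<psi>)"
  proof (rule smooth_coinduct[where S = "conv k ` Collect test_function"])
    fix f assume "f \<in> conv k ` Collect test_function"
    then obtain \<psi> where "f = conv k \<psi>" "test_function \<psi>" by auto
    then show "\<exists>fx\<in>conv k ` Collect test_function. \<exists>fy\<in>conv k ` Collect test_function.
     \<forall>z. (f has_derivative (\<lambda>h. of_real (Re h) * fx z + of_real (Im h) * fy z)) (at z)"
      using conv_has_derivative[OF k] test_functionD(2,3)[of \<psi>] by blast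
  qed (use t in auto)
  show d: "dx (conv k \<psi>) z = conv k (dx \<psi>) z" "dy (conv k \<psi>) z = conv k (dy \<psi>) z"
    using dx_dy_eqI[OF conv_has_derivative[OF k t]] by auto
  show "first_order a b (conv k \<psi>) z = conv k (first_order a b \<psi>) z"
    using conv_integrable[OF k test_functionD(2)[OF t], of z] conv_integrable[OF k test_functionD(3)[OF t], of z]
    unfolding first_order_eq d unfolding conv_def first_order_eq
    by (simp add: distrib_left mult.left_commute[of "k _"])
qed

lemma lborel_distr_reflect: "distr lborel borel (\<lambda>w. z - w) = (lborel :: complex measure)"
proof -
  have "distr (distr lborel borel (\<lambda>w. -1 * w)) borel ((+) z) = (lborel :: complex measure)"
    by (subst lborel_distr_rotation) (auto simp: lborel_distr_plus)
  then show ?thesis by (simp add: distr_distr o_def)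
qed

lemma conv_commute:
  assumes [measurable]: "k \<in> borel_measurable borel" "\<psi> \<in> borel_measurable borel"
  shows "conv k \<psi> z = conv \<psi> k z"
proof -
  have "conv k \<psi> z = integral\<^sup>L (distr lborel borel (\<lambda>w. z - w)) (\<lambda>w. k w * \<psi> (z - w))" by (simp add: conv_def lborel_distr_reflect)
  also have "\<dots> = (LINT w|lborel. k (z - w) * \<psi> w)" by (subst integral_distr) auto
  finally show ?thesis by (simp add: conv_def mult.commute)
qed

subsection \<open>Mollifiers\<close>

text \<open>The support is a square of half side \<delta>; the radius 2 \<delta> that occurs below
  is a crude bound for half of its diagonal.\<close>

definition mollifier :: "real \<Rightarrow> complex \<Rightarrow> real" where
  "mollifier \<delta> z = box_bump 1 (Complex (-\<delta>) (-\<delta>)) (Complex \<delta> \<delta>) z /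
     (LINT w|lborel. box_bump 1 (Complex (-\<delta>) (-\<delta>)) (Complex \<delta> \<delta>) w)"

lemma mollifier:
  assumes d: "\<delta> > 0"
  shows "0 \<le> mollifier \<delta> z" "2 * \<delta> \<le> norm z \<Longrightarrow> mollifier \<delta> z = 0" "mollifier \<delta> (- z) = mollifier \<delta> z"
    "test_function (\<lambda>z. of_real (mollifier \<delta> z))"
    "integrable lborel (mollifier \<delta>)" "(LINT w|lborel. mollifier \<delta> w) = 1"
proof -
  let ?b = "box_bump 1 (Complex (-\<delta>) (-\<delta>)) (Complex \<delta> \<delta>)"
  have t: "test_function (\<lambda>z. of_real (?b z))" by (rule test_function_box_bump) simp
  have "integrable lborel (\<lambda>z. 1 * complex_of_real (?b z))"
    by (intro loc_int_test loc_int_continuous t) auto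
  then have i: "integrable lborel ?b" using integrable_Re by fastforce
  have nz: "(LINT w|lborel. ?b w) \<noteq> 0"
  proof
    assume "(LINT w|lborel. ?b w) = 0"
    then have "AE w in lborel. ?b w = 0"
      using integral_nonneg_eq_0_iff_AE[OF i] box_bump_bounds by auto
    then have "AE w in lborel. w \<notin> box (Complex (-\<delta>) (-\<delta>)) (Complex \<delta> \<delta>)"
      by eventually_elim (use box_bump_pos[of 1] in fastforce)
    then have "emeasure lborel (box (Complex (-\<delta>) (-\<delta>)) (Complex \<delta> \<delta>)) = 0"
      using AE_iff_null_sets[of "box (Complex (-\<delta>) (-\<delta>)) (Complex \<delta> \<delta>)" lborel] by auto
    then show False using d by (auto simp: emeasure_lborel_box_eq Basis_complex_def)
  qed
  then have pos: "(LINT w|lborel. ?b w) > 0"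
    using integral_nonneg_AE[of ?b lborel] box_bump_bounds by (simp add: order_less_le)
  show "0 \<le> mollifier \<delta> z" unfolding mollifier_def using pos box_bump_bounds by (intro divide_nonneg_pos)
  show "mollifier \<delta> z = 0" if "2 * \<delta> \<le> norm z"
  proof -
    have "z \<notin> box (Complex (-\<delta>) (-\<delta>)) (Complex \<delta> \<delta>)"
    proof
      assume "z \<in> box (Complex (-\<delta>) (-\<delta>)) (Complex \<delta> \<delta>)"
      then have "\<bar>Re z\<bar> < \<delta>" "\<bar>Im z\<bar> < \<delta>" by (auto simp: in_box_complex_iff)
      then show False using cmod_le[of z] that by linarith
    qed
    then show ?thesis by (simp add: mollifier_def box_bump_zero)
  qed
  show "mollifier \<delta> (- z) = mollifier \<delta> z"
    by (simp add: mollifier_def box_bump_def mult.commute add.commute)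
  have "test_function (\<lambda>z. of_real (?b z) * of_real (1 / (LINT w|lborel. ?b w)))"
    by (intro test_function_intros(1) t smooth_intros(1))
  then show "test_function (\<lambda>z. of_real (mollifier \<delta> z))" by (simp add: mollifier_def)
  show "integrable lborel (mollifier \<delta>)" "(LINT w|lborel. mollifier \<delta> w) = 1"
    unfolding mollifier_def[abs_def] using i nz by auto
qed

text \<open>Mollifying takes a weighted mean over the disc of radius 2 \<delta>. The case c = 0
  transfers bounds, c = f z gives convergence at points of continuity, and \<eta> = 0 gives equality
  where f is locally constant.\<close>

lemma conv_mollifier_bound:
  assumes d: "\<delta> > 0" and f: "loc_int f" and b: "\<And>w. dist w z < 2 * \<delta> \<Longrightarrow> norm (f w - c) \<le> \<eta>"
  shows "norm (conv f (\<lambda>w. of_real (mollifier \<delta> w)) z - c) \<le> \<eta>"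
proof -
  have [measurable]: "f \<in> borel_measurable borel" using f by (rule loc_intD)
  note t = mollifier(4)[OF d]
  have ms: "integrable lborel (\<lambda>w. mollifier \<delta> (z - w))" "(LINT w|lborel. mollifier \<delta> (z - w)) = 1"
  proof -
    have [measurable]: "(\<lambda>w. complex_of_real (mollifier \<delta> w)) \<in> borel_measurable borel" by (rule test_function_measurable[OF t])
    have i: "integrable lborel (\<lambda>w. 1 * complex_of_real (mollifier \<delta> (z - w)))"
      by (rule conv_integrable[OF loc_int_continuous t]) auto
    then show "integrable lborel (\<lambda>w. mollifier \<delta> (z - w))" using integrable_Re by fastforce
    have "conv (\<lambda>_. 1) (\<lambda>w. complex_of_real (mollifier \<delta> w)) z = conv (\<lambda>w. complex_of_real (mollifier \<delta> w)) (\<lambda>_. 1) z"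
      by (rule conv_commute) auto
    then have "complex_of_real (LINT w|lborel. mollifier \<delta> (z - w)) = complex_of_real (LINT w|lborel. mollifier \<delta> w)"
      by (simp add: conv_def)
    then show "(LINT w|lborel. mollifier \<delta> (z - w)) = 1" using mollifier(6)[OF d] by simp
  qed
  have i: "integrable lborel (\<lambda>w. f w * of_real (mollifier \<delta> (z - w)))" by (rule conv_integrable[OF f t])
  have "c = (LINT w|lborel. c * of_real (mollifier \<delta> (z - w)))" using ms by simp
  then have "conv f (\<lambda>w. of_real (mollifier \<delta> w)) z - c
     = (LINT w|lborel. f w * of_real (mollifier \<delta> (z - w))) - (LINT w|lborel. c * of_real (mollifier \<delta> (z - w)))"
    by (simp add: conv_def)
  also have "\<dots> = (LINT w|lborel. f w * of_real (mollifier \<delta> (z - w)) - c * of_real (mollifier \<delta> (z - w)))"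
    using ms i by (intro Bochner_Integration.integral_diff[symmetric]) auto
  also have "norm \<dots> \<le> (LINT w|lborel. \<eta> * mollifier \<delta> (z - w))"
  proof (rule Bochner_Integration.integral_norm_bound_integral)
    show "integrable lborel (\<lambda>w. f w * of_real (mollifier \<delta> (z - w)) - c * of_real (mollifier \<delta> (z - w)))"
      using ms i by (intro Bochner_Integration.integrable_diff) auto
    show "integrable lborel (\<lambda>w. \<eta> * mollifier \<delta> (z - w))" using ms by simp
    fix w
    show "norm (f w * of_real (mollifier \<delta> (z - w)) - c * of_real (mollifier \<delta> (z - w))) \<le> \<eta> * mollifier \<delta> (z - w)"
    proof (cases "dist w z < 2 * \<delta>")
      case True
      have "norm (f w * of_real (mollifier \<delta> (z - w)) - c * of_real (mollifier \<delta> (z - w))) = norm (f w - c) * mollifier \<delta> (z - w)"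
        using mollifier(1)[OF d] by (simp add: left_diff_distrib[symmetric] norm_mult)
      then show ?thesis using b[OF True] mollifier(1)[OF d] by (simp add: mult_right_mono)
    next
      case False
      then have "mollifier \<delta> (z - w) = 0" by (intro mollifier(2)[OF d]) (simp add: dist_norm norm_minus_commute)
      then show ?thesis by simp
    qed
  qed
  finally show ?thesis using ms by simp
qed

section \<open>The Cauchy kernel\<close>

text \<open>Stated for C^1 functions because it is applied to products with the regularised Cauchy
  kernel, of which only one derivative is computed.\<close>

lemma C1_compact_support_integral:
  assumes der: "\<And>z. (F has_derivative (\<lambda>h. of_real (Re h) * Fx z + of_real (Im h) * Fy z)) (at z)"
    and cx: "continuous_on UNIV Fx" and cy: "continuous_on UNIV Fy"
    and z: "\<And>z. norm z > R \<Longrightarrow> F z = (0::complex)"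
  shows "integrable lborel Fx" "integrable lborel Fy" "(LINT z|lborel. Fx z) = 0" "(LINT z|lborel. Fy z) = 0"
proof -
  have z0: "Fx w = 0" "Fy w = 0" if "norm w > R" for w
  proof -
    have "(F has_derivative (\<lambda>h. 0)) (at w)"
      by (rule has_derivative_transform_within_open[of "\<lambda>_. 0" _ _ _ "- cball 0 R"]) (use z that in auto)
    then have "(\<lambda>h. of_real (Re h) * Fx w + of_real (Im h) * Fy w) = (\<lambda>h. 0)"
      using has_derivative_unique[OF der[of w]] by blast
    from fun_cong[OF this, of 1] fun_cong[OF this, of \<i>] show "Fx w = 0" "Fy w = 0" by auto
  qed
  have l1: "loc_int (\<lambda>_. 1)" by (rule loc_int_continuous) simp
  show ix: "integrable lborel Fx" using loc_int_mult[OF l1 cx, of R] z0 by simp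
  show iy: "integrable lborel Fy" using loc_int_mult[OF l1 cy, of R] z0 by simp
  have "bounded (Fx ` cball 0 R)" "bounded (Fy ` cball 0 R)"
    using continuous_on_subset[OF cx] continuous_on_subset[OF cy]
    by (auto intro!: compact_imp_bounded compact_continuous_image)
  then obtain A B where AB: "\<And>w. w \<in> cball 0 R \<Longrightarrow> norm (Fx w) \<le> A" "\<And>w. w \<in> cball 0 R \<Longrightarrow> norm (Fy w) \<le> B"
    unfolding bounded_iff by blast
  have B1: "norm (Fx w) \<le> \<bar>A\<bar>" "norm (Fy w) \<le> \<bar>B\<bar>" for w
    using AB[of w] z0[of w] by (cases "norm w > R"; auto)+
  have lip: "(\<bar>A\<bar> + \<bar>B\<bar>)-lipschitz_on UNIV F"
    by (rule gradient_bound_lipschitz[OF der B1])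
  have line: "((\<lambda>s. F (w + u * of_real s)) has_vector_derivative of_real (Re u) * Fx (w + u * of_real s) + of_real (Im u) * Fy (w + u * of_real s)) (at s)" for u w s
  proof -
    have "((\<lambda>s. w + u * of_real s) has_derivative (\<lambda>t. u * of_real t)) (at s)" by (auto intro!: derivative_eq_intros)
    from has_derivative_compose[OF this der] show ?thesis
      by (auto simp: has_vector_derivative_def algebra_simps scaleR_conv_of_real elim!: back_subst)
  qed
  show "(LINT z|lborel. Fx z) = 0"
    using line[where u=1] by (intro plane_directional_derivative_integral[of 1 _ F R, OF _ lip z ix]) auto
  show "(LINT z|lborel. Fy z) = 0"
    using line[where u=\<i>] by (intro plane_directional_derivative_integral[of \<i> _ F R, OF _ lip z iy]) auto
qed

section \<open>Local integrability of negative powers of the modulus\<close>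

lemma integrable_plane_product:
  fixes f g :: "real \<Rightarrow> real"
  assumes f: "integrable lborel f" "\<And>x. 0 \<le> f x" and g: "integrable lborel g" "\<And>x. 0 \<le> g x"
  shows "integrable lborel (\<lambda>z. f (Re z) * g (Im z))"
proof (rule integrableI_nonneg)
  have [measurable]: "f \<in> borel_measurable borel" "g \<in> borel_measurable borel"
    using f g borel_measurable_integrable by auto
  show "(\<lambda>z. f (Re z) * g (Im z)) \<in> borel_measurable lborel" by measurable
  show "AE z in lborel. 0 \<le> f (Re z) * g (Im z)" using f g by simp
  have "(\<integral>\<^sup>+z. ennreal (f (Re z) * g (Im z)) \<partial>lborel) = (\<integral>\<^sup>+x. \<integral>\<^sup>+y. ennreal (f x * g y) \<partial>lborel \<partial>lborel)"
    by (subst nn_integral_plane(2)) auto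
  also have "\<dots> = (\<integral>\<^sup>+x. ennreal (f x) * (\<integral>\<^sup>+y. ennreal (g y) \<partial>lborel) \<partial>lborel)"
    using f g by (intro nn_integral_cong) (simp add: ennreal_mult nn_integral_cmult)
  also have "\<dots> = (\<integral>\<^sup>+x. ennreal (f x) \<partial>lborel) * (\<integral>\<^sup>+y. ennreal (g y) \<partial>lborel)"
    by (simp add: nn_integral_multc)
  also have "\<dots> < \<infinity>"
    using f g by (simp add: nn_integral_eq_integral ennreal_mult_less_top)
  finally show "(\<integral>\<^sup>+z. ennreal (f (Re z) * g (Im z)) \<partial>lborel) < \<infinity>" .
qed

lemma integrable_even_real:
  fixes f :: "real \<Rightarrow> real"
  assumes [measurable]: "f \<in> borel_measurable borel" and even: "\<And>x. f (- x) = f x" and pos: "\<And>x. 0 \<le> f x"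
    and fin: "(\<integral>\<^sup>+x. ennreal (f x) * indicator {0..} x \<partial>lborel) < \<infinity>"
  shows "integrable lborel f"
proof -
  have "integrable lborel (\<lambda>x. indicator {0..} x *\<^sub>R f x)"
  proof (rule integrableI_nonneg)
    have "(\<integral>\<^sup>+x. ennreal (indicator {0..} x *\<^sub>R f x) \<partial>lborel) = (\<integral>\<^sup>+x. ennreal (f x) * indicator {0..} x \<partial>lborel)"
      by (intro nn_integral_cong) (auto simp: indicator_def)
    then show "(\<integral>\<^sup>+x. ennreal (indicator {0..} x *\<^sub>R f x) \<partial>lborel) < \<infinity>" using fin by simp
  qed (use pos in auto)
  from has_bochner_integral_even_function[OF has_bochner_integral_integrable[OF this] even]
  show ?thesis by (auto simp: has_bochner_integral_iff)
qed

lemma integrable_abs_powr: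
  assumes a: "a > -1"
  shows "integrable lborel (\<lambda>x::real. indicator {-R..R} x * \<bar>x\<bar> powr a)"
proof (rule integrable_even_real)
  have "(\<integral>\<^sup>+x. ennreal (indicator {-R..R} x * \<bar>x\<bar> powr a) * indicator {0..} x \<partial>lborel) =
     (\<integral>\<^sup>+x. ennreal (x powr a) * indicator {0..\<bar>R\<bar>} x * indicator {-R..R} x \<partial>lborel)"
    by (intro nn_integral_cong) (auto simp: indicator_def)
  also have "\<dots> \<le> (\<integral>\<^sup>+x. ennreal (x powr a) * indicator {0..\<bar>R\<bar>} x \<partial>lborel)"
    by (intro nn_integral_mono) (auto simp: indicator_def)
  also have "\<dots> = ennreal (\<bar>R\<bar> powr (a+1) / (a+1))"
    by (rule nn_integral_has_integral_lebesgue') (use has_integral_powr_from_0[OF a, of "\<bar>R\<bar>"] in auto)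
  also have "\<dots> < \<infinity>" by simp
  finally show "(\<integral>\<^sup>+x. ennreal (indicator {-R..R} x * \<bar>x\<bar> powr a) * indicator {0..} x \<partial>lborel) < \<infinity>" .
qed (auto simp: indicator_def)

lemma AE_Re_Im_nonzero: "AE z in lborel. Re z \<noteq> 0 \<and> Im z \<noteq> 0"
proof -
  have "{z. Im z = 0} \<in> null_sets lborel"
  proof (rule chart_null_set[of 1 _ 0])
    show "{z. Im z = 0} \<in> sets borel" by (intro borel_closed closed_Collect_eq continuous_intros)
    show "AE t in lborel. 0 + 1 * Complex s t \<notin> {z. Im z = 0}" for s using AE_lborel_singleton[of 0] by simp
  qed simp
  moreover have "{z. Re z = 0} \<in> null_sets lborel"
  proof (rule chart_null_set[of \<i> _ 0])
    show "{z. Re z = 0} \<in> sets borel" by (intro borel_closed closed_Collect_eq continuous_intros)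
    show "AE t in lborel. 0 + \<i> * Complex s t \<notin> {z. Re z = 0}" for s using AE_lborel_singleton[of 0] by simp
  qed simp
  ultimately have "AE z in lborel. z \<notin> {z. Im z = 0}" "AE z in lborel. z \<notin> {z. Re z = 0}" by (blast intro: AE_not_in)+
  then show ?thesis by eventually_elim auto
qed

text \<open>Since |Re z| and |Im z| are at most |z|, the function |z|^(-p) is at most |Re z|^(-p/2)
  |Im z|^(-p/2), a product of integrable functions of one variable because p/2 < 1; this takes the
  place of polar coordinates. On the axes the majorant is 0, as \<open>0 powr\<close> is 0, so the
  comparison is made almost everywhere.\<close>

lemma integrable_norm_powr:
  assumes p: "0 < p" "p < 2"
  shows "integrable lborel (\<lambda>z::complex. indicator (cball 0 R) z * norm z powr (-p))"
proof (rule Bochner_Integration.integrable_bound)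
  let ?g = "\<lambda>x::real. indicator {-R..R} x * \<bar>x\<bar> powr (-p/2)"
  show "integrable lborel (\<lambda>z. ?g (Re z) * ?g (Im z))"
    by (intro integrable_plane_product integrable_abs_powr) (use p in auto)
  show "AE z in lborel. norm (indicator (cball 0 R) z * norm z powr (-p)) \<le> norm (?g (Re z) * ?g (Im z))"
    using AE_Re_Im_nonzero
  proof eventually_elim
    case (elim z)
    show ?case
    proof (cases "norm z \<le> R")
      case True
      have 1: "\<bar>Re z\<bar> \<le> norm z" "\<bar>Im z\<bar> \<le> norm z" by (rule abs_Re_le_cmod abs_Im_le_cmod)+
      have nz: "norm z > 0" using elim by auto
      have "norm z powr (-p/2) \<le> \<bar>Re z\<bar> powr (-p/2)" "norm z powr (-p/2) \<le> \<bar>Im z\<bar> powr (-p/2)"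
        using 1 elim p by (auto intro!: powr_mono2')
      then have "norm z powr (-p/2) * norm z powr (-p/2) \<le> \<bar>Re z\<bar> powr (-p/2) * \<bar>Im z\<bar> powr (-p/2)"
        by (intro mult_mono) auto
      moreover have "norm z powr (-p/2) * norm z powr (-p/2) = norm z powr (-p)"
        by (simp add: powr_add[symmetric])
      moreover have "Re z \<in> {-R..R}" "Im z \<in> {-R..R}" using 1 True by auto
      ultimately show ?thesis using True by simp
    qed simp
  qed
qed (intro borel_measurable_times borel_measurable_indicator, simp_all)

lemma loc_int_inverse: "loc_int (\<lambda>w. 1 / w)"
  unfolding loc_int_def
proof (intro conjI allI)
  show m: "(\<lambda>w::complex. 1 / w) \<in> borel_measurable borel" by measurable
  fix R
  have "integrable lborel (\<lambda>z::complex. indicator (cball 0 R) z * norm z powr (-1))"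
    by (rule integrable_norm_powr) auto
  then show "set_integrable lborel (cball 0 R) (\<lambda>w::complex. 1 / w)"
    unfolding set_integrable_def
  proof (rule Bochner_Integration.integrable_bound)
    show "AE z::complex in lborel. norm (indicator (cball 0 R) z *\<^sub>R (1 / z)) \<le> norm (indicator (cball 0 R) z * norm z powr (-1))"
      by (intro AE_I2) (auto simp: indicator_def norm_divide powr_minus_divide)
  qed (auto intro!: borel_measurable_scaleR borel_measurable_indicator)
qed

text \<open>This number is \<pi>: it is the mass of the approximate identity that arises from the
  regularised kernel 1/w.\<close>

definition cauchy_const :: real where
  "cauchy_const = (LINT w|(lborel :: complex measure). 1 / (1 + (norm w)\<^sup>2)\<^sup>2)"

lemma integrable_inverse_one_plus_square: "integrable lborel (\<lambda>x::real. 1 / (1 + x\<^sup>2))"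
proof (rule integrable_even_real)
  have "(\<integral>\<^sup>+x. ennreal (1 / (1 + x\<^sup>2)) * indicator {0..} x \<partial>lborel) = ennreal (pi/2 - arctan 0)"
    by (rule nn_integral_FTC_atLeast) (auto intro!: derivative_eq_intros tendsto_arctan_at_top simp: inverse_eq_divide)
  then show "(\<integral>\<^sup>+x. ennreal (1 / (1 + x\<^sup>2)) * indicator {0..} x \<partial>lborel) < \<infinity>" by simp
qed auto

lemma integrable_cauchy_const: "integrable lborel (\<lambda>w::complex. 1 / (1 + (norm w)\<^sup>2)\<^sup>2)"
proof (rule Bochner_Integration.integrable_bound)
  show "integrable lborel (\<lambda>z. 1 / (1 + (Re z)\<^sup>2) * (1 / (1 + (Im z)\<^sup>2)))"
    by (intro integrable_plane_product integrable_inverse_one_plus_square) auto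
  \<comment> \<open>The product (1 + x^2) (1 + y^2) is at most (1 + |w|^2)^2, which gives a majorant
    that separates the variables.\<close>
  have "1 / (1 + (norm w)\<^sup>2)\<^sup>2 \<le> 1 / (1 + (Re w)\<^sup>2) * (1 / (1 + (Im w)\<^sup>2))" for w
  proof -
    have "(1 + (Re w)\<^sup>2) * (1 + (Im w)\<^sup>2) \<le> (1 + (norm w)\<^sup>2) * (1 + (norm w)\<^sup>2)"
      by (intro mult_mono) (auto simp: cmod_power2)
    moreover have "(1 + (Re w)\<^sup>2) * (1 + (Im w)\<^sup>2) > 0" by (intro mult_pos_pos) (auto intro: add_pos_nonneg)
    ultimately have "1 / ((1 + (norm w)\<^sup>2) * (1 + (norm w)\<^sup>2)) \<le> 1 / ((1 + (Re w)\<^sup>2) * (1 + (Im w)\<^sup>2))"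
      by (intro frac_le) auto
    then show ?thesis by (simp add: power2_eq_square)
  qed
  then show "AE w in lborel. norm (1 / (1 + (norm w)\<^sup>2)\<^sup>2) \<le> norm (1 / (1 + (Re w)\<^sup>2) * (1 / (1 + (Im w)\<^sup>2)))"
    by (intro AE_I2) simp
qed simp

lemma cauchy_const_pos: "cauchy_const > 0"
proof -
  have "cauchy_const \<noteq> 0"
  proof
    assume "cauchy_const = 0"
    then have "AE w::complex in lborel. 1 / (1 + (norm w)\<^sup>2)\<^sup>2 = 0"
      using integral_nonneg_eq_0_iff_AE[OF integrable_cauchy_const] by (simp add: cauchy_const_def)
    moreover have "1 / (1 + (norm w)\<^sup>2)\<^sup>2 \<noteq> 0" for w :: complex
      by (simp add: add_nonneg_eq_0_iff)
    ultimately have "AE w::complex in lborel. False" by simp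
    then show False using ae_filter_eq_bot_iff[of "lborel :: complex measure"] trivial_limit_def
      by (metis emeasure_lborel_UNIV ennreal_top_neq_zero space_borel space_lborel infinity_ennreal_def)
  qed
  moreover have "cauchy_const \<ge> 0" unfolding cauchy_const_def by simp
  ultimately show ?thesis by simp
qed

lemma lborel_integral_scale:
  fixes f :: "complex \<Rightarrow> complex"
  assumes [measurable]: "f \<in> borel_measurable borel" and e: "e > 0"
  shows "(LINT w|lborel. f w) = (LINT v|lborel. e\<^sup>2 *\<^sub>R f (e *\<^sub>R v))"
proof -
  have L: "lborel = density (distr lborel borel (\<lambda>x::complex. 0 + e *\<^sub>R x)) (\<lambda>_. ennreal (\<bar>e\<bar> ^ DIM(complex)))"
    by (rule lborel_affine) (use e in simp)
  have "(LINT w|lborel. f w) = integral\<^sup>L (distr lborel borel (\<lambda>x::complex. 0 + e *\<^sub>R x)) (\<lambda>w. (\<bar>e\<bar> ^ DIM(complex)) *\<^sub>R f w)"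
    by (subst L, subst integral_density) auto
  also have "\<dots> = (LINT v|lborel. (\<bar>e\<bar> ^ DIM(complex)) *\<^sub>R f (0 + e *\<^sub>R v))"
    by (subst integral_distr) auto
  finally show ?thesis by simp
qed

text \<open>The kernel \<open>1/w\<close> is regularised to \<open>\<bar>w\<bar>\<^sup>2 / (w (\<bar>w\<bar>\<^sup>2 + \<epsilon>\<^sup>2))\<close>, whose \<open>\<partial>\<close>-bar
  derivative is the approximate identity \<open>\<epsilon>\<^sup>2 / (\<bar>w\<bar>\<^sup>2 + \<epsilon>\<^sup>2)\<^sup>2\<close>; its mass is never computed.\<close>

lemma cauchy_regularised:
  assumes t: "test_function \<theta>" and e: "\<epsilon> > 0"
  shows "(LINT w|lborel. first_order (1/2) (\<i>/2) \<theta> w * (cnj w / of_real ((norm w)\<^sup>2 + \<epsilon>\<^sup>2))) =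
     - (LINT v|lborel. \<theta> (of_real \<epsilon> * v) * of_real (1 / (1 + (norm v)\<^sup>2)\<^sup>2))"
proof -
  define N where "N w = w * cnj w + of_real (\<epsilon>\<^sup>2)" for w :: complex
  have N_eq: "N w = of_real ((norm w)\<^sup>2 + \<epsilon>\<^sup>2)" for w using complex_norm_square[of w] by (simp add: N_def)
  have Npos: "(norm w)\<^sup>2 + \<epsilon>\<^sup>2 > 0" for w :: complex using e by (simp add: add_nonneg_pos)
  have N0: "N w \<noteq> 0" for w unfolding N_eq of_real_eq_0_iff using Npos[of w] by linarith
  \<comment> \<open>The regularised kernel with the factor w cancelled, which shows that it is
    regular at the origin; \<open>Kx\<close> and \<open>Ky\<close> are its partial
    derivatives.\<close>
  define K where "K w = cnj w * inverse (N w)" for w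
  define Kx where "Kx w = inverse (N w) - cnj w * (w + cnj w) * (inverse (N w) * inverse (N w))" for w
  define Ky where "Ky w = - \<i> * inverse (N w) - cnj w * (\<i> * (cnj w - w)) * (inverse (N w) * inverse (N w))" for w
  have contN: "continuous_on UNIV (\<lambda>w. inverse (N w))"
    unfolding N_def using N0 by (intro continuous_intros) (auto simp: N_def)
  have cK: "continuous_on UNIV K" "continuous_on UNIV Kx" "continuous_on UNIV Ky"
    unfolding K_def Kx_def Ky_def by (intro continuous_intros contN)+
  have Kd: "(K has_derivative (\<lambda>h. of_real (Re h) * Kx w + of_real (Im h) * Ky w)) (at w)" for w
  proof -
    have cn: "(cnj has_derivative cnj) (at w)"
      using bounded_linear.has_derivative[OF bounded_linear_cnj has_derivative_ident] .
    have "(N has_derivative (\<lambda>h. w * cnj h + h * cnj w + 0)) (at w)"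
      unfolding N_def[abs_def] by (intro derivative_intros cn has_derivative_ident)
    from has_derivative_mult[OF cn Deriv.has_derivative_inverse[OF N0 this]]
    have "(K has_derivative (\<lambda>h. cnj w * - (inverse (N w) * (w * cnj h + h * cnj w + 0) * inverse (N w)) + cnj h * inverse (N w))) (at w)"
      unfolding K_def[abs_def] .
    then show ?thesis
    proof (rule has_derivative_eq_rhs)
      have "cnj w * - (m * (w * cnj h + h * cnj w + 0) * m) + cnj h * m
        = of_real (Re h) * (m - cnj w * (w + cnj w) * (m * m)) + of_real (Im h) * (- \<i> * m - cnj w * (\<i> * (cnj w - w)) * (m * m))"
        for h m
      proof -
        obtain a b where h: "h = of_real a + \<i> * of_real b" by (metis complex_eq)
        show ?thesis unfolding h by (simp add: algebra_simps)
      qed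
      then show "(\<lambda>h. cnj w * - (inverse (N w) * (w * cnj h + h * cnj w + 0) * inverse (N w)) + cnj h * inverse (N w)) =
        (\<lambda>h. of_real (Re h) * Kx w + of_real (Im h) * Ky w)" unfolding Kx_def Ky_def by blast
    qed
  qed
  have dbarK: "Kx w / 2 + \<i> / 2 * Ky w = of_real (\<epsilon>\<^sup>2 / ((norm w)\<^sup>2 + \<epsilon>\<^sup>2)\<^sup>2)" for w
  proof -
    have "Kx w / 2 + \<i> / 2 * Ky w = inverse (N w) - w * cnj w * (inverse (N w) * inverse (N w))"
    proof -
      define m W where "m = inverse (N w)" "W = cnj w"
      have "(m - W * (w + W) * (m * m)) + \<i> * (- \<i> * m - W * (\<i> * (W - w)) * (m * m)) = 2 * (m - w * W * (m * m))"
        by (simp add: algebra_simps)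
      then show ?thesis unfolding Kx_def Ky_def m_W_def[symmetric] by (simp add: field_simps)
    qed
    also have "\<dots> = (N w - w * cnj w) * (inverse (N w) * inverse (N w))"
      using N0[of w] by (simp add: field_simps)
    also have "N w - w * cnj w = of_real (\<epsilon>\<^sup>2)" by (simp add: N_def)
    finally show ?thesis
      unfolding N_eq of_real_inverse[symmetric] of_real_mult[symmetric]
      by (simp only: divide_inverse power2_eq_square inverse_mult_distrib)
  qed
  define F where "F w = \<theta> w * K w" for w
  define Fx where "Fx w = \<theta> w * Kx w + dx \<theta> w * K w" for w
  define Fy where "Fy w = \<theta> w * Ky w + dy \<theta> w * K w" for w
  obtain R where R: "\<And>z. norm z > R \<Longrightarrow> \<theta> z = 0" using test_functionD(5)[OF t] by blast
  note s = test_functionD(1)[OF t]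
  have Fd: "(F has_derivative (\<lambda>h. of_real (Re h) * Fx w + of_real (Im h) * Fy w)) (at w)" for w
    unfolding F_def[abs_def]
    by (rule has_derivative_eq_rhs[OF has_derivative_mult[OF smoothD(1)[OF s] Kd]]) (simp add: Fx_def Fy_def algebra_simps)
  have cF: "continuous_on UNIV Fx" "continuous_on UNIV Fy" unfolding Fx_def Fy_def
    by (intro continuous_intros cK smoothD(4) s smoothD(2,3)[OF s])+
  note I = C1_compact_support_integral[OF Fd cF, of R]
  have Rz: "norm z > R \<Longrightarrow> F z = 0" for z by (simp add: F_def R)
  have "(LINT w|lborel. Fx w / 2 + \<i> / 2 * Fy w) = 0" using I Rz by simp
  moreover have "Fx w / 2 + \<i> / 2 * Fy w = first_order (1/2) (\<i>/2) \<theta> w * K w + \<theta> w * of_real (\<epsilon>\<^sup>2 / ((norm w)\<^sup>2 + \<epsilon>\<^sup>2)\<^sup>2)" for w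
  proof -
    have "Fx w / 2 + \<i> / 2 * Fy w = (1/2 * dx \<theta> w + \<i>/2 * dy \<theta> w) * K w + \<theta> w * (Kx w / 2 + \<i> / 2 * Ky w)"
      unfolding Fx_def Fy_def by (simp add: algebra_simps add_divide_distrib)
    then show ?thesis unfolding first_order_eq dbarK .
  qed
  ultimately have "(LINT w|lborel. first_order (1/2) (\<i>/2) \<theta> w * K w + \<theta> w * of_real (\<epsilon>\<^sup>2 / ((norm w)\<^sup>2 + \<epsilon>\<^sup>2)\<^sup>2)) = 0" by simp
  moreover have cP: "continuous_on UNIV (\<lambda>w::complex. complex_of_real (\<epsilon>\<^sup>2 / ((norm w)\<^sup>2 + \<epsilon>\<^sup>2)\<^sup>2))"
  proof (intro continuous_intros ballI)
    fix w :: complex show "((norm w)\<^sup>2 + \<epsilon>\<^sup>2)\<^sup>2 \<noteq> 0"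
      using zero_less_power[OF Npos[of w], of 2] by linarith
  qed
  moreover have i1: "integrable lborel (\<lambda>w. first_order (1/2) (\<i>/2) \<theta> w * K w)"
    using loc_int_test[OF loc_int_continuous[OF cK(1)] test_first_order[OF t]] by (simp add: mult.commute)
  moreover have i2: "integrable lborel (\<lambda>w. \<theta> w * complex_of_real (\<epsilon>\<^sup>2 / ((norm w)\<^sup>2 + \<epsilon>\<^sup>2)\<^sup>2))"
    using loc_int_test[OF loc_int_continuous[OF cP] t] by (simp add: mult.commute)
  ultimately have eq: "(LINT w|lborel. first_order (1/2) (\<i>/2) \<theta> w * K w) = - (LINT w|lborel. \<theta> w * of_real (\<epsilon>\<^sup>2 / ((norm w)\<^sup>2 + \<epsilon>\<^sup>2)\<^sup>2))"
    by (simp add: eq_neg_iff_add_eq_0)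
  have "(LINT w|lborel. \<theta> w * of_real (\<epsilon>\<^sup>2 / ((norm w)\<^sup>2 + \<epsilon>\<^sup>2)\<^sup>2))
     = (LINT v|lborel. \<theta> (of_real \<epsilon> * v) * of_real (1 / (1 + (norm v)\<^sup>2)\<^sup>2))"
  proof -
    let ?g = "\<lambda>w. \<theta> w * complex_of_real (\<epsilon>\<^sup>2 / ((norm w)\<^sup>2 + \<epsilon>\<^sup>2)\<^sup>2)"
    have [measurable]: "?g \<in> borel_measurable borel"
      using borel_measurable_integrable[OF i2] unfolding measurable_lborel2 .
    \<comment> \<open>The substitution w = \<epsilon> v, after which \<epsilon> survives only in the
      argument of \<theta>.\<close>
    have "(LINT w|lborel. ?g w) = (LINT v|lborel. \<epsilon>\<^sup>2 *\<^sub>R ?g (\<epsilon> *\<^sub>R v))"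
      by (rule lborel_integral_scale) fact+
    also have "\<dots> = (LINT v|lborel. \<theta> (of_real \<epsilon> * v) * of_real (1 / (1 + (norm v)\<^sup>2)\<^sup>2))"
    proof (rule Bochner_Integration.integral_cong[OF refl])
      fix v :: complex
      have n: "(norm (\<epsilon> *\<^sub>R v))\<^sup>2 + \<epsilon>\<^sup>2 = \<epsilon>\<^sup>2 * (1 + (norm v)\<^sup>2)" by (simp add: power_mult_distrib algebra_simps)
      have X: "\<epsilon>\<^sup>2 * (\<epsilon>\<^sup>2 / ((norm (\<epsilon> *\<^sub>R v))\<^sup>2 + \<epsilon>\<^sup>2)\<^sup>2) = 1 / (1 + (norm v)\<^sup>2)\<^sup>2"
        unfolding n using e by (simp add: power2_eq_square)
      have gen: "c *\<^sub>R (a * complex_of_real x) = a * of_real (c * x)" for a c x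
        by (simp add: scaleR_conv_of_real)
      have "\<epsilon>\<^sup>2 *\<^sub>R ?g (\<epsilon> *\<^sub>R v) = \<theta> (\<epsilon> *\<^sub>R v) * of_real (\<epsilon>\<^sup>2 * (\<epsilon>\<^sup>2 / ((norm (\<epsilon> *\<^sub>R v))\<^sup>2 + \<epsilon>\<^sup>2)\<^sup>2))"
        by (rule gen)
      also have "\<dots> = \<theta> (of_real \<epsilon> * v) * of_real (1 / (1 + (norm v)\<^sup>2)\<^sup>2)"
        by (subst X) (simp only: scaleR_conv_of_real)
      finally show "\<epsilon>\<^sup>2 *\<^sub>R ?g (\<epsilon> *\<^sub>R v) = \<theta> (of_real \<epsilon> * v) * of_real (1 / (1 + (norm v)\<^sup>2)\<^sup>2)" .
    qed
    finally show ?thesis .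
  qed
  moreover have "K = (\<lambda>w. cnj w / of_real ((norm w)\<^sup>2 + \<epsilon>\<^sup>2))"
    by (rule ext) (simp only: K_def N_eq divide_inverse)
  ultimately show ?thesis using eq by (simp only:)
qed

text \<open>The limit \<epsilon> to 0 in the regularised identity. The left integrands are dominated
  by the derivative of \<theta> times 1/|w|, which is integrable, and the right ones by a multiple
  of the density that defines \<open>cauchy_const\<close>.\<close>

lemma cauchy_pompeiu:
  assumes t: "test_function \<theta>"
  shows "(LINT w|lborel. first_order (1/2) (\<i>/2) \<theta> w * (1 / w)) = - (of_real cauchy_const * \<theta> 0)"
proof -
  define e where "e n = 1 / real (Suc n)" for n
  have e: "e n > 0" "e \<longlonglongrightarrow> 0" for n unfolding e_def using lim_1_over_n[THEN LIMSEQ_Suc] by auto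
  let ?D = "first_order (1/2) (\<i>/2) \<theta>"
  note tD = test_first_order[OF t, of "1/2" "\<i>/2"]
  have [measurable]: "?D \<in> borel_measurable borel" "\<theta> \<in> borel_measurable borel"
    using test_function_measurable t tD by auto
  have [measurable]: "(\<lambda>w. cnj w / complex_of_real ((norm w)\<^sup>2 + (e n)\<^sup>2)) \<in> borel_measurable borel" for n
  proof (intro borel_measurable_continuous_onI continuous_intros ballI)
    fix w :: complex
    have "(norm w)\<^sup>2 + (e n)\<^sup>2 > 0" using e(1)[of n] by (simp add: add_nonneg_pos)
    then show "complex_of_real ((norm w)\<^sup>2 + (e n)\<^sup>2) \<noteq> 0" unfolding of_real_eq_0_iff by linarith
  qed
  have "(\<lambda>n. LINT w|lborel. ?D w * (cnj w / of_real ((norm w)\<^sup>2 + (e n)\<^sup>2))) \<longlonglongrightarrow> (LINT w|lborel. ?D w * (1 / w))"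
  proof (rule integral_dominated_convergence)
    show "integrable lborel (\<lambda>w. norm (?D w * (1 / w)))"
      using loc_int_test[OF loc_int_inverse tD] by (intro integrable_norm) (simp add: mult.commute)
    show "AE w in lborel. (\<lambda>n. ?D w * (cnj w / of_real ((norm w)\<^sup>2 + (e n)\<^sup>2))) \<longlonglongrightarrow> ?D w * (1 / w)"
      using AE_Re_Im_nonzero
    proof eventually_elim
      case (elim w)
      then have w: "w \<noteq> 0" by auto
      have "(\<lambda>n. ?D w * (cnj w / of_real ((norm w)\<^sup>2 + (e n)\<^sup>2))) \<longlonglongrightarrow> ?D w * (cnj w / of_real ((norm w)\<^sup>2 + 0\<^sup>2))"
        using w by (intro tendsto_intros e(2)) auto
      also have "cnj w / of_real ((norm w)\<^sup>2 + 0\<^sup>2) = 1 / w"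
        using w complex_norm_square[of w] by (simp add: field_simps)
      finally show ?case .
    qed
    fix n show "AE w in lborel. norm (?D w * (cnj w / of_real ((norm w)\<^sup>2 + (e n)\<^sup>2))) \<le> norm (?D w * (1 / w))"
    proof (rule AE_I2)
      fix w :: complex
      have "norm (cnj w / of_real ((norm w)\<^sup>2 + (e n)\<^sup>2)) \<le> norm (1 / w)"
      proof (cases "w = 0")
        case False
        then have pos: "(norm w)\<^sup>2 + (e n)\<^sup>2 > 0" "norm w > 0" by (auto simp: add_pos_nonneg)
        have "norm (cnj w / of_real ((norm w)\<^sup>2 + (e n)\<^sup>2)) = norm w / ((norm w)\<^sup>2 + (e n)\<^sup>2)"
          using pos by (simp add: norm_divide del: of_real_add of_real_power)
        also have "\<dots> \<le> norm w / (norm w)\<^sup>2" using pos by (intro divide_left_mono) auto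
        also have "\<dots> = norm (1 / w)" using pos by (simp add: norm_divide power2_eq_square)
        finally show ?thesis .
      qed simp
      then show "norm (?D w * (cnj w / of_real ((norm w)\<^sup>2 + (e n)\<^sup>2))) \<le> norm (?D w * (1 / w))"
        unfolding norm_mult by (rule mult_left_mono) simp
    qed
  qed measurable
  moreover obtain B where B: "\<And>z. norm (\<theta> z) \<le> B" using test_functionD(6)[OF t] by blast
  have "(\<lambda>n. - (LINT v|lborel. \<theta> (of_real (e n) * v) * of_real (1 / (1 + (norm v)\<^sup>2)\<^sup>2))) \<longlonglongrightarrow>
      - (LINT v|lborel. \<theta> 0 * of_real (1 / (1 + (norm (v::complex))\<^sup>2)\<^sup>2))"
  proof (rule tendsto_minus, rule integral_dominated_convergence[where w = "\<lambda>v::complex. B * (1 / (1 + (norm v)\<^sup>2)\<^sup>2)"])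
    show "integrable lborel (\<lambda>v::complex. B * (1 / (1 + (norm v)\<^sup>2)\<^sup>2))"
      by (intro integrable_mult_right integrable_cauchy_const)
    show "AE v in lborel. norm (\<theta> (of_real (e n) * v) * of_real (1 / (1 + (norm v)\<^sup>2)\<^sup>2)) \<le> B * (1 / (1 + (norm v)\<^sup>2)\<^sup>2)" for n
    proof (rule AE_I2)
      fix v :: complex
      have "norm (complex_of_real (1 / (1 + (norm v)\<^sup>2)\<^sup>2)) = 1 / (1 + (norm v)\<^sup>2)\<^sup>2" unfolding norm_of_real by simp
      then show "norm (\<theta> (of_real (e n) * v) * of_real (1 / (1 + (norm v)\<^sup>2)\<^sup>2)) \<le> B * (1 / (1 + (norm v)\<^sup>2)\<^sup>2)"
        unfolding norm_mult using B by (simp add: mult_right_mono divide_right_mono)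
    qed
    have "isCont \<theta> 0" using test_functionD(4)[OF t, of UNIV] by (simp add: continuous_on_eq_continuous_at)
    then have "(\<lambda>n. \<theta> (of_real (e n) * v)) \<longlonglongrightarrow> \<theta> 0" for v
      by (rule isCont_tendsto_compose) (auto intro!: tendsto_eq_intros e(2))
    then show "AE v in lborel. (\<lambda>n. \<theta> (of_real (e n) * v) * of_real (1 / (1 + (norm v)\<^sup>2)\<^sup>2)) \<longlonglongrightarrow> \<theta> 0 * of_real (1 / (1 + (norm v)\<^sup>2)\<^sup>2)"
      by (intro AE_I2 tendsto_intros)
  qed measurable
  ultimately have "(LINT w|lborel. ?D w * (1 / w)) = - (LINT v|lborel. \<theta> 0 * of_real (1 / (1 + (norm (v::complex))\<^sup>2)\<^sup>2))"
    unfolding cauchy_regularised[OF t e(1)] by (rule LIMSEQ_unique)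
  also have "(LINT v|lborel. \<theta> 0 * complex_of_real (1 / (1 + (norm (v::complex))\<^sup>2)\<^sup>2)) = \<theta> 0 * of_real cauchy_const"
    unfolding cauchy_const_def by (subst integral_mult_right_zero, subst integral_complex_of_real) simp
  finally show ?thesis by (simp add: mult.commute)
qed

section \<open>The Cauchy transform and continuity of solutions\<close>

lemma lborel_reflect:
  fixes f :: "complex \<Rightarrow> 'a::{banach, second_countable_topology}"
  assumes [measurable]: "f \<in> borel_measurable borel"
  shows "integrable lborel (\<lambda>w. f (z - w)) \<longleftrightarrow> integrable lborel f" "(LINT w|lborel. f (z - w)) = (LINT w|lborel. f w)"
proof -
  have "integrable (distr lborel borel (\<lambda>w. z - w)) f \<longleftrightarrow> integrable lborel (\<lambda>w. f (z - w))"
    by (rule integrable_distr_eq) auto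
  then show "integrable lborel (\<lambda>w. f (z - w)) \<longleftrightarrow> integrable lborel f" unfolding lborel_distr_reflect by simp
  have "integral\<^sup>L (distr lborel borel (\<lambda>w. z - w)) f = (LINT w|lborel. f (z - w))"
    by (rule integral_distr) auto
  then show "(LINT w|lborel. f (z - w)) = (LINT w|lborel. f w)" unfolding lborel_distr_reflect by simp
qed

text \<open>The fundamental solution 1/(\<pi> w) of the dbar operator.\<close>

definition ckern :: "complex \<Rightarrow> complex" where
  "ckern w = 1 / (of_real cauchy_const * w)"

lemma loc_int_ckern: "loc_int ckern"
proof -
  have "loc_int (\<lambda>w. (1 / w) * (1 / of_real cauchy_const))"
    by (intro loc_int_times_continuous loc_int_inverse continuous_intros)
  then show ?thesis by (simp add: ckern_def[abs_def] mult.commute)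
qed

lemma norm_ckern: "norm (ckern w) = 1 / (cauchy_const * norm w)"
  using cauchy_const_pos by (simp add: ckern_def norm_divide norm_mult)

text \<open>The derivative of the convolution falls on \<psi>. For the reflected function w to
  \<psi> (z - w) the identity at the origin returns \<psi> z, and the sign of the reflection cancels
  the minus sign there.\<close>

lemma dbar_cauchy_transform:
  assumes t: "test_function \<psi>"
  shows "first_order (1/2) (\<i>/2) (conv ckern \<psi>) z = \<psi> z"
proof -
  define \<theta> where "\<theta> w = \<psi> (z - w)" for w
  have tt: "test_function \<theta>" unfolding \<theta>_def by (rule test_function_intros(4)[OF t])
  have d: "first_order (1/2) (\<i>/2) \<theta> w = - first_order (1/2) (\<i>/2) \<psi> (z - w)" for w
    unfolding \<theta>_def first_order_eq dx_dy_reflect[OF test_functionD(1)[OF t]] by simp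
  have "first_order (1/2) (\<i>/2) (conv ckern \<psi>) z = conv ckern (first_order (1/2) (\<i>/2) \<psi>) z"
    by (rule smooth_conv(4)[OF loc_int_ckern t])
  also have "\<dots> = (LINT w|lborel. (- 1 / of_real cauchy_const) * (first_order (1/2) (\<i>/2) \<theta> w * (1 / w)))"
    unfolding conv_def d by (intro Bochner_Integration.integral_cong) (auto simp: ckern_def)
  also have "\<dots> = (- 1 / of_real cauchy_const) * - (of_real cauchy_const * \<theta> 0)"
    by (subst integral_mult_right_zero) (simp only: cauchy_pompeiu[OF tt])
  also have "\<dots> = \<psi> z" using cauchy_const_pos by (simp add: \<theta>_def)
  finally show ?thesis .
qed

text \<open>Whichever of \<open>b\<close> and \<open>\<delta> a\<^sup>q\<^sup>-\<^sup>1\<close> is larger bounds the product.\<close>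

lemma crude_young:
  fixes a b \<delta> q :: real
  assumes "a \<ge> 0" "b \<ge> 0" "\<delta> > 0" "q > 1"
  shows "a * b \<le> \<delta> * a powr q + \<delta> powr (-1/(q-1)) * b powr (q/(q-1))"
proof (cases "a = 0 \<or> b = 0")
  case True
  then show ?thesis using assms by (auto intro!: add_nonneg_nonneg)
next
  case False
  then have ab: "a > 0" "b > 0" using assms by auto
  show ?thesis
  proof (cases "b \<le> \<delta> * a powr (q - 1)")
    case True
    have "a * b \<le> a * (\<delta> * a powr (q - 1))" using True ab by (intro mult_left_mono) auto
    also have "\<dots> = \<delta> * (a powr 1 * a powr (q - 1))" using ab by simp
    also have "\<dots> = \<delta> * a powr q" by (simp only: powr_add[symmetric]) simp
    finally show ?thesis using assms by (smt (verit) powr_ge_zero mult_nonneg_nonneg)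
  next
    case False
    then have "a powr (q - 1) < b / \<delta>" using assms by (simp add: field_simps)
    then have "(a powr (q - 1)) powr (1/(q-1)) < (b / \<delta>) powr (1/(q-1))"
      using assms ab by (intro powr_less_mono2) auto
    then have "a < (b / \<delta>) powr (1/(q-1))" using assms ab by (simp add: powr_powr)
    then have "a * b \<le> (b / \<delta>) powr (1/(q-1)) * b" using ab by (intro mult_right_mono) auto
    also have "\<dots> = \<delta> powr (-1/(q-1)) * (b powr (1/(q-1)) * b powr 1)"
      using assms ab by (simp add: powr_divide powr_minus_divide field_simps)
    also have "b powr (1/(q-1)) * b powr 1 = b powr (q/(q-1))"
    proof -
      have "1/(q-1) + 1 = q/(q-1)" using assms by (simp add: field_simps)
      then show ?thesis by (simp only: powr_add[symmetric])
    qed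
    finally show ?thesis using assms by (smt (verit) powr_ge_zero mult_nonneg_nonneg)
  qed
qed

lemma continuous_conv_bounded:
  assumes G: "integrable lborel G" and k: "continuous_on UNIV k" and b: "\<And>w. norm (k w) \<le> B"
  shows "continuous_on UNIV (conv G k)"
proof (rule continuous_on_sequentiallyI)
  fix u :: "nat \<Rightarrow> complex" and a assume "\<forall>n. u n \<in> UNIV" "a \<in> UNIV" "u \<longlonglongrightarrow> a"
  have [measurable]: "G \<in> borel_measurable borel" "k \<in> borel_measurable borel"
    using G k borel_measurable_integrable by (auto intro: borel_measurable_continuous_onI)
  show "(\<lambda>n. conv G k (u n)) \<longlonglongrightarrow> conv G k a"
    unfolding conv_def
  proof (rule integral_dominated_convergence)
    show "integrable lborel (\<lambda>w. norm (G w) * B)" using G by auto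
    show "AE w in lborel. norm (G w * k (u n - w)) \<le> norm (G w) * B" for n
      by (intro AE_I2) (auto simp: norm_mult intro: mult_left_mono b)
    have "(\<lambda>n. k (u n - w)) \<longlonglongrightarrow> k (a - w)" for w
      using k \<open>u \<longlonglongrightarrow> a\<close> by (intro isCont_tendsto_compose[of _ k]) (auto simp: continuous_on_eq_continuous_at intro!: tendsto_intros)
    then show "AE w in lborel. (\<lambda>n. G w * k (u n - w)) \<longlonglongrightarrow> G w * k (a - w)"
      by (intro AE_I2 tendsto_intros)
  qed measurable
qed

text \<open>Convolution of G with a bounded continuous kernel is continuous. The Cauchy kernel is
  approximated by such kernels with an error that is small in L^p for the exponent p conjugate to q,
  so the convolutions converge uniformly.\<close>

lemma continuous_cauchy_transform:
  assumes G: "integrable lborel G" and q: "q > 2" and Gq: "integrable lborel (\<lambda>w. norm (G w) powr q)"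
  shows "continuous_on UNIV (conv G ckern)"
proof -
  have [measurable]: "G \<in> borel_measurable borel" using G borel_measurable_integrable by auto
  have [measurable]: "ckern \<in> borel_measurable borel" using loc_int_ckern by (rule loc_intD)
  have c: "cauchy_const > 0" by (rule cauchy_const_pos)
  \<comment> \<open>The conjugate exponent; q > 2 is the same as p < 2, the condition for |w|^(-p)
    to be locally integrable.\<close>
  define p where "p = q / (q - 1)"
  have p: "1 < p" "p < 2" using q by (auto simp: p_def field_simps)
  \<comment> \<open>The kernel is cnj w / (c |w|^2) with c = \<open>cauchy_const\<close>. Replacing
    |w|^2 by its maximum with (n + 1)^(-2) changes it only in the disc of radius 1/(n + 1) and
    bounds it by (n + 1)/c.\<close>
  define kt where "kt n w = cnj w / of_real (cauchy_const * max ((norm w)\<^sup>2) ((1 / real (Suc n))\<^sup>2))" for n w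
  define b where "b n w = indicator (cball 0 (1 / real (Suc n))) w * norm (ckern w)" for n w
  have mpos: "cauchy_const * max ((norm w)\<^sup>2) ((1 / real (Suc n))\<^sup>2) > 0" for w :: complex and n
    using c by (intro mult_pos_pos) (auto simp: max_def)
  have ktc: "continuous_on UNIV (kt n)" for n
    unfolding kt_def
  proof (intro continuous_intros ballI)
    fix w :: complex show "complex_of_real (cauchy_const * max ((norm w)\<^sup>2) ((1 / real (Suc n))\<^sup>2)) \<noteq> 0"
      unfolding of_real_eq_0_iff using mpos[of w n] by linarith
  qed
  have [measurable]: "kt n \<in> borel_measurable borel" for n using ktc by (rule borel_measurable_continuous_onI)
  have nkt: "norm (kt n w) = norm w / (cauchy_const * max ((norm w)\<^sup>2) ((1 / real (Suc n))\<^sup>2))" for n w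
    unfolding kt_def norm_divide norm_of_real complex_mod_cnj using mpos[of w n] by simp
  have kteq: "kt n w = ckern w" if "norm w > 1 / real (Suc n)" for n w
  proof -
    have "(1 / real (Suc n))\<^sup>2 \<le> (norm w)\<^sup>2" using that by (intro power_mono) auto
    then have "max ((norm w)\<^sup>2) ((1 / real (Suc n))\<^sup>2) = (norm w)\<^sup>2" by simp
    moreover have "w \<noteq> 0" using that by (auto simp: field_simps)
    ultimately show ?thesis using c complex_norm_square[of w] by (simp add: kt_def ckern_def field_simps)
  qed
  have ktle: "norm (kt n w) \<le> norm (ckern w)" for n w
  proof (cases "w = 0")
    case False
    have "norm w / (cauchy_const * max ((norm w)\<^sup>2) ((1 / real (Suc n))\<^sup>2)) \<le> norm w / (cauchy_const * (norm w)\<^sup>2)"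
      using c False mpos by (intro divide_left_mono mult_left_mono) auto
    also have "\<dots> = norm (ckern w)" using c False by (simp add: norm_ckern power2_eq_square)
    finally show ?thesis by (simp add: nkt)
  qed (simp add: nkt)
  have ktb: "norm (kt n w) \<le> real (Suc n) / cauchy_const" for n w
  proof (cases "norm w > 1 / real (Suc n)")
    case True
    then have "norm (kt n w) = 1 / (cauchy_const * norm w)" by (simp add: kteq norm_ckern)
    also have "\<dots> \<le> 1 / (cauchy_const * (1 / real (Suc n)))"
      using True c by (intro frac_le mult_left_mono) auto
    finally show ?thesis using c by (simp add: field_simps)
  next
    case False
    have "norm (kt n w) \<le> (1 / real (Suc n)) / (cauchy_const * (1 / real (Suc n))\<^sup>2)"
      unfolding nkt using False c mpos by (intro frac_le mult_left_mono) auto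
    also have "\<dots> = real (Suc n) / cauchy_const" using c by (simp add: power2_eq_square field_simps del: of_nat_Suc)
    finally show ?thesis .
  qed
  have diffb: "norm (kt n w - ckern w) \<le> 2 * b n w" for n w
  proof (cases "norm w > 1 / real (Suc n)")
    case False
    then have "b n w = norm (ckern w)" by (simp add: b_def)
    then show ?thesis using ktle[of n w] norm_triangle_ineq4[of "kt n w" "ckern w"] by simp
  qed (simp add: kteq b_def)
  define D where "D n = (LINT w|lborel. (2 * b n w) powr p)" for n
  have bm[measurable]: "b n \<in> borel_measurable borel" for n unfolding b_def by (intro borel_measurable_times borel_measurable_indicator) auto
  have bp: "(2 * b n w) powr p = (2 / cauchy_const) powr p * (indicator (cball 0 (1 / real (Suc n))) w * norm w powr (-p))" for n w
  proof (cases "w \<in> cball 0 (1 / real (Suc n)) \<and> w \<noteq> 0")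
    case True
    then have "2 * b n w = (2 / cauchy_const) * (1 / norm w)" by (simp add: b_def norm_ckern)
    also have "\<dots> powr p = (2 / cauchy_const) powr p * (1 / norm w) powr p"
      by (rule powr_mult)
    also have "(1 / norm w) powr p = norm w powr (-p)" by (simp add: powr_divide powr_minus_divide)
    finally show ?thesis using True by simp
  next
    case False
    then have "b n w = 0" by (auto simp: b_def norm_ckern)
    moreover have "indicator (cball 0 (1 / real (Suc n))) w * norm w powr (-p) = 0" using False by auto
    ultimately show ?thesis by simp
  qed
  have bi: "integrable lborel (\<lambda>w. (2 * b n w) powr p)" for n
    unfolding bp using p by (intro integrable_mult_right integrable_norm_powr) auto
  have Dlim: "D \<longlonglongrightarrow> 0"
  proof -
    have "D \<longlonglongrightarrow> (LINT w|(lborel::complex measure). 0)"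
      unfolding D_def
    proof (rule integral_dominated_convergence)
      show "integrable lborel (\<lambda>w. (2 * b 0 w) powr p)" by (rule bi)
      show "AE w in lborel. (\<lambda>n. (2 * b n w) powr p) \<longlonglongrightarrow> 0"
        using AE_Re_Im_nonzero
      proof eventually_elim
        case (elim w)
        then have "norm w > 0" by auto
        then obtain m where m: "1 / real (Suc m) < norm w" using nat_approx_posE by metis
        show ?case
        proof (rule tendsto_eventually, rule eventually_sequentiallyI[of m])
          fix n assume "m \<le> n"
          then have "1 / real (Suc n) \<le> 1 / real (Suc m)" by (intro divide_left_mono) auto
          then have "w \<notin> cball 0 (1 / real (Suc n))" using m by auto
          then show "(2 * b n w) powr p = 0" by (simp add: b_def)
        qed
      qed
      fix n show "AE w in lborel. norm ((2 * b n w) powr p) \<le> (2 * b 0 w) powr p"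
      proof (rule AE_I2)
        fix w :: complex
        have "1 / real (Suc n) \<le> 1" by simp
        then have "norm w \<le> 1 / real (Suc n) \<Longrightarrow> norm w \<le> 1" by linarith
        then have "b n w \<le> b 0 w" by (auto simp: b_def indicator_def simp del: of_nat_Suc)
        moreover have "b n w \<ge> 0" by (simp add: b_def)
        ultimately show "norm ((2 * b n w) powr p) \<le> (2 * b 0 w) powr p" using p by (auto intro!: powr_mono2)
      qed
    qed measurable
    then show ?thesis by simp
  qed
  define I where "I = (LINT w|lborel. norm (G w) powr q)"
  have I0: "I \<ge> 0" unfolding I_def by simp
  have ki: "integrable lborel (\<lambda>w. G w * kt n (z - w))" for n z
  proof (rule Bochner_Integration.integrable_bound)
    show "integrable lborel (\<lambda>w. norm (G w) * (real (Suc n) / cauchy_const))" using G by auto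
    show "AE w in lborel. norm (G w * kt n (z - w)) \<le> norm (norm (G w) * (real (Suc n) / cauchy_const))"
    proof (rule AE_I2)
      fix w
      have "norm (G w) * norm (kt n (z - w)) \<le> norm (G w) * (real (Suc n) / cauchy_const)"
        by (intro mult_left_mono ktb) simp
      moreover have "0 \<le> norm (G w) * (real (Suc n) / cauchy_const)" using c by (intro mult_nonneg_nonneg) auto
      ultimately show "norm (G w * kt n (z - w)) \<le> norm (norm (G w) * (real (Suc n) / cauchy_const))"
        unfolding norm_mult real_norm_def by linarith
    qed
  qed measurable
  \<comment> \<open>The crude Young inequality stands in for Hoelder's: the L^q mass of G carries
    the small factor \<delta>, and the L^p mass of the error a large factor that n will
    absorb.\<close>
  have est: "norm (G w * (kt n v - ckern v)) \<le> \<delta> * norm (G w) powr q + \<delta> powr (-1/(q-1)) * (2 * b n v) powr p" if "\<delta> > 0" for \<delta> n v w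
  proof -
    have "norm (G w * (kt n v - ckern v)) \<le> norm (G w) * (2 * b n v)"
      unfolding norm_mult by (intro mult_left_mono diffb) simp
    also have "\<dots> \<le> \<delta> * norm (G w) powr q + \<delta> powr (-1/(q-1)) * (2 * b n v) powr (q/(q-1))"
      using that q by (intro crude_young) (auto simp: b_def)
    finally show ?thesis by (simp add: p_def)
  qed
  have tr: "integrable lborel (\<lambda>w. (2 * b n (z - w)) powr p)" "(LINT w|lborel. (2 * b n (z - w)) powr p) = D n" for n z
    using bi lborel_reflect[of "\<lambda>w. (2 * b n w) powr p" z] by (auto simp: D_def)
  have di: "integrable lborel (\<lambda>w. G w * (kt n (z - w) - ckern (z - w)))" for n z
  proof (rule Bochner_Integration.integrable_bound)
    show "integrable lborel (\<lambda>w. 1 * norm (G w) powr q + 1 powr (-1/(q-1)) * (2 * b n (z - w)) powr p)"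
      by (intro Bochner_Integration.integrable_add integrable_mult_right Gq tr)
    show "AE w in lborel. norm (G w * (kt n (z - w) - ckern (z - w))) \<le> norm (1 * norm (G w) powr q + 1 powr (-1/(q-1)) * (2 * b n (z - w)) powr p)"
      by (intro AE_I2 order_trans[OF est[of 1]]) auto
  qed measurable
  have cd: "norm (conv G (kt n) z - conv G ckern z) \<le> \<delta> * I + \<delta> powr (-1/(q-1)) * D n" if d: "\<delta> > 0" for \<delta> n z
  proof -
    have "integrable lborel (\<lambda>w. G w * kt n (z - w) - G w * (kt n (z - w) - ckern (z - w)))"
      by (intro Bochner_Integration.integrable_diff ki di)
    then have ci: "integrable lborel (\<lambda>w. G w * ckern (z - w))" by (simp add: algebra_simps)
    have "conv G (kt n) z - conv G ckern z = (LINT w|lborel. G w * (kt n (z - w) - ckern (z - w)))"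
      unfolding conv_def by (subst Bochner_Integration.integral_diff[OF ki ci, symmetric]) (simp add: algebra_simps)
    also have "norm \<dots> \<le> (LINT w|lborel. \<delta> * norm (G w) powr q + \<delta> powr (-1/(q-1)) * (2 * b n (z - w)) powr p)"
      by (intro Bochner_Integration.integral_norm_bound_integral di est d Bochner_Integration.integrable_add integrable_mult_right Gq tr)
    also have "\<dots> = \<delta> * I + \<delta> powr (-1/(q-1)) * D n"
      by (subst Bochner_Integration.integral_add) (auto intro!: integrable_mult_right Gq tr simp: I_def tr)
    finally show ?thesis .
  qed
  have "uniform_limit UNIV (\<lambda>n. conv G (kt n)) (conv G ckern) sequentially"
  proof (rule uniform_limitI)
    fix \<eta> :: real assume \<eta>: "\<eta> > 0"
    \<comment> \<open>Chosen before n, so that the part of the error that does not depend on n stays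
      below \<eta>/2; I + 1 avoids division by 0.\<close>
    define \<delta> where "\<delta> = \<eta> / (2 * (I + 1))"
    have d: "\<delta> > 0" using \<eta> I0 by (simp add: \<delta>_def)
    have "\<delta> * I < \<eta>"
    proof -
      have "\<delta> * I \<le> \<delta> * (I + 1)" using d by (intro mult_left_mono) auto
      also have "\<delta> * (I + 1) = \<eta> / 2" using I0 by (simp add: \<delta>_def field_simps)
      finally show ?thesis using \<eta> by simp
    qed
    have "(\<lambda>n. \<delta> * I + \<delta> powr (-1/(q-1)) * D n) \<longlonglongrightarrow> \<delta> * I + \<delta> powr (-1/(q-1)) * 0"
      by (intro tendsto_intros Dlim)
    then have "\<forall>\<^sub>F n in sequentially. \<delta> * I + \<delta> powr (-1/(q-1)) * D n < \<eta>"
      using \<open>\<delta> * I < \<eta>\<close> by (intro order_tendstoD(2)) auto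
    then show "\<forall>\<^sub>F n in sequentially. \<forall>z\<in>UNIV. dist (conv G (kt n) z) (conv G ckern z) < \<eta>"
      by eventually_elim (use cd[OF d] in \<open>auto simp: dist_norm intro: le_less_trans\<close>)
  qed
  then show ?thesis
    by (rule uniform_limit_theorem[rotated]) (auto intro!: always_eventually continuous_conv_bounded[OF G ktc] ktb)
qed

section \<open>Weak solutions as Cauchy transforms\<close>

text \<open>The points of disagreement form an open set, and a nonempty open set is not
  null.\<close>

lemma AE_eq_on_open:
  fixes f g :: "complex \<Rightarrow> complex"
  assumes U: "open U" and f: "continuous_on U f" and g: "continuous_on U g"
    and ae: "AE z in lborel. z \<in> U \<longrightarrow> f z = g z" and z: "z \<in> U"
  shows "f z = g z"
proof (rule ccontr)
  assume ne: "f z \<noteq> g z"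
  have "open {w \<in> U. f w - g w \<noteq> 0}"
    using continuous_open_preimage[OF continuous_on_diff[OF f g] U, of "- {0}"] by (auto simp: vimage_def Int_def)
  moreover have "{w \<in> U. f w - g w \<noteq> 0} \<in> null_sets lborel"
  proof -
    have "AE w in lborel. w \<notin> {w \<in> U. f w - g w \<noteq> 0}" using ae by eventually_elim auto
    moreover have "{w \<in> U. f w - g w \<noteq> 0} \<in> sets lborel" using \<open>open {w \<in> U. f w - g w \<noteq> 0}\<close> by simp
    ultimately show ?thesis using AE_iff_null_sets by blast
  qed
  ultimately have "{w \<in> U. f w - g w \<noteq> 0} = {}"
    using open_not_negligible negligible_iff_null_sets null_sets_completionI by blast
  then show False using ne z by auto
qed

text \<open>The kernel is odd, so moving it from G to \<psi> by Fubini costs a sign.\<close>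

lemma cauchy_transform_antisym:
  assumes G: "integrable lborel G" and t: "test_function \<psi>"
  shows "(LINT z|lborel. conv G ckern z * \<psi> z) = - (LINT w|lborel. G w * conv ckern \<psi> w)"
proof -
  have c: "cauchy_const > 0" by (rule cauchy_const_pos)
  have [measurable]: "G \<in> borel_measurable borel" using G borel_measurable_integrable by auto
  note [measurable] = loc_intD[OF loc_int_ckern] test_function_measurable[OF t]
  obtain B where B: "B > 0" "\<And>z. norm (\<psi> z) \<le> B" using test_functionD(6)[OF t] by blast
  have anti: "ckern (z - w) = - ckern (w - z)" for z w by (simp add: ckern_def field_simps minus_divide_right)
  have i1: "integrable lborel (\<lambda>z. ckern (z - w) * \<psi> z)" for w
  proof -
    have "integrable lborel (\<lambda>v. ckern v * \<psi> (w - v))" by (rule conv_integrable[OF loc_int_ckern t])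
    then have "integrable lborel (\<lambda>z. ckern (w - z) * \<psi> z)"
      using lborel_reflect(1)[of "\<lambda>z. ckern (w - z) * \<psi> z" w] by simp
    then have "integrable lborel (\<lambda>z. - (ckern (w - z) * \<psi> z))" by simp
    then show ?thesis by (simp add: anti[of _ w])
  qed
  have psi: "integrable lborel \<psi>" using loc_int_test[OF loc_int_continuous t, of "\<lambda>_. 1"] by simp
  define k1 where "k1 v = norm (indicator (cball 0 1) v *\<^sub>R ckern v)" for v
  have k1: "integrable lborel k1" unfolding k1_def
    using loc_int_cball[OF loc_int_ckern, of 1] unfolding set_integrable_def by (rule integrable_norm)
  note [measurable] = borel_measurable_integrable[OF k1, unfolded measurable_lborel2]
  \<comment> \<open>A bound uniform in w: within distance 1 of w the kernel is integrable and \<psi>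
    bounded, farther away the kernel is at most 1 / \<open>cauchy_const\<close> and \<psi> is
    integrable.\<close>
  define C where "C = B * (LINT v|lborel. k1 v) + (LINT z|lborel. norm (\<psi> z)) / cauchy_const"
  have Jb: "(LINT z|lborel. norm (ckern (z - w) * \<psi> z)) \<le> C" for w
  proof -
    have k1w: "integrable lborel (\<lambda>z. k1 (w - z))" "(LINT z|lborel. k1 (w - z)) = (LINT v|lborel. k1 v)"
      using lborel_reflect[of k1 w] k1 by auto
    have "(LINT z|lborel. norm (ckern (z - w) * \<psi> z)) \<le> (LINT z|lborel. B * k1 (w - z) + norm (\<psi> z) / cauchy_const)"
    proof (rule integral_mono)
      show "integrable lborel (\<lambda>z. norm (ckern (z - w) * \<psi> z))" by (rule integrable_norm[OF i1])
      show "integrable lborel (\<lambda>z. B * k1 (w - z) + norm (\<psi> z) / cauchy_const)"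
        using k1w psi by auto
      fix z
      show "norm (ckern (z - w) * \<psi> z) \<le> B * k1 (w - z) + norm (\<psi> z) / cauchy_const"
      proof (cases "norm (w - z) \<le> 1")
        case True
        then have "k1 (w - z) = norm (ckern (z - w))" unfolding anti[of z w] by (simp add: k1_def)
        then have "norm (ckern (z - w) * \<psi> z) \<le> B * k1 (w - z)"
          unfolding norm_mult using B by (simp add: mult.commute[of B] mult_left_mono)
        moreover have "norm (\<psi> z) / cauchy_const \<ge> 0" using c by simp
        ultimately show ?thesis by linarith
      next
        case False
        have "norm (ckern (z - w)) \<le> 1 / (cauchy_const * 1)"
          unfolding norm_ckern using False c by (intro frac_le mult_left_mono) (auto simp: norm_minus_commute)
        then have "norm (ckern (z - w) * \<psi> z) \<le> 1 / cauchy_const * norm (\<psi> z)"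
          unfolding norm_mult by (intro mult_right_mono) auto
        moreover have "B * k1 (w - z) \<ge> 0" using B by (simp add: k1_def)
        ultimately show ?thesis by simp
      qed
    qed
    also have "\<dots> = C" using k1w psi by (simp add: C_def)
    finally show ?thesis .
  qed
  have P: "integrable (lborel \<Otimes>\<^sub>M lborel) (\<lambda>(w, z). G w * (ckern (z - w) * \<psi> z))"
  proof (rule lborel_pair.Fubini_integrable)
    show "(\<lambda>(w, z). G w * (ckern (z - w) * \<psi> z)) \<in> borel_measurable (lborel \<Otimes>\<^sub>M lborel)" by measurable
    show "AE w in lborel. integrable lborel (\<lambda>z. case (w, z) of (w, z) \<Rightarrow> G w * (ckern (z - w) * \<psi> z))"
      using i1 by (intro AE_I2) simp
    show "integrable lborel (\<lambda>w. LINT z|lborel. norm (case (w, z) of (w, z) \<Rightarrow> G w * (ckern (z - w) * \<psi> z)))"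
    proof (rule Bochner_Integration.integrable_bound)
      show "integrable lborel (\<lambda>w. norm (G w) * C)" using G by auto
      show "AE w in lborel. norm (LINT z|lborel. norm (case (w, z) of (w, z) \<Rightarrow> G w * (ckern (z - w) * \<psi> z))) \<le> norm (norm (G w) * C)"
      proof (rule AE_I2)
        fix w
        have "(LINT z|lborel. norm (case (w, z) of (w, z) \<Rightarrow> G w * (ckern (z - w) * \<psi> z))) = norm (G w) * (LINT z|lborel. norm (ckern (z - w) * \<psi> z))"
          by (simp add: norm_mult mult.assoc)
        moreover have "\<dots> \<le> norm (G w) * C" using Jb by (intro mult_left_mono) auto
        moreover have "norm (G w) * (LINT z|lborel. norm (ckern (z - w) * \<psi> z)) \<ge> 0" by (intro mult_nonneg_nonneg) auto
        ultimately show "norm (LINT z|lborel. norm (case (w, z) of (w, z) \<Rightarrow> G w * (ckern (z - w) * \<psi> z))) \<le> norm (norm (G w) * C)"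
          by simp
      qed
    qed measurable
  qed
  have "(LINT z|lborel. conv G ckern z * \<psi> z) = (LINT z|lborel. LINT w|lborel. G w * (ckern (z - w) * \<psi> z))"
    unfolding conv_def by (intro Bochner_Integration.integral_cong refl)
      (subst integral_mult_left_zero[symmetric], simp add: mult.assoc)
  also have "\<dots> = (LINT w|lborel. LINT z|lborel. G w * (ckern (z - w) * \<psi> z))"
    by (rule lborel_pair.Fubini_integral[OF P])
  also have "\<dots> = (LINT w|lborel. - (G w * conv ckern \<psi> w))"
  proof (intro Bochner_Integration.integral_cong refl)
    fix w
    have "(LINT z|lborel. ckern (z - w) * \<psi> z) = - conv \<psi> ckern w"
      unfolding conv_def anti[of _ w] by (simp add: mult.commute)
    also have "conv \<psi> ckern w = conv ckern \<psi> w" by (rule conv_commute) measurable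
    finally show "(LINT z|lborel. G w * (ckern (z - w) * \<psi> z)) = - (G w * conv ckern \<psi> w)" by simp
  qed
  finally show ?thesis by simp
qed

text \<open>Compactly supported, f \<rho> is the Cauchy transform of its dbar derivative g \<rho> +
  f dbar \<rho>, both of whose terms lie in L^1 and L^q. This is shown by duality: the weak equation
  is tested with \<rho> times the Cauchy transform of an arbitrary test function \<psi>, and the
  fundamental lemma identifies the two functions.\<close>

lemma cutoff_has_continuous_version:
  assumes w: "weak_deriv (1/2) (\<i>/2) f g" and q: "q > 2"
    and fq: "\<And>R. set_integrable lborel (cball 0 R) (\<lambda>z. norm (f z) powr q)"
    and gq: "\<And>R. set_integrable lborel (cball 0 R) (\<lambda>z. norm (g z) powr q)"
    and t: "test_function \<rho>"
  shows "\<exists>H. continuous_on UNIV H \<and> (AE z in lborel. f z * \<rho> z = H z)"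
proof -
  have lf: "loc_int f" "loc_int g" using w by (auto simp: weak_deriv_def)
  note [measurable] = loc_intD[OF lf(1)] loc_intD[OF lf(2)] test_function_measurable[OF t]
  have [measurable]: "ckern \<in> borel_measurable borel" using loc_int_ckern by (rule loc_intD)
  define \<rho>' where "\<rho>' = first_order (1/2) (\<i>/2) \<rho>"
  have t': "test_function \<rho>'" unfolding \<rho>'_def by (rule test_first_order[OF t])
  note [measurable] = test_function_measurable[OF t']
  have Lq: "integrable lborel (\<lambda>w. norm (h w * \<kappa> w) powr q)"
    if h: "h \<in> borel_measurable borel" "set_integrable lborel (cball 0 R) (\<lambda>z. norm (h z) powr q)"
      and \<kappa>: "test_function \<kappa>" and R: "\<And>z. norm z > R \<Longrightarrow> \<kappa> z = 0" for h \<kappa> R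
  proof -
    obtain B where B: "B > 0" "\<And>z. norm (\<kappa> z) \<le> B" using test_functionD(6)[OF \<kappa>] by blast
    note [measurable] = h(1) test_function_measurable[OF \<kappa>]
    show ?thesis
    proof (rule Bochner_Integration.integrable_bound)
      show "integrable lborel (\<lambda>z. B powr q *\<^sub>R (indicator (cball 0 R) z *\<^sub>R norm (h z) powr q))"
        using h(2) unfolding set_integrable_def by (rule integrable_scaleR_right)
      show "AE z in lborel. norm (norm (h z * \<kappa> z) powr q) \<le> norm (B powr q *\<^sub>R (indicator (cball 0 R) z *\<^sub>R norm (h z) powr q))"
      proof (rule AE_I2)
        fix z
        show "norm (norm (h z * \<kappa> z) powr q) \<le> norm (B powr q *\<^sub>R (indicator (cball 0 R) z *\<^sub>R norm (h z) powr q))"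
        proof (cases "norm z > R")
          case False
          have "norm (h z * \<kappa> z) \<le> norm (h z) * B" unfolding norm_mult using B by (intro mult_left_mono) auto
          then have "norm (h z * \<kappa> z) powr q \<le> (norm (h z) * B) powr q" using q by (intro powr_mono2) auto
          also have "\<dots> = norm (h z) powr q * B powr q" using B by (simp add: powr_mult)
          finally show ?thesis using False by (simp add: mult.commute)
        qed (simp add: R)
      qed
    qed measurable
  qed
  obtain R where R: "R > 0" "\<And>z. norm z > R \<Longrightarrow> \<rho> z = 0" "\<And>z. norm z > R \<Longrightarrow> \<rho>' z = 0"
    using test_functionD(5)[OF t] unfolding \<rho>'_def first_order_eq by (metis mult_zero_right add_0)
  define G1 where "G1 w = g w * \<rho> w" for w
  define G2 where "G2 w = f w * \<rho>' w" for w
  have Gi: "integrable lborel G1" "integrable lborel G2"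
    unfolding G1_def G2_def by (intro loc_int_test lf t t')+
  have c12: "continuous_on UNIV (conv G1 ckern)" "continuous_on UNIV (conv G2 ckern)"
    using Gi unfolding G1_def G2_def
    by (auto intro!: continuous_cauchy_transform[OF _ q] Lq[OF _ gq t R(2)] Lq[OF _ fq t' R(3)])
  define H where "H z = conv G1 ckern z + conv G2 ckern z" for z
  have cH: "continuous_on UNIV H" unfolding H_def by (intro continuous_intros c12)
  have lfr: "loc_int (\<lambda>z. f z * \<rho> z)" by (intro loc_int_times_continuous lf test_functionD(4)[OF t])
  have "AE z in lborel. f z * \<rho> z - H z = 0"
  proof (rule fundamental_lemma[OF loc_int_diff[OF lfr loc_int_continuous[OF cH]]])
    fix \<psi> assume ts: "test_function \<psi>"
    define \<theta> where "\<theta> = conv ckern \<psi>"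
    have st: "smooth \<theta>" unfolding \<theta>_def by (rule smooth_conv(1)[OF loc_int_ckern ts])
    \<comment> \<open>A Cauchy transform need not have compact support; the cutoff makes the product
      admissible in the weak equation.\<close>
    have tr: "test_function (\<lambda>z. \<rho> z * \<theta> z)" by (rule test_function_intros(1)[OF t st])
    have fo: "first_order (1/2) (\<i>/2) (\<lambda>z. \<rho> z * \<theta> z) z = \<rho>' z * \<theta> z + \<rho> z * \<psi> z" for z
      using first_order_mult[OF test_functionD(1)[OF t] st, of "1/2" "\<i>/2" z] dbar_cauchy_transform[OF ts, of z]
      by (simp only: \<rho>'_def \<theta>_def)
    have I: "integrable lborel (\<lambda>z. f z * (\<rho>' z * \<theta> z))" "integrable lborel (\<lambda>z. f z * (\<rho> z * \<psi> z))"
      by (intro loc_int_test lf test_function_intros(1)[OF t' st] test_function_intros(1)[OF t test_functionD(1)[OF ts]])+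
    have "(LINT z|lborel. f z * (\<rho>' z * \<theta> z + \<rho> z * \<psi> z)) = - (LINT z|lborel. g z * (\<rho> z * \<theta> z))"
      using w tr unfolding weak_deriv_def fo[symmetric] by blast
    moreover have "(LINT z|lborel. f z * (\<rho>' z * \<theta> z + \<rho> z * \<psi> z)) = (LINT w|lborel. G2 w * \<theta> w) + (LINT z|lborel. f z * (\<rho> z * \<psi> z))"
      using I by (simp add: distrib_left G2_def mult.assoc)
    moreover have "(LINT z|lborel. g z * (\<rho> z * \<theta> z)) = (LINT w|lborel. G1 w * \<theta> w)" by (simp add: G1_def mult.assoc)
    ultimately have 1: "(LINT z|lborel. f z * (\<rho> z * \<psi> z)) = - (LINT w|lborel. G1 w * \<theta> w) - (LINT w|lborel. G2 w * \<theta> w)"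
      by (simp add: algebra_simps eq_neg_iff_add_eq_0)
    have IH: "integrable lborel (\<lambda>z. conv G1 ckern z * \<psi> z)" "integrable lborel (\<lambda>z. conv G2 ckern z * \<psi> z)"
      by (intro loc_int_test loc_int_continuous c12 ts)+
    have 2: "(LINT z|lborel. H z * \<psi> z) = - (LINT w|lborel. G1 w * \<theta> w) - (LINT w|lborel. G2 w * \<theta> w)"
      using IH cauchy_transform_antisym[OF Gi(1) ts] cauchy_transform_antisym[OF Gi(2) ts]
      by (simp add: H_def distrib_right \<theta>_def)
    have "integrable lborel (\<lambda>z. H z * \<psi> z)" by (intro loc_int_test loc_int_continuous cH ts)
    then show "(LINT z|lborel. (f z * \<rho> z - H z) * \<psi> z) = 0"
      using 1 2 I(2) by (simp add: left_diff_distrib mult.assoc)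
  qed
  then show ?thesis using cH by (intro exI[of _ H]) auto
qed

text \<open>On an open box the cutoff has no zero, so the continuous version of f \<rho> can be
  divided by \<rho>. The quotients for different boxes are continuous and agree almost everywhere,
  hence everywhere, on overlaps, and so they glue.\<close>

theorem weak_dbar_continuous_version:
  assumes w: "weak_deriv (1/2) (\<i>/2) f g" and q: "q > 2"
    and fq: "\<And>R. set_integrable lborel (cball 0 R) (\<lambda>z. norm (f z) powr q)"
    and gq: "\<And>R. set_integrable lborel (cball 0 R) (\<lambda>z. norm (g z) powr q)"
  shows "\<exists>F. continuous_on UNIV F \<and> (AE z in lborel. f z = F z)"
proof -
  define B where "B n = box (Complex (- real n) (- real n)) (Complex (real n) (real n))" for n
  define \<rho> where "\<rho> n z = complex_of_real (box_bump 1 (Complex (- real n) (- real n)) (Complex (real n) (real n)) z)" for n z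
  have t: "test_function (\<rho> n)" for n unfolding \<rho>_def by (rule test_function_box_bump) simp
  have pos: "\<rho> n z \<noteq> 0" if "z \<in> B n" for n z
    using box_bump_pos[of 1 z] that unfolding \<rho>_def B_def by fastforce
  obtain H where H: "\<And>n. continuous_on UNIV (H n)" "\<And>n. AE z in lborel. f z * \<rho> n z = H n z"
    using cutoff_has_continuous_version[OF w q fq gq t] by metis
  have cq: "continuous_on (B n) (\<lambda>z. H n z / \<rho> n z)" for n
    by (intro continuous_intros continuous_on_subset[OF H(1)] test_functionD(4)[OF t]) (use pos in auto)
  have ae: "AE z in lborel. z \<in> B n \<longrightarrow> f z = H n z / \<rho> n z" for n
    using H(2)[of n] by eventually_elim (auto simp: field_simps dest: pos)
  have op: "open (B n)" for n unfolding B_def by (rule open_box)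
  have agree: "H n z / \<rho> n z = H m z / \<rho> m z" if "z \<in> B n" "z \<in> B m" for n m z
  proof (rule AE_eq_on_open[where U = "B n \<inter> B m" and f = "\<lambda>z. H n z / \<rho> n z" and g = "\<lambda>z. H m z / \<rho> m z"])
    show "AE z in lborel. z \<in> B n \<inter> B m \<longrightarrow> H n z / \<rho> n z = H m z / \<rho> m z"
      using ae[of n] ae[of m] by eventually_elim auto
  qed (use that op cq in \<open>auto intro: continuous_on_subset\<close>)
  have ex: "\<exists>n. z \<in> B n" for z
  proof -
    obtain n where "norm z < real n" using reals_Archimedean2 by blast
    then show ?thesis using abs_Re_le_cmod[of z] abs_Im_le_cmod[of z]
      by (intro exI[of _ n]) (auto simp: B_def in_box_complex_iff)
  qed
  define N where "N z = (SOME n. z \<in> B n)" for z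
  have N: "z \<in> B (N z)" for z unfolding N_def by (rule someI_ex[OF ex])
  define F where "F z = H (N z) z / \<rho> (N z) z" for z
  have FB: "F z = H n z / \<rho> n z" if "z \<in> B n" for n z unfolding F_def by (rule agree[OF N that])
  have "isCont F z" for z
  proof -
    obtain n where n: "z \<in> B n" using ex by blast
    have "continuous_on (B n) F" using cq[of n] by (rule continuous_on_eq) (simp add: FB)
    then show ?thesis using n op[of n] by (simp add: continuous_on_eq_continuous_at)
  qed
  then have "continuous_on UNIV F" by (simp add: continuous_on_eq_continuous_at)
  moreover have "AE z in lborel. \<forall>n. z \<in> B n \<longrightarrow> f z = H n z / \<rho> n z" unfolding AE_all_countable using ae by blast
  then have "AE z in lborel. f z = F z" by eventually_elim (simp add: F_def N)
  ultimately show ?thesis by blast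
qed

section \<open>Bounded weak gradients and Lipschitz functions\<close>

lemma weak_deriv_combine:
  assumes w: "weak_deriv a b f g" "weak_deriv a' b' f g'"
  shows "weak_deriv (c * a + c' * a') (c * b + c' * b') f (\<lambda>z. c * g z + c' * g' z)"
proof -
  have l: "loc_int f" "loc_int g" "loc_int g'" using w by (auto simp: weak_deriv_def)
  have "loc_int (\<lambda>z. g z * c + g' z * c')"
    by (intro loc_int_add loc_int_times_continuous l continuous_intros)
  moreover have "(LINT z|lborel. f z * first_order (c * a + c' * a') (c * b + c' * b') \<phi> z) = - (LINT z|lborel. (c * g z + c' * g' z) * \<phi> z)"
    if t: "test_function \<phi>" for \<phi>
  proof -
    note i = loc_int_test[OF l(1) test_first_order[OF t]] loc_int_test[OF l(2) t] loc_int_test[OF l(3) t]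
    have "(LINT z|lborel. f z * first_order (c * a + c' * a') (c * b + c' * b') \<phi> z)
      = (LINT z|lborel. c * (f z * first_order a b \<phi> z) + c' * (f z * first_order a' b' \<phi> z))"
      by (intro Bochner_Integration.integral_cong refl) (simp add: first_order_eq algebra_simps)
    also have "\<dots> = c * (LINT z|lborel. f z * first_order a b \<phi> z) + c' * (LINT z|lborel. f z * first_order a' b' \<phi> z)"
      using i by simp
    also have "\<dots> = - (c * (LINT z|lborel. g z * \<phi> z) + c' * (LINT z|lborel. g' z * \<phi> z))"
      using w t by (simp add: weak_deriv_def)
    also have "c * (LINT z|lborel. g z * \<phi> z) + c' * (LINT z|lborel. g' z * \<phi> z) = (LINT z|lborel. c * (g z * \<phi> z) + c' * (g' z * \<phi> z))"
      using i by simp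
    also have "\<dots> = (LINT z|lborel. (c * g z + c' * g' z) * \<phi> z)"
      by (intro Bochner_Integration.integral_cong refl) (simp add: algebra_simps)
    finally show ?thesis .
  qed
  ultimately show ?thesis using l(1) by (simp add: weak_deriv_def mult.commute)
qed

lemma weak_deriv_cong_AE:
  assumes w: "weak_deriv a b f g"
    and f: "f' \<in> borel_measurable borel" "AE z in lborel. f' z = f z"
    and g: "g' \<in> borel_measurable borel" "AE z in lborel. g' z = g z"
  shows "weak_deriv a b f' g'"
proof -
  have m: "f \<in> borel_measurable borel" "g \<in> borel_measurable borel" using w by (auto simp: weak_deriv_def dest: loc_intD)
  have "has_weak_deriv a b f g" using weak_deriv_iff[of f f g g a b] m w by simp
  moreover have "AE z in lborel. f z = f' z" "AE z in lborel. g z = g' z" using f g by auto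
  ultimately show ?thesis using weak_deriv_iff[OF f(1) _ g(1), of f g a b] by simp
qed

lemma loc_int_bounded:
  assumes "f \<in> borel_measurable borel" "\<And>z. norm (f z) \<le> B"
  shows "loc_int f"
  unfolding loc_int_def set_integrable_def
proof (intro conjI allI assms)
  fix R
  have "loc_int (\<lambda>_::complex. of_real B)" by (rule loc_int_continuous) simp
  then have "integrable lborel (\<lambda>z::complex. indicator (cball 0 R) z *\<^sub>R (of_real B :: complex))"
    by (auto simp: loc_int_def set_integrable_def)
  then show "integrable lborel (\<lambda>z. indicator (cball 0 R) z *\<^sub>R f z)"
  proof (rule Bochner_Integration.integrable_bound)
    show "(\<lambda>z. indicator (cball 0 R) z *\<^sub>R f z) \<in> borel_measurable lborel"
      using assms(1) by (intro borel_measurable_scaleR borel_measurable_indicator) auto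
    have "norm (f z) \<le> \<bar>B\<bar>" for z using assms(2)[of z] by linarith
    then show "AE z in lborel. norm (indicator (cball 0 R) z *\<^sub>R f z) \<le> norm (indicator (cball 0 R) z *\<^sub>R (of_real B :: complex))"
      by (intro AE_I2) (auto simp: indicator_def)
  qed
qed

lemma set_integrable_powr_bounded:
  assumes [measurable]: "f \<in> borel_measurable borel" and B: "\<And>z. norm (f z) \<le> B" and q: "q > 0"
  shows "set_integrable lborel (cball (0::complex) R) (\<lambda>z. norm (f z :: complex) powr q)"
proof -
  have "norm (norm (f z) powr q) \<le> B powr q" for z using B[of z] q by (auto intro!: powr_mono2)
  then have "loc_int (\<lambda>z. complex_of_real (norm (f z) powr q))" by (intro loc_int_bounded[of _ "B powr q"]) auto
  then have "integrable lborel (\<lambda>z. complex_of_real (indicator (cball 0 R) z *\<^sub>R norm (f z) powr q))"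
    by (auto simp: loc_int_def set_integrable_def scaleR_conv_of_real)
  then show ?thesis unfolding set_integrable_def by (simp only: complex_of_real_integrable_eq)
qed

lemma conv_mollifier_deriv:
  assumes w: "weak_deriv a b F g" and d: "\<delta> > 0"
  shows "first_order a b (conv F (\<lambda>w. of_real (mollifier \<delta> w))) z = conv g (\<lambda>w. of_real (mollifier \<delta> w)) z"
proof -
  note t = mollifier(4)[OF d]
  have l: "loc_int F" using w by (auto simp: weak_deriv_def)
  have "first_order a b (conv F (\<lambda>w. of_real (mollifier \<delta> w))) z = conv F (first_order a b (\<lambda>w. of_real (mollifier \<delta> w))) z"
    by (rule smooth_conv(4)[OF l t])
  also have "\<dots> = - (LINT w|lborel. F w * first_order a b (\<lambda>w. of_real (mollifier \<delta> (z - w))) w)"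
    unfolding conv_def first_order_eq dx_dy_reflect[OF test_functionD(1)[OF t]]
    by (subst integral_minus[symmetric]) (simp add: algebra_simps)
  also have "\<dots> = (LINT w|lborel. g w * of_real (mollifier \<delta> (z - w)))"
    using w test_function_intros(4)[OF t, of z] by (simp add: weak_deriv_def)
  finally show ?thesis by (simp add: conv_def)
qed

text \<open>The two partial derivatives combine to a bounded dbar derivative, which yields a
  continuous version F. The mollifications of F have partial derivatives bounded by |B|, so they
  share the Lipschitz constant 2 |B|, and they converge to F pointwise.\<close>

lemma bounded_weak_gradient_lipschitz:
  assumes wx: "weak_deriv 1 0 f gx" and wy: "weak_deriv 0 1 f gy"
    and b: "AE z in lborel. norm (f z) \<le> B" "AE z in lborel. norm (gx z) \<le> B" "AE z in lborel. norm (gy z) \<le> B"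
  shows "\<exists>F. (\<exists>L. L-lipschitz_on UNIV F) \<and> (AE z in lborel. f z = F z)"
proof -
  \<comment> \<open>Truncation turns bounds almost everywhere into bounds everywhere, the form that
    \<open>conv_mollifier_bound\<close> takes.\<close>
  define tr where "tr h z = (if norm (h z) \<le> \<bar>B\<bar> then h z else 0)" for h :: "complex \<Rightarrow> complex" and z
  have m: "f \<in> borel_measurable borel" "gx \<in> borel_measurable borel" "gy \<in> borel_measurable borel"
    using wx wy by (auto simp: weak_deriv_def dest: loc_intD)
  have trm: "tr h \<in> borel_measurable borel" if [measurable]: "h \<in> borel_measurable borel" for h unfolding tr_def by measurable
  have trb: "norm (tr h z) \<le> \<bar>B\<bar>" for h z by (simp add: tr_def)
  have tre: "AE z in lborel. tr h z = h z" if "AE z in lborel. norm (h z) \<le> B" for h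
    using that by eventually_elim (auto simp: tr_def)
  have wx': "weak_deriv 1 0 (tr f) (tr gx)" and wy': "weak_deriv 0 1 (tr f) (tr gy)"
    by (intro weak_deriv_cong_AE[OF wx] weak_deriv_cong_AE[OF wy] trm m tre b)+
  define gb where "gb z = 1/2 * tr gx z + \<i>/2 * tr gy z" for z
  have wb: "weak_deriv (1/2) (\<i>/2) (tr f) gb"
    using weak_deriv_combine[OF wx' wy', of "1/2" "\<i>/2"] by (simp add: gb_def[abs_def])
  have gbm: "gb \<in> borel_measurable borel" using wb by (auto simp: weak_deriv_def dest: loc_intD)
  have gbb: "norm (gb z) \<le> \<bar>B\<bar>" for z
  proof -
    have "norm (gb z) \<le> 1/2 * norm (tr gx z) + 1/2 * norm (tr gy z)"
      unfolding gb_def by (rule norm_triangle_le) (simp add: norm_mult norm_divide)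
    then show ?thesis using trb[of gx z] trb[of gy z] by linarith
  qed
  \<comment> \<open>The truncated functions are bounded, so their powers are locally integrable for
    any exponent; 3 is one above 2.\<close>
  obtain F where F: "continuous_on UNIV F" "AE z in lborel. tr f z = F z"
    using weak_dbar_continuous_version[OF wb, of 3]
      set_integrable_powr_bounded[OF trm[OF m(1)] trb, of 3] set_integrable_powr_bounded[OF gbm gbb, of 3] by auto
  have Fm: "F \<in> borel_measurable borel" using F(1) by (rule borel_measurable_continuous_onI)
  have Fe: "AE z in lborel. F z = tr f z" using F(2) by auto
  have wxF: "weak_deriv 1 0 F (tr gx)" and wyF: "weak_deriv 0 1 F (tr gy)"
    by (intro weak_deriv_cong_AE[OF wx'] weak_deriv_cong_AE[OF wy'] Fm Fe trm m AE_I2 refl)+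
  have lF: "loc_int F" by (rule loc_int_continuous[OF F(1)])
  define r where "r \<delta> w = complex_of_real (mollifier \<delta> w)" for \<delta> w
  have lip: "(\<bar>B\<bar> + \<bar>B\<bar>)-lipschitz_on UNIV (conv F (r \<delta>))" if d: "\<delta> > 0" for \<delta>
  proof (rule gradient_bound_lipschitz)
    note t = mollifier(4)[OF d]
    have s: "smooth (conv F (r \<delta>))" unfolding r_def by (rule smooth_conv(1)[OF lF t])
    show "(conv F (r \<delta>) has_derivative (\<lambda>h. of_real (Re h) * dx (conv F (r \<delta>)) z + of_real (Im h) * dy (conv F (r \<delta>)) z)) (at z)" for z
      by (rule smoothD(1)[OF s])
    have lg: "loc_int (tr gx)" "loc_int (tr gy)" using wx' wy' by (auto simp: weak_deriv_def)
    show "norm (dx (conv F (r \<delta>)) z) \<le> \<bar>B\<bar>" for z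
      using conv_mollifier_deriv[OF wxF d, of z] conv_mollifier_bound[OF d lg(1), of z 0 "\<bar>B\<bar>"] trb
      by (simp add: first_order_eq r_def[abs_def])
    show "norm (dy (conv F (r \<delta>)) z) \<le> \<bar>B\<bar>" for z
      using conv_mollifier_deriv[OF wyF d, of z] conv_mollifier_bound[OF d lg(2), of z 0 "\<bar>B\<bar>"] trb
      by (simp add: first_order_eq r_def[abs_def])
  qed
  have near: "norm (F x - F y) \<le> (\<bar>B\<bar> + \<bar>B\<bar>) * dist x y + 2 * \<eta>" if \<eta>: "\<eta> > 0" for x y \<eta>
  proof -
    have "\<exists>\<delta>>0. \<forall>w. dist w z < \<delta> \<longrightarrow> dist (F w) (F z) < \<eta>" for z
      using F(1) \<eta> by (auto simp: continuous_on_iff)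
    then obtain \<delta>x \<delta>y where dd: "\<delta>x > 0" "\<And>w. dist w x < \<delta>x \<Longrightarrow> dist (F w) (F x) < \<eta>"
      "\<delta>y > 0" "\<And>w. dist w y < \<delta>y \<Longrightarrow> dist (F w) (F y) < \<eta>" by metis
    define \<delta> where "\<delta> = min \<delta>x \<delta>y / 2"
    have d: "\<delta> > 0" using dd by (simp add: \<delta>_def)
    have "norm (conv F (r \<delta>) x - F x) \<le> \<eta>" "norm (conv F (r \<delta>) y - F y) \<le> \<eta>"
      unfolding r_def
    proof (rule_tac[!] conv_mollifier_bound[OF d lF])
      fix w
      show "norm (F w - F x) \<le> \<eta>" if "dist w x < 2 * \<delta>"
        using dd(2)[of w] that by (simp add: \<delta>_def dist_norm)
      show "norm (F w - F y) \<le> \<eta>" if "dist w y < 2 * \<delta>"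
        using dd(4)[of w] that by (simp add: \<delta>_def dist_norm)
    qed
    moreover have "norm (conv F (r \<delta>) x - conv F (r \<delta>) y) \<le> (\<bar>B\<bar> + \<bar>B\<bar>) * dist x y"
      using lipschitz_onD[OF lip[OF d], of x y] by (simp add: dist_norm)
    moreover have "F x - F y = (conv F (r \<delta>) x - conv F (r \<delta>) y) - (conv F (r \<delta>) x - F x) + (conv F (r \<delta>) y - F y)" by simp
    ultimately show ?thesis
      by (smt (verit) norm_triangle_ineq norm_triangle_ineq4)
  qed
  have "(\<bar>B\<bar> + \<bar>B\<bar>)-lipschitz_on UNIV F"
  proof (rule lipschitz_onI)
    fix x y
    show "dist (F x) (F y) \<le> (\<bar>B\<bar> + \<bar>B\<bar>) * dist x y"
    proof (rule field_le_epsilon)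
      fix e :: real assume "e > 0"
      then show "dist (F x) (F y) \<le> (\<bar>B\<bar> + \<bar>B\<bar>) * dist x y + e"
        using near[of "e/2" x y] by (simp add: dist_norm)
    qed
  qed simp
  moreover have "AE z in lborel. f z = F z" using tre[OF b(1)] F(2) by eventually_elim simp
  ultimately show ?thesis by blast
qed

text \<open>F is bounded on the ball that carries \<phi>. If one of the two points lies in it, the
  product estimate is centred there; otherwise both values are 0.\<close>

lemma lipschitz_mult_compact_support:
  fixes F \<phi> :: "complex \<Rightarrow> complex"
  assumes F: "L-lipschitz_on UNIV F" and \<phi>: "L'-lipschitz_on UNIV \<phi>"
    and R: "\<And>z. norm z > R \<Longrightarrow> \<phi> z = 0" and B: "\<And>z. norm (\<phi> z) \<le> B"
  shows "\<exists>C. C-lipschitz_on UNIV (\<lambda>z. F z * \<phi> z)"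
proof -
  have nn: "L \<ge> 0" "L' \<ge> 0" "B \<ge> 0"
    using lipschitz_on_nonneg[OF F] lipschitz_on_nonneg[OF \<phi>] order_trans[OF norm_ge_zero B[of 0]] by simp_all
  have "bounded (F ` cball 0 R)"
    by (intro compact_imp_bounded compact_continuous_image continuous_on_subset[OF lipschitz_on_continuous_on[OF F]]) auto
  then obtain A where A: "\<And>z. z \<in> cball 0 R \<Longrightarrow> norm (F z) \<le> A" unfolding bounded_iff by blast
  have in1: "norm (F x * \<phi> x - F y * \<phi> y) \<le> (\<bar>A\<bar> * L' + L * B) * dist x y" if x: "norm x \<le> R" for x y
  proof -
    have "F x * \<phi> x - F y * \<phi> y = F x * (\<phi> x - \<phi> y) + (F x - F y) * \<phi> y" by (simp add: algebra_simps)
    also have "norm \<dots> \<le> norm (F x) * norm (\<phi> x - \<phi> y) + norm (F x - F y) * norm (\<phi> y)"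
      by (rule norm_triangle_le) (simp add: norm_mult)
    also have "\<dots> \<le> \<bar>A\<bar> * (L' * dist x y) + (L * dist x y) * B"
    proof (intro add_mono mult_mono)
      show "norm (F x) \<le> \<bar>A\<bar>" using A[of x] x by simp
      show "norm (\<phi> x - \<phi> y) \<le> L' * dist x y" using lipschitz_onD[OF \<phi>, of x y] by (simp add: dist_norm)
      show "norm (F x - F y) \<le> L * dist x y" using lipschitz_onD[OF F, of x y] by (simp add: dist_norm)
    qed (use nn B in auto)
    finally show ?thesis by (simp add: algebra_simps)
  qed
  have "(\<bar>A\<bar> * L' + L * B)-lipschitz_on UNIV (\<lambda>z. F z * \<phi> z)"
  proof (rule lipschitz_onI)
    fix x y
    show "dist (F x * \<phi> x) (F y * \<phi> y) \<le> (\<bar>A\<bar> * L' + L * B) * dist x y"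
    proof (cases "norm x \<le> R")
      case True then show ?thesis using in1[of x y] by (simp add: dist_norm)
    next
      case nx: False
      show ?thesis
      proof (cases "norm y \<le> R")
        case True then show ?thesis using in1[of y x] by (simp add: dist_norm norm_minus_commute dist_commute)
      next
        case False then show ?thesis using nx R nn by simp
      qed
    qed
  qed (use nn in simp)
  then show ?thesis by blast
qed

text \<open>Along every line in direction u the derivative exists almost everywhere by the
  one-dimensional theorem, and integrating the derivative of F \<phi> along these lines gives the
  weak equation. The last conjunct holds at every point, not just almost everywhere; it places the
  supports of the potentials.\<close>

lemma lipschitz_has_weak_deriv:
  assumes F: "L-lipschitz_on UNIV F" and u: "norm u = 1"
  shows "\<exists>g. weak_deriv (of_real (Re u)) (of_real (Im u)) F g \<and> (\<forall>z. norm (g z) \<le> L) \<and>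
     (\<forall>U. open U \<longrightarrow> (\<forall>z\<in>U. F z = 0) \<longrightarrow> (\<forall>z\<in>U. g z = 0))"
proof -
  have L: "L \<ge> 0" using F by (rule lipschitz_on_nonneg)
  have cF: "continuous_on UNIV F" using F by (rule lipschitz_on_continuous_on)
  have [measurable]: "F \<in> borel_measurable borel" using cF by (rule borel_measurable_continuous_onI)
  define q where "q z = dquot_lim (\<lambda>s. F (z + u * of_real s)) 0" for z
  \<comment> \<open>Cut at the Lipschitz constant, so that the bound holds also where the difference
    quotients diverge.\<close>
  define g where "g z = (if norm (q z) \<le> L then q z else 0)" for z
  have q_alt: "q z = lim (\<lambda>n. real (Suc n) *\<^sub>R (F (z + u * of_real (1 / real (Suc n))) - F z))" for z
    by (simp add: q_def dquot_lim_def)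
  have [measurable]: "q \<in> borel_measurable borel" unfolding q_alt[abs_def] by measurable
  have gm[measurable]: "g \<in> borel_measurable borel" unfolding g_def by measurable
  have gb: "norm (g z) \<le> L" for z using L by (simp add: g_def)
  have gz: "g z = 0" if U: "open U" "\<And>w. w \<in> U \<Longrightarrow> F w = 0" "z \<in> U" for U z
  proof -
    obtain e where e: "e > 0" "ball z e \<subseteq> U" using U(1,3) openE by blast
    have "((\<lambda>s. F (z + u * of_real s)) has_vector_derivative 0) (at 0)"
    proof (rule has_vector_derivative_transform_within_open[of "\<lambda>_. 0" _ _ "{-e<..<e}"])
      fix s assume "s \<in> {-e<..<e}"
      then have "z + u * of_real s \<in> ball z e" using u by (auto simp: dist_norm norm_mult)
      then show "0 = F (z + u * of_real s)" using e U(2) by auto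
    qed (use e in auto)
    then have "q z = 0" unfolding q_def by (rule dquot_lim_eq(2))
    then show ?thesis by (simp add: g_def)
  qed
  have line: "AE s in lborel. ((\<lambda>s. F (z + u * of_real s)) has_vector_derivative g (z + u * of_real s)) (at s)" for z
  proof -
    have lip: "L-lipschitz_on UNIV (\<lambda>s. F (z + u * of_real s))"
    proof (rule lipschitz_onI)
      fix x y :: real
      have "z + u * of_real x - (z + u * of_real y) = u * of_real (x - y)" by (simp add: algebra_simps)
      then have "dist (z + u * of_real x) (z + u * of_real y) = dist x y"
        using u by (simp add: dist_norm norm_mult del: of_real_diff)
      then show "dist (F (z + u * of_real x)) (F (z + u * of_real y)) \<le> L * dist x y"
        using lipschitz_onD[OF F, of "z + u * of_real x" "z + u * of_real y"] by simp
    qed (rule L)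
    have e: "dquot_lim (\<lambda>s. F (z + u * of_real s)) s = q (z + u * of_real s)" for s
      unfolding q_alt dquot_lim_def by (simp add: algebra_simps)
    show ?thesis using lipschitz_AE_has_vector_derivative[OF lip]
      by eventually_elim (simp add: e g_def)
  qed
  have lF: "loc_int F" by (rule loc_int_continuous[OF cF])
  have lg: "loc_int g" using loc_int_bounded[OF gm gb] .
  have "weak_deriv (of_real (Re u)) (of_real (Im u)) F g"
    unfolding weak_deriv_def
  proof (intro conjI lF lg allI impI)
    fix \<phi> assume t: "test_function \<phi>"
    let ?d = "first_order (of_real (Re u)) (of_real (Im u)) \<phi>"
    obtain R where R: "\<And>z. norm z > R \<Longrightarrow> \<phi> z = 0" using test_functionD(5)[OF t] by blast
    obtain B where B: "\<And>z. norm (\<phi> z) \<le> B" using test_functionD(6)[OF t] by blast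
    obtain L' where L': "L'-lipschitz_on UNIV \<phi>" using test_function_lipschitz[OF t] by blast
    obtain C where C: "C-lipschitz_on UNIV (\<lambda>z. F z * \<phi> z)" using lipschitz_mult_compact_support[OF F L' R B] by blast
    have I: "integrable lborel (\<lambda>z. g z * \<phi> z)" "integrable lborel (\<lambda>z. F z * ?d z)"
      by (intro loc_int_test lg lF t test_first_order[OF t])+
    have "(LINT z|lborel. F z * ?d z + g z * \<phi> z) = 0"
    proof (rule plane_directional_derivative_integral[OF u C])
      show "F z * \<phi> z = 0" if "R < norm z" for z using R[OF that] by simp
      show "integrable lborel (\<lambda>z. F z * ?d z + g z * \<phi> z)" using I by simp
      fix z
      have d\<phi>: "((\<lambda>s. \<phi> (z + u * of_real s)) has_vector_derivative ?d (z + u * of_real s)) (at s)" for s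
      proof -
        have "((\<lambda>s. z + u * of_real s) has_derivative (\<lambda>t. u * of_real t)) (at s)" by (auto intro!: derivative_eq_intros)
        from has_derivative_compose[OF this smoothD(1)[OF test_functionD(1)[OF t]]]
        have "((\<lambda>s. \<phi> (z + u * of_real s)) has_derivative (\<lambda>x. of_real (Re (u * of_real x)) * dx \<phi> (z + u * of_real s) +
           of_real (Im (u * of_real x)) * dy \<phi> (z + u * of_real s))) (at s)" .
        then show ?thesis unfolding has_vector_derivative_def
          by (rule has_derivative_eq_rhs) (simp add: fun_eq_iff first_order_eq scaleR_conv_of_real algebra_simps)
      qed
      show "AE s in lborel. ((\<lambda>s. F (z + u * of_real s) * \<phi> (z + u * of_real s)) has_vector_derivative
          F (z + u * of_real s) * ?d (z + u * of_real s) + g (z + u * of_real s) * \<phi> (z + u * of_real s)) (at s)"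
        using line[of z] by eventually_elim (rule has_vector_derivative_mult[OF _ d\<phi>])
    qed
    then show "(LINT z|lborel. F z * ?d z) = - (LINT z|lborel. g z * \<phi> z)"
      using I by (simp add: eq_neg_iff_add_eq_0)
  qed
  then show ?thesis using gb gz by blast
qed

section \<open>The potentials\<close>

lemma Linf_norm_finite:
  assumes "Linf_norm f < \<infinity>"
  shows "\<exists>B. AE z in lebesgue. norm (f z) \<le> B"
proof (cases "Linf_norm f")
  case (real r)
  have "AE z in lebesgue. ereal (norm (f z)) \<le> Linf_norm f" unfolding Linf_norm_def by (rule esssup_AE)
  then show ?thesis using real by auto
next
  \<comment> \<open>The essential supremum is an \<open>ereal\<close>; with the value minus infinity
    the bound is contradictory at almost every point, so any constant can be concluded.\<close>
  case MInf
  have "AE z in lebesgue. ereal (norm (f z)) \<le> Linf_norm f" unfolding Linf_norm_def by (rule esssup_AE)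
  then have "AE z in lebesgue. norm (f z) \<le> 0" unfolding MInf by eventually_elim simp
  then show ?thesis by blast
qed (use assms in simp)

text \<open>The functions \<open>weak_dx\<close> and \<open>weak_dy\<close> are picked by
  \<open>SOME\<close>, and existence makes them genuine weak derivatives. The Borel representatives
  obtained from the two equations agree almost everywhere and are merged into one function with both
  derivatives.\<close>

lemma W1inf_lipschitz:
  assumes "\<sigma> \<in> W1inf"
  shows "\<exists>F L. L-lipschitz_on UNIV F \<and> (AE z in lborel. complex_of_real (\<sigma> z) = F z)"
proof -
  let ?f = "\<lambda>z. complex_of_real (\<sigma> z)"
  have ex: "\<exists>g. has_weak_dx ?f g" "\<exists>g. has_weak_dy ?f g" and fin: "W1inf_norm \<sigma> < \<infinity>"
    using assms by (auto simp: W1inf_def)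
  have wx: "has_weak_dx ?f (weak_dx ?f)" unfolding weak_dx_def by (rule someI_ex[OF ex(1)])
  have wy: "has_weak_dy ?f (weak_dy ?f)" unfolding weak_dy_def by (rule someI_ex[OF ex(2)])
  have "Linf_norm ?f < \<infinity>" "Linf_norm (weak_dx ?f) < \<infinity>" "Linf_norm (weak_dy ?f) < \<infinity>"
    using fin unfolding W1inf_norm_def Let_def ereal_infty_less by auto
  then obtain B1 B2 B3 where B: "AE z in lborel. norm (?f z) \<le> B1" "AE z in lborel. norm (weak_dx ?f z) \<le> B2"
    "AE z in lborel. norm (weak_dy ?f z) \<le> B3" using Linf_norm_finite unfolding AE_completion_iff by meson
  obtain f1 gx where 1: "weak_deriv 1 0 f1 gx" "AE z in lborel. ?f z = f1 z" "AE z in lborel. weak_dx ?f z = gx z"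
    using weak_deriv_representative[OF wx] by blast
  obtain f2 gy where 2: "weak_deriv 0 1 f2 gy" "AE z in lborel. ?f z = f2 z" "AE z in lborel. weak_dy ?f z = gy z"
    using weak_deriv_representative[OF wy] by blast
  have m: "f1 \<in> borel_measurable borel" "gy \<in> borel_measurable borel" using 1 2 by (auto simp: weak_deriv_def dest: loc_intD)
  have "AE z in lborel. f1 z = f2 z" using 1(2) 2(2) by eventually_elim simp
  then have wy1: "weak_deriv 0 1 f1 gy" by (rule weak_deriv_cong_AE[OF 2(1) m(1) _ m(2)]) simp
  define B where "B = max B1 (max B2 B3)"
  have "AE z in lborel. norm (f1 z) \<le> B" using 1(2) B(1) by eventually_elim (auto simp: B_def)
  moreover have "AE z in lborel. norm (gx z) \<le> B" using 1(3) B(2) by eventually_elim (auto simp: B_def)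
  moreover have "AE z in lborel. norm (gy z) \<le> B" using 2(3) B(3) by eventually_elim (auto simp: B_def)
  ultimately obtain F L where F: "L-lipschitz_on UNIV F" "AE z in lborel. f1 z = F z"
    using bounded_weak_gradient_lipschitz[OF 1(1) wy1] by blast
  have "AE z in lborel. ?f z = F z" using F(2) 1(2) by eventually_elim simp
  then show ?thesis using F(1) by blast
qed

lemma Ln_lipschitz_halfplane:
  assumes "s > 0" "Re a \<ge> s" "Re b \<ge> s"
  shows "norm (Ln a - Ln b) \<le> (1 / s) * norm (a - b)"
proof (rule field_differentiable_bound[of "{z. Re z \<ge> s}" Ln "\<lambda>z. 1 / z"])
  show "convex {z. Re z \<ge> s}" by (rule convex_halfspace_Re_ge)
  fix z assume "z \<in> {z. Re z \<ge> s}"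
  then have z: "Re z \<ge> s" by simp
  then have "z \<notin> \<real>\<^sub>\<le>\<^sub>0" using assms(1) by (auto simp: complex_nonpos_Reals_iff)
  then show "(Ln has_field_derivative 1 / z) (at z within {z. Re z \<ge> s})"
    using has_field_derivative_Ln[of z] by (auto simp: inverse_eq_divide intro: has_field_derivative_at_within)
  have "s \<le> norm z" using z complex_Re_le_cmod[of z] by linarith
  then show "norm (1 / z) \<le> 1 / s" using assms(1) by (simp add: norm_divide frac_le)
qed (use assms in auto)

text \<open>For the Lipschitz version \<gamma> of the conductivity the conditions known almost
  everywhere hold everywhere by continuity: Re \<gamma> stays above \<sigma>_0, a half plane on
  which the principal logarithm is Lipschitz, and \<gamma> is 1 off the closure of \<Omega>.\<close>

lemma log_conductivity_lipschitz:
  assumes s: "\<sigma> \<in> W1inf" and e: "\<epsilon> \<in> W1inf" and s0: "\<sigma>\<^sub>0 > 0" and pos: "AE z in lebesgue. \<sigma> z > \<sigma>\<^sub>0"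
    and one: "AE z in lebesgue. z \<notin> \<Omega> \<longrightarrow> conductivity \<omega> \<sigma> \<epsilon> z = 1"
  shows "\<exists>F L. L-lipschitz_on UNIV F \<and> (AE z in lborel. Ln (conductivity \<omega> \<sigma> \<epsilon> z) = F z) \<and> (\<forall>z. z \<notin> closure \<Omega> \<longrightarrow> F z = 0)"
proof -
  obtain S Ls where S: "Ls-lipschitz_on UNIV S" "AE z in lborel. complex_of_real (\<sigma> z) = S z"
    using W1inf_lipschitz[OF s] by blast
  obtain E Le where E: "Le-lipschitz_on UNIV E" "AE z in lborel. complex_of_real (\<epsilon> z) = E z"
    using W1inf_lipschitz[OF e] by blast
  define \<gamma> where "\<gamma> z = of_real (Re (S z)) + \<i> * of_real \<omega> * of_real (Re (E z))" for z
  have g: "AE z in lborel. conductivity \<omega> \<sigma> \<epsilon> z = \<gamma> z"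
    using S(2) E(2)
  proof eventually_elim
    case (elim z)
    have "\<sigma> z = Re (S z)" "\<epsilon> z = Re (E z)" unfolding elim[symmetric] by simp_all
    then show ?case by (simp add: conductivity_def \<gamma>_def)
  qed
  have nn: "Ls \<ge> 0" "Le \<ge> 0" using S(1) E(1) lipschitz_on_nonneg by auto
  have lip: "(Ls + \<bar>\<omega>\<bar> * Le)-lipschitz_on UNIV \<gamma>"
  proof (rule lipschitz_onI)
    fix x y
    have "\<gamma> x - \<gamma> y = of_real (Re (S x - S y)) + \<i> * of_real \<omega> * of_real (Re (E x - E y))"
      by (simp add: \<gamma>_def algebra_simps)
    also have "norm \<dots> \<le> \<bar>Re (S x - S y)\<bar> + \<bar>\<omega>\<bar> * \<bar>Re (E x - E y)\<bar>"
      by (rule norm_triangle_le) (simp add: norm_mult del: minus_complex.simps)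
    also have "\<dots> \<le> Ls * dist x y + \<bar>\<omega>\<bar> * (Le * dist x y)"
      using abs_Re_le_cmod[of "S x - S y"] abs_Re_le_cmod[of "E x - E y"]
        lipschitz_onD[OF S(1), of x y] lipschitz_onD[OF E(1), of x y]
      by (intro add_mono mult_left_mono) (auto simp: dist_norm)
    finally show "dist (\<gamma> x) (\<gamma> y) \<le> (Ls + \<bar>\<omega>\<bar> * Le) * dist x y" by (simp add: dist_norm algebra_simps)
  qed (use nn in auto)
  have cg: "continuous_on UNIV \<gamma>" using lip by (rule lipschitz_on_continuous_on)
  \<comment> \<open>A closed set that contains almost every point is everything; the strict
    inequality becomes a weak one in the limit.\<close>
  have Rg: "Re (\<gamma> z) \<ge> \<sigma>\<^sub>0" for z
  proof -
    have "closed {z. \<sigma>\<^sub>0 \<le> Re (\<gamma> z)}" by (intro closed_Collect_le continuous_intros cg)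
    moreover have "AE z in lebesgue. z \<in> {z. \<sigma>\<^sub>0 \<le> Re (\<gamma> z)}"
      using pos AE_completion[OF g] by eventually_elim (auto simp: conductivity_def dest!: arg_cong[where f=Re])
    ultimately show ?thesis using mem_closed_if_AE_lebesgue by blast
  qed
  define F where "F z = Ln (\<gamma> z)" for z
  have "(1 / \<sigma>\<^sub>0 * (Ls + \<bar>\<omega>\<bar> * Le))-lipschitz_on UNIV F"
  proof (rule lipschitz_onI)
    fix x y
    have "dist (F x) (F y) \<le> 1 / \<sigma>\<^sub>0 * norm (\<gamma> x - \<gamma> y)"
      unfolding F_def dist_norm by (rule Ln_lipschitz_halfplane[OF s0 Rg Rg])
    also have "\<dots> \<le> 1 / \<sigma>\<^sub>0 * ((Ls + \<bar>\<omega>\<bar> * Le) * dist x y)"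
      using lipschitz_onD[OF lip, of x y] s0 by (intro mult_left_mono) (auto simp: dist_norm)
    finally show "dist (F x) (F y) \<le> 1 / \<sigma>\<^sub>0 * (Ls + \<bar>\<omega>\<bar> * Le) * dist x y" by (simp add: mult.assoc)
  qed (use nn s0 in auto)
  moreover have "AE z in lborel. Ln (conductivity \<omega> \<sigma> \<epsilon> z) = F z" using g by eventually_elim (simp add: F_def)
  moreover have "F z = 0" if "z \<notin> closure \<Omega>" for z
  proof -
    have "\<gamma> z = (\<lambda>_. 1) z"
    proof (rule AE_eq_on_open[where U = "- closure \<Omega>" and f = \<gamma> and g = "\<lambda>_. 1"])
      have "AE z in lborel. z \<notin> \<Omega> \<longrightarrow> conductivity \<omega> \<sigma> \<epsilon> z = 1" using one by (simp add: AE_completion_iff)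
      then show "AE z in lborel. z \<in> - closure \<Omega> \<longrightarrow> \<gamma> z = 1"
        using g by eventually_elim (use closure_subset in auto)
    qed (use that cg in \<open>auto intro: continuous_on_subset\<close>)
    then show ?thesis by (simp add: F_def)
  qed
  ultimately show ?thesis by blast
qed

text \<open>The second claim is about every weak derivative, hence about those picked by
  \<open>SOME\<close> in \<open>Q12\<close> and \<open>Q21\<close>. Uniqueness compares it with a
  combination of directional derivatives that is bounded and vanishes on \<open>U\<close>
  pointwise.\<close>

lemma lipschitz_complex_weak_deriv:
  assumes F: "L-lipschitz_on UNIV F" and F': "AE z in lborel. f z = F z" and z: "\<And>z. z \<in> U \<Longrightarrow> F z = 0" and U: "open U"
  shows "\<exists>g. has_weak_deriv a b f g"
    "has_weak_deriv a b f g \<Longrightarrow> \<exists>h B. h \<in> borel_measurable borel \<and> (AE z in lborel. g z = h z) \<and> (\<forall>z. norm (h z) \<le> B) \<and> (\<forall>z\<in>U. h z = 0)"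
proof -
  have cF: "continuous_on UNIV F" using F by (rule lipschitz_on_continuous_on)
  have Fm: "F \<in> borel_measurable borel" using cF by (rule borel_measurable_continuous_onI)
  obtain g1 where 1: "weak_deriv 1 0 F g1" "\<And>z. norm (g1 z) \<le> L" "\<And>z. z \<in> U \<Longrightarrow> g1 z = 0"
    using lipschitz_has_weak_deriv[OF F, of 1] U z by auto
  obtain g2 where 2: "weak_deriv 0 1 F g2" "\<And>z. norm (g2 z) \<le> L" "\<And>z. z \<in> U \<Longrightarrow> g2 z = 0"
    using lipschitz_has_weak_deriv[OF F, of \<i>] U z by auto
  define h where "h z = a * g1 z + b * g2 z" for z
  have w: "weak_deriv a b F h" using weak_deriv_combine[OF 1(1) 2(1), of a b] by (simp add: h_def[abs_def])
  have hm: "h \<in> borel_measurable borel" using w by (auto simp: weak_deriv_def dest: loc_intD)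
  have "has_weak_deriv a b f h" using weak_deriv_iff[OF Fm F' hm, of h a b] w by simp
  then show "\<exists>g. has_weak_deriv a b f g" by blast
  have hb: "norm (h z) \<le> (norm a + norm b) * L" for z
  proof -
    have "norm (h z) \<le> norm a * norm (g1 z) + norm b * norm (g2 z)"
      unfolding h_def by (rule norm_triangle_le) (simp add: norm_mult)
    also have "\<dots> \<le> norm a * L + norm b * L" by (intro add_mono mult_left_mono 1 2) auto
    finally show ?thesis by (simp add: algebra_simps)
  qed
  show "\<exists>h B. h \<in> borel_measurable borel \<and> (AE z in lborel. g z = h z) \<and> (\<forall>z. norm (h z) \<le> B) \<and> (\<forall>z\<in>U. h z = 0)"
    if g: "has_weak_deriv a b f g"
  proof -
    obtain f' g' where fg: "weak_deriv a b f' g'" "AE z in lborel. f z = f' z" "AE z in lborel. g z = g' z"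
      using weak_deriv_representative[OF g] by blast
    have gm: "g' \<in> borel_measurable borel" using fg by (auto simp: weak_deriv_def dest: loc_intD)
    have "AE z in lborel. F z = f' z" using F' fg(2) by eventually_elim simp
    then have "weak_deriv a b F g'" by (rule weak_deriv_cong_AE[OF fg(1) Fm _ gm]) simp
    then have "AE z in lborel. g' z = h z" using weak_deriv_unique w by blast
    then have "AE z in lborel. g z = h z" using fg(3) by eventually_elim simp
    then show ?thesis using hm hb 1(3) 2(3) by (intro exI[of _ h] exI[of _ "(norm a + norm b) * L"]) (auto simp: h_def)
  qed
qed

lemma potentials_bounded:
  assumes "\<sigma> \<in> W1inf" "\<epsilon> \<in> W1inf" "\<sigma>\<^sub>0 > 0" "AE z in lebesgue. \<sigma> z > \<sigma>\<^sub>0"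
    "AE z in lebesgue. z \<notin> \<Omega> \<longrightarrow> conductivity \<omega> \<sigma> \<epsilon> z = 1"
  defines "\<gamma> \<equiv> conductivity \<omega> \<sigma> \<epsilon>"
  shows "\<exists>h B. h \<in> borel_measurable borel \<and> (AE z in lborel. Q12 \<gamma> z = h z) \<and> (\<forall>z. norm (h z) \<le> B) \<and> (\<forall>z. z \<notin> closure \<Omega> \<longrightarrow> h z = 0)"
    "\<exists>h B. h \<in> borel_measurable borel \<and> (AE z in lborel. Q21 \<gamma> z = h z) \<and> (\<forall>z. norm (h z) \<le> B) \<and> (\<forall>z. z \<notin> closure \<Omega> \<longrightarrow> h z = 0)"
proof -
  obtain F L where F: "L-lipschitz_on UNIV F" "AE z in lborel. Ln (\<gamma> z) = F z" "\<And>z. z \<in> - closure \<Omega> \<Longrightarrow> F z = 0"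
    using log_conductivity_lipschitz[OF assms(1-5)] unfolding \<gamma>_def by auto
  note w = lipschitz_complex_weak_deriv[OF F(1,2,3) open_Compl[OF closed_closure], of \<Omega>]
  have ex: "\<exists>g. has_weak_deriv a b (\<lambda>w. Ln (\<gamma> w)) g" for a b by (rule w(1)) simp
  have half: "\<exists>h B. h \<in> borel_measurable borel \<and> (AE z in lborel. - (1/2) * g z = h z) \<and> (\<forall>z. norm (h z) \<le> B) \<and> (\<forall>z. z \<notin> closure \<Omega> \<longrightarrow> h z = 0)"
    if hw: "has_weak_deriv a b (\<lambda>w. Ln (\<gamma> w)) g" for a b g
  proof -
    obtain h B where h: "h \<in> borel_measurable borel" "AE z in lborel. g z = h z" "\<And>z. norm (h z) \<le> B" "\<And>z. z \<in> - closure \<Omega> \<Longrightarrow> h z = 0"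
      using w(2)[OF _ hw] by auto
    have nb: "norm (- (1/2) * h z) \<le> B" for z using h(3)[of z] order_trans[OF norm_ge_zero h(3)[of z]] by (simp add: norm_mult norm_divide)
    show ?thesis using h nb by (intro exI[of _ "\<lambda>z. - (1/2) * h z"] exI[of _ B]) auto
  qed
  have "has_weak_dz (\<lambda>w. Ln (\<gamma> w)) (weak_dz (\<lambda>w. Ln (\<gamma> w)))" unfolding weak_dz_def by (rule someI_ex[OF ex])
  from half[OF this] show "\<exists>h B. h \<in> borel_measurable borel \<and> (AE z in lborel. Q12 \<gamma> z = h z) \<and> (\<forall>z. norm (h z) \<le> B) \<and> (\<forall>z. z \<notin> closure \<Omega> \<longrightarrow> h z = 0)"
    by (simp add: Q12_def)
  have "has_weak_dbar (\<lambda>w. Ln (\<gamma> w)) (weak_dbar (\<lambda>w. Ln (\<gamma> w)))" unfolding weak_dbar_def by (rule someI_ex[OF ex])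
  from half[OF this] show "\<exists>h B. h \<in> borel_measurable borel \<and> (AE z in lborel. Q21 \<gamma> z = h z) \<and> (\<forall>z. norm (h z) \<le> B) \<and> (\<forall>z. z \<notin> closure \<Omega> \<longrightarrow> h z = 0)"
    by (simp add: Q21_def)
qed

section \<open>One-dimensional Hausdorff measure\<close>

definition h1_cover :: "real \<Rightarrow> complex set \<Rightarrow> (nat \<Rightarrow> complex set) \<Rightarrow> bool" where
  "h1_cover \<delta> A C \<longleftrightarrow> A \<subseteq> \<Union>(range C) \<and> (\<forall>n. bounded (C n) \<and> diameter (C n) \<le> \<delta>)"

lemma hausdorff1_delta_le: "h1_cover \<delta> A C \<Longrightarrow> hausdorff1_delta \<delta> A \<le> (\<Sum>n. ennreal (diameter (C n)))"
  unfolding hausdorff1_delta_def h1_cover_def by (rule INF_lower) simp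

lemma hausdorff1_delta_greatest:
  "(\<And>C. h1_cover \<delta> A C \<Longrightarrow> x \<le> (\<Sum>n. ennreal (diameter (C n)))) \<Longrightarrow> x \<le> hausdorff1_delta \<delta> A"
  unfolding hausdorff1_delta_def h1_cover_def by (rule INF_greatest) simp

lemma hausdorff1_delta_approx:
  assumes "hausdorff1_delta \<delta> A < x"
  shows "\<exists>C. h1_cover \<delta> A C \<and> (\<Sum>n. ennreal (diameter (C n))) < x"
  using assms unfolding hausdorff1_delta_def h1_cover_def INF_less_iff by auto

lemma hausdorff1_delta_mono: "A \<subseteq> B \<Longrightarrow> hausdorff1_delta \<delta> A \<le> hausdorff1_delta \<delta> B"
  by (rule hausdorff1_delta_greatest, rule hausdorff1_delta_le) (auto simp: h1_cover_def)

lemma hausdorff1_delta_antimono: "\<delta> \<le> \<delta>' \<Longrightarrow> hausdorff1_delta \<delta>' A \<le> hausdorff1_delta \<delta> A"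
  by (rule hausdorff1_delta_greatest, rule hausdorff1_delta_le) (auto simp: h1_cover_def intro: order_trans)

lemma hausdorff1_delta_countable_subadditive:
  assumes d: "\<delta> > 0"
  shows "hausdorff1_delta \<delta> (\<Union>i. A i) \<le> (\<Sum>i. hausdorff1_delta \<delta> (A i))"
proof (cases "\<exists>i. hausdorff1_delta \<delta> (A i) = top")
  case True
  then obtain i where "hausdorff1_delta \<delta> (A i) = top" by blast
  then have "(\<Sum>i. hausdorff1_delta \<delta> (A i)) = top"
    using sum_le_suminf[of "\<lambda>i. hausdorff1_delta \<delta> (A i)" "{i}"] by (simp add: top_unique)
  then show ?thesis by simp
next
  case False
  show ?thesis
  proof (rule ennreal_le_epsilon)
    fix e :: real assume e: "0 < e"
    have "\<exists>C. h1_cover \<delta> (A i) C \<and> (\<Sum>n. ennreal (diameter (C n))) < hausdorff1_delta \<delta> (A i) + ennreal (e * (1/2) ^ Suc i)" for i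
    proof (rule hausdorff1_delta_approx)
      have "hausdorff1_delta \<delta> (A i) + 0 < hausdorff1_delta \<delta> (A i) + ennreal (e * (1/2) ^ Suc i)"
        using False e by (subst ennreal_add_left_cancel_less) auto
      then show "hausdorff1_delta \<delta> (A i) < hausdorff1_delta \<delta> (A i) + ennreal (e * (1/2) ^ Suc i)" by simp
    qed
    then obtain C where C: "\<And>i. h1_cover \<delta> (A i) (C i)"
      "\<And>i. (\<Sum>n. ennreal (diameter (C i n))) < hausdorff1_delta \<delta> (A i) + ennreal (e * (1/2) ^ Suc i)" by metis
    define D where "D n = C (fst (prod_decode n)) (snd (prod_decode n))" for n
    have "h1_cover \<delta> (\<Union>i. A i) D"
      unfolding h1_cover_def
    proof (intro conjI allI)
      show "(\<Union>i. A i) \<subseteq> \<Union> (range D)"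
      proof clarify
        fix x i assume "x \<in> A i"
        then obtain n where "x \<in> C i n" using C(1)[of i] by (auto simp: h1_cover_def)
        then have "x \<in> D (prod_encode (i, n))" by (simp add: D_def)
        then show "x \<in> \<Union> (range D)" by blast
      qed
    qed (use C(1) in \<open>auto simp: D_def h1_cover_def\<close>)
    then have "hausdorff1_delta \<delta> (\<Union>i. A i) \<le> (\<Sum>n. ennreal (diameter (D n)))" by (rule hausdorff1_delta_le)
    also have "\<dots> = (\<Sum>i. \<Sum>n. ennreal (diameter (C i n)))"
      using suminf_ennreal_2dimen[of "\<lambda>i. \<Sum>n. ennreal (diameter (C i n))" "\<lambda>(i,n). ennreal (diameter (C i n))"]
      by (simp add: D_def o_def case_prod_beta)
    also have "\<dots> \<le> (\<Sum>i. hausdorff1_delta \<delta> (A i) + ennreal (e * (1/2) ^ Suc i))"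
      using C(2) by (intro suminf_le) (auto intro: less_imp_le)
    also have "\<dots> = (\<Sum>i. hausdorff1_delta \<delta> (A i)) + (\<Sum>i. ennreal (e * (1/2) ^ Suc i))"
      by (intro suminf_add[symmetric] summableI)
    also have "(\<Sum>i. ennreal (e * (1/2) ^ Suc i)) = ennreal (\<Sum>i. e * (1/2) ^ Suc i)"
      using e by (intro suminf_ennreal2) (auto intro!: summable_mult power_half_series[THEN sums_summable])
    also have "(\<Sum>i. e * (1/2) ^ Suc i) = e"
      using sums_mult[OF power_half_series, of e] by (simp add: sums_iff)
    finally show "hausdorff1_delta \<delta> (\<Union>i. A i) \<le> (\<Sum>i. hausdorff1_delta \<delta> (A i)) + ennreal e" .
  qed
qed

lemma hausdorff1_delta_empty: "\<delta> > 0 \<Longrightarrow> hausdorff1_delta \<delta> {} = 0"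
  using hausdorff1_delta_le[of \<delta> "{}" "\<lambda>_. {}"] by (simp add: h1_cover_def)

lemma hausdorff1_outer_upper: "\<delta> > 0 \<Longrightarrow> hausdorff1_delta \<delta> A \<le> hausdorff1_outer A"
  unfolding hausdorff1_outer_def by (rule SUP_upper) simp

lemma hausdorff1_outer_least: "(\<And>\<delta>. \<delta> > 0 \<Longrightarrow> hausdorff1_delta \<delta> A \<le> x) \<Longrightarrow> hausdorff1_outer A \<le> x"
  unfolding hausdorff1_outer_def by (rule SUP_least) simp

lemma hausdorff1_outer_mono: "A \<subseteq> B \<Longrightarrow> hausdorff1_outer A \<le> hausdorff1_outer B"
  by (rule hausdorff1_outer_least) (meson hausdorff1_delta_mono hausdorff1_outer_upper order_trans)

lemma hausdorff1_outer_empty: "hausdorff1_outer {} = 0"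
  using hausdorff1_outer_least[of "{}" 0] hausdorff1_delta_empty by simp

lemma hausdorff1_outer_subadditive: "hausdorff1_outer (\<Union>i. A i) \<le> (\<Sum>i. hausdorff1_outer (A i))"
proof (rule hausdorff1_outer_least)
  fix \<delta> :: real assume d: "\<delta> > 0"
  have "hausdorff1_delta \<delta> (\<Union>i. A i) \<le> (\<Sum>i. hausdorff1_delta \<delta> (A i))"
    by (rule hausdorff1_delta_countable_subadditive[OF d])
  also have "\<dots> \<le> (\<Sum>i. hausdorff1_outer (A i))"
    by (intro suminf_le hausdorff1_outer_upper d summableI)
  finally show "hausdorff1_delta \<delta> (\<Union>i. A i) \<le> (\<Sum>i. hausdorff1_outer (A i))" .
qed

lemma hausdorff1_outer_Un: "hausdorff1_outer (A \<union> B) \<le> hausdorff1_outer A + hausdorff1_outer B"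
proof -
  have "A \<union> B = (\<Union>i::nat. if i = 0 then A else if i = 1 then B else {})" by (auto split: if_splits)
  then have "hausdorff1_outer (A \<union> B) \<le> (\<Sum>i::nat. hausdorff1_outer (if i = 0 then A else if i = 1 then B else {}))"
    using hausdorff1_outer_subadditive[of "\<lambda>i::nat. if i = 0 then A else if i = 1 then B else {}"] by simp
  also have "\<dots> = (\<Sum>i\<in>{0,1::nat}. hausdorff1_outer (if i = 0 then A else if i = 1 then B else {}))"
    by (rule suminf_finite) (auto simp: hausdorff1_outer_empty)
  finally show ?thesis by simp
qed

lemma outer_measure_hausdorff1: "outer_measure_space UNIV hausdorff1_outer"
  unfolding outer_measure_space_def positive_def increasing_def countably_subadditive_def
  using hausdorff1_outer_empty hausdorff1_outer_mono hausdorff1_outer_subadditive by auto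

text \<open>A covering by sets of diameter at most \<delta> < d splits, because none of its members
  can meet both A and B.\<close>

lemma hausdorff1_outer_separated:
  assumes d: "d > 0" and sep: "\<And>x y. x \<in> A \<Longrightarrow> y \<in> B \<Longrightarrow> dist x y \<ge> d"
  shows "hausdorff1_outer A + hausdorff1_outer B \<le> hausdorff1_outer (A \<union> B)"
proof -
  have *: "hausdorff1_delta \<delta> A + hausdorff1_delta \<delta> B \<le> hausdorff1_delta \<delta> (A \<union> B)" if \<delta>: "0 < \<delta>" "\<delta> < d" for \<delta>
  proof (rule hausdorff1_delta_greatest)
    fix C assume C: "h1_cover \<delta> (A \<union> B) C"
    \<comment> \<open>Members that miss \<open>A\<close> become empty and contribute diameter 0, so
      both subcoverings keep the index set.\<close>
    define CA where "CA n = (if C n \<inter> A = {} then {} else C n)" for n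
    define CB where "CB n = (if C n \<inter> B = {} then {} else C n)" for n
    have "h1_cover \<delta> A CA" "h1_cover \<delta> B CB"
      using C \<delta> unfolding h1_cover_def CA_def CB_def by auto blast+
    then have "hausdorff1_delta \<delta> A + hausdorff1_delta \<delta> B \<le> (\<Sum>n. ennreal (diameter (CA n))) + (\<Sum>n. ennreal (diameter (CB n)))"
      by (intro add_mono hausdorff1_delta_le)
    also have "\<dots> = (\<Sum>n. ennreal (diameter (CA n)) + ennreal (diameter (CB n)))" by (intro suminf_add summableI)
    also have "\<dots> \<le> (\<Sum>n. ennreal (diameter (C n)))"
    proof (intro suminf_le summableI)
      fix n
      have "C n \<inter> A = {} \<or> C n \<inter> B = {}"
      proof (rule ccontr)
        assume "\<not> ?thesis"
        then obtain x y where xy: "x \<in> C n" "x \<in> A" "y \<in> C n" "y \<in> B" by auto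
        have "bounded (C n)" using C by (simp add: h1_cover_def)
        then have "dist x y \<le> diameter (C n)" using xy by (intro diameter_bounded_bound)
        also have "\<dots> \<le> \<delta>" using C by (simp add: h1_cover_def)
        finally show False using sep[OF xy(2,4)] \<delta> by simp
      qed
      then show "ennreal (diameter (CA n)) + ennreal (diameter (CB n)) \<le> ennreal (diameter (C n))"
        by (auto simp: CA_def CB_def)
    qed
    finally show "hausdorff1_delta \<delta> A + hausdorff1_delta \<delta> B \<le> (\<Sum>n. ennreal (diameter (C n)))" .
  qed
  have "hausdorff1_outer A + hausdorff1_outer B = (SUP \<delta>\<in>{0<..}. hausdorff1_delta \<delta> A + hausdorff1_delta \<delta> B)"
    unfolding hausdorff1_outer_def
  proof (rule SUP_add_directed_ennreal[symmetric])
    fix i j :: real assume "i \<in> {0<..}" "j \<in> {0<..}"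
    then show "\<exists>k\<in>{0<..}. hausdorff1_delta i A + hausdorff1_delta j B \<le> hausdorff1_delta k A + hausdorff1_delta k B"
      by (intro bexI[of _ "min i j"] add_mono hausdorff1_delta_antimono) auto
  qed
  also have "\<dots> \<le> hausdorff1_outer (A \<union> B)"
  proof (rule SUP_least)
    fix \<delta> :: real assume "\<delta> \<in> {0<..}"
    then have m: "0 < min \<delta> (d/2)" "min \<delta> (d/2) < d" using d by auto
    have "hausdorff1_delta \<delta> A + hausdorff1_delta \<delta> B \<le> hausdorff1_delta (min \<delta> (d/2)) A + hausdorff1_delta (min \<delta> (d/2)) B"
      by (intro add_mono hausdorff1_delta_antimono) auto
    also have "\<dots> \<le> hausdorff1_delta (min \<delta> (d/2)) (A \<union> B)" by (rule *[OF m])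
    also have "\<dots> \<le> hausdorff1_outer (A \<union> B)" by (rule hausdorff1_outer_upper[OF m(1)])
    finally show "hausdorff1_delta \<delta> A + hausdorff1_delta \<delta> B \<le> hausdorff1_outer (A \<union> B)" .
  qed
  finally show ?thesis .
qed

text \<open>Caratheodory's criterion. With \<open>A\<^sub>n = {x \<in> X. d(x, E) \<ge> 1/(n+1)}\<close> and \<open>R\<^sub>n = A\<^sub>n\<^sub>+\<^sub>1 - A\<^sub>n\<close>, the sets
  \<open>A\<^sub>n\<close> and \<open>R\<^sub>n\<^sub>+\<^sub>1\<close> are separated, so the measures of the rings \<open>R\<^sub>n\<close> form a telescoping, hence
  summable, series.\<close>

lemma closed_lambda_hausdorff1:
  assumes E: "closed E"
  shows "E \<in> lambda_system UNIV UNIV hausdorff1_outer"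
  unfolding lambda_system_def
proof (intro CollectI conjI ballI UNIV_I)
  fix X :: "complex set"
  have "hausdorff1_outer X \<le> hausdorff1_outer (E \<inter> X) + hausdorff1_outer ((UNIV - E) \<inter> X)"
    using hausdorff1_outer_Un[of "E \<inter> X" "(UNIV - E) \<inter> X"] by (simp add: Int_Un_distrib2[symmetric])
  moreover have "hausdorff1_outer (E \<inter> X) + hausdorff1_outer ((UNIV - E) \<inter> X) \<le> hausdorff1_outer X"
  proof (cases "E = {} \<or> hausdorff1_outer X = top")
    case True
    then show ?thesis by (auto simp: hausdorff1_outer_empty)
  next
    case False
    then have Ene: "E \<noteq> {}" and fin: "hausdorff1_outer X < top" by (auto simp: less_top)
    define A where "A n = {x \<in> X. infdist x E \<ge> 1 / real (Suc n)}" for n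
    have AX: "A n \<subseteq> X" for n by (auto simp: A_def)
    have Amono: "A n \<subseteq> A (Suc n)" for n
    proof
      fix x assume "x \<in> A n"
      moreover have "1 / real (Suc (Suc n)) \<le> 1 / real (Suc n)" by (intro divide_left_mono) auto
      ultimately show "x \<in> A (Suc n)" unfolding A_def by (auto intro: order_trans)
    qed
    \<comment> \<open>The index is shifted: this is ring number n + 1 of the description above, so
      that \<open>A n\<close> and \<open>R n\<close> with the same index are at positive
      distance.\<close>
    define R where "R n = A (Suc (Suc n)) - A (Suc n)" for n
    have sepE: "hausdorff1_outer (E \<inter> X) + hausdorff1_outer (A n) \<le> hausdorff1_outer X" for n
    proof -
      have "hausdorff1_outer (E \<inter> X) + hausdorff1_outer (A n) \<le> hausdorff1_outer (E \<inter> X \<union> A n)"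
      proof (rule hausdorff1_outer_separated[where d = "1 / real (Suc n)"])
        fix x y assume "x \<in> E \<inter> X" "y \<in> A n"
        then show "1 / real (Suc n) \<le> dist x y"
          using infdist_le[of x E y] by (auto simp: A_def dist_commute)
      qed simp
      also have "\<dots> \<le> hausdorff1_outer X" by (intro hausdorff1_outer_mono) (use AX in auto)
      finally show ?thesis .
    qed
    have sepR: "hausdorff1_outer (A n) + hausdorff1_outer (R n) \<le> hausdorff1_outer (A (Suc (Suc n)))" for n
    proof -
      have "1 / real (Suc (Suc n)) < 1 / real (Suc n)" by (intro divide_strict_left_mono) auto
      then have "1 / real (Suc n) - 1 / real (Suc (Suc n)) > 0" by simp
      then have "hausdorff1_outer (A n) + hausdorff1_outer (R n) \<le> hausdorff1_outer (A n \<union> R n)"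
      proof (rule hausdorff1_outer_separated)
        fix x y assume x: "x \<in> A n" and y: "y \<in> R n"
        have "infdist y E < 1 / real (Suc (Suc n))" using y by (auto simp: R_def A_def)
        moreover have "infdist x E \<ge> 1 / real (Suc n)" using x by (auto simp: A_def)
        moreover have "infdist x E \<le> infdist y E + dist x y" by (rule infdist_triangle)
        ultimately show "1 / real (Suc n) - 1 / real (Suc (Suc n)) \<le> dist x y" by linarith
      qed
      also have "\<dots> \<le> hausdorff1_outer (A (Suc (Suc n)))"
        by (intro hausdorff1_outer_mono) (use Amono R_def in blast)
      finally show ?thesis .
    qed
    \<comment> \<open>Each separation leads from \<open>A n\<close> to \<open>A (n + 2)\<close>, so
      the sum telescopes in steps of two and two consecutive terms remain.\<close>
    have sumR: "(\<Sum>k<N. hausdorff1_outer (R k)) \<le> hausdorff1_outer (A (Suc N)) + hausdorff1_outer (A N)" for N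
    proof (induction N)
      case (Suc N)
      have "(\<Sum>k<Suc N. hausdorff1_outer (R k)) \<le> hausdorff1_outer (A (Suc N)) + (hausdorff1_outer (A N) + hausdorff1_outer (R N))"
        using Suc by (simp add: add_right_mono add.assoc[symmetric])
      also have "\<dots> \<le> hausdorff1_outer (A (Suc N)) + hausdorff1_outer (A (Suc (Suc N)))"
        by (intro add_left_mono sepR)
      finally show ?case by (simp add: add.commute)
    qed simp
    have Rfin: "hausdorff1_outer (R n) < top" for n
      using fin hausdorff1_outer_mono[of "R n" X] AX by (auto simp: R_def intro: le_less_trans)
    define r where "r n = enn2real (hausdorff1_outer (R n))" for n
    have r: "hausdorff1_outer (R n) = ennreal (r n)" "r n \<ge> 0" for n using Rfin[of n] by (auto simp: r_def)
    have "(\<Sum>n. ennreal (r n)) \<le> hausdorff1_outer X + hausdorff1_outer X"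
      unfolding suminf_eq_SUP r(1)[symmetric]
    proof (rule SUP_least)
      fix N
      show "(\<Sum>k<N. hausdorff1_outer (R k)) \<le> hausdorff1_outer X + hausdorff1_outer X"
        using sumR[of N] add_mono[OF hausdorff1_outer_mono[OF AX[of "Suc N"]] hausdorff1_outer_mono[OF AX[of N]]] by (rule order_trans)
    qed
    also have "\<dots> < top" using fin by simp
    finally have sr: "summable r" using r(2) by (intro summable_suminf_not_top) auto
    have cov: "(UNIV - E) \<inter> X \<subseteq> A (Suc n) \<union> (\<Union>i. R (i + n))" for n
    proof
      fix x assume x: "x \<in> (UNIV - E) \<inter> X"
      then have "infdist x E > 0" using E Ene infdist_pos_not_in_closed by auto
      then obtain m where m: "1 / real (Suc m) < infdist x E" using nat_approx_posE by metis
      then have "x \<in> A m" using x by (simp add: A_def)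
      have mono: "i \<le> j \<Longrightarrow> A i \<subseteq> A j" for i j using lift_Suc_mono_le[of A] Amono by blast
      show "x \<in> A (Suc n) \<union> (\<Union>i. R (i + n))"
      proof (rule ccontr)
        assume no: "x \<notin> A (Suc n) \<union> (\<Union>i. R (i + n))"
        have "x \<notin> A (Suc (i + n))" for i
        proof (induction i)
          case (Suc i)
          have "x \<notin> R (i + n)" using no by blast
          then show ?case using Suc by (simp add: R_def)
        qed (use no in simp)
        then have "x \<notin> A (Suc (m + n))" .
        then show False using \<open>x \<in> A m\<close> mono[of m "Suc (m + n)"] by auto
      qed
    qed
    show ?thesis
    proof (rule ennreal_le_epsilon)
      fix e :: real assume e: "0 < e"
      obtain n where n: "norm (\<Sum>i. r (i + n)) < e" using suminf_exist_split[OF e sr] by blast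
      have "hausdorff1_outer ((UNIV - E) \<inter> X) \<le> hausdorff1_outer (A (Suc n)) + hausdorff1_outer (\<Union>i. R (i + n))"
        using hausdorff1_outer_mono[OF cov] hausdorff1_outer_Un order_trans by blast
      also have "hausdorff1_outer (\<Union>i. R (i + n)) \<le> (\<Sum>i. ennreal (r (i + n)))"
        using hausdorff1_outer_subadditive[of "\<lambda>i. R (i + n)"] by (simp add: r(1))
      also have "(\<Sum>i. ennreal (r (i + n))) = ennreal (\<Sum>i. r (i + n))"
        using r(2) sr by (intro suminf_ennreal2) (auto simp: summable_iff_shift)
      also have "\<dots> \<le> ennreal e" using n by (intro ennreal_leI) auto
      finally have "hausdorff1_outer ((UNIV - E) \<inter> X) \<le> hausdorff1_outer (A (Suc n)) + ennreal e" by (simp add: add_left_mono)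
      then have "hausdorff1_outer (E \<inter> X) + hausdorff1_outer ((UNIV - E) \<inter> X) \<le> hausdorff1_outer (E \<inter> X) + (hausdorff1_outer (A (Suc n)) + ennreal e)"
        by (rule add_left_mono)
      also have "\<dots> \<le> hausdorff1_outer X + ennreal e" using sepE by (simp add: add.assoc[symmetric] add_right_mono)
      finally show "hausdorff1_outer (E \<inter> X) + hausdorff1_outer ((UNIV - E) \<inter> X) \<le> hausdorff1_outer X + ennreal e" .
    qed
  qed
  ultimately show "hausdorff1_outer (E \<inter> X) + hausdorff1_outer ((UNIV - E) \<inter> X) = hausdorff1_outer X" by simp
qed

section \<open>Arc length as a complete measure on a sigma-algebra containing the Borel sets\<close>

lemma measure_space_hausdorff1:
  "measure_space UNIV (lambda_system UNIV UNIV hausdorff1_outer) hausdorff1_outer"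
proof -
  have "sigma_algebra (UNIV :: complex set) UNIV" using sigma_algebra_Pow[of "UNIV :: complex set"] by simp
  then show ?thesis using sigma_algebra.caratheodory_lemma outer_measure_hausdorff1 by blast
qed

lemma arc_length_basics:
  "space arc_length = UNIV" "sets arc_length = lambda_system UNIV UNIV hausdorff1_outer"
  "A \<in> sets arc_length \<Longrightarrow> emeasure arc_length A = hausdorff1_outer A"
proof -
  have sa: "sigma_algebra UNIV (lambda_system UNIV UNIV hausdorff1_outer)"
    and pc: "positive (lambda_system UNIV UNIV hausdorff1_outer) hausdorff1_outer"
      "countably_additive (lambda_system UNIV UNIV hausdorff1_outer) hausdorff1_outer"
    using measure_space_hausdorff1 by (auto simp: measure_space_def)
  show "space arc_length = UNIV" by (simp add: arc_length_def)
  show s: "sets arc_length = lambda_system UNIV UNIV hausdorff1_outer"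
    unfolding arc_length_def by (rule sigma_algebra.sets_measure_of_eq[OF sa])
  show "A \<in> sets arc_length \<Longrightarrow> emeasure arc_length A = hausdorff1_outer A"
    unfolding s unfolding arc_length_def by (rule emeasure_measure_of_sigma[OF sa pc])
qed

lemma borel_sets_arc_length: "sets borel \<subseteq> sets arc_length"
proof -
  have "sigma_sets UNIV {S :: complex set. closed S} \<subseteq> sets arc_length"
    using sets.sigma_sets_subset[of "{S. closed S}" arc_length] closed_lambda_hausdorff1
    by (auto simp: arc_length_basics)
  then show ?thesis by (simp add: borel_eq_closed)
qed

lemma borel_measurable_arc_length: "f \<in> borel_measurable borel \<Longrightarrow> f \<in> borel_measurable arc_length"
  using borel_sets_arc_length by (auto simp: measurable_def arc_length_basics)

text \<open>Completeness makes a set measurable as soon as it agrees with a Borel set up to a null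
  set. The outward normal is known only in this sense.\<close>

interpretation arc_length: complete_measure arc_length
proof
  fix A B :: "complex set" assume AB: "B \<subseteq> A" "A \<in> null_sets arc_length"
  then have "hausdorff1_outer A = 0" using arc_length_basics(3)[of A] by (auto simp: null_sets_def)
  then have B0: "hausdorff1_outer (B \<inter> X) = 0" for X
    using hausdorff1_outer_mono[of "B \<inter> X" A] AB(1) by (metis Int_lower1 le_zero_eq order_trans)
  show "B \<in> sets arc_length"
    unfolding arc_length_basics lambda_system_def
  proof (intro CollectI conjI ballI UNIV_I antisym)
    fix X :: "complex set"
    show "hausdorff1_outer (B \<inter> X) + hausdorff1_outer ((UNIV - B) \<inter> X) \<le> hausdorff1_outer X"
      unfolding B0 by (simp add: hausdorff1_outer_mono)
    show "hausdorff1_outer X \<le> hausdorff1_outer (B \<inter> X) + hausdorff1_outer ((UNIV - B) \<inter> X)"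
      using hausdorff1_outer_Un[of "B \<inter> X" "(UNIV - B) \<inter> X"] by (simp add: Int_Un_distrib2[symmetric])
  qed
qed

section \<open>Lower and upper estimates of the outer measure\<close>

text \<open>A contraction to the line maps each member of a covering into an interval as long as its
  diameter, so the diameters add up to at least the length of the image.\<close>

lemma hausdorff1_outer_projection:
  fixes \<pi> :: "complex \<Rightarrow> real"
  assumes lip: "\<And>z w. \<bar>\<pi> z - \<pi> w\<bar> \<le> dist z w" and sub: "{a<..b} \<subseteq> \<pi> ` A"
  shows "ennreal (b - a) \<le> hausdorff1_outer A"
proof (cases "a < b")
  case True
  have "ennreal (b - a) \<le> hausdorff1_delta 1 A"
  proof (rule hausdorff1_delta_greatest)
    fix C assume C: "h1_cover 1 A C"
    define l where "l n = (INF z\<in>C n. \<pi> z)" for n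
    \<comment> \<open>The empty member is treated apart, since an infimum over the empty set carries
      no information.\<close>
    define J where "J n = (if C n = {} then {} else {l n..l n + diameter (C n)})" for n
    have CJ: "\<pi> z \<in> J n" if z: "z \<in> C n" for z n
    proof -
      have bd: "bounded (C n)" using C by (simp add: h1_cover_def)
      have ge: "\<pi> z - diameter (C n) \<le> \<pi> w" if "w \<in> C n" for w
        using lip[of z w] diameter_bounded_bound[OF bd z that] by linarith
      then have "bdd_below (\<pi> ` C n)" by (auto intro!: bdd_belowI)
      then have "l n \<le> \<pi> z" unfolding l_def using z by (intro cINF_lower)
      moreover have "\<pi> z - diameter (C n) \<le> l n" unfolding l_def using z ge by (intro cINF_greatest) auto
      ultimately show ?thesis using z by (auto simp: J_def)
    qed
    have "{a<..b} \<subseteq> (\<Union>n. J n)"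
    proof
      fix x assume "x \<in> {a<..b}"
      then obtain z where "z \<in> A" "x = \<pi> z" using sub by auto
      moreover then obtain n where "z \<in> C n" using C by (auto simp: h1_cover_def)
      ultimately show "x \<in> (\<Union>n. J n)" using CJ by auto
    qed
    then have "emeasure lborel {a<..b} \<le> emeasure lborel (\<Union>n. J n)" by (intro emeasure_mono) (auto simp: J_def)
    also have "\<dots> \<le> (\<Sum>n. emeasure lborel (J n))" by (intro emeasure_subadditive_countably) (auto simp: J_def)
    also have "\<dots> \<le> (\<Sum>n. ennreal (diameter (C n)))"
      by (intro suminf_le summableI) (auto simp: J_def emeasure_lborel_Icc_eq)
    finally show "ennreal (b - a) \<le> (\<Sum>n. ennreal (diameter (C n)))" using True by simp
  qed
  also have "\<dots> \<le> hausdorff1_outer A" by (rule hausdorff1_outer_upper) simp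
  finally show ?thesis .
qed (simp add: ennreal_neg)

lemma hausdorff1_outer_finite_pieces:
  assumes "\<And>\<delta>. \<delta> > 0 \<Longrightarrow> \<exists>N P. A \<subseteq> (\<Union>i<N. P i) \<and> (\<forall>i<N. bounded (P i) \<and> diameter (P i) \<le> \<delta>) \<and> (\<Sum>i<N::nat. diameter (P i)) \<le> x"
  shows "hausdorff1_outer A \<le> ennreal x"
proof (rule hausdorff1_outer_least)
  fix \<delta> :: real assume d: "\<delta> > 0"
  then obtain N P where P: "A \<subseteq> (\<Union>i<N. P i)" "\<And>i. i < N \<Longrightarrow> bounded (P i) \<and> diameter (P i) \<le> \<delta>" "(\<Sum>i<N::nat. diameter (P i)) \<le> x"
    using assms by blast
  define C where "C i = (if i < N then P i else {})" for i
  have "h1_cover \<delta> A C" unfolding h1_cover_def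
  proof (intro conjI allI)
    show "A \<subseteq> \<Union> (range C)" using P(1) by (fastforce simp: C_def)
  qed (use P(2) d in \<open>auto simp: C_def\<close>)
  then have "hausdorff1_delta \<delta> A \<le> (\<Sum>n. ennreal (diameter (C n)))" by (rule hausdorff1_delta_le)
  also have "\<dots> = (\<Sum>n<N. ennreal (diameter (C n)))" by (rule suminf_finite) (auto simp: C_def)
  also have "\<dots> = ennreal (\<Sum>n<N. diameter (P n))"
    by (subst sum_ennreal[symmetric]) (auto simp: C_def intro!: sum.cong diameter_ge_0 P(2)[THEN conjunct1])
  also have "\<dots> \<le> ennreal x" using P(3) by (rule ennreal_leI)
  finally show "hausdorff1_delta \<delta> A \<le> ennreal x" .
qed

section \<open>Arc length on a Lipschitz graph\<close>

locale lipschitz_graph =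
  fixes p u :: complex and \<phi> :: "real \<Rightarrow> real" and L :: real
  assumes u: "norm u = 1" and lip: "L-lipschitz_on UNIV \<phi>"
begin

definition gr :: "real \<Rightarrow> complex" where "gr s = p + u * Complex s (\<phi> s)"
definition abscissa :: "complex \<Rightarrow> real" where "abscissa z = Re (cnj u * (z - p))"
definition ordinate :: "complex \<Rightarrow> real" where "ordinate z = Im (cnj u * (z - p))"
definition speed :: "real \<Rightarrow> real" where "speed s = norm (dquot_lim gr s)"

lemma cnj_u: "cnj u * u = 1" "u * cnj u = 1"
  using u complex_norm_square[of u] by (auto simp: mult.commute)

lemma coordinates [simp]:
  "abscissa (p + u * Complex s t) = s" "ordinate (p + u * Complex s t) = t"
  "p + u * Complex (abscissa z) (ordinate z) = z"
proof -
  have "cnj u * (p + u * w - p) = w" for w using cnj_u by (simp add: mult.assoc[symmetric])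
  then show "abscissa (p + u * Complex s t) = s" "ordinate (p + u * Complex s t) = t"
    unfolding abscissa_def ordinate_def by (simp_all only: complex.sel)
  have X: "u * (cnj u * (z - p)) = z - p" unfolding mult.assoc[symmetric] cnj_u by simp
  show "p + u * Complex (abscissa z) (ordinate z) = z"
    unfolding abscissa_def ordinate_def complex_surj X by simp
qed

lemma abscissa_gr [simp]: "abscissa (gr s) = s" and ordinate_gr [simp]: "ordinate (gr s) = \<phi> s"
  by (simp_all add: gr_def)

lemma inj_gr: "inj gr"
  by (rule inj_on_inverseI[of _ abscissa]) simp

lemma continuous_coordinates: "continuous_on S abscissa" "continuous_on S ordinate"
  unfolding abscissa_def[abs_def] ordinate_def[abs_def] by (intro continuous_intros)+

lemma coordinate_diff:
  "abscissa z - abscissa w = Re (cnj u * (z - w))" "ordinate z - ordinate w = Im (cnj u * (z - w))"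
  by (simp_all add: abscissa_def ordinate_def algebra_simps)

lemma abscissa_lipschitz: "\<bar>abscissa z - abscissa w\<bar> \<le> dist z w"
  using abs_Re_le_cmod[of "cnj u * (z - w)"] u by (simp add: coordinate_diff norm_mult dist_norm del: times_complex.sel minus_complex.sel)

lemma L_nonneg: "L \<ge> 0" using lip by (rule lipschitz_on_nonneg)

lemma continuous_phi: "continuous_on S \<phi>"
  using lip lipschitz_on_continuous_on lipschitz_on_subset by blast

lemma lipschitz_gr: "(1 + L)-lipschitz_on UNIV gr"
proof (rule lipschitz_onI)
  fix x y
  have "gr x - gr y = u * Complex (x - y) (\<phi> x - \<phi> y)" by (simp add: gr_def complex_eq_iff algebra_simps)
  then have "dist (gr x) (gr y) = norm (Complex (x - y) (\<phi> x - \<phi> y))" using u by (simp add: dist_norm norm_mult)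
  also have "\<dots> \<le> \<bar>x - y\<bar> + \<bar>\<phi> x - \<phi> y\<bar>" using cmod_le[of "Complex (x - y) (\<phi> x - \<phi> y)"] by simp
  also have "\<bar>\<phi> x - \<phi> y\<bar> \<le> L * dist x y" using lipschitz_onD[OF lip, of x y] by (simp add: dist_real_def)
  finally show "dist (gr x) (gr y) \<le> (1 + L) * dist x y" by (simp add: dist_real_def algebra_simps)
qed (use L_nonneg in simp)

lemma continuous_gr: "continuous_on S gr"
  using lipschitz_gr lipschitz_on_continuous_on lipschitz_on_subset by blast

lemma borel_gr [measurable]: "gr \<in> borel_measurable borel"
  using continuous_gr by (rule borel_measurable_continuous_onI)

lemma borel_speed [measurable]: "speed \<in> borel_measurable borel"
  unfolding speed_def[abs_def] by measurable

lemma speed_nonneg: "speed s \<ge> 0" by (simp add: speed_def)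

lemma borel_abscissa [measurable]: "abscissa \<in> borel_measurable borel"
  by (rule borel_measurable_continuous_onI[OF continuous_coordinates(1)])

lemma range_gr: "range gr = {z. ordinate z = \<phi> (abscissa z)}"
proof
  show "{z. ordinate z = \<phi> (abscissa z)} \<subseteq> range gr"
  proof clarify
    fix z assume "ordinate z = \<phi> (abscissa z)"
    then have "gr (abscissa z) = z" unfolding gr_def using coordinates(3)[of z] by simp
    then show "z \<in> range gr" by (metis rangeI)
  qed
qed auto

lemma closed_range_gr: "closed (range gr)"
  unfolding range_gr using continuous_phi[of UNIV]
  by (intro closed_Collect_eq continuous_coordinates continuous_on_compose2[OF continuous_phi[of UNIV] continuous_coordinates(1)]) auto

lemma image_gr: "gr ` S = range gr \<inter> abscissa -` S"
  by (auto simp: image_iff)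

lemma gr_sets: "S \<in> sets borel \<Longrightarrow> gr ` S \<in> sets borel"
proof -
  assume "S \<in> sets borel"
  then have "abscissa -` S \<in> sets borel" using measurable_sets[OF borel_abscissa, of S] by simp
  then show ?thesis unfolding image_gr[of S] using closed_range_gr by (intro sets.Int) auto
qed

lemma gr_arc_sets: "S \<in> sets borel \<Longrightarrow> gr ` S \<in> sets arc_length"
  using gr_sets borel_sets_arc_length by blast

lemma speed_integrable: "a \<le> b \<Longrightarrow> set_integrable lborel {a..b} speed"
  using lipschitz_FTC(1)[OF lipschitz_gr] unfolding speed_def[abs_def] by (rule set_integrable_norm)

lemma speed_integrable_on: "speed integrable_on {a..b}"
proof (cases "a \<le> b")
  case True
  then show ?thesis using set_borel_integral_eq_integral(1)[OF speed_integrable] by blast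
qed auto

lemma gr_dist_le_speed:
  assumes "x \<le> y" shows "norm (gr y - gr x) \<le> integral {x..y} speed"
proof -
  have "norm (gr y - gr x) = norm (LINT s:{x..y}|lborel. dquot_lim gr s)"
    using lipschitz_FTC(2)[OF lipschitz_gr assms] by simp
  also have "\<dots> \<le> (LINT s:{x..y}|lborel. norm (dquot_lim gr s))"
    by (rule set_integral_norm_bound[OF lipschitz_FTC(1)[OF lipschitz_gr assms]])
  also have "\<dots> = integral {x..y} speed"
    using set_borel_integral_eq_integral(2)[OF speed_integrable[OF assms]] by (simp add: speed_def)
  finally show ?thesis .
qed

section \<open>The area formula for a graph\<close>

text \<open>The increments of \<open>W\<close> dominate chords, so the diameters of the pieces of a
  fine subdivision are bounded by a telescoping sum. It is applied to the accumulated speed and to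
  the linear function (1 + L) x.\<close>

lemma hausdorff1_graph_le:
  assumes ab: "a \<le> b" and W: "\<And>x y. a \<le> x \<Longrightarrow> x \<le> y \<Longrightarrow> norm (gr y - gr x) \<le> W y - W x"
  shows "hausdorff1_outer (gr ` {a..b}) \<le> ennreal (W b - W a)"
proof (rule hausdorff1_outer_finite_pieces)
  fix \<delta> :: real assume d: "\<delta> > 0"
  \<comment> \<open>With N equal parts the Lipschitz constant 1 + L of \<open>gr\<close> keeps every
    piece within diameter \<delta>.\<close>
  obtain N where N: "(1 + L) * (b - a) / \<delta> < real N" using reals_Archimedean2 by blast
  have "(1 + L) * (b - a) / \<delta> \<ge> 0" using ab d L_nonneg by simp
  then have N0: "real N > 0" using N by linarith
  define s where "s i = a + (b - a) * real i / real N" for i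
  have sle: "s i \<le> s (Suc i)" for i using ab N0 by (simp add: s_def divide_right_mono mult_left_mono)
  have as: "a \<le> s i" for i using ab by (simp add: s_def)
  have sN: "s 0 = a" "s N = b" using N0 by (auto simp: s_def)
  have step: "s (Suc i) - s i = (b - a) / real N" for i by (simp add: s_def diff_divide_distrib[symmetric] algebra_simps)
  define P where "P i = gr ` {s i..s (Suc i)}" for i
  have Wmono: "W x \<le> W y" if "a \<le> x" "x \<le> y" for x y using W[OF that] norm_ge_zero[of "gr y - gr x"] by linarith
  have diam1: "diameter (P i) \<le> W (s (Suc i)) - W (s i)" for i
  proof (rule diameter_le)
    show "P i \<noteq> {} \<or> 0 \<le> W (s (Suc i)) - W (s i)" using sle by (auto simp: P_def)
    have *: "norm (gr x - gr y) \<le> W (s (Suc i)) - W (s i)" if "x \<in> {s i..s (Suc i)}" "y \<in> {s i..s (Suc i)}" "y \<le> x" for x y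
    proof -
      have "a \<le> y" using that as[of i] by simp
      then have "norm (gr x - gr y) \<le> W x - W y" using that by (intro W)
      moreover have "W x \<le> W (s (Suc i))" using that \<open>a \<le> y\<close> by (intro Wmono) auto
      moreover have "W (s i) \<le> W y" using that as by (intro Wmono) auto
      ultimately show ?thesis by linarith
    qed
    show "norm (x - y) \<le> W (s (Suc i)) - W (s i)" if "x \<in> P i" "y \<in> P i" for x y
      using that *  unfolding P_def by (smt (verit, best) image_iff norm_minus_commute)
  qed
  have diam2: "diameter (P i) \<le> \<delta>" for i
  proof (rule diameter_le)
    show "norm (x - y) \<le> \<delta>" if xy: "x \<in> P i" "y \<in> P i" for x y
    proof -
      obtain s' t' where st: "x = gr s'" "y = gr t'" "s' \<in> {s i..s (Suc i)}" "t' \<in> {s i..s (Suc i)}"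
        using xy by (auto simp: P_def)
      have "norm (x - y) \<le> (1 + L) * dist s' t'" using lipschitz_onD[OF lipschitz_gr, of s' t'] st by (simp add: dist_norm)
      also have "\<dots> \<le> (1 + L) * ((b - a) / real N)"
        using st step[of i] L_nonneg by (intro mult_left_mono) (auto simp: dist_real_def abs_le_iff)
      also have "\<dots> \<le> \<delta>" using N N0 d by (simp add: field_simps)
      finally show ?thesis .
    qed
  qed (use d in simp)
  have "gr ` {a..b} \<subseteq> (\<Union>i<N. P i)"
  proof clarify
    fix x assume x: "x \<in> {a..b}"
    have "\<exists>i<n. x \<in> {s i..s (Suc i)}" if "x \<le> s n" "n > 0" for n
      using that
    proof (induction n)
      case (Suc n)
      show ?case
      proof (cases "n > 0 \<and> x \<le> s n")
        case True then show ?thesis using Suc.IH less_SucI by blast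
      next
        case False
        then have "s n \<le> x" using x sN by (cases "n = 0") auto
        then show ?thesis using Suc.prems by (intro exI[of _ n]) auto
      qed
    qed simp
    then obtain i where "i < N" "x \<in> {s i..s (Suc i)}" using x sN N0 by (metis atLeastAtMost_iff of_nat_0_less_iff)
    then have "gr x \<in> P i" unfolding P_def by (intro imageI)
    then show "gr x \<in> (\<Union>i<N. P i)" using \<open>i < N\<close> by auto
  qed
  moreover have "bounded (P i)" for i
    unfolding P_def by (intro compact_imp_bounded compact_continuous_image continuous_gr) auto
  moreover have "(\<Sum>i<N. diameter (P i)) \<le> W b - W a"
  proof -
    have "(\<Sum>i<N. diameter (P i)) \<le> (\<Sum>i<N. W (s (Suc i)) - W (s i))" by (intro sum_mono diam1)
    also have "\<dots> = W (s N) - W (s 0)" by (rule sum_lessThan_telescope)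
    finally show ?thesis by (simp add: sN)
  qed
  ultimately show "\<exists>N P. gr ` {a..b} \<subseteq> (\<Union>i<N. P i) \<and> (\<forall>i<N. bounded (P i) \<and> diameter (P i) \<le> \<delta>) \<and> (\<Sum>i<N::nat. diameter (P i)) \<le> W b - W a"
    using diam2 by blast
qed

text \<open>By the intermediate value theorem the arc projects onto its whole chord, and the
  projection is a contraction. Half-open intervals are used because lengths over adjacent ones add
  up.\<close>

lemma hausdorff1_graph_ge:
  assumes ab: "a \<le> b"
  shows "ennreal (norm (gr b - gr a)) \<le> hausdorff1_outer (gr ` {a<..b})"
proof (cases "gr b = gr a")
  case False
  define e where "e = (gr b - gr a) / of_real (norm (gr b - gr a))"
  have ne: "norm e = 1" using False by (simp add: e_def norm_divide)
  define \<rho> where "\<rho> z = Re (cnj e * z)" for z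
  have lipr: "\<bar>\<rho> z - \<rho> w\<bar> \<le> dist z w" for z w
  proof -
    have "\<rho> z - \<rho> w = Re (cnj e * (z - w))" by (simp add: \<rho>_def algebra_simps)
    then show ?thesis using abs_Re_le_cmod[of "cnj e * (z - w)"] ne by (simp add: norm_mult dist_norm del: times_complex.sel minus_complex.sel)
  qed
  have diff: "\<rho> (gr b) - \<rho> (gr a) = norm (gr b - gr a)"
  proof -
    have "cnj e * (gr b - gr a) = of_real (norm (gr b - gr a))"
      using False complex_norm_square[of "gr b - gr a"] by (simp add: e_def field_simps power2_eq_square)
    moreover have "\<rho> (gr b) - \<rho> (gr a) = Re (cnj e * (gr b - gr a))" by (simp add: \<rho>_def algebra_simps)
    ultimately show ?thesis by (simp only: Re_complex_of_real)
  qed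
  have c: "continuous_on {a..b} (\<lambda>s. \<rho> (gr s))" unfolding \<rho>_def by (intro continuous_intros continuous_gr)
  have "{\<rho> (gr a)<..\<rho> (gr b)} \<subseteq> \<rho> ` (gr ` {a<..b})"
  proof
    fix y assume y: "y \<in> {\<rho> (gr a)<..\<rho> (gr b)}"
    then obtain x where x: "a \<le> x" "x \<le> b" "\<rho> (gr x) = y"
      using IVT'[of "\<lambda>s. \<rho> (gr s)" a y b, OF _ _ ab c] by auto
    have "x \<noteq> a" using x y by auto
    then show "y \<in> \<rho> ` (gr ` {a<..b})" using x by (auto intro!: image_eqI[of _ _ "gr x"] image_eqI[of _ _ x])
  qed
  from hausdorff1_outer_projection[of \<rho>, OF lipr this] show ?thesis unfolding diff .
qed simp

text \<open>The upper bound holds because chords are at most the integral of the speed. For the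
  lower bound the length of the arc up to x is a Lipschitz function of x whose increments dominate
  chords; its derivative is therefore at least the speed almost everywhere, and the derivative
  integrates to the increment.\<close>

lemma hausdorff1_graph_Ioc:
  assumes ab: "a \<le> b"
  shows "hausdorff1_outer (gr ` {a<..b}) = ennreal (integral {a..b} speed)"
proof (rule antisym)
  have W: "norm (gr y - gr x) \<le> integral {a..y} speed - integral {a..x} speed" if "a \<le> x" "x \<le> y" for x y
    using gr_dist_le_speed[OF that(2)] Henstock_Kurzweil_Integration.integral_combine[OF that speed_integrable_on] by simp
  have "hausdorff1_outer (gr ` {a<..b}) \<le> hausdorff1_outer (gr ` {a..b})" by (intro hausdorff1_outer_mono) auto
  also have "\<dots> \<le> ennreal (integral {a..b} speed - integral {a..a} speed)"
    using hausdorff1_graph_le[OF ab, of "\<lambda>y. integral {a..y} speed"] W by blast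
  finally show "hausdorff1_outer (gr ` {a<..b}) \<le> ennreal (integral {a..b} speed)" by simp
next
  define K where "K = 1 + L"
  have K: "K \<ge> 0" using L_nonneg by (simp add: K_def)
  have up: "hausdorff1_outer (gr ` {x<..y}) \<le> ennreal (K * (y - x))" if "x \<le> y" for x y
  proof -
    have "hausdorff1_outer (gr ` {x<..y}) \<le> hausdorff1_outer (gr ` {x..y})" by (intro hausdorff1_outer_mono) auto
    also have "\<dots> \<le> ennreal (K * y - K * x)"
    proof (rule hausdorff1_graph_le[OF that])
      fix v w assume "x \<le> v" "v \<le> w"
      then show "norm (gr w - gr v) \<le> K * w - K * v"
        using lipschitz_onD[OF lipschitz_gr, of w v] by (simp add: K_def dist_norm algebra_simps)
    qed
    finally show ?thesis by (simp add: algebra_simps)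
  qed
  \<comment> \<open>The length of the arc from a to x, equal to 0 to the left of a.\<close>
  define G where "G x = enn2real (hausdorff1_outer (gr ` {a<..x}))" for x
  have fin: "hausdorff1_outer (gr ` {x<..y}) < top" for x y
  proof (cases "x \<le> y")
    case True then show ?thesis using up[OF True] le_less_trans by (metis ennreal_less_top)
  qed (simp add: hausdorff1_outer_empty)
  have inc: "ennreal (G y - G x) = hausdorff1_outer (gr ` {x<..y}) \<and> G x \<le> G y" if "a \<le> x" "x \<le> y" for x y
  proof -
    have "gr ` {a<..x} \<union> gr ` {x<..y} = gr ` {a<..y}" using that by (auto simp: image_Un[symmetric] ivl_disj_un)
    moreover have "gr ` {a<..x} \<inter> gr ` {x<..y} = {}" unfolding image_Int[OF inj_gr, symmetric] by auto
    ultimately have "hausdorff1_outer (gr ` {a<..x}) + hausdorff1_outer (gr ` {x<..y}) = hausdorff1_outer (gr ` {a<..y})"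
      using plus_emeasure[of "gr ` {a<..x}" arc_length "gr ` {x<..y}"] gr_arc_sets by (simp add: arc_length_basics)
    then have e: "ennreal (G x) + hausdorff1_outer (gr ` {x<..y}) = ennreal (G y)" using fin by (simp add: G_def)
    define h where "h = enn2real (hausdorff1_outer (gr ` {x<..y}))"
    have h: "hausdorff1_outer (gr ` {x<..y}) = ennreal h" "h \<ge> 0" using fin by (simp_all add: h_def)
    have nn: "G t \<ge> 0" for t by (simp add: G_def)
    have "ennreal (G x + h) = ennreal (G y)" using e h nn by (simp add: ennreal_plus)
    then have "G x + h = G y" by (rule ennreal_inj[THEN iffD1, rotated 2]) (use h nn in auto)
    then show ?thesis using h by auto
  qed
  have Gneg: "G x = 0" if "x \<le> a" for x using that by (simp add: G_def hausdorff1_outer_empty)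
  \<comment> \<open>The fundamental theorem is stated for functions that are Lipschitz on the whole
    line, hence the cases in which x, or both x and y, lie to the left of a.\<close>
  have lipG0: "G y - G x \<le> K * (y - x) \<and> G x \<le> G y" if "x \<le> y" for x y
  proof (cases "a \<le> x")
    case True
    have "ennreal (G y - G x) \<le> ennreal (K * (y - x))" using inc[OF True that] up[OF that] by simp
    then have "G y - G x \<le> K * (y - x)" by (rule ennreal_le_iff[THEN iffD1, rotated]) (use K that in auto)
    then show ?thesis using inc[OF True that] by simp
  next
    case False
    show ?thesis
    proof (cases "a \<le> y")
      case True
      have "ennreal (G y - G a) \<le> ennreal (K * (y - a))" using inc[of a y] up[OF True] True by simp
      then have "G y - G a \<le> K * (y - a)" by (rule ennreal_le_iff[THEN iffD1, rotated]) (use K True in auto)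
      moreover have "K * (y - a) \<le> K * (y - x)" using False K by (intro mult_left_mono) auto
      moreover have "G a \<le> G y" using inc[of a y] True by simp
      ultimately show ?thesis using Gneg[of a] Gneg[of x] False by simp
    next
      case F2: False
      then show ?thesis using False Gneg K that by simp
    qed
  qed
  have lipG: "K-lipschitz_on UNIV G"
  proof (rule lipschitz_onI[OF _ K])
    fix x y show "dist (G x) (G y) \<le> K * dist x y"
      using lipG0[of x y] lipG0[of y x] by (cases "x \<le> y") (auto simp: dist_real_def abs_if)
  qed
  have "(LINT s:{a..b}|lborel. speed s) \<le> (LINT s:{a..b}|lborel. dquot_lim G s)"
  proof (rule set_integral_mono_AE[OF speed_integrable[OF ab] lipschitz_FTC(1)[OF lipG ab]])
    have "AE s in lborel. s \<in> {a..b} \<longrightarrow> speed s \<le> dquot_lim G s"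
      using lipschitz_AE_has_vector_derivative[OF lipG] lipschitz_AE_has_vector_derivative[OF lipschitz_gr]
    proof eventually_elim
      case (elim s)
      show ?case
      proof
        assume s: "s \<in> {a..b}"
        have "(\<lambda>n. norm (real (Suc n) *\<^sub>R (gr (s + 1 / real (Suc n)) - gr s))) \<longlonglongrightarrow> speed s"
          unfolding speed_def using elim by (intro tendsto_norm dquot_lim_eq(1)) auto
        moreover have "(\<lambda>n. real (Suc n) *\<^sub>R (G (s + 1 / real (Suc n)) - G s)) \<longlonglongrightarrow> dquot_lim G s"
          using elim by (intro dquot_lim_eq(1)) auto
        ultimately show "speed s \<le> dquot_lim G s"
        proof (rule LIMSEQ_le, intro exI allI impI)
          fix n
          let ?t = "s + 1 / real (Suc n)"
          have st: "s \<le> ?t" by simp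
          have "ennreal (norm (gr ?t - gr s)) \<le> ennreal (G ?t - G s)"
            using hausdorff1_graph_ge[OF st] inc[OF _ st] s by simp
          moreover have "0 \<le> G ?t - G s" using inc[OF _ st] s by simp
          ultimately have "norm (gr ?t - gr s) \<le> G ?t - G s" by (rule ennreal_le_iff[THEN iffD1, rotated])
          then show "norm (real (Suc n) *\<^sub>R (gr ?t - gr s)) \<le> real (Suc n) *\<^sub>R (G ?t - G s)"
            by (simp del: of_nat_Suc add: mult_left_mono)
        qed
      qed
    qed
    then show "AE s \<in> {a..b} in lborel. speed s \<le> dquot_lim G s" by simp
  qed
  also have "\<dots> = G b - G a" by (rule lipschitz_FTC(2)[OF lipG ab])
  finally have "integral {a..b} speed \<le> G b - G a"
    using set_borel_integral_eq_integral(2)[OF speed_integrable[OF ab]] by simp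
  then have "ennreal (integral {a..b} speed) \<le> ennreal (G b - G a)" by (rule ennreal_leI)
  then show "ennreal (integral {a..b} speed) \<le> hausdorff1_outer (gr ` {a<..b})" using inc[of a b] ab by simp
qed

lemma abscissa_measurable_arc: "abscissa \<in> restrict_space arc_length (range gr) \<rightarrow>\<^sub>M borel"
  by (intro measurable_restrict_space1 borel_measurable_arc_length borel_abscissa)

lemma range_gr_arc: "range gr \<in> sets arc_length"
  using gr_arc_sets[of UNIV] by simp

text \<open>The two measures agree on half-open intervals by the length formula for arcs, and these
  intervals are stable under intersection and generate the Borel sets.\<close>

lemma distr_arc_length: "distr (restrict_space arc_length (range gr)) borel abscissa = density lborel (\<lambda>s. ennreal (speed s))"
proof (rule measure_eqI_generator_eq)
  let ?M = "distr (restrict_space arc_length (range gr)) borel abscissa"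
  let ?E = "range (\<lambda>(a, b). {a <.. b::real})"
  have em: "emeasure ?M S = hausdorff1_outer (gr ` S)" if "S \<in> sets borel" for S
  proof -
    have "emeasure ?M S = emeasure (restrict_space arc_length (range gr)) (abscissa -` S \<inter> range gr)"
      using that by (subst emeasure_distr[OF abscissa_measurable_arc]) (auto simp: space_restrict_space arc_length_basics)
    also have "abscissa -` S \<inter> range gr = gr ` S" unfolding image_gr[of S] by auto
    also have "emeasure (restrict_space arc_length (range gr)) (gr ` S) = emeasure arc_length (gr ` S)"
      using range_gr_arc by (intro emeasure_restrict_space) (auto simp: arc_length_basics)
    finally show ?thesis using gr_arc_sets[OF that] by (simp add: arc_length_basics)
  qed
  show "Int_stable ?E" by (auto simp: Int_stable_def)
  show "?E \<subseteq> Pow UNIV" by simp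
  show "sets ?M = sigma_sets UNIV ?E" "sets (density lborel (\<lambda>s. ennreal (speed s))) = sigma_sets UNIV ?E"
    unfolding sets_distr sets_density sets_lborel by (subst borel_sigma_sets_Ioc, simp)+
  show "range (\<lambda>i::nat. {- real i<..real i}) \<subseteq> ?E" by auto
  show "(\<Union>i::nat. {- real i<..real i}) = UNIV"
  proof (intro UNIV_eq_I[symmetric])
    fix x :: real
    obtain n where "\<bar>x\<bar> < real n" using reals_Archimedean2 by blast
    then show "x \<in> (\<Union>i::nat. {- real i<..real i})" by (intro UN_I[of n]) auto
  qed
  show "emeasure ?M {- real i<..real i} \<noteq> \<infinity>" for i
    using em[of "{- real i<..real i}"] hausdorff1_graph_Ioc[of "- real i" "real i"] by simp
  fix X assume "X \<in> ?E"
  then obtain a b where X: "X = {a<..b}" by auto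
  show "emeasure ?M X = emeasure (density lborel (\<lambda>s. ennreal (speed s))) X"
  proof (cases "a \<le> b")
    case True
    have "emeasure (density lborel (\<lambda>s. ennreal (speed s))) X = (\<integral>\<^sup>+s. ennreal (speed s) * indicator {a<..b} s \<partial>lborel)"
      unfolding X by (subst emeasure_density) auto
    also have "\<dots> = (\<integral>\<^sup>+s. ennreal (speed s) * indicator {a..b} s \<partial>lborel)"
      using AE_lborel_singleton[of a] by (intro nn_integral_cong_AE, eventually_elim) (auto simp: indicator_def)
    also have "\<dots> = ennreal (integral {a..b} speed)"
      by (rule nn_integral_has_integral_lebesgue') (auto simp: speed_nonneg intro: integrable_integral speed_integrable_on)
    finally show ?thesis using em[of X] hausdorff1_graph_Ioc[OF True] X by simp
  qed (simp add: X)
qed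

lemma arc_length_graph_integral:
  fixes f :: "complex \<Rightarrow> complex"
  assumes f[measurable]: "f \<in> borel_measurable borel" and S[measurable]: "S \<in> sets borel"
  shows "(LINT z:gr ` S|arc_length. f z) = (LINT s:S|lborel. speed s *\<^sub>R f (gr s))"
proof -
  define k where "k s = indicator S s *\<^sub>R f (gr s)" for s
  have k[measurable]: "k \<in> borel_measurable borel" unfolding k_def by measurable
  have "(LINT z:gr ` S|arc_length. f z) = (LINT z|arc_length. indicator (range gr) z *\<^sub>R k (abscissa z))"
    unfolding set_lebesgue_integral_def
  proof (rule Bochner_Integration.integral_cong[OF refl])
    fix z
    show "indicator (gr ` S) z *\<^sub>R f z = indicator (range gr) z *\<^sub>R k (abscissa z)"
    proof (cases "z \<in> range gr")
      case True
      then obtain s where "z = gr s" by auto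
      then show ?thesis unfolding image_gr[of S] by (auto simp: k_def indicator_def)
    qed (auto simp: indicator_def)
  qed
  also have "\<dots> = integral\<^sup>L (restrict_space arc_length (range gr)) (\<lambda>z. k (abscissa z))"
    using range_gr_arc by (intro integral_restrict_space[symmetric]) (auto simp: arc_length_basics)
  also have "\<dots> = integral\<^sup>L (distr (restrict_space arc_length (range gr)) borel abscissa) k"
    by (rule integral_distr[symmetric, OF abscissa_measurable_arc]) measurable
  also have "\<dots> = (LINT s|lborel. speed s *\<^sub>R k s)"
    unfolding distr_arc_length by (rule integral_density) (auto simp: speed_nonneg)
  also have "\<dots> = (LINT s:S|lborel. speed s *\<^sub>R f (gr s))"
    unfolding set_lebesgue_integral_def k_def by (simp add: mult.commute)
  finally show ?thesis .
qed

lemma arc_length_graph_null: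
  assumes "N \<in> null_sets lborel" shows "gr ` N \<in> null_sets arc_length"
proof -
  have N: "N \<in> sets borel" using assms by auto
  have "emeasure arc_length (gr ` N) = emeasure (distr (restrict_space arc_length (range gr)) borel abscissa) N"
  proof -
    have "emeasure (distr (restrict_space arc_length (range gr)) borel abscissa) N = emeasure (restrict_space arc_length (range gr)) (abscissa -` N \<inter> range gr)"
      using N by (subst emeasure_distr[OF abscissa_measurable_arc]) (auto simp: space_restrict_space arc_length_basics)
    also have "abscissa -` N \<inter> range gr = gr ` N" unfolding image_gr[of N] by auto
    also have "emeasure (restrict_space arc_length (range gr)) (gr ` N) = emeasure arc_length (gr ` N)"
      using range_gr_arc by (intro emeasure_restrict_space) (auto simp: arc_length_basics)
    finally show ?thesis ..
  qed
  also have "\<dots> = 0"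
  proof -
    have "AE s in lborel. s \<in> N \<longrightarrow> ennreal (speed s) = 0" using AE_not_in[OF assms] by eventually_elim simp
    then have "N \<in> null_sets (density lborel (\<lambda>s. ennreal (speed s)))"
      using N by (subst null_sets_density_iff) auto
    then show ?thesis unfolding distr_arc_length by (simp add: null_sets_def)
  qed
  finally show ?thesis using gr_arc_sets[OF N] by (simp add: null_sets_def)
qed

lemma arc_length_graph_finite: "emeasure arc_length (gr ` {a<..<b}) < top"
proof (cases "a \<le> b")
  case True
  have "emeasure arc_length (gr ` {a<..<b}) \<le> emeasure arc_length (gr ` {a<..b})"
    by (intro emeasure_mono gr_arc_sets image_mono) auto
  also have "\<dots> < top" using hausdorff1_graph_Ioc[OF True] gr_arc_sets[of "{a<..b}"] by (simp add: arc_length_basics)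
  finally show ?thesis .
qed simp

end

section \<open>The outward normal\<close>

text \<open>Move from z in the direction m - n. Its inner product with n is -c and with m is c,
  where c = 1 - <n, m>, so a short step lands inside \<Omega> according to n and outside according
  to m.\<close>

lemma outward_unit_normal_unique:
  assumes n: "is_outward_unit_normal \<Omega> z n" and m: "is_outward_unit_normal \<Omega> z m"
  shows "n = m"
proof (rule ccontr)
  assume ne: "n \<noteq> m"
  define c where "c = 1 - Re (n * cnj m)"
  define d where "d = m - n"
  have nn: "norm n = 1" "norm m = 1" using n m by (auto simp: is_outward_unit_normal_def)
  then have sq: "n * cnj n = 1" "m * cnj m = 1" using complex_norm_square[of n] complex_norm_square[of m] by auto
  have sym: "Re (m * cnj n) = Re (n * cnj m)" by simp
  have dn: "Re (d * cnj n) = - c" unfolding d_def left_diff_distrib minus_complex.sel(1) sq sym c_def by simp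
  have dm: "Re (d * cnj m) = c" unfolding d_def left_diff_distrib minus_complex.sel(1) sq c_def by simp
  have d0: "norm d > 0" using ne by (simp add: d_def)
  have "(norm d)\<^sup>2 = 2 * c"
  proof -
    have "complex_of_real ((norm d)\<^sup>2) = d * cnj d" by (rule complex_norm_square)
    also have "cnj d = cnj m - cnj n" by (simp add: d_def)
    finally have "complex_of_real ((norm d)\<^sup>2) = d * cnj m - d * cnj n" by (simp only: right_diff_distrib)
    then have "Re (complex_of_real ((norm d)\<^sup>2)) = Re (d * cnj m - d * cnj n)" by (simp only:)
    then show ?thesis unfolding minus_complex.sel(1) dn dm by simp
  qed
  then have c: "c > 0" using d0 by (metis mult_pos_pos zero_less_mult_pos zero_less_numeral zero_less_power)
  \<comment> \<open>Half of the slope c / |m - n| of the move against either normal, which makes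
    both cone conditions strict.\<close>
  define \<epsilon> where "\<epsilon> = c / (2 * norm d)"
  have e: "\<epsilon> > 0" using c d0 by (simp add: \<epsilon>_def)
  obtain \<delta>1 where d1: "\<delta>1 > 0" "\<And>w. 0 < dist w z \<Longrightarrow> dist w z < \<delta>1 \<Longrightarrow> Re ((w - z) * cnj n) < - \<epsilon> * dist w z \<Longrightarrow> w \<in> \<Omega>"
    using n e unfolding is_outward_unit_normal_def by blast
  obtain \<delta>2 where d2: "\<delta>2 > 0" "\<And>w. 0 < dist w z \<Longrightarrow> dist w z < \<delta>2 \<Longrightarrow> Re ((w - z) * cnj m) > \<epsilon> * dist w z \<Longrightarrow> w \<notin> \<Omega>"
    using m e unfolding is_outward_unit_normal_def by blast
  define t where "t = min \<delta>1 \<delta>2 / (2 * norm d)"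
  have t: "t > 0" using d0 d1(1) d2(1) by (simp add: t_def)
  define w where "w = z + of_real t * d"
  have dw: "dist w z = t * norm d" using t by (simp add: w_def dist_norm norm_mult)
  have lt: "dist w z < \<delta>1" "dist w z < \<delta>2" "0 < dist w z"
    using d0 d1(1) d2(1) t unfolding dw by (auto simp: t_def min_def)
  have ed: "\<epsilon> * dist w z = t * c / 2" using d0 by (simp add: \<epsilon>_def dw)
  have wz: "(w - z) * x = of_real t * (d * x)" for x by (simp add: w_def mult.assoc)
  have rt: "Re (of_real t * y) = t * Re y" for y by simp
  have tc: "t * c > 0" using t c by (rule mult_pos_pos)
  have "Re ((w - z) * cnj n) < - \<epsilon> * dist w z"
    unfolding wz rt dn mult_minus_right mult_minus_left using ed tc by linarith
  moreover have "Re ((w - z) * cnj m) > \<epsilon> * dist w z"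
    unfolding wz rt dm using ed tc by linarith
  ultimately have "Re ((w - z) * cnj n) < - \<epsilon> * dist w z" "Re ((w - z) * cnj m) > \<epsilon> * dist w z" .
  then show False using d1(2) d2(2) lt by blast
qed

lemma outward_normal_eq: "is_outward_unit_normal \<Omega> z n \<Longrightarrow> outward_normal \<Omega> z = n"
  unfolding outward_normal_def by (rule the_equality) (auto intro: outward_unit_normal_unique)

section \<open>A boundary chart: frontier, normal and measurability\<close>

locale domain_chart = lipschitz_graph +
  fixes \<Omega> :: "complex set" and r h :: real
  assumes op: "open \<Omega>" and rh: "r > 0" "h > 0" and small: "\<And>s. \<bar>s\<bar> < r \<Longrightarrow> \<bar>\<phi> s\<bar> < h"
    and below: "\<And>s t. \<bar>s\<bar> < r \<Longrightarrow> \<bar>t\<bar> < h \<Longrightarrow> p + u * Complex s t \<in> \<Omega> \<longleftrightarrow> t < \<phi> s"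
begin

definition rect :: "complex set" where "rect = {z. \<bar>abscissa z\<bar> < r \<and> \<bar>ordinate z\<bar> < h}"

lemma open_rect: "open rect"
  unfolding rect_def Collect_conj_eq
  by (intro open_Int open_Collect_less continuous_intros continuous_coordinates)

lemma in_domain: "z \<in> rect \<Longrightarrow> z \<in> \<Omega> \<longleftrightarrow> ordinate z < \<phi> (abscissa z)"
  using below[of "abscissa z" "ordinate z"] by (simp add: rect_def)

lemma gr_rect: "\<bar>s\<bar> < r \<Longrightarrow> gr s \<in> rect"
  using small by (simp add: rect_def)

lemma frontier_rect: "frontier \<Omega> \<inter> rect = gr ` {-r<..<r}"
proof
  show "gr ` {-r<..<r} \<subseteq> frontier \<Omega> \<inter> rect"
  proof clarify
    fix s assume "s \<in> {-r<..<r}"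
    then have s: "\<bar>s\<bar> < r" by auto
    have "gr s \<in> closure \<Omega>"
      unfolding closure_approachable
    proof (intro allI impI)
      fix e :: real assume e: "0 < e"
      define k where "k = min (e/2) ((\<phi> s + h) / 2)"
      have "- h < \<phi> s" "\<phi> s < h" using small[OF s] by auto
      then have k: "0 < k" "k < e" "\<bar>\<phi> s - k\<bar> < h" using e by (auto simp: k_def min_def abs_if)
      have "p + u * Complex s (\<phi> s - k) \<in> \<Omega>" using below[OF s k(3)] k by simp
      moreover have "dist (p + u * Complex s (\<phi> s - k)) (gr s) < e"
      proof -
        have "p + u * Complex s (\<phi> s - k) - gr s = u * Complex 0 (-k)"
          unfolding gr_def by (simp add: complex_eq_iff algebra_simps)
        moreover have "norm (Complex 0 (-k)) = k" using k by (simp add: cmod_def)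
        ultimately show ?thesis using u k by (simp add: dist_norm norm_mult)
      qed
      ultimately show "\<exists>y\<in>\<Omega>. dist y (gr s) < e" by blast
    qed
    moreover have "gr s \<notin> \<Omega>" using in_domain[OF gr_rect[OF s]] by simp
    ultimately show "gr s \<in> frontier \<Omega> \<inter> rect" using gr_rect[OF s] op by (simp add: frontier_def interior_open)
  qed
  show "frontier \<Omega> \<inter> rect \<subseteq> gr ` {-r<..<r}"
  proof
    fix z assume z: "z \<in> frontier \<Omega> \<inter> rect"
    then have zc: "z \<in> closure \<Omega>" "z \<notin> \<Omega>" "z \<in> rect" using op by (auto simp: frontier_def interior_open)
    define U where "U = {w. \<phi> (abscissa w) < ordinate w} \<inter> rect"
    have "open U" unfolding U_def
      by (intro open_Int open_rect open_Collect_less continuous_coordinates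
          continuous_on_compose2[OF continuous_phi[of UNIV] continuous_coordinates(1)]) auto
    moreover have "U \<inter> \<Omega> = {}" using in_domain by (fastforce simp: U_def)
    ultimately have "z \<notin> U" using zc(1) open_Int_closure_eq_empty by blast
    then have "ordinate z = \<phi> (abscissa z)" using in_domain[OF zc(3)] zc by (auto simp: U_def)
    then have "z \<in> range gr" unfolding range_gr by simp
    then obtain s where "z = gr s" by auto
    moreover have "s \<in> {-r<..<r}" using \<open>z = gr s\<close> zc(3) by (auto simp: rect_def abs_less_iff)
    ultimately show "z \<in> gr ` {-r<..<r}" by (simp only: imageI)
  qed
qed

text \<open>The upward normal of the graph, which is the outward one because \<Omega> lies below. It
  is a unit vector at every s, also where \<phi> is not differentiable.\<close>

definition nrm :: "real \<Rightarrow> complex" where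
  "nrm s = u * Complex (- dquot_lim \<phi> s) 1 / of_real (sqrt (1 + (dquot_lim \<phi> s)\<^sup>2))"

lemma borel_phi [measurable]: "\<phi> \<in> borel_measurable borel"
  using continuous_phi by (rule borel_measurable_continuous_onI)

lemma borel_nrm [measurable]: "nrm \<in> borel_measurable borel"
  unfolding nrm_def[abs_def] by measurable

lemma sqrt_pos: "sqrt (1 + x\<^sup>2) > 0" by (simp add: add_pos_nonneg)

lemma norm_nrm: "norm (nrm s) = 1"
proof -
  have "norm (Complex (- dquot_lim \<phi> s) 1) = sqrt (1 + (dquot_lim \<phi> s)\<^sup>2)" by (simp add: cmod_def add.commute)
  then show ?thesis using u sqrt_pos[of "dquot_lim \<phi> s"]
    by (simp add: nrm_def norm_divide norm_mult)
qed

text \<open>Up to the factor sqrt (1 + d^2) \<ge> 1, the component of w - gr s along the normal is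
  the height of w over the tangent line. Graph and tangent differ by less than \<epsilon> times the
  distance, so the sign of the height over the graph is decided outside the cone.\<close>

lemma outward_normal_gr:
  assumes s: "\<bar>s\<bar> < r" and der: "(\<phi> has_vector_derivative dquot_lim \<phi> s) (at s)"
  shows "is_outward_unit_normal \<Omega> (gr s) (nrm s)"
  unfolding is_outward_unit_normal_def
proof (intro conjI norm_nrm allI impI)
  fix \<epsilon> :: real assume e: "\<epsilon> > 0"
  define d where "d = dquot_lim \<phi> s"
  define D where "D = sqrt (1 + d\<^sup>2)"
  have D1: "D \<ge> 1" by (simp add: D_def)
  have "(\<phi> has_derivative (\<lambda>x. d * x)) (at s)"
    using der by (simp add: has_vector_derivative_def d_def mult.commute)
  \<comment> \<open>Only \<epsilon>/2 is spent on the tangent error, which leaves the comparison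
    with \<epsilon> strict.\<close>
  then obtain \<delta>1 where d1: "\<delta>1 > 0" "\<And>x. norm (x - s) < \<delta>1 \<Longrightarrow> norm (\<phi> x - \<phi> s - d * (x - s)) \<le> \<epsilon>/2 * norm (x - s)"
    unfolding has_derivative_at_alt using e by (metis half_gt_zero)
  obtain \<delta>2 where d2: "\<delta>2 > 0" "ball (gr s) \<delta>2 \<subseteq> rect" using open_rect gr_rect[OF s] openE by blast
  show "\<exists>\<delta>>0. \<forall>w. 0 < dist w (gr s) \<and> dist w (gr s) < \<delta> \<longrightarrow>
        (Re ((w - gr s) * cnj (nrm s)) < - \<epsilon> * dist w (gr s) \<longrightarrow> w \<in> \<Omega>) \<and>
        (Re ((w - gr s) * cnj (nrm s)) > \<epsilon> * dist w (gr s) \<longrightarrow> w \<notin> \<Omega>)"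
  proof (intro exI[of _ "min \<delta>1 \<delta>2"] conjI allI impI)
    show "0 < min \<delta>1 \<delta>2" using d1 d2 by simp
    fix w assume w: "0 < dist w (gr s) \<and> dist w (gr s) < min \<delta>1 \<delta>2"
    define x where "x = abscissa w"
    define t where "t = ordinate w"
    have wr: "w \<in> rect" using w d2 by (auto simp: dist_commute)
    have xs: "\<bar>x - s\<bar> \<le> dist w (gr s)" using abscissa_lipschitz[of w "gr s"] by (simp add: x_def)
    then have err: "\<bar>\<phi> x - \<phi> s - d * (x - s)\<bar> \<le> \<epsilon>/2 * \<bar>x - s\<bar>" using d1(2)[of x] w by simp
    have "\<epsilon>/2 * \<bar>x - s\<bar> < \<epsilon> * dist w (gr s)"
    proof -
      have "\<epsilon>/2 * \<bar>x - s\<bar> \<le> \<epsilon>/2 * dist w (gr s)" using xs e by (intro mult_left_mono) auto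
      also have "\<dots> < \<epsilon> * dist w (gr s)" using e w by (intro mult_strict_right_mono) auto
      finally show ?thesis .
    qed
    with err have err': "\<bar>\<phi> x - \<phi> s - d * (x - s)\<bar> < \<epsilon> * dist w (gr s)" by linarith
    have "w - gr s = u * Complex (x - s) (t - \<phi> s)"
    proof -
      have "w = p + u * Complex x t" by (simp add: x_def t_def)
      then show ?thesis by (simp add: gr_def complex_eq_iff algebra_simps)
    qed
    then have "(w - gr s) * cnj (nrm s) = (u * cnj u) * (Complex (x - s) (t - \<phi> s) * Complex (- d) (- 1)) / of_real D"
      by (simp add: nrm_def d_def[symmetric] D_def[symmetric] complex_cnj mult_ac)
    also have "\<dots> = of_real (1/D) * (Complex (x - s) (t - \<phi> s) * Complex (- d) (- 1))" unfolding cnj_u by simp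
    finally have "Re ((w - gr s) * cnj (nrm s)) = Re (of_real (1/D) * (Complex (x - s) (t - \<phi> s) * Complex (- d) (- 1)))" by simp
    then have R: "D * Re ((w - gr s) * cnj (nrm s)) = t - \<phi> s - d * (x - s)"
      using D1 by (simp add: field_simps)
    have Dd: "\<epsilon> * dist w (gr s) \<le> D * (\<epsilon> * dist w (gr s))"
      using mult_right_mono[OF D1, of "\<epsilon> * dist w (gr s)"] e w by simp
    have dom: "w \<in> \<Omega> \<longleftrightarrow> t < \<phi> x" using in_domain[OF wr] by (simp add: x_def t_def)
    {
      assume "Re ((w - gr s) * cnj (nrm s)) < - \<epsilon> * dist w (gr s)"
      then have "D * Re ((w - gr s) * cnj (nrm s)) < D * (- \<epsilon> * dist w (gr s))" using D1 by (intro mult_strict_left_mono) auto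
      then show "w \<in> \<Omega>" unfolding dom R using err' Dd by (simp add: abs_less_iff)
    next
      assume "Re ((w - gr s) * cnj (nrm s)) > \<epsilon> * dist w (gr s)"
      then have "D * Re ((w - gr s) * cnj (nrm s)) > D * (\<epsilon> * dist w (gr s))" using D1 by (intro mult_strict_left_mono) auto
      then show "w \<notin> \<Omega>" unfolding dom R using err' Dd by (simp add: abs_less_iff)
    }
  qed
qed

lemma outward_normal_AE: "AE z in arc_length. z \<in> frontier \<Omega> \<inter> rect \<longrightarrow> outward_normal \<Omega> z = nrm (abscissa z)"
proof -
  obtain N where N: "N \<in> null_sets lborel" "{s. \<not> (\<phi> has_vector_derivative dquot_lim \<phi> s) (at s)} \<subseteq> N"
    using lipschitz_AE_has_vector_derivative[OF lip] unfolding eventually_ae_filter by auto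
  show ?thesis
  proof (rule AE_I'[OF arc_length_graph_null[OF N(1)]])
    show "{z \<in> space arc_length. \<not> (z \<in> frontier \<Omega> \<inter> rect \<longrightarrow> outward_normal \<Omega> z = nrm (abscissa z))} \<subseteq> gr ` N"
    proof
      fix z assume z: "z \<in> {z \<in> space arc_length. \<not> (z \<in> frontier \<Omega> \<inter> rect \<longrightarrow> outward_normal \<Omega> z = nrm (abscissa z))}"
      then have "z \<in> gr ` {-r<..<r}" unfolding frontier_rect[symmetric] by blast
      then obtain s where s: "z = gr s" "s \<in> {-r<..<r}" by auto
      have "\<not> (\<phi> has_vector_derivative dquot_lim \<phi> s) (at s)"
        using outward_normal_eq[OF outward_normal_gr, of s] s z by (auto simp: abs_less_iff)
      then show "z \<in> gr ` N" using N(2) s(1) by blast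
    qed
  qed
qed

lemma outward_normal_sets:
  assumes B: "B \<in> sets borel"
  shows "{z \<in> frontier \<Omega> \<inter> rect. outward_normal \<Omega> z \<in> B} \<in> sets arc_length"
proof (rule arc_length.in_sets_AE)
  have fr: "frontier \<Omega> \<inter> rect \<in> sets borel" using open_rect by (intro sets.Int borel_closed borel_open) auto
  have "(\<lambda>z. nrm (abscissa z)) -` B \<in> sets borel"
    using measurable_sets[of "\<lambda>z. nrm (abscissa z)" borel borel B] B by simp
  from sets.Int[OF fr this] have "(frontier \<Omega> \<inter> rect) \<inter> (\<lambda>z. nrm (abscissa z)) -` B \<in> sets borel" .
  then show "(frontier \<Omega> \<inter> rect) \<inter> (\<lambda>z. nrm (abscissa z)) -` B \<in> sets arc_length" using borel_sets_arc_length by blast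
  show "AE z in arc_length. z \<in> (frontier \<Omega> \<inter> rect) \<inter> (\<lambda>z. nrm (abscissa z)) -` B \<longleftrightarrow> z \<in> {z \<in> frontier \<Omega> \<inter> rect. outward_normal \<Omega> z \<in> B}"
    using outward_normal_AE by eventually_elim auto
qed (simp add: arc_length_basics)

lemma frontier_rect_null: "frontier \<Omega> \<inter> rect \<in> null_sets lborel"
proof (rule chart_null_set[OF u])
  show "frontier \<Omega> \<inter> rect \<in> sets borel" using open_rect by (intro sets.Int borel_closed borel_open) auto
  show "AE t in lborel. p + u * Complex s t \<notin> frontier \<Omega> \<inter> rect" for s
    using AE_lborel_singleton[of "\<phi> s"]
  proof eventually_elim
    case (elim t)
    show ?case
    proof
      assume "p + u * Complex s t \<in> frontier \<Omega> \<inter> rect"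
      then obtain s' where "p + u * Complex s t = gr s'" unfolding frontier_rect by auto
      from arg_cong[OF this, of abscissa] arg_cong[OF this, of ordinate] show False using elim by simp
    qed
  qed
qed

lemma frontier_rect_finite: "emeasure arc_length (frontier \<Omega> \<inter> rect) < top"
  unfolding frontier_rect by (rule arc_length_graph_finite)

section \<open>Green's formula in a chart\<close>

text \<open>The speed sqrt (1 + \<phi>'^2) cancels the denominator of the normal, so normal times dS
  pulls back to the vector (-\<phi>', 1) ds rotated by u.\<close>

lemma speed_nrm: "AE s in lborel. speed s *\<^sub>R nrm s = u * Complex (- dquot_lim \<phi> s) 1"
  using lipschitz_AE_has_vector_derivative[OF lip]
proof eventually_elim
  case (elim s)
  define d where "d = dquot_lim \<phi> s"
  have "(\<phi> has_vector_derivative d) (at s)" using elim by (simp add: d_def)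
  then have pd: "((\<lambda>s. complex_of_real (\<phi> s)) has_vector_derivative of_real d) (at s)"
    by (rule bounded_linear.has_vector_derivative[OF bounded_linear_of_real])
  have idd: "((\<lambda>s. complex_of_real s) has_vector_derivative 1) (at s)"
    using bounded_linear.has_vector_derivative[OF bounded_linear_of_real has_vector_derivative_id[of "at s"]] by simp
  have "((\<lambda>s. p + u * (of_real s + \<i> * of_real (\<phi> s))) has_vector_derivative 0 + u * (1 + \<i> * of_real d)) (at s)"
    by (intro has_vector_derivative_add has_vector_derivative_const has_vector_derivative_mult_right idd pd)
  then have "(gr has_vector_derivative u * (1 + \<i> * of_real d)) (at s)" by (simp add: gr_def[abs_def] Complex_eq)
  then have "dquot_lim gr s = u * (1 + \<i> * of_real d)" by (rule dquot_lim_eq(2))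
  moreover have "norm (1 + \<i> * complex_of_real d) = sqrt (1 + d\<^sup>2)" by (simp add: cmod_def)
  ultimately have "speed s = sqrt (1 + d\<^sup>2)" using u by (simp add: speed_def norm_mult)
  then show ?case using sqrt_pos[of d] by (simp add: nrm_def d_def[symmetric] scaleR_conv_of_real)
qed

lemma chart_integral_nrm:
  assumes [measurable]: "G \<in> borel_measurable borel" and G0: "\<And>z. z \<notin> rect \<Longrightarrow> G z = 0"
  shows "(LINT z:frontier \<Omega> \<inter> rect|arc_length. G z * nrm (abscissa z))
    = (LINT s|lborel. G (gr s) * (u * Complex (- dquot_lim \<phi> s) 1))"
proof -
  have "(LINT z:frontier \<Omega> \<inter> rect|arc_length. G z * nrm (abscissa z)) = (LINT s:{-r<..<r}|lborel. speed s *\<^sub>R (G (gr s) * nrm s))"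
    unfolding frontier_rect by (subst arc_length_graph_integral) auto
  also have "\<dots> = (LINT s|lborel. G (gr s) * (u * Complex (- dquot_lim \<phi> s) 1))"
    unfolding set_lebesgue_integral_def
  proof (rule integral_cong_AE)
    show "AE s in lborel. indicator {-r<..<r} s *\<^sub>R speed s *\<^sub>R (G (gr s) * nrm s) = G (gr s) * (u * Complex (- dquot_lim \<phi> s) 1)"
      using speed_nrm
    proof eventually_elim
      case (elim s)
      show ?case
      proof (cases "s \<in> {-r<..<r}")
        case True
        have "speed s *\<^sub>R (G (gr s) * nrm s) = G (gr s) * (speed s *\<^sub>R nrm s)" by simp
        then show ?thesis using True elim by simp
      next
        case False
        then have "gr s \<notin> rect" by (auto simp: rect_def)
        then show ?thesis using False G0 by simp
      qed
    qed
  qed measurable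
  finally show ?thesis .
qed

end

context domain_chart
begin

text \<open>The shear \<open>(s, t) \<mapsto> (s, t + \<phi> s)\<close> straightens the boundary; the integral of the tangential derivative
  \<open>\<partial>\<^sub>s + \<phi>' \<partial>\<^sub>t\<close> along each translate of the graph vanishes.\<close>

lemma chart_green:
  assumes t: "test_function G" and S: "closed S" "S \<subseteq> rect" and G0: "\<And>z. z \<notin> S \<Longrightarrow> G z = 0"
  shows "(LINT z|lborel. indicator \<Omega> z *\<^sub>R first_order (1/2) (\<i>/2) G z)
    = 1/2 * (LINT s|lborel. G (gr s) * (u * Complex (- dquot_lim \<phi> s) 1))"
proof -
  define E where "E s t = p + u * Complex s t" for s t
  \<comment> \<open>Derivatives of \<open>G\<close> along the rotated axes u and \<i> u, that is,
    with respect to the chart coordinates s and t.\<close>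
  define Gs where "Gs = first_order (of_real (Re u)) (of_real (Im u)) G"
  define Gt where "Gt = first_order (of_real (- Im u)) (of_real (Re u)) G"
  have tG: "test_function Gs" "test_function Gt" unfolding Gs_def Gt_def by (rule test_first_order[OF t])+
  note sm = test_functionD(1)[OF t]
  note [measurable] = test_function_measurable[OF t] test_function_measurable[OF tG(1)] test_function_measurable[OF tG(2)]
  have [measurable]: "\<Omega> \<in> sets borel" using op by simp
  have Em[measurable]: "(\<lambda>x. E (f x) (g x)) \<in> borel_measurable M" if [measurable]: "f \<in> borel_measurable M" "g \<in> borel_measurable M" for f g and M :: "'z measure"
    unfolding E_def by measurable
  have z0: "Gs z = 0" "Gt z = 0" if "z \<notin> S" for z
    using deriv_zero_outside[OF sm S(1) G0 that] by (auto simp: Gs_def Gt_def first_order_eq)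
  obtain R0 where R0: "\<And>z. norm z > R0 \<Longrightarrow> G z = 0" "\<And>z. norm z > R0 \<Longrightarrow> Gs z = 0" "\<And>z. norm z > R0 \<Longrightarrow> Gt z = 0"
  proof -
    obtain R0 where R0: "\<And>z. norm z > R0 \<Longrightarrow> G z = 0" "\<And>z. norm z > R0 \<Longrightarrow> dx G z = 0" "\<And>z. norm z > R0 \<Longrightarrow> dy G z = 0"
      using test_functionD(5)[OF t] by blast
    have "Gs z = 0" "Gt z = 0" if "norm z > R0" for z
      using R0[OF that] by (simp_all add: Gs_def Gt_def first_order_eq)
    then show thesis using R0(1) that by blast
  qed
  define R where "R = \<bar>R0\<bar> + norm p"
  have far: "norm (E s t) > R0" if "\<bar>s\<bar> > R \<or> \<bar>t\<bar> > R" for s t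
  proof -
    have "norm (Complex s t) \<le> norm (E s t) + norm p"
      using norm_triangle_ineq4[of "E s t" p] u by (simp add: E_def norm_mult)
    moreover have "\<bar>s\<bar> \<le> norm (Complex s t)" "\<bar>t\<bar> \<le> norm (Complex s t)"
      using abs_Re_le_cmod[of "Complex s t"] abs_Im_le_cmod[of "Complex s t"] by auto
    ultimately show ?thesis using that unfolding R_def by linarith
  qed
  obtain B1 B2 where B: "\<And>z. norm (Gs z) \<le> B1" "\<And>z. norm (Gt z) \<le> B2"
    using test_functionD(6)[OF tG(1)] test_functionD(6)[OF tG(2)] by blast
  have Bn: "B1 \<ge> 0" "B2 \<ge> 0" using order_trans[OF norm_ge_zero B(1)] order_trans[OF norm_ge_zero B(2)] by auto
  have grE: "gr s = E s (\<phi> s)" for s by (simp add: gr_def E_def)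
  \<comment> \<open>A Borel version of \<phi>' that is bounded by L at every s; the bound makes
    \<open>K\<close> below bounded.\<close>
  define \<psi> where "\<psi> s = (if \<bar>dquot_lim \<phi> s\<bar> \<le> L then dquot_lim \<phi> s else 0)" for s
  have [measurable]: "\<psi> \<in> borel_measurable borel" unfolding \<psi>_def by measurable
  have \<psi>b: "\<bar>\<psi> s\<bar> \<le> L" for s using L_nonneg by (simp add: \<psi>_def)
  have \<psi>ae: "AE s in lborel. (\<phi> has_vector_derivative \<psi> s) (at s) \<and> \<psi> s = dquot_lim \<phi> s"
    using lipschitz_AE_has_vector_derivative[OF lip] by eventually_elim (auto simp: \<psi>_def)
  have Gd: "((\<lambda>s. G (c s)) has_vector_derivative of_real (Re c') * dx G (c x) + of_real (Im c') * dy G (c x)) (at x within T)"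
    if "(c has_vector_derivative c') (at x within T)" for c c' x T
  proof -
    from has_derivative_compose[OF that[unfolded has_vector_derivative_def] smoothD(1)[OF sm]]
    have "((\<lambda>s. G (c s)) has_derivative (\<lambda>y. of_real (Re (y *\<^sub>R c')) * dx G (c x) + of_real (Im (y *\<^sub>R c')) * dy G (c x))) (at x within T)" .
    then show ?thesis unfolding has_vector_derivative_def
      by (rule has_derivative_eq_rhs) (simp add: fun_eq_iff scaleR_conv_of_real algebra_simps)
  qed
  have Ealt: "E s t = p + u * (of_real s + \<i> * of_real t)" for s t by (simp add: E_def Complex_eq)
  have tline: "((\<lambda>t. G (E s t)) has_vector_derivative Gt (E s t)) (at t within T)" for s t T
  proof -
    have "((\<lambda>t. p + u * (of_real s + \<i> * of_real t)) has_vector_derivative 0 + u * (0 + \<i> * 1)) (at t within T)"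
      by (intro has_vector_derivative_add has_vector_derivative_const has_vector_derivative_mult_right
        bounded_linear.has_vector_derivative[OF bounded_linear_of_real has_vector_derivative_id, simplified])
    then have "((\<lambda>t. E s t) has_vector_derivative u * \<i>) (at t within T)" by (simp add: Ealt)
    from Gd[OF this] show ?thesis by (simp add: Gt_def first_order_eq)
  qed
  define A where "A s = (LINT t|lborel. indicator {..<\<phi> s} t *\<^sub>R Gs (E s t))" for s
  define Bt where "Bt s = (LINT t|lborel. indicator {..<\<phi> s} t *\<^sub>R Gt (E s t))" for s
  have inner: "integrable lborel (\<lambda>t. indicator X t *\<^sub>R H (E s t))"
    if [measurable]: "X \<in> sets borel" "H \<in> borel_measurable borel" and H: "\<And>z. norm (H z) \<le> C" "\<And>z. norm z > R0 \<Longrightarrow> H z = 0" for X C s and H :: "complex \<Rightarrow> complex"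
  proof (rule Bochner_Integration.integrable_bound)
    show "integrable lborel (\<lambda>t. indicator {-R..R} t *\<^sub>R C)" by (intro integrable_scaleR_left integrable_real_indicator)
       (auto simp: emeasure_lborel_Icc_eq)
    show "AE t in lborel. norm (indicator X t *\<^sub>R H (E s t)) \<le> norm (indicator {-R..R} t *\<^sub>R C)"
    proof (rule AE_I2)
      fix t show "norm (indicator X t *\<^sub>R H (E s t)) \<le> norm (indicator {-R..R} t *\<^sub>R C)"
      proof (cases "\<bar>t\<bar> > R")
        case True then show ?thesis using H(2)[OF far[of s t]] by simp
      next
        case False
        then have "t \<in> {-R..R}" by (auto simp: abs_le_iff)
        moreover have "norm (H (E s t)) \<le> \<bar>C\<bar>" using H(1)[of "E s t"] by linarith
        ultimately show ?thesis by (auto simp: indicator_def)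
      qed
    qed
  qed measurable
  have Bt_eq: "Bt s = G (gr s)" for s
  proof -
    \<comment> \<open>Beyond R the function and its derivatives vanish, so the half line below the
      graph may be cut at -M; the second entry of the maximum keeps -M below the graph.\<close>
    define M where "M = max (\<bar>R\<bar> + 1) (- \<phi> s)"
    have M: "- M \<le> \<phi> s" "M > R" by (auto simp: M_def)
    have c: "continuous_on {-M..\<phi> s} (\<lambda>t. Gt (E s t))"
      unfolding E_def by (intro continuous_on_compose2[OF test_functionD(4)[OF tG(2), of UNIV]] continuous_intros) auto
    have "(LINT t|lborel. indicator {-M..\<phi> s} t *\<^sub>R Gt (E s t)) = G (E s (\<phi> s)) - G (E s (-M))"
      by (rule integral_FTC_Icc[OF M(1) tline c])
    also have "G (E s (-M)) = 0" using R0(1)[OF far[OF disjI2]] M(2) by (smt (verit))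
    also have "(LINT t|lborel. indicator {-M..\<phi> s} t *\<^sub>R Gt (E s t)) = Bt s"
      unfolding Bt_def
    proof (rule integral_cong_AE)
      show "AE t in lborel. indicator {-M..\<phi> s} t *\<^sub>R Gt (E s t) = indicator {..<\<phi> s} t *\<^sub>R Gt (E s t)"
        using AE_lborel_singleton[of "\<phi> s"]
      proof eventually_elim
        case (elim t)
        show ?case
        proof (cases "t < -M")
          case True
          then have "\<bar>t\<bar> > R" using M by linarith
          then have "Gt (E s t) = 0" using R0(3)[OF far] by blast
          then show ?thesis by simp
        qed (use elim in \<open>auto simp: indicator_def\<close>)
      qed
    qed measurable
    finally show ?thesis by (simp add: grE)
  qed
  have indE: "indicator \<Omega> (E s t) *\<^sub>R H (E s t) = indicator {..<\<phi> s} t *\<^sub>R H (E s t)"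
    if "\<And>z. z \<notin> S \<Longrightarrow> H z = 0" for s t and H :: "complex \<Rightarrow> complex"
  proof (cases "E s t \<in> S")
    case True
    then have "E s t \<in> rect" using S by auto
    then have "E s t \<in> \<Omega> \<longleftrightarrow> t < \<phi> s" using in_domain by (simp add: E_def)
    then show ?thesis by (auto simp: indicator_def)
  qed (simp add: that)
  have ind: "indicator \<Omega> (E s t) *\<^sub>R Gs (E s t) = indicator {..<\<phi> s} t *\<^sub>R Gs (E s t)"
    "indicator \<Omega> (E s t) *\<^sub>R Gt (E s t) = indicator {..<\<phi> s} t *\<^sub>R Gt (E s t)" for s t
    by (rule indE, rule z0, assumption)+
  have I\<Omega>: "integrable lborel (\<lambda>z. indicator \<Omega> z *\<^sub>R Gs z)" "integrable lborel (\<lambda>z. indicator \<Omega> z *\<^sub>R Gt z)"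
    using loc_int_test[OF loc_int_continuous tG(1), of "\<lambda>_. 1"] loc_int_test[OF loc_int_continuous tG(2), of "\<lambda>_. 1"]
    by (auto intro!: integrable_mult_indicator)
  note f1 = chart_fubini[OF u I\<Omega>(1), of p, folded E_def, unfolded ind(1)]
  note f2 = chart_fubini[OF u I\<Omega>(2), of p, folded E_def, unfolded ind(2)]
  have IA: "(LINT z|lborel. indicator \<Omega> z *\<^sub>R Gs z) = (LINT s|lborel. A s)" using f1(3) by (simp add: A_def)
  have iA: "integrable lborel A" using lborel_pair.integrable_fst'[OF f1(1)] by (simp add: A_def[abs_def])
  have IB: "(LINT z|lborel. indicator \<Omega> z *\<^sub>R Gt z) = (LINT s|lborel. G (gr s))" using f2(3) by (simp add: Bt_def[symmetric] Bt_eq)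
  have iB: "integrable lborel (\<lambda>s. G (gr s))" using lborel_pair.integrable_fst'[OF f2(1)] by (simp add: Bt_def[symmetric] Bt_eq)
  have iPB: "integrable lborel (\<lambda>s. of_real (\<psi> s) * G (gr s))"
  proof (rule Bochner_Integration.integrable_bound)
    show "integrable lborel (\<lambda>s. L *\<^sub>R G (gr s))" using iB by simp
    show "AE s in lborel. norm (of_real (\<psi> s) * G (gr s)) \<le> norm (L *\<^sub>R G (gr s))"
      using \<psi>b L_nonneg by (intro AE_I2) (auto simp: norm_mult intro!: mult_right_mono)
  qed measurable
  \<comment> \<open>The tangential derivative in straightened coordinates, with \<tau> = t - \<phi>
    s the height over the graph. Integrated first over s it gives 0, and first over \<tau> it gives
    \<open>A s\<close> plus \<psi> s times the boundary value of G.\<close>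
  define K where "K s \<tau> = indicator {..<0} \<tau> *\<^sub>R (Gs (E s (\<tau> + \<phi> s)) + of_real (\<psi> s) * Gt (E s (\<tau> + \<phi> s)))" for s \<tau> :: real
  have Km: "(\<lambda>(s, \<tau>). K s \<tau>) \<in> borel_measurable (lborel \<Otimes>\<^sub>M lborel)" unfolding K_def by measurable
  have "bounded (\<phi> ` {-R..R})" using continuous_phi by (intro compact_imp_bounded compact_continuous_image) auto
  then obtain \<Phi> where "\<forall>s\<in>{-R..R}. \<bar>\<phi> s\<bar> \<le> \<Phi>" unfolding bounded_iff by auto
  then have \<Phi>: "\<And>s. s \<in> {-R..R} \<Longrightarrow> \<bar>\<phi> s\<bar> \<le> \<Phi>" by blast
  define C where "C = B1 + L * B2"
  \<comment> \<open>If s is in [-R, R] and |\<tau>| > R', then |\<tau> + \<phi> s| > R, so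
    \<open>K\<close> vanishes off a fixed rectangle and is integrable on the product.\<close>
  define R' where "R' = \<bar>R\<bar> + \<bar>\<Phi>\<bar>"
  have Ki: "integrable (lborel \<Otimes>\<^sub>M lborel) (\<lambda>(s, \<tau>). K s \<tau>)"
  proof (rule Bochner_Integration.integrable_bound[OF _ Km])
    have "emeasure (lborel \<Otimes>\<^sub>M lborel) ({-R..R} \<times> {-R'..R'}) < \<infinity>"
      by (subst lborel.emeasure_pair_measure_Times) (auto simp: emeasure_lborel_Icc_eq ennreal_mult_less_top)
    then show "integrable (lborel \<Otimes>\<^sub>M lborel) (\<lambda>x. C * indicator ({-R..R} \<times> {-R'..R'}) x)"
      by (intro integrable_mult_right integrable_real_indicator) auto
    show "AE x in lborel \<Otimes>\<^sub>M lborel. norm (case x of (s, \<tau>) \<Rightarrow> K s \<tau>) \<le> norm (C * indicator ({-R..R} \<times> {-R'..R'}) x)"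
    proof (rule AE_I2, clarify)
      fix s \<tau> :: real
      have Cn: "C \<ge> 0" using Bn L_nonneg by (simp add: C_def)
      have kb: "norm (K s \<tau>) \<le> C"
      proof -
        have "norm (Gs (E s (\<tau> + \<phi> s)) + of_real (\<psi> s) * Gt (E s (\<tau> + \<phi> s))) \<le> norm (Gs (E s (\<tau> + \<phi> s))) + \<bar>\<psi> s\<bar> * norm (Gt (E s (\<tau> + \<phi> s)))"
          by (rule norm_triangle_le) (simp add: norm_mult)
        also have "\<dots> \<le> C" unfolding C_def using Bn L_nonneg by (intro add_mono mult_mono B \<psi>b) auto
        finally show ?thesis using Cn by (auto simp: K_def indicator_def)
      qed
      have k0: "K s \<tau> = 0" if "s \<notin> {-R..R} \<or> \<tau> \<notin> {-R'..R'}"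
      proof -
        have "\<bar>s\<bar> > R \<or> \<bar>\<tau> + \<phi> s\<bar> > R"
        proof (cases "s \<in> {-R..R}")
          case True
          then have "\<bar>\<phi> s\<bar> \<le> \<Phi>" by (rule \<Phi>)
          moreover have "\<bar>\<tau>\<bar> > R'" using that True by (auto simp: abs_if)
          ultimately show ?thesis unfolding R'_def by linarith
        qed (auto simp: abs_if)
        then have "norm (E s (\<tau> + \<phi> s)) > R0" by (rule far)
        then show ?thesis using R0 by (simp add: K_def)
      qed
      show "norm (K s \<tau>) \<le> norm (C * indicator ({-R..R} \<times> {-R'..R'}) (s, \<tau>))"
        using kb k0 Cn by (cases "s \<notin> {-R..R} \<or> \<tau> \<notin> {-R'..R'}") auto
    qed
  qed
  obtain L' where L': "L'-lipschitz_on UNIV G" using test_function_lipschitz[OF t] by blast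
  have Ks: "(LINT s|lborel. K s \<tau>) = 0" for \<tau>
  proof -
    have "(LINT s|lborel. Gs (E s (\<tau> + \<phi> s)) + of_real (\<psi> s) * Gt (E s (\<tau> + \<phi> s))) = 0"
    proof (rule lipschitz_compact_support_integral(2))
      have shift: "E s (\<tau> + \<phi> s) = gr s + u * Complex 0 \<tau>" for s
        by (simp add: E_def gr_def complex_eq_iff algebra_simps)
      show "(L' * (1 + L))-lipschitz_on UNIV (\<lambda>s. G (E s (\<tau> + \<phi> s)))"
      proof (rule lipschitz_onI)
        fix x y
        have "dist (G (E x (\<tau> + \<phi> x))) (G (E y (\<tau> + \<phi> y))) \<le> L' * dist (E x (\<tau> + \<phi> x)) (E y (\<tau> + \<phi> y))"
          by (rule lipschitz_onD[OF L']) auto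
        also have "\<dots> = L' * dist (gr x) (gr y)" unfolding shift by simp
        also have "\<dots> \<le> L' * ((1 + L) * dist x y)"
          using lipschitz_onD[OF lipschitz_gr, of x y] lipschitz_on_nonneg[OF L'] by (intro mult_left_mono) auto
        finally show "dist (G (E x (\<tau> + \<phi> x))) (G (E y (\<tau> + \<phi> y))) \<le> L' * (1 + L) * dist x y" by (simp add: mult.assoc)
      qed (use L_nonneg lipschitz_on_nonneg[OF L'] in simp)
      show "G (E s (\<tau> + \<phi> s)) = 0" if "R < \<bar>s\<bar>" for s using R0(1)[OF far[of s "\<tau> + \<phi> s"]] that by simp
      show "(\<lambda>s. Gs (E s (\<tau> + \<phi> s)) + of_real (\<psi> s) * Gt (E s (\<tau> + \<phi> s))) \<in> borel_measurable borel" by measurable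
      show "AE s in lborel. ((\<lambda>s. G (E s (\<tau> + \<phi> s))) has_vector_derivative Gs (E s (\<tau> + \<phi> s)) + of_real (\<psi> s) * Gt (E s (\<tau> + \<phi> s))) (at s)"
        using \<psi>ae
      proof eventually_elim
        case (elim s)
        have pd: "((\<lambda>s. complex_of_real (\<tau> + \<phi> s)) has_vector_derivative of_real (0 + \<psi> s)) (at s)"
          by (intro bounded_linear.has_vector_derivative[OF bounded_linear_of_real] has_vector_derivative_add has_vector_derivative_const) (use elim in blast)
        have idd: "((\<lambda>s. complex_of_real s) has_vector_derivative 1) (at s)"
          using bounded_linear.has_vector_derivative[OF bounded_linear_of_real has_vector_derivative_id[of "at s"]] by simp
        have "((\<lambda>s. p + u * (of_real s + \<i> * of_real (\<tau> + \<phi> s))) has_vector_derivative 0 + u * (1 + \<i> * of_real (0 + \<psi> s))) (at s)"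
          by (intro has_vector_derivative_add has_vector_derivative_const has_vector_derivative_mult_right idd pd)
        then have "((\<lambda>s. E s (\<tau> + \<phi> s)) has_vector_derivative u * (1 + \<i> * of_real (\<psi> s))) (at s)" by (simp add: Ealt)
        from Gd[OF this] show ?case
          by (simp add: Gs_def Gt_def first_order_eq algebra_simps)
      qed
    qed
    then show ?thesis by (simp add: K_def)
  qed
  have Kt: "(LINT \<tau>|lborel. K s \<tau>) = A s + of_real (\<psi> s) * G (gr s)" for s
  proof -
    define k where "k t = indicator {..<\<phi> s} t *\<^sub>R (Gs (E s t) + of_real (\<psi> s) * Gt (E s t))" for t
    have "(LINT t|lborel. k t) = \<bar>1\<bar> *\<^sub>R (LINT \<tau>|lborel. k (\<phi> s + 1 * \<tau>))"
      by (rule lborel_integral_real_affine) simp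
    also have "(LINT \<tau>|lborel. k (\<phi> s + 1 * \<tau>)) = (LINT \<tau>|lborel. K s \<tau>)"
      by (intro Bochner_Integration.integral_cong refl) (auto simp: k_def K_def indicator_def add.commute)
    finally have "(LINT \<tau>|lborel. K s \<tau>) = (LINT t|lborel. k t)" by simp
    also have "\<dots> = (LINT t|lborel. indicator {..<\<phi> s} t *\<^sub>R Gs (E s t) + of_real (\<psi> s) * (indicator {..<\<phi> s} t *\<^sub>R Gt (E s t)))"
      by (simp add: k_def scaleR_add_right)
    also have "\<dots> = A s + of_real (\<psi> s) * Bt s"
      by (subst Bochner_Integration.integral_add[OF inner[of "{..<\<phi> s}" Gs B1 s] integrable_mult_right[OF inner[of "{..<\<phi> s}" Gt B2 s]]])
        (simp_all add: A_def Bt_def B R0 del: mult_scaleR_right)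
    finally show ?thesis by (simp add: Bt_eq)
  qed
  have "(LINT s|lborel. A s + of_real (\<psi> s) * G (gr s)) = 0"
    unfolding Kt[symmetric] using lborel_pair.Fubini_integral[OF Ki] Ks by simp
  then have A1: "(LINT s|lborel. A s) = - (LINT s|lborel. of_real (\<psi> s) * G (gr s))"
    using iA iPB by (simp add: eq_neg_iff_add_eq_0)
  \<comment> \<open>The chain rule for the rotation: dbar is u/2 times the derivative in s plus \<i>
    times the derivative in t, because cnj u is the inverse of u.\<close>
  have dbar: "first_order (1/2) (\<i>/2) G z = u/2 * (Gs z + \<i> * Gt z)" for z
  proof -
    have c: "u * (of_real (Re u) - \<i> * of_real (Im u)) = 1"
      using cnj_u(2) by (metis complex_cnj complex_surj Complex_eq complex_cnj_add complex_cnj_complex_of_real complex_cnj_i complex_cnj_mult diff_conv_add_uminus mult_minus_left)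
    have "u * (Gs z + \<i> * Gt z) = u * (of_real (Re u) - \<i> * of_real (Im u)) * (dx G z + \<i> * dy G z)"
      by (simp add: Gs_def Gt_def first_order_eq algebra_simps)
    then show ?thesis unfolding c by (simp add: first_order_eq)
  qed
  have "(LINT z|lborel. indicator \<Omega> z *\<^sub>R first_order (1/2) (\<i>/2) G z)
      = (LINT z|lborel. u/2 * (indicator \<Omega> z *\<^sub>R Gs z + \<i> * (indicator \<Omega> z *\<^sub>R Gt z)))"
    by (intro Bochner_Integration.integral_cong refl) (auto simp: dbar indicator_def)
  also have "\<dots> = u/2 * ((LINT z|lborel. indicator \<Omega> z *\<^sub>R Gs z) + \<i> * (LINT z|lborel. indicator \<Omega> z *\<^sub>R Gt z))"
    by (simp only: integral_mult_right_zero Bochner_Integration.integral_add[OF I\<Omega>(1) integrable_mult_right[OF I\<Omega>(2)]])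
  also have "\<dots> = u/2 * (- (LINT s|lborel. of_real (\<psi> s) * G (gr s)) + \<i> * (LINT s|lborel. G (gr s)))"
    unfolding IA IB A1 ..
  also have "\<dots> = (LINT s|lborel. u/2 * (- (of_real (\<psi> s) * G (gr s)) + \<i> * G (gr s)))"
    using iB iPB by simp
  also have "\<dots> = (LINT s|lborel. 1/2 * (G (gr s) * (u * Complex (- dquot_lim \<phi> s) 1)))"
  proof (rule integral_cong_AE)
    show "AE s in lborel. u/2 * (- (of_real (\<psi> s) * G (gr s)) + \<i> * G (gr s)) = 1/2 * (G (gr s) * (u * Complex (- dquot_lim \<phi> s) 1))"
      using \<psi>ae by eventually_elim (simp add: Complex_eq algebra_simps)
  qed measurable
  finally show ?thesis by simp
qed

end

section \<open>Green's formula on a Lipschitz domain\<close>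

lemma indicator_times_measurable:
  fixes f :: "'a \<Rightarrow> 'b::real_normed_vector"
  assumes X: "X \<in> sets M" and f: "\<And>B. B \<in> sets borel \<Longrightarrow> {z \<in> X. f z \<in> B} \<in> sets M"
  shows "(\<lambda>z. indicator X z *\<^sub>R f z) \<in> borel_measurable M"
proof -
  have Xs: "X \<inter> space M \<in> sets M" "X \<subseteq> space M" using X sets.sets_into_space by auto
  have "f \<in> borel_measurable (restrict_space M X)"
  proof (rule measurableI)
    fix B :: "'b set" assume "B \<in> sets borel"
    from f[OF this] have "{z \<in> X. f z \<in> B} \<in> sets (restrict_space M X)"
      using Xs by (auto simp: sets_restrict_space_iff)
    also have "{z \<in> X. f z \<in> B} = f -` B \<inter> space (restrict_space M X)" using Xs by (auto simp: space_restrict_space)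
    finally show "f -` B \<inter> space (restrict_space M X) \<in> sets (restrict_space M X)" .
  qed simp
  then show ?thesis using borel_measurable_restrict_space_iff[OF Xs(1)] by blast
qed

text \<open>Collects what a chart delivers without mentioning its parameters, so that compactness
  can be applied to the family of all such open sets. The closed set \<open>S\<close> keeps the
  support of \<open>G\<close> inside \<open>U\<close>.\<close>

definition green_chart :: "complex set \<Rightarrow> complex set \<Rightarrow> bool" where
  "green_chart \<Omega> U \<longleftrightarrow> open U \<and> frontier \<Omega> \<inter> U \<in> null_sets lborel \<and> emeasure arc_length (frontier \<Omega> \<inter> U) < top \<and>
     (\<forall>B\<in>sets borel. {z \<in> frontier \<Omega> \<inter> U. outward_normal \<Omega> z \<in> B} \<in> sets arc_length) \<and>
     (AE z in arc_length. z \<in> frontier \<Omega> \<inter> U \<longrightarrow> norm (outward_normal \<Omega> z) = 1) \<and>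
     (\<forall>G S. test_function G \<and> closed S \<and> S \<subseteq> U \<and> (\<forall>z. z \<notin> S \<longrightarrow> G z = 0) \<longrightarrow>
       (LINT z|lborel. indicator \<Omega> z *\<^sub>R first_order (1/2) (\<i>/2) G z)
         = 1/2 * (LINT z:frontier \<Omega>|arc_length. G z * outward_normal \<Omega> z))"

lemma green_chartD:
  assumes "green_chart \<Omega> U"
  shows "open U" "frontier \<Omega> \<inter> U \<in> null_sets lborel" "emeasure arc_length (frontier \<Omega> \<inter> U) < top"
    "B \<in> sets borel \<Longrightarrow> {z \<in> frontier \<Omega> \<inter> U. outward_normal \<Omega> z \<in> B} \<in> sets arc_length"
    "AE z in arc_length. z \<in> frontier \<Omega> \<inter> U \<longrightarrow> norm (outward_normal \<Omega> z) = 1"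
    "test_function G \<Longrightarrow> closed S \<Longrightarrow> S \<subseteq> U \<Longrightarrow> (\<And>z. z \<notin> S \<Longrightarrow> G z = 0) \<Longrightarrow>
       (LINT z|lborel. indicator \<Omega> z *\<^sub>R first_order (1/2) (\<i>/2) G z)
         = 1/2 * (LINT z:frontier \<Omega>|arc_length. G z * outward_normal \<Omega> z)"
  using assms unfolding green_chart_def by blast+

lemma (in domain_chart) green_chart_rect: "green_chart \<Omega> rect"
  unfolding green_chart_def
proof (intro conjI ballI allI impI open_rect frontier_rect_null frontier_rect_finite outward_normal_sets)
  show "AE z in arc_length. z \<in> frontier \<Omega> \<inter> rect \<longrightarrow> norm (outward_normal \<Omega> z) = 1"
    using outward_normal_AE by eventually_elim (auto simp: norm_nrm)
  fix G S assume "test_function G \<and> closed S \<and> S \<subseteq> rect \<and> (\<forall>z. z \<notin> S \<longrightarrow> G z = 0)"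
  then have t: "test_function G" and S: "closed S" "S \<subseteq> rect" and G0: "\<And>z. z \<notin> S \<Longrightarrow> G z = 0" by auto
  note [measurable] = test_function_measurable[OF t]
  have G1: "G z = 0" if "z \<notin> rect" for z using G0 S that by blast
  have Xs: "frontier \<Omega> \<inter> rect \<in> sets arc_length"
    using borel_sets_arc_length sets.Int[OF borel_closed[OF frontier_closed] borel_open[OF open_rect]] by blast
  have n: "(\<lambda>z. indicator (frontier \<Omega> \<inter> rect) z *\<^sub>R outward_normal \<Omega> z) \<in> borel_measurable arc_length"
    by (rule indicator_times_measurable[OF Xs outward_normal_sets])
  have Gm: "G \<in> borel_measurable arc_length" by (rule borel_measurable_arc_length) measurable
  have "(LINT z:frontier \<Omega> \<inter> rect|arc_length. G z * nrm (abscissa z)) = (LINT z:frontier \<Omega>|arc_length. G z * outward_normal \<Omega> z)"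
    unfolding set_lebesgue_integral_def
  proof (rule integral_cong_AE)
    have "(\<lambda>z. G z * nrm (abscissa z)) \<in> borel_measurable arc_length"
      by (rule borel_measurable_arc_length) measurable
    then show "(\<lambda>z. indicator (frontier \<Omega> \<inter> rect) z *\<^sub>R (G z * nrm (abscissa z))) \<in> borel_measurable arc_length"
      using Xs by (intro borel_measurable_scaleR borel_measurable_indicator)
    have "(\<lambda>z. G z * (indicator (frontier \<Omega> \<inter> rect) z *\<^sub>R outward_normal \<Omega> z)) \<in> borel_measurable arc_length"
      by (rule borel_measurable_times[OF Gm n])
    also have "(\<lambda>z. G z * (indicator (frontier \<Omega> \<inter> rect) z *\<^sub>R outward_normal \<Omega> z)) = (\<lambda>z. indicator (frontier \<Omega>) z *\<^sub>R (G z * outward_normal \<Omega> z))"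
      using G1 by (auto simp: fun_eq_iff indicator_def)
    finally show "(\<lambda>z. indicator (frontier \<Omega>) z *\<^sub>R (G z * outward_normal \<Omega> z)) \<in> borel_measurable arc_length" .
    show "AE z in arc_length. indicator (frontier \<Omega> \<inter> rect) z *\<^sub>R (G z * nrm (abscissa z)) = indicator (frontier \<Omega>) z *\<^sub>R (G z * outward_normal \<Omega> z)"
      using outward_normal_AE by eventually_elim (use G1 in \<open>auto simp: indicator_def\<close>)
  qed
  then show "(LINT z|lborel. indicator \<Omega> z *\<^sub>R first_order (1/2) (\<i>/2) G z) = 1/2 * (LINT z:frontier \<Omega>|arc_length. G z * outward_normal \<Omega> z)"
    using chart_green[OF t S G0] chart_integral_nrm[OF _ G1] by simp
qed

section \<open>From charts to the whole boundary\<close>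

locale lipschitz_domain =
  fixes \<Omega> :: "complex set"
  assumes dom: "bounded_lipschitz_domain \<Omega>"
begin

lemma op: "open \<Omega>" and bd: "bounded \<Omega>"
  using dom by (auto simp: bounded_lipschitz_domain_def)

lemma borel_domain [measurable]: "\<Omega> \<in> sets borel" using op by simp

abbreviation normal :: "complex \<Rightarrow> complex" where "normal \<equiv> outward_normal \<Omega>"

lemma chart_exists:
  assumes p: "p \<in> frontier \<Omega>" shows "\<exists>U. p \<in> U \<and> green_chart \<Omega> U"
proof -
  obtain u r h \<phi> where "lipschitz_chart \<Omega> p u r h \<phi>" using dom p unfolding bounded_lipschitz_domain_def by blast
  then obtain L where c: "norm u = 1" "0 < r" "0 < h" "L-lipschitz_on UNIV \<phi>"
     "\<And>s. \<bar>s\<bar> < r \<Longrightarrow> \<bar>\<phi> s\<bar> < h" "\<And>s t. \<bar>s\<bar> < r \<Longrightarrow> \<bar>t\<bar> < h \<Longrightarrow> (p + u * Complex s t \<in> \<Omega> \<longleftrightarrow> t < \<phi> s)"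
    unfolding lipschitz_chart_def by blast
  interpret domain_chart p u \<phi> L \<Omega> r h
    using c op by unfold_locales auto
  have "p \<in> rect" using c by (simp add: rect_def abscissa_def ordinate_def)
  then show ?thesis using green_chart_rect by blast
qed

text \<open>A Lebesgue number of a finite subcover of the compact boundary. The cap at 1 later keeps
  mollified functions within distance 1 of the domain.\<close>

lemma uniform_charts:
  obtains e \<C> where "e > 0" "e \<le> 1" "finite \<C>" "\<And>U. U \<in> \<C> \<Longrightarrow> green_chart \<Omega> U" "frontier \<Omega> \<subseteq> \<Union>\<C>"
    "\<And>x. x \<in> frontier \<Omega> \<Longrightarrow> \<exists>U\<in>\<C>. ball x e \<subseteq> U"
proof -
  have cpt: "compact (frontier \<Omega>)" using bd by (simp add: compact_frontier_bounded)
  have cov: "frontier \<Omega> \<subseteq> \<Union>{U. green_chart \<Omega> U}" using chart_exists by blast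
  have opn: "open U" if "U \<in> {U. green_chart \<Omega> U}" for U using that by (simp add: green_chart_def)
  obtain \<C> where C: "\<C> \<subseteq> {U. green_chart \<Omega> U}" "finite \<C>" "frontier \<Omega> \<subseteq> \<Union>\<C>"
    using compactE[OF cpt cov opn] by metis
  obtain e where e: "e > 0" "\<And>x. x \<in> frontier \<Omega> \<Longrightarrow> \<exists>U\<in>\<C>. ball x e \<subseteq> U"
  proof (rule Heine_Borel_lemma[OF cpt C(3)])
    show "open U" if "U \<in> \<C>" for U using that C(1) opn by blast
  qed (rule that)
  show thesis
  proof (rule that[of "min e 1" \<C>])
    show "\<exists>U\<in>\<C>. ball x (min e 1) \<subseteq> U" if x: "x \<in> frontier \<Omega>" for x
    proof -
      obtain U where "U \<in> \<C>" "ball x e \<subseteq> U" using e(2)[OF x] by blast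
      moreover have "ball x (min e 1) \<subseteq> ball x e" by auto
      ultimately show ?thesis by blast
    qed
    show "green_chart \<Omega> U" if "U \<in> \<C>" for U using that C(1) by blast
  qed (use e(1) C(2,3) in simp_all)
qed

lemma frontier_sets: "frontier \<Omega> \<in> sets borel" "frontier \<Omega> \<in> sets arc_length"
  using borel_sets_arc_length borel_closed[OF frontier_closed] by auto

lemma frontier_null: "frontier \<Omega> \<in> null_sets lborel"
proof -
  obtain e \<C> where C: "finite \<C>" "\<And>U. U \<in> \<C> \<Longrightarrow> green_chart \<Omega> U" "frontier \<Omega> \<subseteq> \<Union>\<C>" using uniform_charts by metis
  have "(\<Union>U\<in>\<C>. frontier \<Omega> \<inter> U) \<in> null_sets lborel"
    using C green_chartD(2) by (intro null_sets_UN' countable_finite) auto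
  also have "(\<Union>U\<in>\<C>. frontier \<Omega> \<inter> U) = frontier \<Omega>" using C(3) by blast
  finally show ?thesis .
qed

lemma frontier_finite: "emeasure arc_length (frontier \<Omega>) < top"
proof -
  obtain e \<C> where C: "finite \<C>" "\<And>U. U \<in> \<C> \<Longrightarrow> green_chart \<Omega> U" "frontier \<Omega> \<subseteq> \<Union>\<C>" using uniform_charts by metis
  have s: "frontier \<Omega> \<inter> U \<in> sets arc_length" if "U \<in> \<C>" for U
    using borel_sets_arc_length sets.Int[OF frontier_sets(1) borel_open[OF green_chartD(1)[OF C(2)[OF that]]]] by blast
  have "emeasure arc_length (frontier \<Omega>) = emeasure arc_length (\<Union>U\<in>\<C>. frontier \<Omega> \<inter> U)" using C(3) by (intro arg_cong2[where f=emeasure]) auto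
  also have "\<dots> \<le> (\<Sum>U\<in>\<C>. emeasure arc_length (frontier \<Omega> \<inter> U))"
    using s C(1) by (intro emeasure_subadditive_finite) auto
  also have "\<dots> < top" using C(1,2) green_chartD(3) by (simp add: less_top)
  finally show ?thesis .
qed

lemma normal_sets: "B \<in> sets borel \<Longrightarrow> {z \<in> frontier \<Omega>. normal z \<in> B} \<in> sets arc_length"
proof -
  assume B: "B \<in> sets borel"
  obtain e \<C> where C: "finite \<C>" "\<And>U. U \<in> \<C> \<Longrightarrow> green_chart \<Omega> U" "frontier \<Omega> \<subseteq> \<Union>\<C>" using uniform_charts by metis
  have "(\<Union>U\<in>\<C>. {z \<in> frontier \<Omega> \<inter> U. normal z \<in> B}) \<in> sets arc_length"
    using C B green_chartD(4) by (intro sets.finite_UN) blast+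
  also have "(\<Union>U\<in>\<C>. {z \<in> frontier \<Omega> \<inter> U. normal z \<in> B}) = {z \<in> frontier \<Omega>. normal z \<in> B}" using C(3) by blast
  finally show ?thesis .
qed

lemma norm_normal: "AE z in arc_length. z \<in> frontier \<Omega> \<longrightarrow> norm (normal z) = 1"
proof -
  obtain e \<C> where C: "finite \<C>" "\<And>U. U \<in> \<C> \<Longrightarrow> green_chart \<Omega> U" "frontier \<Omega> \<subseteq> \<Union>\<C>" using uniform_charts by metis
  have "AE z in arc_length. \<forall>U\<in>\<C>. z \<in> frontier \<Omega> \<inter> U \<longrightarrow> norm (normal z) = 1"
    using C green_chartD(5) by (intro AE_finite_allI) blast+
  then show ?thesis by eventually_elim (use C(3) in blast)
qed

text \<open>A small ball that meets the boundary lies in one chart. Otherwise it is connected and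
  either misses \<Omega> or lies inside, where the area integral is that of derivatives of a
  compactly supported function; both sides are then 0.\<close>

lemma local_green:
  obtains e where "e > 0" "e \<le> 1"
    "\<And>G w. test_function G \<Longrightarrow> (\<And>z. z \<notin> cball w e \<Longrightarrow> G z = 0) \<Longrightarrow>
      (LINT z|lborel. indicator \<Omega> z *\<^sub>R first_order (1/2) (\<i>/2) G z)
        = 1/2 * (LINT z:frontier \<Omega>|arc_length. G z * normal z)"
proof -
  obtain e \<C> where e: "e > 0" "e \<le> 1" "\<And>U. U \<in> \<C> \<Longrightarrow> green_chart \<Omega> U"
    "\<And>x. x \<in> frontier \<Omega> \<Longrightarrow> \<exists>U\<in>\<C>. ball x e \<subseteq> U" using uniform_charts by metis
  \<comment> \<open>With radius e/3, all points of the ball are within 2e/3 < e of a boundary point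
    x in it, so the ball lies in the chart around x.\<close>
  have green: "(LINT z|lborel. indicator \<Omega> z *\<^sub>R first_order (1/2) (\<i>/2) G z) = 1/2 * (LINT z:frontier \<Omega>|arc_length. G z * normal z)"
    if t: "test_function G" and z: "\<And>z. z \<notin> cball w (e/3) \<Longrightarrow> G z = 0" for G w
  proof (cases "cball w (e/3) \<inter> frontier \<Omega> = {}")
    case False
    then obtain x where x: "x \<in> cball w (e/3)" "x \<in> frontier \<Omega>" by blast
    obtain U where U: "U \<in> \<C>" "ball x e \<subseteq> U" using e(4)[OF x(2)] by blast
    have "cball w (e/3) \<subseteq> ball x e"
    proof
      fix y assume "y \<in> cball w (e/3)"
      then show "y \<in> ball x e" using x(1) e(1) dist_triangle[of x y w] by (simp add: dist_commute)
    qed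
    then have "cball w (e/3) \<subseteq> U" using U(2) by blast
    then show ?thesis by (rule green_chartD(6)[OF e(3)[OF U(1)] t closed_cball]) (rule z)
  next
    case True
    have "(LINT z:frontier \<Omega>|arc_length. G z * normal z) = (LINT z|arc_length. (0::complex))"
      unfolding set_lebesgue_integral_def
    proof (intro Bochner_Integration.integral_cong refl)
      fix x show "indicator (frontier \<Omega>) x *\<^sub>R (G x * normal x) = 0"
      proof (cases "x \<in> frontier \<Omega>")
        case x: True
        then have "x \<notin> cball w (e/3)" using True by blast
        then show ?thesis using z by simp
      qed simp
    qed
    moreover have "(LINT z|lborel. indicator \<Omega> z *\<^sub>R first_order (1/2) (\<i>/2) G z) = 0"
    proof -
      have d0: "first_order (1/2) (\<i>/2) G z = 0" if "z \<notin> cball w (e/3)" for z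
        using deriv_zero_outside[OF test_functionD(1)[OF t] closed_cball z that] by (simp add: first_order_eq)
      consider "cball w (e/3) \<inter> \<Omega> = {}" | "cball w (e/3) \<subseteq> \<Omega>"
        using connected_Int_frontier[of "cball w (e/3)" \<Omega>] True by auto
      then show ?thesis
      proof cases
        case 1
        have "(LINT z|lborel. indicator \<Omega> z *\<^sub>R first_order (1/2) (\<i>/2) G z) = (LINT z|(lborel::complex measure). (0::complex))"
        proof (intro Bochner_Integration.integral_cong refl)
          fix z show "indicator \<Omega> z *\<^sub>R first_order (1/2) (\<i>/2) G z = 0"
          proof (cases "z \<in> \<Omega>")
            case z: True
            then have "z \<notin> cball w (e/3)" using \<open>cball w (e/3) \<inter> \<Omega> = {}\<close> by blast
            then show ?thesis using d0 by simp
          qed simp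
        qed
        then show ?thesis by simp
      next
        case 2
        have "(LINT z|lborel. indicator \<Omega> z *\<^sub>R first_order (1/2) (\<i>/2) G z) = (LINT z|lborel. 1/2 * dx G z + \<i>/2 * dy G z)"
        proof (intro Bochner_Integration.integral_cong refl)
          fix z show "indicator \<Omega> z *\<^sub>R first_order (1/2) (\<i>/2) G z = 1/2 * dx G z + \<i>/2 * dy G z"
          proof (cases "z \<in> \<Omega>")
            case z: False
            then have "z \<notin> cball w (e/3)" using \<open>cball w (e/3) \<subseteq> \<Omega>\<close> by blast
            then show ?thesis using d0[of z] z by (simp add: first_order_eq)
          qed (simp add: first_order_eq)
        qed
        also obtain R where R: "\<And>z. norm z > R \<Longrightarrow> G z = 0" using test_functionD(5)[OF t] by blast
        note C1 = C1_compact_support_integral[OF smoothD(1)[OF test_functionD(1)[OF t]] test_functionD(4)[OF test_functionD(2)[OF t]]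
            test_functionD(4)[OF test_functionD(3)[OF t]] R]
        have "(LINT z|lborel. 1/2 * dx G z + \<i>/2 * dy G z) = 0"
          using C1 by simp
        finally show ?thesis .
      qed
    qed
    ultimately show ?thesis by simp
  qed
  show thesis by (rule that[of "e/3"]) (use e(1,2) green in auto)
qed


lemma domain_indicator:
  obtains R where "R > 0" "\<And>z. z \<in> \<Omega> \<Longrightarrow> norm z \<le> R" "\<And>z. z \<in> frontier \<Omega> \<Longrightarrow> norm z \<le> R"
proof -
  obtain R where R: "R > 0" "\<And>z. z \<in> closure \<Omega> \<Longrightarrow> norm z \<le> R"
    using bounded_closure[OF bd] by (auto simp: bounded_pos)
  show thesis by (rule that[OF R(1)]) (use R(2) closure_subset[of \<Omega>] in \<open>auto simp: frontier_def\<close>)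
qed

lemma loc_int_indicator: "loc_int (indicator \<Omega>)"
  by (rule loc_int_bounded[where B=1]) (auto simp: indicator_def)

text \<open>Cutting the normal at norm 1 changes it only on a null set of the boundary and gives the
  bound at every point that Fubini and dominated convergence are fed with.\<close>

lemma normal_version:
  obtains n where "n \<in> borel_measurable (restrict_space arc_length (frontier \<Omega>))" "\<And>z. norm (n z) \<le> 1"
    "\<And>G. G \<in> borel_measurable borel \<Longrightarrow> (LINT z:frontier \<Omega>|arc_length. G z * normal z) = (LINT z|restrict_space arc_length (frontier \<Omega>). G z * n z)"
proof -
  let ?N = "restrict_space arc_length (frontier \<Omega>)"
  have X: "frontier \<Omega> \<inter> space arc_length \<in> sets arc_length" using frontier_sets by (simp add: arc_length_basics)
  have nm[measurable]: "normal \<in> borel_measurable ?N"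
    using indicator_times_measurable[OF frontier_sets(2) normal_sets] borel_measurable_restrict_space_iff[OF X] by blast
  define n where "n z = (if norm (normal z) \<le> 1 then normal z else 0)" for z
  have nn[measurable]: "n \<in> borel_measurable ?N" unfolding n_def by measurable
  show thesis
  proof (rule that[OF nn])
    show "norm (n z) \<le> 1" for z by (simp add: n_def)
    fix G :: "complex \<Rightarrow> complex" assume "G \<in> borel_measurable borel"
    then have [measurable]: "G \<in> borel_measurable ?N" by (intro measurable_restrict_space1 borel_measurable_arc_length)
    have "(LINT z:frontier \<Omega>|arc_length. G z * normal z) = (LINT z|?N. G z * normal z)"
      unfolding set_lebesgue_integral_def integral_restrict_space[OF X] ..
    also have "\<dots> = (LINT z|?N. G z * n z)"
    proof (rule integral_cong_AE)
      show "AE z in ?N. G z * normal z = G z * n z"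
        unfolding AE_restrict_space_iff[OF X] using norm_normal by eventually_elim (auto simp: n_def)
    qed measurable
    finally show "(LINT z:frontier \<Omega>|arc_length. G z * normal z) = (LINT z|?N. G z * n z)" .
  qed
qed

text \<open>The mollified indicator of the domain is a test function; its \<open>\<partial>\<close>-bar derivative is, by Green's formula
  for the mollifier, a boundary integral.\<close>

theorem weak_green:
  assumes F: "continuous_on UNIV F" and w: "weak_deriv (1/2) (\<i>/2) F g"
  shows "(LINT z|lborel. g z * indicator \<Omega> z) = 1/2 * (LINT z:frontier \<Omega>|arc_length. F z * normal z)"
proof -
  let ?N = "restrict_space arc_length (frontier \<Omega>)"
  obtain n where n[measurable]: "n \<in> borel_measurable ?N" and n1: "\<And>z. norm (n z) \<le> 1"
    and neq: "\<And>G. G \<in> borel_measurable borel \<Longrightarrow> (LINT z:frontier \<Omega>|arc_length. G z * normal z) = (LINT z|?N. G z * n z)"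
    using normal_version by blast
  obtain e where e: "e > 0" "e \<le> 1" and green: "\<And>G w. test_function G \<Longrightarrow> (\<And>z. z \<notin> cball w e \<Longrightarrow> G z = 0) \<Longrightarrow>
      (LINT z|lborel. indicator \<Omega> z *\<^sub>R first_order (1/2) (\<i>/2) G z) = 1/2 * (LINT z:frontier \<Omega>|arc_length. G z * normal z)"
    using local_green by blast
  obtain R where R: "R > 0" "\<And>z. z \<in> \<Omega> \<Longrightarrow> norm z \<le> R" "\<And>z. z \<in> frontier \<Omega> \<Longrightarrow> norm z \<le> R"
    using domain_indicator by blast
  have [measurable]: "F \<in> borel_measurable borel" using F by (rule borel_measurable_continuous_onI)
  have gl: "loc_int g" and Fl: "loc_int F" using w by (auto simp: weak_deriv_def)
  note [measurable] = loc_intD[OF gl]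
  have "bounded (F ` cball 0 (R + 1))"
    by (intro compact_imp_bounded compact_continuous_image continuous_on_subset[OF F]) auto
  then obtain C where "\<forall>z\<in>cball 0 (R+1). norm (F z) \<le> C" unfolding bounded_iff by auto
  then have C: "\<And>z. norm z \<le> R + 1 \<Longrightarrow> norm (F z) \<le> C" by simp
  have C0: "C \<ge> 0" using C[of 0] R(1) norm_ge_zero[of "F 0"] by (simp del: norm_ge_zero)
  \<comment> \<open>Then 2 \<delta> m \<le> e, so a mollifier fits into the ball of the local Green
    formula, and 2 \<delta> m \<le> 1, so all supports stay within radius R + 1.\<close>
  define \<delta> where "\<delta> m = e / (2 * real (Suc m))" for m
  have \<delta>: "\<delta> m > 0" "2 * \<delta> m \<le> e" for m
    using e by (simp_all add: \<delta>_def field_simps del: of_nat_Suc)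
  have \<delta>1: "2 * \<delta> m \<le> 1" for m using \<delta>(2)[of m] e by linarith
  have \<delta>lim: "(\<lambda>m. 2 * \<delta> m) \<longlonglongrightarrow> 0"
  proof -
    have "2 * \<delta> m = e * inverse (real (Suc m))" for m unfolding \<delta>_def by (simp add: field_simps del: of_nat_Suc)
    then show ?thesis using tendsto_mult_right_zero[OF LIMSEQ_inverse_real_of_nat, of e] by (simp only: )
  qed
  define \<rho> where "\<rho> m z = complex_of_real (mollifier (\<delta> m) z)" for m z
  have t\<rho>: "test_function (\<rho> m)" for m using mollifier(4)[OF \<delta>(1)[of m]] by (simp add: \<rho>_def[abs_def])
  have \<rho>0: "\<rho> m z = 0" if "2 * \<delta> m \<le> norm z" for m z using mollifier(2)[OF \<delta>(1) that] by (simp add: \<rho>_def)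
  have \<rho>s: "\<rho> m (- z) = \<rho> m z" for m z using mollifier(3)[OF \<delta>(1)] by (simp add: \<rho>_def)
  have [measurable]: "\<rho> m \<in> borel_measurable borel" for m by (rule test_function_measurable[OF t\<rho>])
  define X where "X m = conv (indicator \<Omega>) (\<rho> m)" for m
  have cb: "norm (X m z - c) \<le> \<eta>" if "\<And>w. dist w z < 2 * \<delta> m \<Longrightarrow> norm (indicator \<Omega> w - c) \<le> \<eta>" for m z c \<eta>
    using conv_mollifier_bound[OF \<delta>(1) loc_int_indicator that] by (simp add: X_def \<rho>_def[abs_def])
  have X1: "norm (X m z) \<le> 1" for m z
    using cb[of z m 0 1] by (auto simp: indicator_def)
  have X0: "X m z = 0" if "norm z > R + 1" for m z
  proof -
    have "norm (indicator \<Omega> w - 0 :: complex) \<le> 0" if "dist w z < 2 * \<delta> m" for w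
    proof -
      have "norm z \<le> norm w + dist w z" using norm_triangle_ineq2[of z w] by (simp add: dist_norm norm_minus_commute)
      then have "norm w > R" using that \<open>norm z > R + 1\<close> \<delta>1[of m] by linarith
      then show ?thesis using R(2)[of w] by (auto simp: indicator_def)
    qed
    from cb[OF this] show ?thesis by simp
  qed
  have tX: "test_function (X m)" for m
    unfolding test_function_iff using X0 smooth_conv(1)[OF loc_int_indicator t\<rho>] by (auto simp: X_def)
  note [measurable] = test_function_measurable[OF tX]
  \<comment> \<open>Differentiation falls on the mollifier; rewriting it as a derivative in w of the
    reflected mollifier gives the minus sign, and the local Green formula turns the area integral
    into one over the boundary.\<close>
  have dX: "first_order (1/2) (\<i>/2) (X m) z = - (1/2 * (LINT w|?N. \<rho> m (z - w) * n w))" for m z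
  proof -
    have t: "test_function (\<lambda>w. \<rho> m (z - w))" by (rule test_function_intros(4)[OF t\<rho>])
    have "first_order (1/2) (\<i>/2) (X m) z = (LINT w|lborel. indicator \<Omega> w * first_order (1/2) (\<i>/2) (\<rho> m) (z - w))"
      unfolding X_def smooth_conv(4)[OF loc_int_indicator t\<rho>] conv_def ..
    also have "\<dots> = (LINT w|lborel. - (indicator \<Omega> w *\<^sub>R first_order (1/2) (\<i>/2) (\<lambda>w. \<rho> m (z - w)) w))"
      using dx_dy_reflect[OF test_functionD(1)[OF t\<rho>]]
      by (intro Bochner_Integration.integral_cong refl) (simp add: first_order_eq indicator_def)
    also have "\<dots> = - (LINT w|lborel. indicator \<Omega> w *\<^sub>R first_order (1/2) (\<i>/2) (\<lambda>w. \<rho> m (z - w)) w)"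
      by (rule Bochner_Integration.integral_minus)
    also have "(LINT w|lborel. indicator \<Omega> w *\<^sub>R first_order (1/2) (\<i>/2) (\<lambda>w. \<rho> m (z - w)) w)
        = 1/2 * (LINT w:frontier \<Omega>|arc_length. \<rho> m (z - w) * normal w)"
    proof (rule green[OF t])
      fix w assume "w \<notin> cball z e"
      then have "2 * \<delta> m \<le> norm (z - w)" using \<delta>(2)[of m] by (simp add: dist_norm)
      then show "\<rho> m (z - w) = 0" by (rule \<rho>0)
    qed
    also have "(LINT w:frontier \<Omega>|arc_length. \<rho> m (z - w) * normal w) = (LINT w|?N. \<rho> m (z - w) * n w)"
      by (rule neq) measurable
    finally show ?thesis .
  qed
  have fN: "finite_measure ?N"
    using frontier_finite frontier_sets by (intro finite_measureI) (simp add: emeasure_restrict_space space_restrict_space arc_length_basics)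
  interpret N: finite_measure ?N by (rule fN)
  interpret P: pair_sigma_finite "lborel :: complex measure" ?N ..
  have spN: "space ?N = frontier \<Omega>" by (simp add: space_restrict_space arc_length_basics)
  have [measurable]: "(\<lambda>w. w) \<in> borel_measurable ?N"
    by (intro measurable_restrict_space1 borel_measurable_arc_length) measurable
  \<comment> \<open>The weak equation tested with the mollified indicator; Fubini then moves the
    mollifier from the indicator to F.\<close>
  have main: "(LINT z|lborel. g z * X m z) = 1/2 * (LINT w|?N. conv F (\<rho> m) w * n w)" for m
  proof -
    obtain B where B: "\<And>z. norm (\<rho> m z) \<le> B" using test_functionD(6)[OF t\<rho>] by blast
    have B0: "B \<ge> 0" using order_trans[OF norm_ge_zero B[of 0]] .
    have K: "integrable (lborel \<Otimes>\<^sub>M ?N) (\<lambda>(z, w). F z * (\<rho> m (z - w) * n w))"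
    proof (rule Bochner_Integration.integrable_bound)
      have fb: "emeasure lborel (cball (0::complex) (R+1)) < \<infinity>" by (rule emeasure_lborel_cball_finite)
      have sN: "emeasure ?N (space ?N) < top" using N.emeasure_finite[of "space ?N"] by (simp only: less_top)
      have "emeasure (lborel \<Otimes>\<^sub>M ?N) (cball (0::complex) (R+1) \<times> space ?N) < \<infinity>"
        using fb sN by (subst N.emeasure_pair_measure_Times) (simp_all add: ennreal_mult_less_top)
      then show "integrable (lborel \<Otimes>\<^sub>M ?N) (\<lambda>x. (C * B) * indicator (cball (0::complex) (R+1) \<times> space ?N) x)"
        by (intro integrable_mult_right integrable_real_indicator) auto
      show "AE x in lborel \<Otimes>\<^sub>M ?N. norm (case x of (z, w) \<Rightarrow> F z * (\<rho> m (z - w) * n w)) \<le> norm ((C * B) * indicator (cball 0 (R+1) \<times> space ?N) x :: real)"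
      proof (rule AE_I2, clarify)
        fix z w :: complex assume "(z, w) \<in> space (lborel \<Otimes>\<^sub>M ?N)"
        then have wN: "w \<in> space ?N" by (simp add: space_pair_measure)
        show "norm (F z * (\<rho> m (z - w) * n w)) \<le> norm ((C * B) * indicator (cball 0 (R+1) \<times> space ?N) (z, w) :: real)"
        proof (cases "norm z \<le> R + 1")
          case True
          have "norm (F z * (\<rho> m (z - w) * n w)) = norm (F z) * (norm (\<rho> m (z - w)) * norm (n w))" by (simp add: norm_mult)
          also have "\<dots> \<le> C * (B * 1)" using C0 B0 by (intro mult_mono C[OF True] B n1) auto
          finally show ?thesis using True wN C0 B0 by simp
        next
          case False
          have "norm w \<le> R" using wN R(3) by (simp add: spN)
          then have "norm (z - w) \<ge> 2 * \<delta> m" using False norm_triangle_ineq2[of z w] \<delta>1[of m] by linarith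
          then show ?thesis using \<rho>0 by simp
        qed
      qed
    qed measurable
    have "(LINT z|lborel. g z * X m z) = - (LINT z|lborel. F z * first_order (1/2) (\<i>/2) (X m) z)"
      using w tX by (simp add: weak_deriv_def)
    also have "\<dots> = 1/2 * (LINT z|lborel. F z * (LINT w|?N. \<rho> m (z - w) * n w))"
      unfolding dX by simp
    also have "(LINT z|lborel. F z * (LINT w|?N. \<rho> m (z - w) * n w)) = (LINT z|lborel. (LINT w|?N. F z * (\<rho> m (z - w) * n w)))"
      by simp
    also have "\<dots> = (LINT w|?N. (LINT z|lborel. F z * (\<rho> m (z - w) * n w)))"
      using P.Fubini_integral[OF K] by simp
    also have "\<dots> = (LINT w|?N. conv F (\<rho> m) w * n w)"
    proof (rule Bochner_Integration.integral_cong[OF refl])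
      fix w
      \<comment> \<open>The mollifier is even, so the integral over z is the convolution at the
        boundary point w.\<close>
      have "(LINT z|lborel. F z * (\<rho> m (z - w) * n w)) = (LINT z|lborel. (F z * \<rho> m (w - z)) * n w)"
        using \<rho>s[of m] by (intro Bochner_Integration.integral_cong refl) (metis minus_diff_eq mult.assoc)
      then show "(LINT z|lborel. F z * (\<rho> m (z - w) * n w)) = conv F (\<rho> m) w * n w"
        by (simp add: conv_def)
    qed
    finally show ?thesis .
  qed
  have gR: "integrable lborel (\<lambda>z. indicator (cball 0 (R+1)) z *\<^sub>R g z)"
    using loc_int_cball[OF gl, of "R+1"] by (simp add: set_integrable_def)
  have L1: "(\<lambda>m. LINT z|lborel. g z * X m z) \<longlonglongrightarrow> (LINT z|lborel. g z * indicator \<Omega> z)"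
  proof (rule integral_dominated_convergence[where w="\<lambda>z. norm (indicator (cball 0 (R+1)) z *\<^sub>R g z)"])
    show "integrable lborel (\<lambda>z. norm (indicator (cball 0 (R+1)) z *\<^sub>R g z))" using gR by (rule integrable_norm)
    show "AE z in lborel. norm (g z * X m z) \<le> norm (indicator (cball 0 (R+1)) z *\<^sub>R g z)" for m
    proof (rule AE_I2)
      fix z show "norm (g z * X m z) \<le> norm (indicator (cball 0 (R+1)) z *\<^sub>R g z)"
        using X0[of z m] X1[of m z] mult_left_mono[OF X1[of m z], of "norm (g z)"]
        by (cases "norm z \<le> R + 1") (auto simp: norm_mult)
    qed
    \<comment> \<open>Off the boundary the indicator is locally constant, so the mollified indicator
      equals it from some m on.\<close>
    show "AE z in lborel. (\<lambda>m. g z * X m z) \<longlonglongrightarrow> g z * indicator \<Omega> z"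
      using AE_not_in[OF frontier_null]
    proof eventually_elim
      case (elim z)
      have "\<exists>d>0. \<forall>w. dist w z < d \<longrightarrow> (w \<in> \<Omega> \<longleftrightarrow> z \<in> \<Omega>)"
      proof (cases "z \<in> \<Omega>")
        case True
        then show ?thesis using op unfolding open_dist by auto
      next
        case False
        then have "z \<in> - closure \<Omega>" using elim op by (auto simp: frontier_def interior_open)
        moreover have "open (- closure \<Omega>)" by (rule open_Compl) simp
        ultimately obtain d where "d > 0" "\<And>w. dist w z < d \<Longrightarrow> w \<in> - closure \<Omega>" unfolding open_dist by blast
        then show ?thesis using False closure_subset by blast
      qed
      then obtain d where d: "d > 0" "\<And>w. dist w z < d \<Longrightarrow> (w \<in> \<Omega> \<longleftrightarrow> z \<in> \<Omega>)" by blast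
      have "eventually (\<lambda>m. 2 * \<delta> m < d) sequentially" using order_tendstoD(2)[OF \<delta>lim d(1)] .
      then have "eventually (\<lambda>m. X m z = indicator \<Omega> z) sequentially"
      proof eventually_elim
        case (elim m)
        have "norm (X m z - indicator \<Omega> z) \<le> 0"
          by (rule cb) (use d(2) elim in \<open>force simp: indicator_def\<close>)
        then show ?case by simp
      qed
      then have "(\<lambda>m. X m z) \<longlonglongrightarrow> indicator \<Omega> z" by (rule tendsto_eventually)
      then show ?case by (intro tendsto_mult tendsto_const)
    qed
  next
    have "(\<lambda>z. g z * indicator \<Omega> z) \<in> borel_measurable borel"
      by (rule borel_measurable_times[OF loc_intD[OF gl] borel_measurable_indicator[OF borel_domain]])
    then show "(\<lambda>z. g z * indicator \<Omega> z) \<in> borel_measurable lborel" by simp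
    have "(\<lambda>z. g z * X m z) \<in> borel_measurable borel" for m
      by (rule borel_measurable_times[OF loc_intD[OF gl] test_function_measurable[OF tX]])
    then show "(\<lambda>z. g z * X m z) \<in> borel_measurable lborel" for m by simp
  qed
  have L2: "(\<lambda>m. LINT w|?N. conv F (\<rho> m) w * n w) \<longlonglongrightarrow> (LINT w|?N. F w * n w)"
  proof (rule integral_dominated_convergence[where w="\<lambda>_. C"])
    show "integrable ?N (\<lambda>_. C)" by simp
    have "F \<in> borel_measurable ?N" by (intro measurable_restrict_space1 borel_measurable_arc_length) measurable
    then show "(\<lambda>w. F w * n w) \<in> borel_measurable ?N" by measurable
    show "(\<lambda>w. conv F (\<rho> m) w * n w) \<in> borel_measurable ?N" for m
    proof -
      have "conv F (\<rho> m) \<in> borel_measurable borel"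
        using smoothD(4)[OF smooth_conv(1)[OF Fl t\<rho>]] by (rule borel_measurable_continuous_onI)
      then have "conv F (\<rho> m) \<in> borel_measurable ?N" by (intro measurable_restrict_space1 borel_measurable_arc_length)
      then show ?thesis by measurable
    qed
    have cF: "norm (conv F (\<rho> m) z - c) \<le> \<eta>" if "\<And>w. dist w z < 2 * \<delta> m \<Longrightarrow> norm (F w - c) \<le> \<eta>" for m z c \<eta>
      using conv_mollifier_bound[OF \<delta>(1) Fl that] by (simp add: \<rho>_def[abs_def])
    show "AE w in ?N. norm (conv F (\<rho> m) w * n w) \<le> C" for m
    proof (rule AE_I2)
      fix z assume "z \<in> space ?N"
      then have zR: "norm z \<le> R" using R(3) by (simp add: spN)
      have "norm (conv F (\<rho> m) z - 0) \<le> C"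
      proof (rule cF)
        fix w assume "dist w z < 2 * \<delta> m"
        moreover have "norm w \<le> norm z + dist w z" using norm_triangle_ineq2[of w z] by (simp add: dist_norm)
        ultimately show "norm (F w - 0) \<le> C" using C[of w] zR \<delta>1[of m] by simp
      qed
      then have "norm (conv F (\<rho> m) z) * norm (n z) \<le> C * 1" using n1 C0 by (intro mult_mono) auto
      then show "norm (conv F (\<rho> m) z * n z) \<le> C" by (simp add: norm_mult)
    qed
    show "AE w in ?N. (\<lambda>m. conv F (\<rho> m) w * n w) \<longlonglongrightarrow> F w * n w"
    proof (intro AE_I2 tendsto_mult tendsto_const)
      fix z
      show "(\<lambda>m. conv F (\<rho> m) z) \<longlonglongrightarrow> F z"
      proof (rule tendstoI)
        fix \<eta> :: real assume \<eta>: "\<eta> > 0"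
        have "isCont F z" using F by (simp add: continuous_on_eq_continuous_at)
        then obtain d where d: "d > 0" "\<And>w. dist w z < d \<Longrightarrow> dist (F w) (F z) < \<eta>/2"
          using \<eta> unfolding continuous_at_eps_delta by (metis half_gt_zero)
        have "eventually (\<lambda>m. 2 * \<delta> m < d) sequentially" using order_tendstoD(2)[OF \<delta>lim d(1)] .
        then show "eventually (\<lambda>m. dist (conv F (\<rho> m) z) (F z) < \<eta>) sequentially"
        proof eventually_elim
          case (elim m)
          have "norm (conv F (\<rho> m) z - F z) \<le> \<eta>/2"
          proof (rule cF)
            fix w assume "dist w z < 2 * \<delta> m"
            then show "norm (F w - F z) \<le> \<eta>/2" using d(2)[of w] elim by (simp add: dist_norm)
          qed
          then show ?case using \<eta> by (simp add: dist_norm)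
        qed
      qed
    qed
  qed
  have "(\<lambda>m. LINT z|lborel. g z * X m z) \<longlonglongrightarrow> 1/2 * (LINT w|?N. F w * n w)"
    unfolding main by (intro tendsto_mult tendsto_const L2)
  then have "(LINT z|lborel. g z * indicator \<Omega> z) = 1/2 * (LINT w|?N. F w * n w)"
    using L1 LIMSEQ_unique by blast
  then show ?thesis using neq[of F] by simp
qed

end

section \<open>The boundary formulas\<close>

lemma cont_rep_eq:
  assumes F: "continuous_on UNIV F" and ae: "AE z in lborel. f z = F z"
  shows "cont_rep f = F"
  unfolding cont_rep_def
proof (rule the_equality)
  show "continuous_on UNIV F \<and> (AE z in lebesgue. F z = f z)"
    using F ae by (auto simp: AE_completion_iff elim: eventually_mono)
  fix g assume g: "continuous_on UNIV g \<and> (AE z in lebesgue. g z = f z)"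
  then have gf: "AE z in lborel. g z = f z" by (simp add: AE_completion_iff)
  have "AE z in lborel. z \<in> UNIV \<longrightarrow> g z = F z" using gf ae by eventually_elim simp
  then have "g z = F z" for z using AE_eq_on_open[where U=UNIV and f=g and g=F and z=z] g F by auto
  then show "g = F" by blast
qed

text \<open>Testing the equation of f with E \<phi> moves the factor E onto f. Only b survives in
  the derivative, since exp (a z) is holomorphic.\<close>

lemma weak_deriv_exp_mult:
  fixes a b :: complex
  assumes w: "weak_deriv (1/2) (\<i>/2) f g"
  defines "E \<equiv> \<lambda>z. exp (a * z + b * cnj z)"
  shows "weak_deriv (1/2) (\<i>/2) (\<lambda>z. f z * E z) (\<lambda>z. (g z + b * f z) * E z)"
  unfolding weak_deriv_def
proof (intro conjI allI impI)
  have fl: "loc_int f" and gl: "loc_int g" using w by (auto simp: weak_deriv_def)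
  have sE: "smooth E" unfolding E_def by (rule smooth_exp_linear)
  have cE: "continuous_on UNIV E" by (rule smoothD(4)[OF sE])
  have bl: "loc_int (\<lambda>z. b * f z)" using loc_int_times_continuous[OF fl, of "\<lambda>_. b"] by (simp add: mult.commute)
  show "loc_int (\<lambda>z. f z * E z)" by (rule loc_int_times_continuous[OF fl cE])
  show "loc_int (\<lambda>z. (g z + b * f z) * E z)" by (rule loc_int_times_continuous[OF loc_int_add[OF gl bl] cE])
  fix \<phi> assume t: "test_function \<phi>"
  have tE: "test_function (\<lambda>z. E z * \<phi> z)" by (rule test_function_intros(2)[OF sE t])
  have dE: "first_order (1/2) (\<i>/2) E z = b * E z" for z
    unfolding first_order_eq E_def dx_exp_linear dy_exp_linear by (simp add: field_simps)
  have i1: "integrable lborel (\<lambda>z. f z * first_order (1/2) (\<i>/2) (\<lambda>z. E z * \<phi> z) z)"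
    by (rule loc_int_test[OF fl test_first_order[OF tE]])
  have i2: "integrable lborel (\<lambda>z. f z * (b * (E z * \<phi> z)))"
    using loc_int_test[OF bl tE] by (simp add: ac_simps)
  have i3: "integrable lborel (\<lambda>z. g z * (E z * \<phi> z))" by (rule loc_int_test[OF gl tE])
  have "(LINT z|lborel. (f z * E z) * first_order (1/2) (\<i>/2) \<phi> z)
      = (LINT z|lborel. f z * first_order (1/2) (\<i>/2) (\<lambda>z. E z * \<phi> z) z - f z * (b * (E z * \<phi> z)))"
    unfolding first_order_mult[OF sE test_functionD(1)[OF t]] dE by (simp add: algebra_simps)
  also have "\<dots> = (LINT z|lborel. f z * first_order (1/2) (\<i>/2) (\<lambda>z. E z * \<phi> z) z) - (LINT z|lborel. f z * (b * (E z * \<phi> z)))"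
    by (rule Bochner_Integration.integral_diff[OF i1 i2])
  also have "(LINT z|lborel. f z * first_order (1/2) (\<i>/2) (\<lambda>z. E z * \<phi> z) z) = - (LINT z|lborel. g z * (E z * \<phi> z))"
    using w tE unfolding weak_deriv_def by blast
  also have "- (LINT z|lborel. g z * (E z * \<phi> z)) - (LINT z|lborel. f z * (b * (E z * \<phi> z)))
      = - ((LINT z|lborel. g z * (E z * \<phi> z)) + (LINT z|lborel. f z * (b * (E z * \<phi> z))))" by simp
  also have "(LINT z|lborel. g z * (E z * \<phi> z)) + (LINT z|lborel. f z * (b * (E z * \<phi> z)))
      = (LINT z|lborel. g z * (E z * \<phi> z) + f z * (b * (E z * \<phi> z)))"
    by (rule Bochner_Integration.integral_add[OF i3 i2, symmetric])
  also have "\<dots> = (LINT z|lborel. (g z + b * f z) * E z * \<phi> z)" by (simp add: algebra_simps)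
  finally show "(LINT z|lborel. f z * E z * first_order (1/2) (\<i>/2) \<phi> z) = - (LINT z|lborel. (g z + b * f z) * E z * \<phi> z)" .
qed

lemma Lq_representative:
  fixes f :: "complex \<Rightarrow> complex"
  assumes f: "f \<in> borel_measurable lebesgue" "integrable lebesgue (\<lambda>z. norm (f z) powr q)"
  obtains f' where "f' \<in> borel_measurable borel" "AE z in lborel. f z = f' z"
    "\<And>R. set_integrable lborel (cball 0 R) (\<lambda>z. norm (f' z) powr q)"
proof -
  obtain f' where f'[measurable]: "f' \<in> borel_measurable borel" and ae: "AE z in lborel. f z = f' z"
    using borel_representative[OF f(1)] by blast
  have "integrable lebesgue (\<lambda>z. complex_of_real (norm (f z) powr q))" using f(2) by simp
  also have "integrable lebesgue (\<lambda>z. complex_of_real (norm (f z) powr q)) \<longleftrightarrow> integrable lborel (\<lambda>z. complex_of_real (norm (f' z) powr q))"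
    by (rule integral_lebesgue_lborel(2)) (measurable, use ae in eventually_elim, simp)
  finally have i: "integrable lborel (\<lambda>z. norm (f' z) powr q)" by (simp only: complex_of_real_integrable_eq)
  show thesis
  proof (rule that[OF f' ae])
    show "set_integrable lborel (cball 0 R) (\<lambda>z. norm (f' z) powr q)" for R
      unfolding set_integrable_def by (rule integrable_mult_indicator[OF _ i]) simp
  qed
qed

context lipschitz_domain
begin

text \<open>Serves both scattering entries: A is the off-diagonal entry, N the diagonal entry in its
  equation and V the potential, all conjugated in the second case. The coefficient - \<i> \<kappa>
  of cnj z in the exponent cancels the term \<i> \<kappa> A, and a is free because exp (a z) is
  holomorphic. N enters through N - 1, as it is M - I that lies in L^q.\<close>

lemma boundary_identity:
  fixes a \<kappa> :: complex
  assumes q: "q > 2"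
    and A: "A \<in> borel_measurable lebesgue" "integrable lebesgue (\<lambda>z. norm (A z) powr q)"
    and N: "(\<lambda>z. N z - 1) \<in> borel_measurable lebesgue" "integrable lebesgue (\<lambda>z. norm (N z - 1) powr q)"
    and V: "h \<in> borel_measurable borel" "AE z in lborel. V z = h z" "\<And>z. norm (h z) \<le> B" "\<And>z. z \<notin> closure \<Omega> \<Longrightarrow> h z = 0"
    and w: "has_weak_dbar A (\<lambda>z. \<i> * \<kappa> * A z + V z * N z)"
  defines "E \<equiv> \<lambda>z. exp (a * z + (- \<i> * \<kappa>) * cnj z)"
  obtains F where "continuous_on UNIV F" "AE z in lborel. A z = F z"
    "(LINT z|lebesgue. V z * E z * N z) = 1/2 * (LINT z:frontier \<Omega>|arc_length. E z * F z * normal z)"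
proof -
  note [measurable] = V(1)
  obtain A' where A'[measurable]: "A' \<in> borel_measurable borel" and Aae: "AE z in lborel. A z = A' z"
    and Aq: "\<And>R. set_integrable lborel (cball 0 R) (\<lambda>z. norm (A' z) powr q)"
    using Lq_representative[OF A] by metis
  obtain N' where N'[measurable]: "N' \<in> borel_measurable borel" and Nae: "AE z in lborel. N z - 1 = N' z"
    and Nq: "\<And>R. set_integrable lborel (cball 0 R) (\<lambda>z. norm (N' z) powr q)"
    using Lq_representative[OF N] by metis
  define g where "g z = \<i> * \<kappa> * A' z + h z * (N' z + 1)" for z
  have g[measurable]: "g \<in> borel_measurable borel" unfolding g_def by measurable
  have gae: "AE z in lborel. \<i> * \<kappa> * A z + V z * N z = g z"
    using Aae Nae V(2)
  proof eventually_elim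
    case (elim z)
    have "N z = N' z + 1" using elim(2) by (metis diff_add_cancel)
    then show ?case unfolding g_def using elim by simp
  qed
  have wd: "weak_deriv (1/2) (\<i>/2) A' g" using w weak_deriv_iff[OF A' Aae g gae] by blast
  \<comment> \<open>With x the largest of |A'|, |N'| and 1, the two terms of g are at most
    |\<kappa>| x and 2 |B| x, and the power of x is one of the three summands in the bound.\<close>
  define K where "K = norm \<kappa> + 2 * \<bar>B\<bar>"
  have gb: "norm (g z) powr q \<le> K powr q * (norm (A' z) powr q + norm (N' z) powr q + 1)" for z
  proof -
    define x where "x = max (norm (A' z)) (max (norm (N' z)) 1)"
    have x: "norm (A' z) \<le> x" "norm (N' z + 1) \<le> 2 * x" "x \<ge> 0"
      using norm_triangle_ineq[of "N' z" 1] by (auto simp: x_def max_def)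
    have "norm (g z) \<le> norm \<kappa> * norm (A' z) + norm (h z) * norm (N' z + 1)"
      unfolding g_def by (rule norm_triangle_le) (simp add: norm_mult)
    also have "\<dots> \<le> norm \<kappa> * x + \<bar>B\<bar> * (2 * x)"
      using x order_trans[OF V(3)[of z] abs_ge_self] by (intro add_mono mult_mono) auto
    also have "\<dots> = K * x" by (simp add: K_def algebra_simps)
    finally have "norm (g z) powr q \<le> (K * x) powr q" using q by (intro powr_mono2) auto
    also have "\<dots> = K powr q * x powr q" using x by (simp add: powr_mult K_def)
    also have "x powr q \<le> norm (A' z) powr q + norm (N' z) powr q + 1" by (auto simp: x_def max_def)
    finally show ?thesis by (simp add: mult_left_mono)
  qed
  have gq: "set_integrable lborel (cball 0 R) (\<lambda>z. norm (g z) powr q)" for R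
    unfolding set_integrable_def
  proof (rule Bochner_Integration.integrable_bound)
    have o: "set_integrable lborel (cball (0::complex) R) (\<lambda>z. 1::real)"
      unfolding set_integrable_def using emeasure_lborel_cball_finite[of "0::complex" R] by simp
    have "set_integrable lborel (cball 0 R) (\<lambda>z. K powr q * (norm (A' z) powr q + norm (N' z) powr q + 1))"
      by (intro set_integrable_mult_right set_integral_add(1) Aq Nq o)
    then show "integrable lborel (\<lambda>z. indicator (cball 0 R) z *\<^sub>R (K powr q * (norm (A' z) powr q + norm (N' z) powr q + 1)))"
      by (simp add: set_integrable_def)
    show "AE z in lborel. norm (indicator (cball 0 R) z *\<^sub>R norm (g z) powr q) \<le> norm (indicator (cball 0 R) z *\<^sub>R (K powr q * (norm (A' z) powr q + norm (N' z) powr q + 1)))"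
    proof (rule AE_I2)
      fix z show "norm (indicator (cball 0 R) z *\<^sub>R norm (g z) powr q) \<le> norm (indicator (cball 0 R) z *\<^sub>R (K powr q * (norm (A' z) powr q + norm (N' z) powr q + 1)))"
        using order_trans[OF gb[of z] abs_ge_self] by (cases "z \<in> cball 0 R") auto
    qed
    have "(\<lambda>z. indicator (cball 0 R) z *\<^sub>R norm (g z) powr q) \<in> borel_measurable borel"
      by (intro borel_measurable_scaleR borel_measurable_indicator borel_closed closed_cball) measurable
    then show "(\<lambda>z. indicator (cball 0 R) z *\<^sub>R norm (g z) powr q) \<in> borel_measurable lborel" by simp
  qed
  obtain F where F: "continuous_on UNIV F" "AE z in lborel. A' z = F z"
    using weak_dbar_continuous_version[OF wd q Aq gq] by blast
  have [measurable]: "F \<in> borel_measurable borel" using F(1) by (rule borel_measurable_continuous_onI)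
  have F'A: "AE z in lborel. F z = A' z" using F(2) by eventually_elim simp
  have AF: "AE z in lborel. A z = F z" using Aae F(2) by eventually_elim simp
  have wF: "weak_deriv (1/2) (\<i>/2) F g"
    by (rule weak_deriv_cong_AE[OF wd _ F'A]) auto
  have cE: "continuous_on UNIV E" unfolding E_def by (intro continuous_intros)
  have [measurable]: "E \<in> borel_measurable borel" using cE by (rule borel_measurable_continuous_onI)
  have cFE: "continuous_on UNIV (\<lambda>z. F z * E z)" using F(1) cE by (rule continuous_on_mult)
  have wFE: "weak_deriv (1/2) (\<i>/2) (\<lambda>z. F z * E z) (\<lambda>z. (g z + (- \<i> * \<kappa>) * F z) * E z)"
    unfolding E_def by (rule weak_deriv_exp_mult[OF wF])
  have "(LINT z|lebesgue. V z * E z * N z) = (LINT z|lborel. h z * E z * (N' z + 1))"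
  proof (rule integral_lebesgue_lborel(1))
    show "AE z in lborel. V z * E z * N z = h z * E z * (N' z + 1)"
      using Nae V(2)
    proof eventually_elim
      case (elim z)
      have "N z = N' z + 1" using elim(1) by (metis diff_add_cancel)
      then show ?case using elim by simp
    qed
  qed measurable
  \<comment> \<open>Inside \<Omega> the terms with \<kappa> cancel, off the closure h is 0, and the
    boundary between is a null set.\<close>
  also have "\<dots> = (LINT z|lborel. (g z + (- \<i> * \<kappa>) * F z) * E z * indicator \<Omega> z)"
  proof (rule integral_cong_AE)
    show "AE z in lborel. h z * E z * (N' z + 1) = (g z + (- \<i> * \<kappa>) * F z) * E z * indicator \<Omega> z"
      using F(2) AE_not_in[OF frontier_null]
    proof eventually_elim
      case (elim z)
      show ?case
      proof (cases "z \<in> \<Omega>")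
        case True
        then show ?thesis using elim by (simp add: g_def algebra_simps)
      next
        case False
        then have "z \<notin> closure \<Omega>" using elim op by (auto simp: frontier_def interior_open)
        then show ?thesis using V(4) False by simp
      qed
    qed
    have "(\<lambda>z. (g z + (- \<i> * \<kappa>) * F z) * E z * indicator \<Omega> z) \<in> borel_measurable borel"
      by (intro borel_measurable_times borel_measurable_indicator borel_domain) measurable
    then show "(\<lambda>z. (g z + (- \<i> * \<kappa>) * F z) * E z * indicator \<Omega> z) \<in> borel_measurable lborel" by simp
  qed measurable
  also have "\<dots> = 1/2 * (LINT z:frontier \<Omega>|arc_length. F z * E z * normal z)"
    by (rule weak_green[OF cFE wFE])
  also have "(\<lambda>z. F z * E z * normal z) = (\<lambda>z. E z * F z * normal z)" by (simp add: fun_eq_iff)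
  finally show thesis using that[OF F(1) AF] by blast
qed

end

lemma in_Lp_component:
  fixes f :: "complex \<Rightarrow> complex^2^2"
  assumes f: "in_Lp q f" and q: "q > 0"
  shows "(\<lambda>z. f z $ i $ j) \<in> borel_measurable lebesgue" "integrable lebesgue (\<lambda>z. norm (f z $ i $ j) powr q)"
proof -
  have [measurable]: "f \<in> borel_measurable lebesgue" and i: "integrable lebesgue (\<lambda>z. norm (f z) powr q)"
    using f by (auto simp: in_Lp_def)
  have "(\<lambda>x::complex^2^2. x $ i $ j) \<in> borel_measurable borel"
    by (intro borel_measurable_continuous_onI continuous_intros)
  then show m[measurable]: "(\<lambda>z. f z $ i $ j) \<in> borel_measurable lebesgue" by measurable
  show "integrable lebesgue (\<lambda>z. norm (f z $ i $ j) powr q)"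
  proof (rule Bochner_Integration.integrable_bound[OF i])
    have "norm (f z $ i $ j) \<le> norm (f z)" for z using order_trans[OF Finite_Cartesian_Product.norm_nth_le Finite_Cartesian_Product.norm_nth_le] .
    then show "AE z in lebesgue. norm (norm (f z $ i $ j) powr q) \<le> norm (norm (f z) powr q)"
      using q by (intro AE_I2) (simp add: powr_mono2)
  qed measurable
qed

text \<open>Conjugation exchanges the two first order operators and preserves test functions; it
  brings the equation of the entry 21 into dbar form.\<close>

lemma has_weak_dz_cnj:
  assumes "has_weak_dz f g" shows "has_weak_dbar (\<lambda>z. cnj (f z)) (\<lambda>z. cnj (g z))"
  unfolding has_weak_deriv_def
proof (intro conjI allI impI)
  have lc: "locally_integrable (\<lambda>z. cnj (f z))" if "locally_integrable f" for f
    using that unfolding locally_integrable_def set_integrable_def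
    by (metis (no_types, lifting) integrable_cnj complex_cnj_scaleR ext)
  show "locally_integrable (\<lambda>z. cnj (f z))" "locally_integrable (\<lambda>z. cnj (g z))"
    using assms lc by (auto simp: has_weak_deriv_def)
  fix \<phi> assume t: "test_function \<phi>"
  have "first_order (1/2) (- (\<i>/2)) (\<lambda>z. cnj (\<phi> z)) z = cnj (first_order (1/2) (\<i>/2) \<phi> z)" for z
    using dx_dy_cnj[OF test_functionD(1)[OF t]] by (simp add: first_order_eq)
  moreover have "(LINT z|lebesgue. f z * first_order (1/2) (- (\<i>/2)) (\<lambda>z. cnj (\<phi> z)) z) = - (LINT z|lebesgue. g z * cnj (\<phi> z))"
    using assms test_function_intros(3)[OF t] unfolding has_weak_deriv_def by blast
  ultimately have "(LINT z|lebesgue. f z * cnj (first_order (1/2) (\<i>/2) \<phi> z)) = - (LINT z|lebesgue. g z * cnj (\<phi> z))" by simp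
  moreover have "(LINT z|lebesgue. cnj (f z) * \<psi> z) = cnj (LINT z|lebesgue. f z * cnj (\<psi> z))" for f \<psi> :: "complex \<Rightarrow> complex"
    using Bochner_Integration.integral_cnj[of lebesgue "\<lambda>z. f z * cnj (\<psi> z)"] by simp
  ultimately show "(LINT z|lebesgue. cnj (f z) * first_order (1/2) (\<i>/2) \<phi> z) = - (LINT z|lebesgue. cnj (g z) * \<phi> z)"
    by (simp only: complex_cnj_minus)
qed

theorem mainTheorem7:
  fixes \<Omega> :: "complex set" and \<beta> \<sigma>\<^sub>0 :: real
  assumes "bounded_lipschitz_domain \<Omega>" and "\<sigma>\<^sub>0 > 0" and "\<beta> > 0"
  shows "\<exists>\<omega>\<^sub>0>0. \<forall>(\<omega>::real) (\<sigma> :: complex \<Rightarrow> real) (\<epsilon> :: complex \<Rightarrow> real).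
    0 \<le> \<omega> \<and> \<omega> < \<omega>\<^sub>0 \<and>
    \<sigma> \<in> W1inf \<and> W1inf_norm \<sigma> \<le> ereal \<beta> \<and>
    \<epsilon> \<in> W1inf \<and> W1inf_norm \<epsilon> \<le> ereal \<beta> \<and>
    (AE z in lebesgue. \<sigma> z > \<sigma>\<^sub>0) \<and>
    (AE z in lebesgue. z \<notin> \<Omega> \<longrightarrow> conductivity \<omega> \<sigma> \<epsilon> z = 1)
    \<longrightarrow>
    (\<forall>(k::complex) (M :: complex \<Rightarrow> complex \<Rightarrow> complex^2^2).
       cgo_solution (conductivity \<omega> \<sigma> \<epsilon>) k (\<lambda>z. M z k) \<longrightarrow>
       S12 (conductivity \<omega> \<sigma> \<epsilon>) M k =
         \<i> / (2 * of_real pi) *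
           (LINT z:frontier \<Omega>|arc_length. exp (- \<i> * cnj k * z) * Psi12 M z k *
              (of_real (Re (outward_normal \<Omega> z)) + \<i> * of_real (Im (outward_normal \<Omega> z)))) \<and>
       S21 (conductivity \<omega> \<sigma> \<epsilon>) M k =
         - (\<i> / (2 * of_real pi)) *
           (LINT z:frontier \<Omega>|arc_length. exp (\<i> * cnj k * cnj z) * Psi21 M z k *
              (of_real (Re (outward_normal \<Omega> z)) - \<i> * of_real (Im (outward_normal \<Omega> z)))))"
proof (rule exI[of _ 1], intro conjI allI impI)
  \<comment> \<open>The witness is 1: for the given \<omega> the solution \<open>M\<close> is
    supplied by \<open>cgo_solution\<close>, and both identities are derived from its
    equations.\<close>
  show "(0::real) < 1" by simp
  interpret lipschitz_domain \<Omega> using assms(1) by unfold_locales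
  fix \<omega> \<sigma> \<epsilon> k and M :: "complex \<Rightarrow> complex \<Rightarrow> complex^2^2"
  assume H: "0 \<le> \<omega> \<and> \<omega> < 1 \<and>
    \<sigma> \<in> W1inf \<and> W1inf_norm \<sigma> \<le> ereal \<beta> \<and>
    \<epsilon> \<in> W1inf \<and> W1inf_norm \<epsilon> \<le> ereal \<beta> \<and>
    (AE z in lebesgue. \<sigma> z > \<sigma>\<^sub>0) \<and>
    (AE z in lebesgue. z \<notin> \<Omega> \<longrightarrow> conductivity \<omega> \<sigma> \<epsilon> z = 1)"
  define \<gamma> where "\<gamma> = conductivity \<omega> \<sigma> \<epsilon>"
  assume "cgo_solution (conductivity \<omega> \<sigma> \<epsilon>) k (\<lambda>z. M z k)"
  then have cgo: "cgo_solution \<gamma> k (\<lambda>z. M z k)" by (simp add: \<gamma>_def)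
  then obtain q where q: "q > 2" and Mq: "in_Lp q (\<lambda>z. M z k - mat 1)" unfolding cgo_solution_def by blast
  have "q > 0" using q by simp
  note comp = in_Lp_component[OF Mq this]
  have c12: "(\<lambda>z. M z k $ 1 $ 2) \<in> borel_measurable lebesgue" "integrable lebesgue (\<lambda>z. norm (M z k $ 1 $ 2) powr q)"
    using comp[of 1 2] by (simp_all add: mat_def)
  have c21: "(\<lambda>z. M z k $ 2 $ 1) \<in> borel_measurable lebesgue" "integrable lebesgue (\<lambda>z. norm (M z k $ 2 $ 1) powr q)"
    using comp[of 2 1] by (simp_all add: mat_def)
  have c11: "(\<lambda>z. M z k $ 1 $ 1 - 1) \<in> borel_measurable lebesgue" "integrable lebesgue (\<lambda>z. norm (M z k $ 1 $ 1 - 1) powr q)"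
    using comp[of 1 1] by (simp_all add: mat_def)
  have c22: "(\<lambda>z. M z k $ 2 $ 2 - 1) \<in> borel_measurable lebesgue" "integrable lebesgue (\<lambda>z. norm (M z k $ 2 $ 2 - 1) powr q)"
    using comp[of 2 2] by (simp_all add: mat_def)
  have pb: "\<exists>h B. h \<in> borel_measurable borel \<and> (AE z in lborel. Q12 \<gamma> z = h z) \<and> (\<forall>z. norm (h z) \<le> B) \<and> (\<forall>z. z \<notin> closure \<Omega> \<longrightarrow> h z = 0)"
    "\<exists>h B. h \<in> borel_measurable borel \<and> (AE z in lborel. Q21 \<gamma> z = h z) \<and> (\<forall>z. norm (h z) \<le> B) \<and> (\<forall>z. z \<notin> closure \<Omega> \<longrightarrow> h z = 0)"
    unfolding \<gamma>_def using potentials_bounded[of \<sigma> \<epsilon> \<sigma>\<^sub>0 \<Omega> \<omega>] H assms(2) by blast+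
  have nc: "complex_of_real (Re n) + \<i> * of_real (Im n) = n" "complex_of_real (Re n) - \<i> * of_real (Im n) = cnj n" for n
    by (simp_all add: complex_eq_iff)
  show "S12 (conductivity \<omega> \<sigma> \<epsilon>) M k = \<i> / (2 * of_real pi) *
           (LINT z:frontier \<Omega>|arc_length. exp (- \<i> * cnj k * z) * Psi12 M z k *
              (of_real (Re (outward_normal \<Omega> z)) + \<i> * of_real (Im (outward_normal \<Omega> z))))"
  proof -
    obtain h B where h: "h \<in> borel_measurable borel" "AE z in lborel. Q12 \<gamma> z = h z" "\<And>z. norm (h z) \<le> B" "\<And>z. z \<notin> closure \<Omega> \<Longrightarrow> h z = 0"
      using pb(1) by blast
    have w: "has_weak_dbar (\<lambda>z. M z k $ 1 $ 2) (\<lambda>z. \<i> * k * M z k $ 1 $ 2 + Q12 \<gamma> z * M z k $ 2 $ 2)"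
      using cgo unfolding cgo_solution_def by blast
    \<comment> \<open>Here \<kappa> = k is dictated by the equation, and a = - \<i> cnj k completes
      the exponent to that of e(z, - cnj k).\<close>
    obtain F where F: "continuous_on UNIV F" "AE z in lborel. M z k $ 1 $ 2 = F z"
      and id: "(LINT z|lebesgue. Q12 \<gamma> z * exp ((- \<i> * cnj k) * z + (- \<i> * k) * cnj z) * M z k $ 2 $ 2)
        = 1/2 * (LINT z:frontier \<Omega>|arc_length. exp ((- \<i> * cnj k) * z + (- \<i> * k) * cnj z) * F z * normal z)"
      using boundary_identity[OF q c12 c22 h w, of "- \<i> * cnj k"] by blast
    have e: "exp ((- \<i> * cnj k) * z + (- \<i> * k) * cnj z) = e_zk z (- cnj k)" for z
      unfolding e_zk_def by (rule arg_cong[where f=exp]) (simp add: algebra_simps)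
    have b: "exp ((- \<i> * cnj k) * z + (- \<i> * k) * cnj z) * F z * n = exp (- \<i> * cnj k * z) * Psi12 M z k * n" for z n
      unfolding Psi12_def cont_rep_eq[OF F] exp_add by (simp add: ac_simps)
    show ?thesis unfolding S12_def \<gamma>_def[symmetric] nc id[unfolded b, unfolded e] by simp
  qed
  show "S21 (conductivity \<omega> \<sigma> \<epsilon>) M k = - (\<i> / (2 * of_real pi)) *
           (LINT z:frontier \<Omega>|arc_length. exp (\<i> * cnj k * cnj z) * Psi21 M z k *
              (of_real (Re (outward_normal \<Omega> z)) - \<i> * of_real (Im (outward_normal \<Omega> z))))"
  proof -
    obtain h B where h: "h \<in> borel_measurable borel" "AE z in lborel. Q21 \<gamma> z = h z" "\<And>z. norm (h z) \<le> B" "\<And>z. z \<notin> closure \<Omega> \<Longrightarrow> h z = 0"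
      using pb(2) by blast
    have h': "(\<lambda>z. cnj (h z)) \<in> borel_measurable borel" "AE z in lborel. cnj (Q21 \<gamma> z) = cnj (h z)"
      "\<And>z. norm (cnj (h z)) \<le> B" "\<And>z. z \<notin> closure \<Omega> \<Longrightarrow> cnj (h z) = 0"
      using h by (simp_all add: measurable_compose[OF h(1) borel_measurable_continuous_onI[OF continuous_on_cnj[OF continuous_on_id]]])
    have "has_weak_dz (\<lambda>z. M z k $ 2 $ 1) (\<lambda>z. - \<i> * k * M z k $ 2 $ 1 + Q21 \<gamma> z * M z k $ 1 $ 1)"
      using cgo unfolding cgo_solution_def by blast
    from has_weak_dz_cnj[OF this]
    \<comment> \<open>The conjugated entry solves an equation of the same type as the entry 12, with
      cnj k in place of k.\<close>
    have w: "has_weak_dbar (\<lambda>z. cnj (M z k $ 2 $ 1)) (\<lambda>z. \<i> * cnj k * cnj (M z k $ 2 $ 1) + cnj (Q21 \<gamma> z) * cnj (M z k $ 1 $ 1))"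
      by (simp add: add.commute)
    have cm: "(\<lambda>z. cnj (f z)) \<in> borel_measurable lebesgue" if "f \<in> borel_measurable lebesgue" for f :: "complex \<Rightarrow> complex"
      using measurable_compose[OF that borel_measurable_continuous_onI[OF continuous_on_cnj[OF continuous_on_id]]] .
    have n: "norm (cnj x - 1) = norm (x - 1)" for x by (metis complex_cnj_diff complex_cnj_one complex_mod_cnj)
    have cc: "(\<lambda>z. cnj (M z k $ 2 $ 1)) \<in> borel_measurable lebesgue" "integrable lebesgue (\<lambda>z. norm (cnj (M z k $ 2 $ 1)) powr q)"
       "(\<lambda>z. cnj (M z k $ 1 $ 1) - 1) \<in> borel_measurable lebesgue" "integrable lebesgue (\<lambda>z. norm (cnj (M z k $ 1 $ 1) - 1) powr q)"
    proof -
      show "(\<lambda>z. cnj (M z k $ 1 $ 1) - 1) \<in> borel_measurable lebesgue" using cm[OF c11(1)] by simp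
    qed (use cm c21 c11 in \<open>simp_all add: n\<close>)
    \<comment> \<open>Now \<kappa> = cnj k and a = - \<i> k. Conjugating back at the end turns this
      exponential into e(z, k) and the normal into its conjugate.\<close>
    define e where "e z = exp ((- \<i> * k) * z + (- \<i> * cnj k) * cnj z)" for z
    obtain F where F: "continuous_on UNIV F" "AE z in lborel. cnj (M z k $ 2 $ 1) = F z"
      and id: "(LINT z|lebesgue. cnj (Q21 \<gamma> z) * e z * cnj (M z k $ 1 $ 1))
        = 1/2 * (LINT z:frontier \<Omega>|arc_length. e z * F z * normal z)"
      using boundary_identity[OF q cc h' w, of "- \<i> * k"] unfolding e_def by blast
    have ce: "cnj (e z) = exp (\<i> * cnj k * cnj z) * exp (\<i> * z * k)" for z
      unfolding e_def exp_cnj exp_add[symmetric] by (rule arg_cong[where f=exp]) simp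
    have ce': "cnj (e z) = e_zk z k" for z
      unfolding e_zk_def ce exp_add[symmetric] by (rule arg_cong[where f=exp]) (simp add: algebra_simps)
    have F': "continuous_on UNIV (\<lambda>z. cnj (F z))" by (intro continuous_intros F)
    have "AE z in lborel. M z k $ 2 $ 1 = cnj (F z)" using F(2) by eventually_elim (metis complex_cnj_cnj)
    note cr = cont_rep_eq[OF F' this]
    have "(LINT z|lebesgue. Q21 \<gamma> z * e_zk z k * M z k $ 1 $ 1) = cnj (LINT z|lebesgue. cnj (Q21 \<gamma> z) * e z * cnj (M z k $ 1 $ 1))"
      by (simp add: ce' flip: Bochner_Integration.integral_cnj)
    also have "\<dots> = 1/2 * (LINT z:frontier \<Omega>|arc_length. exp (\<i> * cnj k * cnj z) * Psi21 M z k * cnj (normal z))"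
      unfolding id Psi21_def cr set_lebesgue_integral_def by (simp add: ce mult.assoc flip: Bochner_Integration.integral_cnj)
    finally have id': "(LINT z|lebesgue. Q21 \<gamma> z * e_zk z k * M z k $ 1 $ 1)
        = 1/2 * (LINT z:frontier \<Omega>|arc_length. exp (\<i> * cnj k * cnj z) * Psi21 M z k * cnj (normal z))" .
    show ?thesis unfolding S21_def \<gamma>_def[symmetric] nc id' by simp
  qed
qed

end
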